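(* For every integer $n\ge0$ there exist infinitely many integers $a$ with $a(4a+27)\neq0$ such that $$\dim_{\mathbb{F}_3}\mathrm{Sel}^3(E_{a,1}/K)\ge\dim_{\mathbb{F}_3}\mathrm{Sel}^{\psi_{a,1}}(E_{a,1}/K)\ge 2n,$$ where $E_{a,1}:y^2=x^3+a(x-1)^2$; these curves have a $\mathbb{Q}$-rational $3$-isogeny ($\psi_{a,1}$) and satisfy $E_{a,1}(K)[3]=0$.
   Context: Let $\zeta_3=(-1+\sqrt{-3})/2$ and $K=\mathbb{Q}(\zeta_3)$. For integers $a,b$ with $ab(4a+27b)\neq0$ put $d=4a+27b$, $E_{a,b}:y^2=x^3+a(x-b)^2$, $\widehat{E}_{a,b}:y^2=x^3-27a(x-d)^2$, and $\psi_{a,b}:E_{a,b}\to\widehat{E}_{a,b}$ the $\mathbb{Q}$-rational $3$-isogeny $\psi_{a,b}(x,y)=\big(9(x^3+\tfrac43ax^2-4abx+4ab^2)/x^2,\ 27y(x^3+4abx-8ab^2)/x^3\big)$. $\mathrm{Sel}^{\psi_{a,b}}(E_{a,b}/K)$ is the set of classes in $H^1(G_K,E_{a,b}[\psi_{a,b}])$ whose restriction at every finite prime $\mathfrak{q}$ of $K$ lies in the image of the local Kummer map $\widehat{E}_{a,b}(K_{\mathfrak{q}})\to H^1(G_{K_{\mathfrak{q}}},E_{a,b}[\psi_{a,b}])$; $\mathrm{Sel}^3(E_{a,b}/K)$ is the $3$-Selmer group over $K$. *)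

theory Defs
  imports "HOL-Analysis.Analysis" "HOL-Algebra.Coset" "HOL-Algebra.FiniteProduct"
    "HOL-Library.Extended_Nat" "HOL-Computational_Algebra.Polynomial"
begin

section \<open>Subfields of the complex numbers and their Galois groups\<close>

text \<open>
  All fields (number fields, their completions, and algebraic closures of these) are realised as
  subfields of the field of complex numbers.
\<close>

definition complex_subfield :: "complex set \<Rightarrow> bool" where
  "complex_subfield F \<longleftrightarrow>
     0 \<in> F \<and> 1 \<in> F \<and>
     (\<forall>x\<in>F. \<forall>y\<in>F. x + y \<in> F \<and> x * y \<in> F) \<and>
     (\<forall>x\<in>F. - x \<in> F \<and> inverse x \<in> F)"

definition zeta3 :: complex where
  "zeta3 = (-1 + \<i> * complex_of_real (sqrt 3)) / 2"

definition K :: "complex set" where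
  "K = {of_rat r + of_rat s * zeta3 | r s. True}"

text \<open>Since the complex numbers are algebraically closed, this is an algebraic closure of \<open>F\<close>.\<close>

definition alg_cl :: "complex set \<Rightarrow> complex set" where
  "alg_cl F = {x. \<exists>p. p \<noteq> 0 \<and> (\<forall>i. coeff p i \<in> F) \<and> poly p x = 0}"

text \<open>
  The absolute Galois group of \<open>F\<close>. Automorphisms are extensional functions, so that each of them
  is represented by exactly one function on the complex numbers.
\<close>

definition gal :: "complex set \<Rightarrow> (complex \<Rightarrow> complex) set" where
  "gal F = {\<sigma> \<in> extensional (alg_cl F).
     bij_betw \<sigma> (alg_cl F) (alg_cl F) \<and>
     (\<forall>x\<in>alg_cl F. \<forall>y\<in>alg_cl F. \<sigma> (x + y) = \<sigma> x + \<sigma> y \<and> \<sigma> (x * y) = \<sigma> x * \<sigma> y) \<and>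
     (\<forall>x\<in>F. \<sigma> x = x)}"

text \<open>The Krull topology is the topology of pointwise convergence on the discrete algebraic closure.\<close>

definition krull_topology :: "complex set \<Rightarrow> (complex \<Rightarrow> complex) topology" where
  "krull_topology F =
     subtopology (product_topology (\<lambda>_. discrete_topology (alg_cl F)) (alg_cl F)) (gal F)"


section \<open>Finite primes and completions\<close>

definition nonarch_abs :: "complex set \<Rightarrow> (complex \<Rightarrow> real) \<Rightarrow> bool" where
  "nonarch_abs F v \<longleftrightarrow>
     (\<forall>x\<in>F. v x \<ge> 0 \<and> (v x = 0 \<longleftrightarrow> x = 0)) \<and>
     (\<forall>x\<in>F. \<forall>y\<in>F. v (x * y) = v x * v y \<and> v (x + y) \<le> max (v x) (v y))"

text \<open>
  A finite prime of \<open>F\<close> is an equivalence class of nontrivial non-archimedean absolute values on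
  \<open>F\<close>; it is represented here by any member of the class. Everything below depends on \<open>v\<close>
  only through its class.
\<close>

definition finite_prime :: "complex set \<Rightarrow> (complex \<Rightarrow> real) \<Rightarrow> bool" where
  "finite_prime F v \<longleftrightarrow> nonarch_abs F v \<and> (\<exists>x\<in>F. x \<noteq> 0 \<and> v x \<noteq> 1)"

text \<open>The distance is cut off outside \<open>F\<close> because \<open>Metric_space\<close> asks for a globally
  nonnegative and symmetric function.\<close>

definition abs_dist :: "complex set \<Rightarrow> (complex \<Rightarrow> real) \<Rightarrow> complex \<Rightarrow> complex \<Rightarrow> real" where
  "abs_dist F v x y = (if x \<in> F \<and> y \<in> F then v (x - y) else 0)"

text \<open>
  \<open>(L, w)\<close> is a completion of \<open>(F, v)\<close>. For a finite prime \<open>v\<close> of a number field such an \<open>L\<close>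
  exists inside the complex numbers: the algebraic closure of the abstract completion is an
  algebraically closed field of characteristic 0 with the cardinality of the continuum, hence
  isomorphic to the field of complex numbers by Steinitz, and the isomorphism may be chosen to be
  the identity on \<open>F\<close>. The choice of \<open>L\<close> amounts to the choice of an embedding of \<open>alg_cl F\<close>
  into an algebraic closure of the completion.
\<close>

definition completion_of ::
    "complex set \<Rightarrow> (complex \<Rightarrow> real) \<Rightarrow> complex set \<Rightarrow> (complex \<Rightarrow> real) \<Rightarrow> bool" where
  "completion_of F v L w \<longleftrightarrow>
     complex_subfield L \<and> F \<subseteq> L \<and> nonarch_abs L w \<and> (\<forall>x\<in>F. w x = v x) \<and>
     Metric_space.mcomplete L (abs_dist L w) \<and>
     Metric_space.mtopology L (abs_dist L w) closure_of F = L"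

lemma complex_subfield_diff:
  assumes "complex_subfield F" "x \<in> F" "y \<in> F"
  shows "x - y \<in> F"
  using assms unfolding complex_subfield_def by (metis diff_conv_add_uminus)

lemma Metric_space_abs_dist:
  assumes F: "complex_subfield F" and v: "nonarch_abs F v"
  shows "Metric_space F (abs_dist F v)"
proof
  have nn: "v x \<ge> 0" and z: "v x = 0 \<longleftrightarrow> x = 0" if "x \<in> F" for x
    using v that by (auto simp: nonarch_abs_def)
  have m: "v (x * y) = v x * v y" and ult: "v (x + y) \<le> max (v x) (v y)"
    if "x \<in> F" "y \<in> F" for x y
    using v that by (auto simp: nonarch_abs_def)
  have one: "1 \<in> F" and mone: "-1 \<in> F" using F by (auto simp: complex_subfield_def)
  have "v 1 = 1" using m[OF one one] z[OF one] by simp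
  then have "v (-1) * v (-1) = 1" using m[OF mone mone] by simp
  then have vm: "v (-1) = 1" using nn[OF mone]
    by (metis abs_of_nonneg abs_mult_self_eq mult_cancel_left2 real_sqrt_abs2 real_sqrt_one)
  have sym: "v (x - y) = v (y - x)" if "x \<in> F" "y \<in> F" for x y
    using m[OF mone complex_subfield_diff[OF F that]] vm by simp
  show "0 \<le> abs_dist F v x y" for x y
    using nn complex_subfield_diff[OF F] by (auto simp: abs_dist_def)
  show "abs_dist F v x y = abs_dist F v y x" for x y
    using sym by (auto simp: abs_dist_def)
  show "(abs_dist F v x y = 0) = (x = y)" if "x \<in> F" "y \<in> F" for x y
    using that z[OF complex_subfield_diff[OF F that]] by (auto simp: abs_dist_def)
  show "abs_dist F v x z \<le> abs_dist F v x y + abs_dist F v y z"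
    if "x \<in> F" "y \<in> F" "z \<in> F" for x y z
  proof -
    have "v (x - z) \<le> max (v (x - y)) (v (y - z))"
      using ult[of "x - y" "y - z"] that complex_subfield_diff[OF F] by simp
    also have "\<dots> \<le> v (x - y) + v (y - z)"
      using nn complex_subfield_diff[OF F] that by auto
    finally show ?thesis using that by (simp add: abs_dist_def)
  qed
qed


section \<open>Elliptic curves $y^2 = x^3 + a_2 x^2 + a_4 x + a_6$\<close>

record weierstrass =
  a2 :: complex
  a4 :: complex
  a6 :: complex

type_synonym point = "(complex \<times> complex) option"

text \<open>\<open>None\<close> is the point at infinity.\<close>

definition points :: "weierstrass \<Rightarrow> complex set \<Rightarrow> point set" where
  "points W F = insert None
     {Some (x, y) | x y. x \<in> F \<and> y \<in> F \<and> y^2 = x^3 + a2 W * x^2 + a4 W * x + a6 W}"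

fun ec_neg :: "point \<Rightarrow> point" where
  "ec_neg None = None"
| "ec_neg (Some (x, y)) = Some (x, - y)"

fun ec_add :: "weierstrass \<Rightarrow> point \<Rightarrow> point \<Rightarrow> point" where
  "ec_add W None Q = Q"
| "ec_add W P None = P"
| "ec_add W (Some (x1, y1)) (Some (x2, y2)) =
    (if x1 = x2 \<and> y1 + y2 = 0 then None
     else let l = (if x1 = x2 then (3 * x1^2 + 2 * a2 W * x1 + a4 W) / (2 * y1)
                   else (y2 - y1) / (x2 - x1));
              x3 = l^2 - a2 W - x1 - x2
          in Some (x3, l * (x1 - x3) - y1))"

definition ec_triple :: "weierstrass \<Rightarrow> point \<Rightarrow> point" where
  "ec_triple W P = ec_add W P (ec_add W P P)"

definition act :: "(complex \<Rightarrow> complex) \<Rightarrow> point \<Rightarrow> point" where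
  "act \<sigma> = map_option (map_prod \<sigma> \<sigma>)"

definition ker_pts :: "weierstrass \<Rightarrow> (point \<Rightarrow> point) \<Rightarrow> complex set \<Rightarrow> point set" where
  "ker_pts W \<phi> F = {P \<in> points W F. \<phi> P = None}"

text \<open>
  Isogenies over the rationals, of degree \<open>m\<close>. An isogeny between curves of the present shape
  commutes with \<open>(x, y) \<mapsto> (x, - y)\<close>, hence is given by $(x,y) \mapsto (R_1(x), y R_2(x))$ with
  rational functions $R_1 = p/q$ and $R_2 = r/s$, and in characteristic 0 its degree is the order of
  its kernel.
\<close>

definition rational_isogeny ::
    "weierstrass \<Rightarrow> weierstrass \<Rightarrow> (point \<Rightarrow> point) \<Rightarrow> nat \<Rightarrow> bool" where
  "rational_isogeny W W' \<phi> m \<longleftrightarrow>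
     \<phi> ` points W (alg_cl \<rat>) = points W' (alg_cl \<rat>) \<and>
     (\<forall>P\<in>points W (alg_cl \<rat>). \<forall>Q\<in>points W (alg_cl \<rat>).
        \<phi> (ec_add W P Q) = ec_add W' (\<phi> P) (\<phi> Q)) \<and>
     finite (ker_pts W \<phi> (alg_cl \<rat>)) \<and> card (ker_pts W \<phi> (alg_cl \<rat>)) = m \<and>
     (\<exists>p q r s :: complex poly.
        (\<forall>i. coeff p i \<in> \<rat> \<and> coeff q i \<in> \<rat> \<and> coeff r i \<in> \<rat> \<and> coeff s i \<in> \<rat>) \<and>
        (\<forall>x y. Some (x, y) \<in> points W (alg_cl \<rat>) \<longrightarrow> \<phi> (Some (x, y)) \<noteq> None \<longrightarrow>
           poly q x \<noteq> 0 \<and> poly s x \<noteq> 0 \<and>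
           \<phi> (Some (x, y)) = Some (poly p x / poly q x, y * (poly r x / poly s x))))"


section \<open>Galois cohomology and Selmer groups\<close>

text \<open>
  Continuous 1-cocycles of the absolute Galois group of \<open>F\<close> with values in the (discrete) kernel of
  \<open>\<phi>\<close>, with pointwise addition.
\<close>

definition Z1 ::
    "weierstrass \<Rightarrow> (point \<Rightarrow> point) \<Rightarrow> complex set \<Rightarrow> ((complex \<Rightarrow> complex) \<Rightarrow> point) monoid" where
  "Z1 W \<phi> F =
    \<lparr>carrier = {f \<in> extensional (gal F).
        continuous_map (krull_topology F) (discrete_topology (ker_pts W \<phi> (alg_cl F))) f \<and>
        (\<forall>\<sigma>\<in>gal F. \<forall>\<tau>\<in>gal F.
           f (compose (alg_cl F) \<sigma> \<tau>) = ec_add W (f \<sigma>) (act \<sigma> (f \<tau>)))},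
     mult = (\<lambda>f g. \<lambda>\<sigma>\<in>gal F. ec_add W (f \<sigma>) (g \<sigma>)),
     one = (\<lambda>\<sigma>\<in>gal F. None)\<rparr>"

definition coboundary ::
    "weierstrass \<Rightarrow> complex set \<Rightarrow> point \<Rightarrow> (complex \<Rightarrow> complex) \<Rightarrow> point" where
  "coboundary W F Q = (\<lambda>\<sigma>\<in>gal F. ec_add W (act \<sigma> Q) (ec_neg Q))"

definition B1 ::
    "weierstrass \<Rightarrow> (point \<Rightarrow> point) \<Rightarrow> complex set \<Rightarrow> ((complex \<Rightarrow> complex) \<Rightarrow> point) set" where
  "B1 W \<phi> F = coboundary W F ` ker_pts W \<phi> (alg_cl F)"

definition H1 ::
    "weierstrass \<Rightarrow> (point \<Rightarrow> point) \<Rightarrow> complex set \<Rightarrow>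
      ((complex \<Rightarrow> complex) \<Rightarrow> point) set monoid" where
  "H1 W \<phi> F = Z1 W \<phi> F Mod B1 W \<phi> F"

definition H1_class ::
    "weierstrass \<Rightarrow> (point \<Rightarrow> point) \<Rightarrow> complex set \<Rightarrow> ((complex \<Rightarrow> complex) \<Rightarrow> point) \<Rightarrow>
      ((complex \<Rightarrow> complex) \<Rightarrow> point) set" where
  "H1_class W \<phi> F f = B1 W \<phi> F #>\<^bsub>Z1 W \<phi> F\<^esub> f"

text \<open>Restriction of cohomology classes from \<open>F\<close> to a larger field \<open>L\<close>, along the map
  \<open>gal L \<rightarrow> gal F\<close> that restricts automorphisms to \<open>alg_cl F\<close>.\<close>

definition res_cocycle ::
    "complex set \<Rightarrow> complex set \<Rightarrow> ((complex \<Rightarrow> complex) \<Rightarrow> point) \<Rightarrow> (complex \<Rightarrow> complex) \<Rightarrow> point" where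
  "res_cocycle F L f = (\<lambda>\<sigma>\<in>gal L. f (restrict \<sigma> (alg_cl F)))"

definition H1_res ::
    "weierstrass \<Rightarrow> (point \<Rightarrow> point) \<Rightarrow> complex set \<Rightarrow> complex set \<Rightarrow>
      ((complex \<Rightarrow> complex) \<Rightarrow> point) set \<Rightarrow> ((complex \<Rightarrow> complex) \<Rightarrow> point) set" where
  "H1_res W \<phi> F L c = the_elem ((\<lambda>f. H1_class W \<phi> L (res_cocycle F L f)) ` c)"

text \<open>The Kummer map sends \<open>P\<close> to the class of \<open>\<sigma> \<mapsto> \<sigma> Q - Q\<close>, for any \<open>Q\<close> with \<open>\<phi> Q = P\<close>.\<close>

definition kummer ::
    "weierstrass \<Rightarrow> (point \<Rightarrow> point) \<Rightarrow> complex set \<Rightarrow> point \<Rightarrow>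
      ((complex \<Rightarrow> complex) \<Rightarrow> point) set" where
  "kummer W \<phi> L P =
     the_elem ((\<lambda>Q. H1_class W \<phi> L (coboundary W L Q)) ` {Q \<in> points W (alg_cl L). \<phi> Q = P})"

text \<open>
  The Selmer group of an isogeny \<open>\<phi>\<close> from \<open>W\<close> to \<open>W'\<close> over \<open>F\<close>. Only finite primes are considered,
  which is the usual definition when \<open>F\<close> has no real embedding.
\<close>

definition selmer ::
    "weierstrass \<Rightarrow> weierstrass \<Rightarrow> (point \<Rightarrow> point) \<Rightarrow> complex set \<Rightarrow>
      ((complex \<Rightarrow> complex) \<Rightarrow> point) set set" where
  "selmer W W' \<phi> F = {c \<in> carrier (H1 W \<phi> F).
     \<forall>v L w. finite_prime F v \<longrightarrow> completion_of F v L w \<longrightarrow>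
       H1_res W \<phi> F L c \<in> kummer W \<phi> L ` points W' L}"

text \<open>
  Dimension over the field with three elements of a subgroup \<open>V\<close> of an abelian group \<open>G\<close>, where
  \<open>V\<close> is killed by 3: the supremum of the sizes of the finite linearly independent subsets of \<open>V\<close>.
  Scalars are represented by integers; the group operation is written multiplicatively.
\<close>

definition F3_independent :: "('a, 'b) monoid_scheme \<Rightarrow> 'a set \<Rightarrow> bool" where
  "F3_independent G S \<longleftrightarrow>
     (\<forall>m :: 'a \<Rightarrow> int. finprod G (\<lambda>s. s [^]\<^bsub>G\<^esub> m s) S = \<one>\<^bsub>G\<^esub> \<longrightarrow> (\<forall>s\<in>S. 3 dvd m s))"

definition F3_dim :: "('a, 'b) monoid_scheme \<Rightarrow> 'a set \<Rightarrow> enat" where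
  "F3_dim G V = (SUP S \<in> {S. finite S \<and> S \<subseteq> V \<and> F3_independent G S}. enat (card S))"


section \<open>The curves and the 3-isogeny\<close>

text \<open>\<open>E a b\<close> is $y^2 = x^3 + a(x-b)^2$ and \<open>Ehat a b\<close> is $y^2 = x^3 - 27a(x-d)^2$ with
  $d = 4a+27b$; see the lemmas after the definitions.\<close>

definition E :: "int \<Rightarrow> int \<Rightarrow> weierstrass" where
  "E a b = \<lparr>a2 = of_int a, a4 = of_int (- 2 * a * b), a6 = of_int (a * b^2)\<rparr>"

definition Ehat :: "int \<Rightarrow> int \<Rightarrow> weierstrass" where
  "Ehat a b = E (- 27 * a) (4 * a + 27 * b)"

fun psi :: "int \<Rightarrow> int \<Rightarrow> point \<Rightarrow> point" where
  "psi a b None = None"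
| "psi a b (Some (x, y)) =
    (if x = 0 then None
     else let A = of_int a; B = of_int b in
       Some (9 * (x^3 + 4/3 * A * x^2 - 4 * A * B * x + 4 * A * B^2) / x^2,
             27 * y * (x^3 + 4 * A * B * x - 8 * A * B^2) / x^3))"

lemma points_E:
  "Some (x, y) \<in> points (E a b) F \<longleftrightarrow>
     x \<in> F \<and> y \<in> F \<and> y^2 = x^3 + of_int a * (x - of_int b)^2"
  by (auto simp: points_def E_def power2_eq_square algebra_simps)

lemma points_Ehat:
  "Some (x, y) \<in> points (Ehat a b) F \<longleftrightarrow>
     x \<in> F \<and> y \<in> F \<and> y^2 = x^3 - 27 * of_int a * (x - of_int (4 * a + 27 * b))^2"
  by (simp add: Ehat_def points_E)

lemma psi_maps_to_Ehat:
  assumes "P \<in> points (E a b) UNIV"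
  shows "psi a b P \<in> points (Ehat a b) UNIV"
proof (cases P)
  case None
  then show ?thesis by (simp add: points_def)
next
  case (Some xy)
  obtain x y where xy: "xy = (x, y)" by force
  define A B where "A = complex_of_int a" and "B = complex_of_int b"
  have eq: "y^2 = x^3 + A * (x - B)^2"
    using assms Some xy by (simp add: points_E A_def B_def)
  show ?thesis
  proof (cases "x = 0")
    case True
    then show ?thesis using Some xy by (simp add: points_def)
  next
    case False
    define N where "N = 9 * x^3 + 12 * A * x^2 - 36 * A * B * x + 36 * A * B^2"
    define M where "M = x^3 + 4 * A * B * x - 8 * A * B^2"
    have "729 * (x^3 + A * (x - B)^2) * M^2
            = N^3 - 27 * A * x^2 * (N - (4 * A + 27 * B) * x^2)^2"
      unfolding N_def M_def by algebra
    then have "(27 * y * M)^2 = N^3 - 27 * A * x^2 * (N - (4 * A + 27 * B) * x^2)^2"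
      by (simp add: power_mult_distrib eq)
    then have "(27 * y * M / x^3)^2 = (N / x^2)^3 - 27 * A * (N / x^2 - (4 * A + 27 * B))^2"
      using False by (simp add: field_simps power2_eq_square power3_eq_cube)
    moreover have "psi a b P = Some (N / x^2, 27 * y * M / x^3)"
      using False Some xy by (simp add: Let_def N_def M_def A_def B_def algebra_simps)
    ultimately show ?thesis
      by (simp add: points_Ehat A_def B_def)
  qed
qed

end

theory Submission
  imports Defs "HOL-Algebra.Finite_Extensions"
    "HOL-Computational_Algebra.Fundamental_Theorem_Algebra"
    "HOL-Computational_Algebra.Nth_Powers" "HOL-Number_Theory.Cong"
begin

text \<open>
  Put \<open>\<rho> = \<surd>6\<close> and take $a = -243 \cdot 6^{N-2}$ with \<open>N\<close> odd. Then \<open>-3a\<close> is the square of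
  $\kappa = \frac{9}{2} \rho^N$ and $d = 4a + 27 = 27(1 - 6^N)$. Over \<open>K(\<rho>)\<close> the kernel of the isogeny
  is isomorphic to $\mu_3$, so an element \<open>u\<close> with conjugate \<open>1/u\<close> defines a class, with torsor
  $u \zeta^3 - u^{-1} t^3 = 6 \kappa (\zeta t - d)$ where \<open>\<zeta>\<close> and \<open>t\<close> are conjugate.
  For every divisor \<open>e\<close> of \<open>N\<close> the quotient $u_e = (1 + \rho^e)/(1 - \rho^e)$ gives a Selmer class.
  Where \<open>6\<close> is not a unit, and at the primes that are inert in \<open>K(\<rho>)\<close>, it is locally the cube of an
  element of norm 1, by Hensel's lemma and by counting in the residue field. At a split prime where
  $u_e$ is a unit one lifts a point of the torsor from the residue field, and where $u_e$ is not a unit,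
  \<open>d\<close> is divisible by the offending factor because \<open>e\<close> divides \<open>N\<close>.
  For distinct primes \<open>e > 5\<close> the classes are independent: $(6^e - 1)/5$ is 7 modulo 9, hence not a
  cube, so some prime occurs in it with exponent not divisible by 3, and that prime divides no other
  $6^{e'} - 1$. The odd multiples \<open>N\<close> of a product of \<open>2n\<close> such primes give infinitely many \<open>a\<close>.
\<close>

subsection \<open>Algebraic closures\<close>

text \<open>The base 6 takes care of the bad primes: \<open>a\<close> has no prime factors besides 2
  and 3, and above these \<open>\<rho>^e\<close> is so small that \<open>unit_u e\<close> is close
  to 1 and therefore a cube. The cube root costs a division by 3, for which \<open>e \<ge> 5\<close>
  provides a spare factor 6. The constant 243 makes \<open>d\<close> equal to
  \<open>27 (1 - \<rho>^N) (1 + \<rho>^N)\<close>, and since \<open>N\<close> is an odd multiple of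
  \<open>e\<close>, both \<open>1 - \<rho>^e\<close> and \<open>1 + \<rho>^e\<close> divide it. An
  odd \<open>N\<close> also keeps \<open>\<rho>^N\<close> outside \<open>K\<close>, so that neither
  curve has nontrivial 3-torsion over \<open>K\<close>.

  The obstacle is a split prime at which \<open>unit_u e\<close> and \<open>d\<close> are units: the
  torsor reduces to a smooth cubic without an evident point. Instead of a general theorem on curves
  of genus one, the numbers of points of the two isogenous curves are compared through a quadratic
  twist, on which the isogeny and its dual are injective. As the kernel is rational on the curve
  itself, some point of the target has no preimage, and this failure supplies a point of the
  torsor.\<close>

definition coeffs_in :: "complex set \<Rightarrow> complex poly \<Rightarrow> bool" where
  "coeffs_in F p \<longleftrightarrow> (\<forall>i. Polynomial.coeff p i \<in> F)"

lemma alg_cl_iff: "x \<in> alg_cl F \<longleftrightarrow> (\<exists>p. p \<noteq> 0 \<and> coeffs_in F p \<and> poly p x = 0)"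
  by (auto simp: alg_cl_def coeffs_in_def)

context
  fixes F :: "complex set"
  assumes F: "complex_subfield F"
begin

lemma subfield_0: "0 \<in> F" and subfield_1: "1 \<in> F"
  and subfield_add: "x \<in> F \<Longrightarrow> y \<in> F \<Longrightarrow> x + y \<in> F"
  and subfield_mult: "x \<in> F \<Longrightarrow> y \<in> F \<Longrightarrow> x * y \<in> F"
  and subfield_uminus: "x \<in> F \<Longrightarrow> - x \<in> F"
  and subfield_inverse: "x \<in> F \<Longrightarrow> inverse x \<in> F"
  using F by (auto simp: complex_subfield_def)

lemma subfield_diff: "x \<in> F \<Longrightarrow> y \<in> F \<Longrightarrow> x - y \<in> F"
  using complex_subfield_diff[OF F] .

lemma subfield_divide: "x \<in> F \<Longrightarrow> y \<in> F \<Longrightarrow> x / y \<in> F"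
  by (simp add: divide_inverse subfield_mult subfield_inverse)

lemma subfield_power: "x \<in> F \<Longrightarrow> x ^ n \<in> F"
  by (induction n) (auto intro: subfield_1 subfield_mult)

lemma subfield_sum: "(\<And>i. i \<in> A \<Longrightarrow> f i \<in> F) \<Longrightarrow> sum f A \<in> F"
  by (induction A rule: infinite_finite_induct) (auto intro: subfield_0 subfield_add)

lemma subfield_prod: "(\<And>i. i \<in> A \<Longrightarrow> f i \<in> F) \<Longrightarrow> prod f A \<in> F"
  by (induction A rule: infinite_finite_induct) (auto intro: subfield_1 subfield_mult)

lemma subfield_of_nat: "of_nat n \<in> F"
  by (induction n) (auto intro: subfield_0 subfield_1 subfield_add)

lemma subfield_numeral: "numeral n \<in> F"
  using subfield_of_nat[of "numeral n"] by simp

lemma subfield_of_int: "of_int n \<in> F"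
  by (cases n rule: int_cases) (auto intro: subfield_of_nat subfield_uminus simp del: of_nat_Suc)

lemma subfield_of_rat: "of_rat r \<in> F"
  by (cases r) (auto simp: of_rat_rat intro: subfield_of_int subfield_divide)

lemmas subfield_intros = subfield_0 subfield_1 subfield_add subfield_mult subfield_uminus
  subfield_inverse subfield_diff subfield_divide subfield_power subfield_of_nat subfield_numeral
  subfield_of_int subfield_of_rat

lemma subfield_poly: "coeffs_in F p \<Longrightarrow> x \<in> F \<Longrightarrow> poly p x \<in> F"
  by (auto simp: poly_altdef coeffs_in_def intro!: subfield_sum subfield_mult subfield_power)

lemma alg_cl_superset: "F \<subseteq> alg_cl F"
proof
  fix x assume "x \<in> F"
  then have "coeffs_in F [:- x, 1:]"
    by (auto simp: coeffs_in_def coeff_pCons split: nat.splits intro: subfield_intros)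
  then show "x \<in> alg_cl F" unfolding alg_cl_iff by (intro exI[of _ "[:- x, 1:]"]) auto
qed

text \<open>If \<open>p\<close> annihilates \<open>x ^ n\<close>, then \<open>p\<close> composed
  with \<open>X ^ n\<close> annihilates \<open>x\<close>. Through this lemma square roots and cube
  roots enter the algebraic closure.\<close>

lemma alg_cl_root:
  assumes "x ^ n \<in> alg_cl F" "n > 0"
  shows "x \<in> alg_cl F"
proof -
  obtain p where p: "p \<noteq> 0" "coeffs_in F p" "poly p (x ^ n) = 0"
    using assms unfolding alg_cl_iff by blast
  have "pcompose p (Polynomial.monom 1 n) \<noteq> 0"
    using p(1) assms(2) by (simp add: pcompose_eq_0_iff degree_monom_eq)
  moreover have "coeffs_in F (pcompose p (Polynomial.monom 1 n))"
  proof -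
    have *: "coeffs_in F (p * q)" if "coeffs_in F p" "coeffs_in F q" for p q
      using that by (auto simp: coeffs_in_def coeff_mult intro!: subfield_sum subfield_mult)
    have m: "coeffs_in F (Polynomial.monom 1 n)"
      by (auto simp: coeffs_in_def intro: subfield_intros)
    show ?thesis using p(2)
    proof (induction p)
      case 0
      then show ?case by simp
    next
      case (pCons a p)
      have "coeffs_in F p"
        unfolding coeffs_in_def
      proof
        fix i show "Polynomial.coeff p i \<in> F"
          using pCons.prems[unfolded coeffs_in_def, rule_format, of "Suc i"] by simp
      qed
      then have "coeffs_in F (Polynomial.monom 1 n * pcompose p (Polynomial.monom 1 n))"
        using pCons m * by blast
      moreover have "a \<in> F" using pCons.prems[unfolded coeffs_in_def, rule_format, of 0] by simp
      ultimately show ?case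
        by (auto simp: pcompose_pCons coeffs_in_def coeff_pCons split: nat.splits
            intro!: subfield_add subfield_0)
    qed
  qed
  moreover have "poly (pcompose p (Polynomial.monom 1 n)) x = 0"
    using p(3) by (simp add: poly_pcompose poly_monom)
  ultimately show ?thesis unfolding alg_cl_iff by blast
qed

end

text \<open>The complex numbers as a structure of HOL-Algebra, introduced to transfer the theorem
  that the algebraic elements over a subfield form a subfield; see
  \<open>complex_subfield_alg_cl\<close>.\<close>

definition complex_ring :: "complex ring" where
  "complex_ring = \<lparr>carrier = UNIV, monoid.mult = (*), one = 1, ring.zero = 0, add = (+)\<rparr>"

lemma complex_ring_simps [simp]:
  "carrier complex_ring = UNIV" "x \<otimes>\<^bsub>complex_ring\<^esub> y = x * y" "\<one>\<^bsub>complex_ring\<^esub> = 1"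
  "\<zero>\<^bsub>complex_ring\<^esub> = 0" "x \<oplus>\<^bsub>complex_ring\<^esub> y = x + y"
  by (simp_all add: complex_ring_def)

lemma field_complex_ring: "field complex_ring"
proof -
  have "cring complex_ring"
    by (rule cringI, rule abelian_groupI, auto intro: comm_monoidI simp: algebra_simps)
      (metis add.right_inverse)
  moreover have "Units complex_ring = UNIV - {0}"
    by (auto simp: Units_def) (metis right_inverse mult.commute)
  ultimately show ?thesis by (intro cring.cring_fieldI) auto
qed

interpretation CR: domain complex_ring by (rule field.axioms(1)[OF field_complex_ring])

lemma complex_ring_uminus [simp]: "\<ominus>\<^bsub>complex_ring\<^esub> x = - x"
  by (rule CR.minus_equality) auto

lemma complex_ring_inv: "x \<noteq> 0 \<Longrightarrow> inv\<^bsub>complex_ring\<^esub> x = inverse x"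
  by (rule CR.inv_char) auto

lemma complex_ring_pow [simp]: "x [^]\<^bsub>complex_ring\<^esub> (n::nat) = x ^ n"
  by (induction n) (auto simp: mult.commute)

lemma subfield_complex_ring: "subfield F complex_ring \<longleftrightarrow> complex_subfield F"
proof
  assume F: "complex_subfield F"
  note i = subfield_intros[OF F]
  have "subring F complex_ring"
    by (rule CR.subringI) (auto intro: i)
  then show "subfield F complex_ring"
    by (rule field.subfieldI'[OF field_complex_ring]) (auto simp: complex_ring_inv intro: i)
next
  assume F: "subfield F complex_ring"
  note sr = subfieldE(1)[OF F]
  have "inverse x \<in> F" if "x \<in> F" for x
  proof (cases "x = 0")
    case True
    then show ?thesis using that by simp
  next
    case False
    then show ?thesis
      using CR.subfield_m_inv(1)[OF F, of x] that by (simp add: complex_ring_inv)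
  qed
  then show "complex_subfield F"
    using subringE[OF sr] by (auto simp: complex_subfield_def)
qed

text \<open>HOL-Algebra lists coefficients from the leading one downwards, \<open>Poly\<close> from
  the constant one upwards.\<close>

lemma poly_Poly_rev: "poly (Poly (rev p)) x = CR.eval p x"
  by (induction p) (auto simp: Poly_append poly_monom algebra_simps)

lemma algebraic_complex_ring:
  assumes F: "complex_subfield F"
  shows "(CR.algebraic over F) x \<longleftrightarrow> x \<in> alg_cl F"
proof
  have sf: "subfield F complex_ring" using F by (simp add: subfield_complex_ring)
  assume "(CR.algebraic over F) x"
  then obtain p where p: "p \<in> carrier (F[X]\<^bsub>complex_ring\<^esub>)" "p \<noteq> []" "CR.eval p x = 0"
    using CR.algebraicE[OF subfieldE(1)[OF sf], of x] by auto
  have lc: "set p \<subseteq> F" "hd p \<noteq> 0"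
    using p by (auto simp: univ_poly_def polynomial_def)
  have "coeffs_in F (Poly (rev p))"
    unfolding coeffs_in_def
  proof
    fix i show "Polynomial.coeff (Poly (rev p)) i \<in> F"
    proof (cases "i < length p")
      case True
      then have "rev p ! i \<in> set (rev p)" by (intro nth_mem) auto
      then show ?thesis using lc True by (auto simp: nth_default_def)
    next
      case False
      then show ?thesis using F by (auto simp: nth_default_def complex_subfield_def)
    qed
  qed
  moreover have "Poly (rev p) \<noteq> 0"
  proof
    assume 0: "Poly (rev p) = 0"
    obtain a q where "p = a # q" using p(2) by (cases p) auto
    then have "Polynomial.coeff (Poly (rev p)) (length q) = hd p"
      by (simp add: nth_default_def nth_append)
    then show False using 0 lc by simp
  qed
  ultimately show "x \<in> alg_cl F"
    using p(3) poly_Poly_rev[of p x] unfolding alg_cl_iff by auto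
next
  assume "x \<in> alg_cl F"
  then obtain p where p: "p \<noteq> 0" "coeffs_in F p" "poly p x = 0" unfolding alg_cl_iff by blast
  have 1: "set (rev (coeffs p)) \<subseteq> F"
    using p(2) by (auto simp: coeffs_in_def coeffs_def)
  have 2: "hd (rev (coeffs p)) \<noteq> 0" using p(1)
    by (simp add: hd_rev last_coeffs_eq_coeff_degree)
  have "rev (coeffs p) \<in> carrier (F[X]\<^bsub>complex_ring\<^esub>)"
    using 1 2 by (auto simp: univ_poly_def polynomial_def)
  moreover have "CR.eval (rev (coeffs p)) x = 0"
    using p(3) poly_Poly_rev[of "rev (coeffs p)" x] by simp
  ultimately show "(CR.algebraic over F) x"
    using CR.algebraicI[of "rev (coeffs p)" F x] p(1) by simp
qed

lemma complex_subfield_alg_cl: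
  assumes "complex_subfield F"
  shows "complex_subfield (alg_cl F)"
  using field.subfield_of_algebraics[OF field_complex_ring, of F] assms
  by (simp add: subfield_complex_ring algebraic_complex_ring)

lemma alg_cl_mono: "F \<subseteq> L \<Longrightarrow> alg_cl F \<subseteq> alg_cl L"
  by (auto simp: alg_cl_def)

subsection \<open>Extension of partial automorphisms\<close>

text \<open>A partial automorphism over \<open>F\<close> is represented by its graph, a subring of the square of the
  algebraic closure which contains the diagonal of \<open>F\<close> and is single-valued.\<close>

definition partial_aut :: "complex set \<Rightarrow> (complex \<times> complex) set \<Rightarrow> bool" where
  "partial_aut F R \<longleftrightarrow> (\<forall>x\<in>F. (x, x) \<in> R) \<and> fst ` R \<subseteq> alg_cl F \<and>
     (\<forall>x y x' y'. (x, y) \<in> R \<longrightarrow> (x', y') \<in> R \<longrightarrow>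
        (x + x', y + y') \<in> R \<and> (x - x', y - y') \<in> R \<and> (x * x', y * y') \<in> R) \<and>
     (\<forall>y. (0, y) \<in> R \<longrightarrow> y = 0)"

text \<open>The polynomial \<open>q\<close> is the conjugate of \<open>p\<close> under the partial
  automorphism; as the latter is single-valued, \<open>p\<close> determines
  \<open>q\<close>.\<close>

definition coeff_pairs :: "(complex \<times> complex) set \<Rightarrow> complex poly \<Rightarrow> complex poly \<Rightarrow> bool" where
  "coeff_pairs R p q \<longleftrightarrow> (\<forall>i. (Polynomial.coeff p i, Polynomial.coeff q i) \<in> R)"

lemma partial_autD:
  assumes "partial_aut F R"
  shows "x \<in> F \<Longrightarrow> (x, x) \<in> R" "(x, y) \<in> R \<Longrightarrow> x \<in> alg_cl F"
    "(x, y) \<in> R \<Longrightarrow> (x', y') \<in> R \<Longrightarrow> (x + x', y + y') \<in> R"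
    "(x, y) \<in> R \<Longrightarrow> (x', y') \<in> R \<Longrightarrow> (x - x', y - y') \<in> R"
    "(x, y) \<in> R \<Longrightarrow> (x', y') \<in> R \<Longrightarrow> (x * x', y * y') \<in> R"
    "(0, y) \<in> R \<Longrightarrow> y = 0"
  using assms unfolding partial_aut_def by auto

lemma partial_aut_unique:
  assumes "partial_aut F R" "(x, y) \<in> R" "(x, y') \<in> R"
  shows "y = y'"
  using partial_autD(4)[OF assms] partial_autD(6)[OF assms(1)] by fastforce

lemma coeff_pairs_add:
  assumes "partial_aut F R" "coeff_pairs R p q" "coeff_pairs R p' q'"
  shows "coeff_pairs R (p + p') (q + q')"
  using assms by (auto simp: coeff_pairs_def intro: partial_autD)

lemma coeff_pairs_diff:
  assumes "partial_aut F R" "coeff_pairs R p q" "coeff_pairs R p' q'"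
  shows "coeff_pairs R (p - p') (q - q')"
  using assms by (auto simp: coeff_pairs_def intro: partial_autD)

lemma partial_aut_sum:
  assumes "partial_aut F R" "0 \<in> F" "\<And>i. i \<in> A \<Longrightarrow> (f i, g i) \<in> R"
  shows "(sum f A, sum g A) \<in> R"
  using assms(3)
  by (induction A rule: infinite_finite_induct) (auto intro: partial_autD[OF assms(1)] assms(2))

lemma coeff_pairs_mult:
  assumes "partial_aut F R" "0 \<in> F" "coeff_pairs R p q" "coeff_pairs R p' q'"
  shows "coeff_pairs R (p * p') (q * q')"
  using assms(3,4)
  by (auto simp: coeff_pairs_def coeff_mult intro!: partial_aut_sum[OF assms(1,2)]
      intro: partial_autD[OF assms(1)])

lemma coeff_pairs_monom:
  assumes "partial_aut F R" "0 \<in> F" "(c, c') \<in> R"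
  shows "coeff_pairs R (Polynomial.monom c n) (Polynomial.monom c' n)"
  using assms(3) partial_autD(1)[OF assms(1,2)] by (auto simp: coeff_pairs_def)

lemma coeff_pairs_poly:
  assumes "partial_aut F R" "1 \<in> F" "0 \<in> F" "coeff_pairs R p q" "(x, y) \<in> R"
  shows "(poly p x, poly q y) \<in> R"
proof -
  have pw: "(x ^ n, y ^ n) \<in> R" for n
    by (induction n) (auto intro: partial_autD[OF assms(1)] assms)
  define n where "n = max (Polynomial.degree p) (Polynomial.degree q)"
  have e: "poly r z = (\<Sum>i\<le>n. Polynomial.coeff r i * z ^ i)" if "Polynomial.degree r \<le> n" for r :: "complex poly" and z
    unfolding poly_altdef[of r z] by (rule sum.mono_neutral_left) (use that in \<open>auto simp: coeff_eq_0\<close>)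
  have "poly p x = (\<Sum>i\<le>n. Polynomial.coeff p i * x ^ i)"
    "poly q y = (\<Sum>i\<le>n. Polynomial.coeff q i * y ^ i)" by (intro e; simp add: n_def)+
  then show ?thesis
    using assms(4) pw
    by (auto simp: coeff_pairs_def intro!: partial_aut_sum[OF assms(1,3)] partial_autD(5)[OF assms(1)])
qed

text \<open>The domain of \<open>R\<close> is only assumed to be a ring. It is closed under inverses
  because its elements are algebraic over \<open>F\<close>: a minimal polynomial
  \<open>a + X q\<close> has \<open>a \<noteq> 0\<close>, and \<open>1/x\<close> is the value of
  \<open>- q / a\<close> at \<open>x\<close>.\<close>

lemma partial_aut_inverse:
  assumes F: "complex_subfield F" and R: "partial_aut F R" and xy: "(x, y) \<in> R" "x \<noteq> 0"
  shows "\<exists>y'. (inverse x, y') \<in> R"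
proof -
  have "\<exists>p. p \<noteq> 0 \<and> coeffs_in F p \<and> poly p x = 0"
    using partial_autD(2)[OF R xy(1)] by (simp add: alg_cl_iff)
  then have "\<exists>p. p \<noteq> 0 \<and> coeffs_in F p \<and> poly p x = 0 \<and>
      (\<forall>q. q \<noteq> 0 \<and> coeffs_in F q \<and> poly q x = 0 \<longrightarrow> Polynomial.degree p \<le> Polynomial.degree q)"
    using ex_has_least_nat[of "\<lambda>p. p \<noteq> 0 \<and> coeffs_in F p \<and> poly p x = 0" _ Polynomial.degree] by metis
  then obtain p where p: "p \<noteq> 0" "coeffs_in F p" "poly p x = 0"
    and min: "\<And>q. q \<noteq> 0 \<Longrightarrow> coeffs_in F q \<Longrightarrow> poly q x = 0 \<Longrightarrow>
      Polynomial.degree p \<le> Polynomial.degree q" by blast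
  obtain a q where pq: "p = pCons a q" by (cases p)
  have a: "a \<in> F" using p(2)[unfolded coeffs_in_def, rule_format, of 0] pq by simp
  have q: "coeffs_in F q"
    unfolding coeffs_in_def
  proof
    fix i show "Polynomial.coeff q i \<in> F"
      using p(2)[unfolded coeffs_in_def, rule_format, of "Suc i"] pq by simp
  qed
  have a0: "a \<noteq> 0"
  proof
    assume "a = 0"
    then have "q \<noteq> 0" "poly q x = 0" using p pq xy(2) by auto
    then show False using min[of q] q pq by simp
  qed
  have "coeff_pairs R q q" using q by (auto simp: coeff_pairs_def coeffs_in_def intro: partial_autD[OF R])
  then have "(poly q x, poly q y) \<in> R"
    using coeff_pairs_poly[OF R _ _ _ xy(1)] subfield_intros(1,2)[OF F] by blast
  moreover have "- inverse a \<in> F" using a F by (auto intro: subfield_intros)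
  ultimately have "(- inverse a * poly q x, - inverse a * poly q y) \<in> R"
    by (intro partial_autD(5)[OF R]) (auto intro: partial_autD(1)[OF R])
  moreover have "- inverse a * poly q x = inverse x"
  proof -
    have "a + x * poly q x = 0" using p(3) pq by simp
    then have "x * poly q x = - a" by (simp add: eq_neg_iff_add_eq_0 add.commute)
    then show ?thesis using a0 xy(2) by (simp add: field_simps)
  qed
  ultimately show ?thesis by auto
qed

text \<open>Division with remainder by a polynomial of minimal degree shows that every relation
  satisfied by \<open>x\<close> is satisfied by the root \<open>y\<close> of the conjugate polynomial.\<close>

lemma partial_aut_minimal:
  assumes F: "complex_subfield F" and R: "partial_aut F R"
    and p: "p \<noteq> 0" "coeff_pairs R p p'" "poly p' y = 0"
    and min: "\<And>q q'. q \<noteq> 0 \<Longrightarrow> coeff_pairs R q q' \<Longrightarrow> poly q x = 0 \<Longrightarrow>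
      Polynomial.degree p \<le> Polynomial.degree q"
    and px: "poly p x = 0"
    and q: "coeff_pairs R q q'" "poly q x = 0"
  shows "poly q' y = 0"
  using q
proof (induction "Polynomial.degree q" arbitrary: q q' rule: less_induct)
  case less
  have 0: "0 \<in> F" using F by (auto simp: complex_subfield_def)
  show ?case
  proof (cases "q = 0")
    case True
    have "Polynomial.coeff q' i = 0" for i
      using less.prems(1)[unfolded coeff_pairs_def, rule_format, of i] True
        partial_autD(6)[OF R] by auto
    then have "q' = 0" by (simp add: poly_eq_iff)
    then show ?thesis by simp
  next
    case False
    define m n where "m = Polynomial.degree q" and "n = Polynomial.degree p"
    have mn: "n \<le> m" using min[OF False less.prems] by (simp add: m_def n_def)
    define a b where "a = Polynomial.coeff q m" and "b = Polynomial.coeff p n"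
    define a' b' where "a' = Polynomial.coeff q' m" and "b' = Polynomial.coeff p' n"
    have ab: "(a, a') \<in> R" "(b, b') \<in> R"
      using less.prems(1) p(2) by (auto simp: coeff_pairs_def a_def b_def a'_def b'_def)
    have b0: "b \<noteq> 0" using p(1) by (simp add: b_def n_def)
    obtain c where c: "(inverse b, c) \<in> R"
      using partial_aut_inverse[OF F R ab(2) b0] by blast
    define M M' where "M = Polynomial.monom (a * inverse b) (m - n) * p"
      and "M' = Polynomial.monom (a' * c) (m - n) * p'"
    have M: "coeff_pairs R M M'"
      unfolding M_def M'_def
      by (intro coeff_pairs_mult[OF R 0] coeff_pairs_monom[OF R 0] partial_autD(5)[OF R] ab c p)
    have D: "coeff_pairs R (q - M) (q' - M')" by (intro coeff_pairs_diff[OF R] less.prems M)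
    have rx: "poly (q - M) x = 0" using less.prems px by (simp add: M_def)
    have ry: "poly (q' - M') y = poly q' y" using p(3) by (simp add: M'_def)
    have dM: "Polynomial.degree M \<le> m"
      unfolding M_def using degree_mult_le[of "Polynomial.monom (a * inverse b) (m - n)" p]
        degree_monom_le[of "a * inverse b" "m - n"] mn by (simp add: n_def)
    have "Polynomial.coeff M m = Polynomial.coeff q m"
      using b0 mn by (simp add: M_def coeff_monom_mult a_def b_def)
    then have cm: "Polynomial.coeff (q - M) m = 0" by simp
    have dle: "Polynomial.degree (q - M) \<le> m" using dM by (intro degree_diff_le) (auto simp: m_def)
    show ?thesis
    proof (cases "m = 0")
      case True
      then have "q - M = 0" using dle cm by (metis le_zero_eq leading_coeff_0_iff)
      then have "Polynomial.coeff (q' - M') i = 0" for i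
        using D[unfolded coeff_pairs_def, rule_format, of i] 
          partial_autD(6)[OF R] by (metis coeff_0)
      then have "q' - M' = 0" unfolding poly_eq_iff by simp
      then show ?thesis using ry by simp
    next
      case False
      then have "Polynomial.degree (q - M) < m"
        using dle cm by (metis le_neq_implies_less leading_coeff_0_iff degree_0 gr0I)
      then show ?thesis using less.hyps[OF _ D rx] ry by (simp add: m_def)
    qed
  qed
qed

text \<open>The enlarged graph consists of the pairs of values of conjugate polynomials at
  \<open>x\<close> and at \<open>y\<close>. It is automatically a ring; the hypothesis on
  \<open>y\<close> is exactly its single-valuedness.\<close>

lemma partial_aut_adjoin:
  assumes F: "complex_subfield F" and R: "partial_aut F R" and x: "x \<in> alg_cl F"
    and xy: "\<And>q q'. coeff_pairs R q q' \<Longrightarrow> poly q x = 0 \<Longrightarrow> poly q' y = 0"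
  shows "\<exists>S. partial_aut F S \<and> R \<subseteq> S \<and> (x, y) \<in> S"
proof (intro exI conjI)
  define S where "S = {(poly q x, poly q' y) | q q'. coeff_pairs R q q'}"
  have 0: "0 \<in> F" "1 \<in> F" using F by (auto simp: complex_subfield_def)
  show RS: "R \<subseteq> S"
  proof (clarify)
    fix a b assume "(a, b) \<in> R"
    then have "coeff_pairs R [:a:] [:b:]"
      using coeff_pairs_monom[OF R 0(1), of a b 0] by (simp add: monom_0)
    then show "(a, b) \<in> S" unfolding S_def
      by (intro CollectI exI[of _ "[:a:]"] exI[of _ "[:b:]"]) auto
  qed
  show "(x, y) \<in> S"
  proof -
    have "coeff_pairs R (Polynomial.monom 1 1) (Polynomial.monom 1 1)"
      using coeff_pairs_monom[OF R 0(1)] partial_autD(1)[OF R] 0 by blast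
    then show ?thesis unfolding S_def
      by (auto intro!: exI[of _ "Polynomial.monom 1 1 :: complex poly"] simp: poly_monom)
  qed
  note A = complex_subfield_alg_cl[OF F]
  show "partial_aut F S"
    unfolding partial_aut_def
  proof (intro conjI allI impI ballI)
    show "(z, z) \<in> S" if "z \<in> F" for z using that RS partial_autD(1)[OF R] by blast
    show "fst ` S \<subseteq> alg_cl F"
    proof (clarsimp simp: S_def)
      fix q q' assume "coeff_pairs R q q'"
      then have "coeffs_in (alg_cl F) q"
        unfolding coeff_pairs_def coeffs_in_def using partial_autD(2)[OF R] by blast
      then show "poly q x \<in> alg_cl F" using subfield_poly[OF A] x by blast
    qed
    show "b = 0" if "(0, b) \<in> S" for b using that xy unfolding S_def by auto
    fix a b a' b' assume *: "(a, b) \<in> S" "(a', b') \<in> S"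
    then obtain p p' q q' where "coeff_pairs R p p'" "coeff_pairs R q q'"
      "a = poly p x" "b = poly p' y" "a' = poly q x" "b' = poly q' y" unfolding S_def by auto
    note pq = this
    have I: "(u, v) \<in> S" if "coeff_pairs R r r'" "u = poly r x" "v = poly r' y" for u v r r'
      unfolding S_def using that by blast
    show "(a + a', b + b') \<in> S"
      by (rule I[OF coeff_pairs_add[OF R pq(1,2)]]) (simp_all add: pq)
    show "(a - a', b - b') \<in> S"
      by (rule I[OF coeff_pairs_diff[OF R pq(1,2)]]) (simp_all add: pq)
    show "(a * a', b * b') \<in> S"
      by (rule I[OF coeff_pairs_mult[OF R 0(1) pq(1,2)]]) (simp_all add: pq)
  qed
qed

text \<open>Take a polynomial of least degree over the domain of \<open>R\<close> with root
  \<open>x\<close>, and for \<open>y\<close> any complex root of its conjugate.\<close>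

lemma partial_aut_extend:
  assumes F: "complex_subfield F" and R: "partial_aut F R" and x: "x \<in> alg_cl F"
  shows "\<exists>S y. partial_aut F S \<and> R \<subseteq> S \<and> (x, y) \<in> S"
proof (cases "x \<in> fst ` R")
  case True
  then show ?thesis using R by force
next
  case False
  define P where "P = (\<lambda>p. p \<noteq> 0 \<and> (\<exists>p'. coeff_pairs R p p') \<and> poly p x = 0)"
  have 0: "0 \<in> F" "1 \<in> F" using F by (auto simp: complex_subfield_def)
  have "\<exists>p. P p"
    using x partial_autD(1)[OF R] unfolding alg_cl_iff P_def coeff_pairs_def coeffs_in_def by metis
  then obtain p where "P p" and min: "\<And>q. P q \<Longrightarrow> Polynomial.degree p \<le> Polynomial.degree q"
    using ex_has_least_nat[of P _ Polynomial.degree] by metis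
  then obtain p' where p: "p \<noteq> 0" "coeff_pairs R p p'" "poly p x = 0" unfolding P_def by blast
  have dp: "Polynomial.degree p > 0"
  proof (rule ccontr)
    assume "\<not> Polynomial.degree p > 0"
    then obtain a where "p = [:a:]" by (metis degree_eq_zeroE neq0_conv)
    then show False using p by auto
  qed
  \<comment> \<open>The conjugate must not be constant if it is to have a root. Its leading
    coefficient survives because that of \<open>p\<close> is invertible in the domain of
    \<open>R\<close>.\<close>
  have "Polynomial.coeff p' (Polynomial.degree p) \<noteq> 0"
  proof
    define l where "l = Polynomial.coeff p (Polynomial.degree p)"
    assume "Polynomial.coeff p' (Polynomial.degree p) = 0"
    then have l: "(l, 0) \<in> R" using p(2) unfolding coeff_pairs_def l_def by metis
    have l0: "l \<noteq> 0" using p(1) by (simp add: l_def)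
    obtain c where "(inverse l, c) \<in> R" using partial_aut_inverse[OF F R l l0] by blast
    then have "(1, 0) \<in> R" using partial_autD(5)[OF R l] l0 by force
    then show False using partial_aut_unique[OF R _ partial_autD(1)[OF R 0(2)]] by force
  qed
  then have "Polynomial.degree p' > 0" using dp le_degree by (metis less_le_trans)
  then have "\<not> constant (poly p')" by (simp add: constant_degree)
  then obtain y where y: "poly p' y = 0" using fundamental_theorem_of_algebra by blast
  have "poly q' y = 0" if "coeff_pairs R q q'" "poly q x = 0" for q q'
    using partial_aut_minimal[OF F R p(1,2) y _ p(3) that] min unfolding P_def by blast
  then show ?thesis using partial_aut_adjoin[OF F R x] by blast
qed

text \<open>An injective map that preserves the finite set of roots of each polynomial permutes it,
  hence is onto. Surjectivity therefore never has to be built into the construction of an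
  automorphism.\<close>

lemma coeffs_in_finite_roots:
  fixes \<sigma> :: "complex \<Rightarrow> complex"
  assumes inj: "inj_on \<sigma> (alg_cl F)"
    and maps: "\<And>p x. coeffs_in F p \<Longrightarrow> x \<in> alg_cl F \<Longrightarrow> poly p x = 0 \<Longrightarrow> poly p (\<sigma> x) = 0"
  shows "\<sigma> ` alg_cl F = alg_cl F"
proof
  show "\<sigma> ` alg_cl F \<subseteq> alg_cl F"
    using maps unfolding alg_cl_iff by (metis (no_types, lifting) alg_cl_iff image_subsetI)
  show "alg_cl F \<subseteq> \<sigma> ` alg_cl F"
  proof
    fix x assume "x \<in> alg_cl F"
    then obtain p where p: "p \<noteq> 0" "coeffs_in F p" "poly p x = 0" unfolding alg_cl_iff by blast
    define Z where "Z = {z. poly p z = 0}"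
    have Z: "finite Z" "Z \<subseteq> alg_cl F" using p by (auto simp: Z_def alg_cl_iff poly_roots_finite)
    have "\<sigma> ` Z \<subseteq> Z" using maps p(2) Z(2) by (auto simp: Z_def)
    then have "\<sigma> ` Z = Z" using Z inj by (intro endo_inj_surj) (auto intro: inj_on_subset)
    then show "x \<in> \<sigma> ` alg_cl F" using p(3) Z(2) by (auto simp: Z_def)
  qed
qed

text \<open>By Zorn's lemma \<open>R\<close> lies in a maximal partial automorphism, and
  \<open>partial_aut_extend\<close> shows that its domain is the whole algebraic closure.\<close>

theorem partial_aut_gal:
  assumes F: "complex_subfield F" and R: "partial_aut F R"
  shows "\<exists>\<sigma>\<in>gal F. \<forall>(x, y)\<in>R. \<sigma> x = y"
proof -
  define A where "A = {S. partial_aut F S \<and> R \<subseteq> S}"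
  have "\<exists>M\<in>A. \<forall>S\<in>A. M \<subseteq> S \<longrightarrow> S = M"
  proof (rule subset_Zorn_nonempty)
    show "A \<noteq> {}" using R by (auto simp: A_def)
    fix C assume C: "C \<noteq> {}" "subset.chain A C"
    then have CA: "\<And>S. S \<in> C \<Longrightarrow> partial_aut F S \<and> R \<subseteq> S" by (auto simp: A_def subset_chain_def)
    have two: "\<exists>S\<in>C. a \<in> S \<and> b \<in> S" if "a \<in> \<Union>C" "b \<in> \<Union>C" for a b
    proof -
      obtain S T where ST: "S \<in> C" "a \<in> S" "T \<in> C" "b \<in> T" using \<open>a \<in> \<Union>C\<close> \<open>b \<in> \<Union>C\<close> by blast
      then have "S \<subseteq> T \<or> T \<subseteq> S" using C(2) unfolding subset_chain_def by blast
      then show ?thesis using ST by blast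
    qed
    have "partial_aut F (\<Union>C)"
      unfolding partial_aut_def
    proof (intro conjI allI impI ballI)
      show "(z, z) \<in> \<Union>C" if "z \<in> F" for z using that C(1) CA partial_autD(1) by blast
      show "fst ` \<Union>C \<subseteq> alg_cl F" using CA partial_autD(2) by (clarsimp, blast)
      show "b = 0" if b: "(0, b) \<in> \<Union>C" for b
      proof -
        obtain S where "S \<in> C" "(0, b) \<in> S" using b by blast
        then show ?thesis using CA[of S] partial_autD(6)[of F S b] by blast
      qed
      fix a b a' b' assume "(a, b) \<in> \<Union>C" "(a', b') \<in> \<Union>C"
      then obtain S where "S \<in> C" "(a, b) \<in> S" "(a', b') \<in> S" using two by blast
      note S = this
      then have p: "partial_aut F S" using CA by blast
      show "(a + a', b + b') \<in> \<Union>C" "(a - a', b - b') \<in> \<Union>C" "(a * a', b * b') \<in> \<Union>C"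
        by (rule UnionI[OF S(1)], rule partial_autD(3,4,5)[OF p S(2,3)])+
    qed
    moreover have "R \<subseteq> \<Union>C" using C(1) CA by blast
    ultimately show "\<Union>C \<in> A" by (simp add: A_def)
  qed
  then obtain M where MA: "M \<in> A" "\<forall>S\<in>A. M \<subseteq> S \<longrightarrow> S = M" by blast
  have M: "partial_aut F M" "R \<subseteq> M" using MA(1) by (simp_all add: A_def)
  have max: "S = M" if "partial_aut F S" "M \<subseteq> S" for S
    using MA(2) M(2) that by (auto simp: A_def)
  define \<sigma> where "\<sigma> = (\<lambda>x\<in>alg_cl F. THE y. (x, y) \<in> M)"
  have \<sigma>M: "(x, \<sigma> x) \<in> M" if x: "x \<in> alg_cl F" for x
  proof -
    obtain S y where "partial_aut F S" "M \<subseteq> S" "(x, y) \<in> S"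
      using partial_aut_extend[OF F M(1) x] by blast
    then have xy: "(x, y) \<in> M" using max by blast
    then have "(THE y. (x, y) \<in> M) = y" using partial_aut_unique[OF M(1)] by blast
    then show ?thesis using x xy by (simp add: \<sigma>_def)
  qed
  note A = complex_subfield_alg_cl[OF F]
  have \<sigma>_eq: "\<sigma> x = y" if "(x, y) \<in> M" for x y
    using that \<sigma>M partial_autD(2)[OF M(1)] partial_aut_unique[OF M(1)] by blast
  have 0: "0 \<in> F" "1 \<in> F" using F by (auto simp: complex_subfield_def)
  have "inj_on \<sigma> (alg_cl F)"
  proof (rule inj_onI, rule ccontr)
    fix x y assume xy: "x \<in> alg_cl F" "y \<in> alg_cl F" "\<sigma> x = \<sigma> y" "x \<noteq> y"
    have d: "(x - y, 0) \<in> M" using partial_autD(4)[OF M(1) \<sigma>M[OF xy(1)] \<sigma>M[OF xy(2)]] xy(3) by simp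
    obtain c where "(inverse (x - y), c) \<in> M" using partial_aut_inverse[OF F M(1) d] xy(4) by auto
    then have "(1, 0) \<in> M" using partial_autD(5)[OF M(1) d] xy(4) by force
    then show False using partial_aut_unique[OF M(1) _ partial_autD(1)[OF M(1) 0(2)]] by force
  qed
  moreover have "poly p (\<sigma> x) = 0" if "coeffs_in F p" "x \<in> alg_cl F" "poly p x = 0" for p x
  proof -
    have "coeff_pairs M p p" using that(1) partial_autD(1)[OF M(1)]
      by (auto simp: coeff_pairs_def coeffs_in_def)
    then have "(poly p x, poly p (\<sigma> x)) \<in> M"
      using coeff_pairs_poly[OF M(1) 0(2,1)] \<sigma>M[OF that(2)] by blast
    then show ?thesis using that(3) partial_autD(6)[OF M(1)] by simp
  qed
  ultimately have "bij_betw \<sigma> (alg_cl F) (alg_cl F)"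
    using coeffs_in_finite_roots[of \<sigma> F] by (auto simp: bij_betw_def)
  moreover have "\<sigma> (x + y) = \<sigma> x + \<sigma> y" "\<sigma> (x * y) = \<sigma> x * \<sigma> y"
    if "x \<in> alg_cl F" "y \<in> alg_cl F" for x y
    using that by (auto intro!: \<sigma>_eq partial_autD[OF M(1)] \<sigma>M)
  ultimately have "\<sigma> \<in> gal F"
    using \<sigma>_eq partial_autD(1)[OF M(1)] by (auto simp: gal_def \<sigma>_def)
  moreover have "\<forall>(x, y)\<in>R. \<sigma> x = y" using M(2) \<sigma>_eq by blast
  ultimately show ?thesis by blast
qed

text \<open>In characteristic 0 a minimal polynomial of degree at least 2 has a second root.\<close>

theorem gal_moves:
  assumes K: "complex_subfield F" and M: "complex_subfield M" "F \<subseteq> M" "M \<subseteq> alg_cl F"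
    and x: "x \<in> alg_cl F" "x \<notin> M"
  shows "\<exists>\<sigma>\<in>gal F. (\<forall>y\<in>M. \<sigma> y = y) \<and> \<sigma> x \<noteq> x"
proof -
  define R where "R = (\<lambda>y. (y, y)) ` M"
  note i = subfield_intros[OF M(1)]
  have R: "partial_aut F R"
    using M by (auto simp: partial_aut_def R_def intro: i)
  have cp: "coeff_pairs R p p' \<longleftrightarrow> p' = p \<and> coeffs_in M p" for p p'
    by (auto simp: coeff_pairs_def coeffs_in_def R_def poly_eq_iff)
  define P where "P = (\<lambda>p. p \<noteq> 0 \<and> coeffs_in M p \<and> poly p x = 0)"
  have "\<exists>p. P p" using x(1) M(2) unfolding alg_cl_iff P_def coeffs_in_def by blast
  then obtain p where "P p" and min: "\<And>q. P q \<Longrightarrow> Polynomial.degree p \<le> Polynomial.degree q"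
    using ex_has_least_nat[of P _ Polynomial.degree] by metis
  then have p: "p \<noteq> 0" "coeffs_in M p" "poly p x = 0" unfolding P_def by auto
  have "\<exists>y. y \<noteq> x \<and> poly p y = 0"
  proof (rule ccontr)
    assume no: "\<not> ?thesis"
    define n where "n = Polynomial.degree p"
    have n: "n > 0"
    proof (rule ccontr)
      assume "\<not> n > 0"
      then obtain a where "p = [:a:]" unfolding n_def by (metis degree_eq_zeroE neq0_conv)
      then show False using p by auto
    qed
    have "n \<noteq> 1"
    proof
      assume n1: "n = 1"
      then obtain a b where pab: "p = [:a, b:]" "b \<noteq> 0"
        unfolding n_def by (metis degree_eq_zeroE One_nat_def degree_pCons_eq_if nat.inject pCons_cases zero_neq_one pCons_0_0)
      have "a \<in> M" "b \<in> M"
        using p(2)[unfolded coeffs_in_def, rule_format, of 0]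
          p(2)[unfolded coeffs_in_def, rule_format, of 1] pab by auto
      moreover have "x = - a / b" using p(3) pab by (simp add: field_simps eq_neg_iff_add_eq_0)
      ultimately have "x \<in> M" using subfield_divide[OF M(1)] subfield_uminus[OF M(1)] by blast
      then show False using x(2) by blast
    qed
    \<comment> \<open>If \<open>x\<close> were the only root, it would be a multiple root and so a
      root of the derivative, which is nonzero and of smaller degree.\<close>
    obtain q where q: "p = [:- x, 1:] * q" using p(3) by (metis poly_eq_0_iff_dvd dvdE)
    have dq: "Polynomial.degree q = n - 1" "q \<noteq> 0"
      using p(1) q degree_mult_eq[of "[:- x, 1:]" q] by (auto simp: n_def simp del: mult_pCons_left)
    then have "\<not> constant (poly q)" using n \<open>n \<noteq> 1\<close> by (simp add: constant_degree)
    then obtain y where y: "poly q y = 0" using fundamental_theorem_of_algebra by blast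
    then have "poly p y = 0" using q by simp
    then have "y = x" using no by blast
    then have qx: "poly q x = 0" using y by simp
    have "pderiv p = [:- x, 1:] * pderiv q + pderiv [:- x, 1:] * q"
      unfolding q pderiv_mult by (simp only: mult.commute)
    also have "pderiv [:- x, 1:] = 1" by (simp add: pderiv_pCons one_pCons)
    finally have "poly (pderiv p) x = 0" using qx by simp
    moreover have "pderiv p \<noteq> 0" using n by (simp add: pderiv_eq_0_iff n_def)
    moreover have "coeffs_in M (pderiv p)"
      using p(2) by (auto simp: coeffs_in_def coeff_pderiv intro!: i(4) simp del: of_nat_Suc intro: i)
    ultimately have "P (pderiv p)" by (simp add: P_def)
    then show False using min[of "pderiv p"] n by (simp add: degree_pderiv n_def)
  qed
  then obtain y where y: "y \<noteq> x" "poly p y = 0" by blast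
  have cpp: "coeff_pairs R p p" using p(2) cp by blast
  have pmin: "Polynomial.degree p \<le> Polynomial.degree q"
    if "q \<noteq> 0" "coeff_pairs R q q'" "poly q x = 0" for q q'
    using min[of q] that cp[of q q'] by (simp add: P_def)
  have "poly q' y = 0" if "coeff_pairs R q q'" "poly q x = 0" for q q'
    by (rule partial_aut_minimal[OF K R p(1) cpp y(2) pmin p(3) that])
  then obtain S where S: "partial_aut F S" "R \<subseteq> S" "(x, y) \<in> S"
    using partial_aut_adjoin[OF K R x(1)] by blast
  obtain \<sigma> where \<sigma>: "\<sigma> \<in> gal F" "\<forall>(x, y)\<in>S. \<sigma> x = y" using partial_aut_gal[OF K S(1)] by blast
  have "\<sigma> z = z" if "z \<in> M" for z
  proof -
    have "(z, z) \<in> S" using that S(2) by (auto simp: R_def)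
    then show ?thesis using \<sigma>(2) by auto
  qed
  moreover have "\<sigma> x \<noteq> x" using \<sigma>(2) S(3) y(1) by auto
  ultimately show ?thesis using \<sigma>(1) by blast
qed

corollary gal_fixed:
  assumes "complex_subfield F" "x \<in> alg_cl F" "\<And>\<sigma>. \<sigma> \<in> gal F \<Longrightarrow> \<sigma> x = x"
  shows "x \<in> F"
  using gal_moves[OF assms(1,1) order_refl alg_cl_superset[OF assms(1)] assms(2)] assms(3) by blast

subsection \<open>The group law\<close>

definition nonsingular :: "weierstrass \<Rightarrow> bool" where
  "nonsingular W \<longleftrightarrow> (\<forall>x. x^3 + a2 W * x^2 + a4 W * x + a6 W = 0 \<longrightarrow>
     3 * x^2 + 2 * a2 W * x + a4 W \<noteq> 0)"

lemma Some_points: "Some (x, y) \<in> points W F \<longleftrightarrow>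
    x \<in> F \<and> y \<in> F \<and> y^2 = x^3 + a2 W * x^2 + a4 W * x + a6 W"
  by (auto simp: points_def)

lemma None_points [simp]: "None \<in> points W F"
  by (auto simp: points_def)

lemma points_mono: "F \<subseteq> L \<Longrightarrow> points W F \<subseteq> points W L"
  by (auto simp: points_def)

text \<open>The three points are the intersection of the curve with the line \<open>y = l x + m\<close>, counted
  with multiplicity.\<close>

definition on_line ::
    "weierstrass \<Rightarrow> complex \<Rightarrow> complex \<Rightarrow> complex \<times> complex \<Rightarrow> complex \<times> complex \<Rightarrow>
      complex \<times> complex \<Rightarrow> bool" where
  "on_line W l m = (\<lambda>(x1, y1) (x2, y2) (x3, y3).
     y1 = l * x1 + m \<and> y2 = l * x2 + m \<and> y3 = l * x3 + m \<and>
     x1 + x2 + x3 = l^2 - a2 W \<and> x1 * x2 + x1 * x3 + x2 * x3 = a4 W - 2 * l * m \<and>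
     x1 * x2 * x3 = m^2 - a6 W)"

lemma on_line_rotate: "on_line W l m P Q R \<Longrightarrow> on_line W l m Q R P"
  by (auto simp: on_line_def algebra_simps split: prod.splits)

lemma on_line_points:
  assumes "on_line W l m P Q R"
  shows "Some P \<in> points W UNIV"
proof -
  obtain x1 y1 x2 y2 x3 y3 where e: "P = (x1, y1)" "Q = (x2, y2)" "R = (x3, y3)"
    by (cases P, cases Q, cases R)
  have "y1 = l * x1 + m" and "a2 W = l^2 - (x1 + x2 + x3)"
    "a4 W = x1 * x2 + x1 * x3 + x2 * x3 + 2 * l * m" "a6 W = m^2 - x1 * x2 * x3"
    using assms e by (auto simp: on_line_def)
  then have "y1^2 = x1^3 + a2 W * x1^2 + a4 W * x1 + a6 W" by Groebner_Basis.algebra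
  then show ?thesis by (simp add: e Some_points)
qed

text \<open>The points determine the slope of the line: by two distinct abscissas, or at a double
  point by the derivative of the cubic. Nonsingularity excludes a double point with
  \<open>y1 = 0\<close>, where the tangent would be vertical.\<close>

lemma on_line_add:
  assumes W: "nonsingular W" and "on_line W l m P Q R"
  shows "ec_add W (Some P) (Some Q) = ec_neg (Some R)"
proof -
  obtain x1 y1 x2 y2 x3 y3 where e: "P = (x1, y1)" "Q = (x2, y2)" "R = (x3, y3)"
    by (cases P, cases Q, cases R)
  have y: "y1 = l * x1 + m" "y2 = l * x2 + m" "y3 = l * x3 + m"
    and s: "a2 W = l^2 - (x1 + x2 + x3)"
    "a4 W = x1 * x2 + x1 * x3 + x2 * x3 + 2 * l * m" "a6 W = m^2 - x1 * x2 * x3"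
    using assms e by (auto simp: on_line_def)
  have der: "3 * x1^2 + 2 * a2 W * x1 + a4 W = 2 * l * y1" if "x1 = x2"
  proof -
    have "x2 = x1" using that by simp
    then show ?thesis unfolding y(1) s(1,2) by (simp add: power2_eq_square algebra_simps)
  qed
  have n: "\<not> (x1 = x2 \<and> y1 + y2 = 0)"
  proof
    assume a: "x1 = x2 \<and> y1 + y2 = 0"
    have "y1 = y2" using y a by simp
    moreover have "y1 + y2 = 0" using a by blast
    ultimately have "y1 = 0" by simp
    moreover have "y1^2 = x1^3 + a2 W * x1^2 + a4 W * x1 + a6 W"
      using on_line_points[OF assms(2)] e by (simp add: Some_points)
    ultimately show False using W der a unfolding nonsingular_def
      by (metis mult_zero_right zero_eq_power2)
  qed
  define L where "L = (if x1 = x2 then (3 * x1^2 + 2 * a2 W * x1 + a4 W) / (2 * y1)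
     else (y2 - y1) / (x2 - x1))"
  have "L = l"
  proof (cases "x1 = x2")
    case True
    then have "y1 + y2 \<noteq> 0" "y2 = y1" using n y by simp_all
    then have "y1 \<noteq> 0" by auto
    then show ?thesis using der[OF True] True by (simp add: L_def)
  next
    case False
    then show ?thesis using y by (simp add: L_def field_simps)
  qed
  moreover have "l^2 - a2 W - x1 - x2 = x3" by (simp add: s(1))
  moreover have "l * (x1 - x3) - y1 = - y3" using y by (simp add: algebra_simps)
  ultimately show ?thesis using n by (auto simp: e Let_def L_def)
qed

lemma ec_add_on_line:
  assumes P: "Some (x1, y1) \<in> points W UNIV" and Q: "Some (x2, y2) \<in> points W UNIV"
    and n: "\<not> (x1 = x2 \<and> y1 + y2 = 0)"
  shows "\<exists>l m x3 y3. on_line W l m (x1, y1) (x2, y2) (x3, y3) \<and>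
    ec_add W (Some (x1, y1)) (Some (x2, y2)) = Some (x3, - y3)"
proof -
  define l where "l = (if x1 = x2 then (3 * x1^2 + 2 * a2 W * x1 + a4 W) / (2 * y1)
     else (y2 - y1) / (x2 - x1))"
  define m where "m = y1 - l * x1"
  define x3 where "x3 = l^2 - a2 W - x1 - x2"
  have c: "y1^2 = x1^3 + a2 W * x1^2 + a4 W * x1 + a6 W"
    "y2^2 = x2^3 + a2 W * x2^2 + a4 W * x2 + a6 W" using P Q by (auto simp: Some_points)
  have y1: "y1 = l * x1 + m" by (simp add: m_def)
  have s1: "x1 + x2 + x3 = l^2 - a2 W" by (simp add: x3_def)
  have *: "y2 = l * x2 + m \<and> x1 * x2 + x1 * x3 + x2 * x3 = a4 W - 2 * l * m"
  proof (cases "x1 = x2")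
    case True
    then have yy: "y2 = y1" using c n by (metis power2_eq_iff add.right_inverse add.left_inverse)
    then have "y1 \<noteq> 0" using n True by auto
    then have "2 * l * y1 = 3 * x1^2 + 2 * a2 W * x1 + a4 W" using True by (simp add: l_def)
    then have "a4 W = 2 * l * y1 - 3 * x1^2 - 2 * a2 W * x1" by simp
    moreover have "x2 = x1" "y2 = l * x1 + m" using True yy y1 by simp_all
    ultimately show ?thesis using y1 x3_def by Groebner_Basis.algebra
  next
    case False
    then have "l * (x2 - x1) = y2 - y1" by (simp add: l_def)
    then have y2: "y2 = l * x2 + m" using y1 by (simp add: algebra_simps)
    \<comment> \<open>Subtracting the two curve equations produces the factor
      \<open>x1 - x2\<close>.\<close>
    have "(x1 - x2) * (x1 * x2 + x1 * x3 + x2 * x3 - (a4 W - 2 * l * m)) = 0"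
      using c y1 y2 s1 by Groebner_Basis.algebra
    then show ?thesis using False y2 by simp
  qed
  moreover have "x1 * x2 * x3 = m^2 - a6 W" using c(1) y1 s1 * by Groebner_Basis.algebra
  ultimately have "on_line W l m (x1, y1) (x2, y2) (x3, l * x3 + m)"
    using y1 s1 by (simp add: on_line_def)
  moreover have "ec_add W (Some (x1, y1)) (Some (x2, y2)) = Some (x3, - (l * x3 + m))"
  proof -
    have "ec_add W (Some (x1, y1)) (Some (x2, y2)) = Some (x3, l * (x1 - x3) - y1)"
      by (subst ec_add.simps, subst if_not_P[OF n]) (simp only: Let_def l_def x3_def)
    then show ?thesis by (simp add: m_def algebra_simps)
  qed
  ultimately show ?thesis by blast
qed

lemma ec_neg_points [simp]: "P \<in> points W UNIV \<Longrightarrow> ec_neg P \<in> points W UNIV"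
  by (cases P) (auto simp: Some_points)

lemma ec_neg_neg [simp]: "ec_neg (ec_neg P) = P"
  by (cases P) auto

lemma ec_neg_inject [simp]: "ec_neg P = ec_neg Q \<longleftrightarrow> P = Q"
  by (metis ec_neg_neg)

lemma ec_add_None [simp]: "ec_add W P None = P"
  by (cases P) auto

lemma ec_add_comm: "ec_add W P Q = ec_add W Q P" if "P \<in> points W UNIV" "Q \<in> points W UNIV"
proof (cases "P = None \<or> Q = None")
  case True
  then show ?thesis by auto
next
  case False
  then obtain x1 y1 x2 y2 where e: "P = Some (x1, y1)" "Q = Some (x2, y2)" by auto
  show ?thesis
  proof (cases "x1 = x2 \<and> y1 + y2 = 0")
    case True
    then show ?thesis by (auto simp: e add.commute)
  next
    case n: False
    show ?thesis
    proof (cases "x1 = x2")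
      case True
      have "y1 = y2"
        using that n True by (simp add: e Some_points) (metis power2_eq_iff add.right_inverse add.left_inverse)
      then show ?thesis using True by (simp add: e)
    next
      case False
      obtain l where l: "(y2 - y1) / (x2 - x1) = l" by blast
      have l': "(y1 - y2) / (x1 - x2) = l" using l by (metis minus_diff_eq minus_divide_divide)
      have "y2 = y1 + l * (x2 - x1)" using False l by auto
      then have "l * (x1 - (l^2 - a2 W - x1 - x2)) - y1 = l * (x2 - (l^2 - a2 W - x2 - x1)) - y2"
        by Groebner_Basis.algebra
      moreover have "l^2 - a2 W - x1 - x2 = l^2 - a2 W - x2 - x1" by simp
      ultimately show ?thesis using False by (simp only: e ec_add.simps l l' Let_def) auto
    qed
  qed
qed

lemma ec_add_neg_neg: "ec_add W (ec_neg P) (ec_neg Q) = ec_neg (ec_add W P Q)"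
proof (cases "P = None \<or> Q = None")
  case True
  then show ?thesis by auto
next
  case False
  then obtain x1 y1 x2 y2 where e: "P = Some (x1, y1)" "Q = Some (x2, y2)" by auto
  have "- y1 - y2 = 0 \<longleftrightarrow> y1 + y2 = 0"
    by (metis add.inverse_inverse add_eq_0_iff diff_eq_eq minus_add_cancel add.right_neutral diff_minus_eq_add eq_neg_iff_add_eq_0)
  moreover have "(y1 - y2) / (x2 - x1) = - ((y2 - y1) / (x2 - x1))"
    by (metis minus_diff_eq minus_divide_left)
  ultimately show ?thesis by (auto simp: e Let_def algebra_simps)
qed

lemma ec_add_neg [simp]: "ec_add W P (ec_neg P) = None"
  by (cases P) auto

lemma ec_add_neg' [simp]: "ec_add W (ec_neg P) P = None"
  by (cases P) auto

lemma ec_add_eq_None: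
  "ec_add W P Q = None \<longleftrightarrow> Q = ec_neg P"
  by (cases "(W, P, Q)" rule: ec_add.cases)
    (auto simp: Let_def add_eq_0_iff add.commute split: if_splits)

lemma ec_add_points [simp]:
  assumes "P \<in> points W UNIV" "Q \<in> points W UNIV"
  shows "ec_add W P Q \<in> points W UNIV"
proof (cases "P = None \<or> Q = None")
  case True
  then show ?thesis using assms by auto
next
  case False
  then obtain x1 y1 x2 y2 where e: "P = Some (x1, y1)" "Q = Some (x2, y2)" by auto
  show ?thesis
  proof (cases "x1 = x2 \<and> y1 + y2 = 0")
    case True
    then show ?thesis by (simp add: e)
  next
    case n: False
    obtain l m x3 y3 where l: "on_line W l m (x1, y1) (x2, y2) (x3, y3)"
      "ec_add W (Some (x1, y1)) (Some (x2, y2)) = Some (x3, - y3)"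
      using ec_add_on_line[of x1 y1 W x2 y2] assms n e by auto
    have "Some (x3, y3) \<in> points W UNIV"
      by (rule on_line_points[OF on_line_rotate[OF on_line_rotate[OF l(1)]]])
    then show ?thesis using l(2) by (simp add: e Some_points)
  qed
qed

section \<open>Associativity of the addition\<close>

context
  fixes W :: weierstrass
  assumes W: "nonsingular W"
begin

text \<open>Both equations say that the three points add up to the point at infinity. Geometrically
  this is collinearity, which does not depend on the order of the points. It is the part of
  associativity that needs only one line.\<close>

lemma ec_add_rotate:
  assumes "P \<in> points W UNIV" "Q \<in> points W UNIV" "ec_add W P Q = ec_neg R"
  shows "ec_add W Q R = ec_neg P"
proof -
  consider "P = None" | "Q = None" | "R = None" "P \<noteq> None" | "P \<noteq> None" "Q \<noteq> None" "R \<noteq> None" by blast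
  then show ?thesis
  proof cases
    case 1
    then show ?thesis using assms by simp
  next
    case 2
    then show ?thesis using assms by simp
  next
    case 3
    then show ?thesis using assms by (simp add: ec_add_eq_None)
  next
    case 4
    then obtain x1 y1 x2 y2 x3 y3 where e: "P = Some (x1, y1)" "Q = Some (x2, y2)"
      "R = Some (x3, y3)" by auto
    have "\<not> (x1 = x2 \<and> y1 + y2 = 0)" using assms(3) by (auto simp: e)
    then obtain l m x4 y4 where l: "on_line W l m (x1, y1) (x2, y2) (x4, y4)"
      "ec_add W (Some (x1, y1)) (Some (x2, y2)) = Some (x4, - y4)"
      using ec_add_on_line[of x1 y1 W x2 y2] assms e by auto
    then have "(x4, y4) = (x3, y3)" using assms(3) e by simp
    then show ?thesis using on_line_add[OF W on_line_rotate[OF l(1)]] e by simp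
  qed
qed

lemma ec_add_cancel:
  assumes "P \<in> points W UNIV" "Q \<in> points W UNIV"
  shows "ec_add W (ec_add W P Q) (ec_neg Q) = P"
proof -
  define R where "R = ec_neg (ec_add W P Q)"
  have "ec_add W Q R = ec_neg P" by (rule ec_add_rotate) (use assms in \<open>simp_all add: R_def\<close>)
  then have "ec_add W R Q = ec_neg P" using ec_add_comm[of Q W R] assms by (simp add: R_def)
  then have "ec_add W (ec_neg R) (ec_neg Q) = P" by (simp add: ec_add_neg_neg)
  then show ?thesis by (simp add: R_def)
qed

text \<open>The function \<open>x\<^sup>2 + \<beta>x + \<gamma> - cy\<close>, whose norm is a quartic in \<open>x\<close>, vanishes precisely at the
  four given points.\<close>

definition on_parabola :: "complex \<Rightarrow> complex \<Rightarrow> complex \<Rightarrow> complex \<times> complex \<Rightarrow>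
    complex \<times> complex \<Rightarrow> complex \<times> complex \<Rightarrow> complex \<times> complex \<Rightarrow> bool" where
  "on_parabola c \<beta> \<gamma> = (\<lambda>(x1, y1) (x2, y2) (x3, y3) (x4, y4).
     x1^2 + \<beta> * x1 + \<gamma> = c * y1 \<and> x2^2 + \<beta> * x2 + \<gamma> = c * y2 \<and>
     x3^2 + \<beta> * x3 + \<gamma> = c * y3 \<and> x4^2 + \<beta> * x4 + \<gamma> = c * y4 \<and>
     c^2 - 2 * \<beta> = x1 + x2 + x3 + x4 \<and>
     \<beta>^2 + 2 * \<gamma> - c^2 * a2 W = x1*x2 + x1*x3 + x1*x4 + x2*x3 + x2*x4 + x3*x4 \<and>
     c^2 * a4 W - 2 * \<beta> * \<gamma> = x1*x2*x3 + x1*x2*x4 + x1*x3*x4 + x2*x3*x4 \<and>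
     \<gamma>^2 - c^2 * a6 W = x1*x2*x3*x4)"

lemma on_parabola_rotate:
  "on_parabola c \<beta> \<gamma> P1 P2 P3 P4 \<Longrightarrow> on_parabola c \<beta> \<gamma> P2 P3 P4 P1"
  by (auto simp: on_parabola_def algebra_simps split: prod.splits)

text \<open>The function of the parabola has a fourfold pole at infinity, so its four zeros add up
  to the point at infinity. Explicitly, if the line through the first two points has slope
  \<open>l\<close> and third point \<open>(x5, y5)\<close>, then the other two points lie with
  \<open>(x5, - y5)\<close> on a line of slope \<open>c - l\<close>.\<close>

lemma on_parabola_add:
  assumes P: "Some (x1, y1) \<in> points W UNIV" "Some (x2, y2) \<in> points W UNIV"
    and n: "\<not> (x1 = x2 \<and> y1 + y2 = 0)" and c: "c \<noteq> 0"
    and par: "on_parabola c \<beta> \<gamma> (x1, y1) (x2, y2) (x3, y3) (x4, y4)"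
  shows "ec_add W (Some (x3, y3)) (Some (x4, y4)) =
    ec_neg (ec_add W (Some (x1, y1)) (Some (x2, y2)))"
proof -
  obtain l m x5 y5 where l: "on_line W l m (x1, y1) (x2, y2) (x5, y5)"
    and add: "ec_add W (Some (x1, y1)) (Some (x2, y2)) = Some (x5, - y5)"
    using ec_add_on_line[OF P n] by blast
  have y: "y1 = l * x1 + m" "y2 = l * x2 + m" "y5 = l * x5 + m"
    and s: "a2 W = l^2 - (x1 + x2 + x5)"
    "a4 W = x1 * x2 + x1 * x5 + x2 * x5 + 2 * l * m" "a6 W = m^2 - x1 * x2 * x5"
    using l by (auto simp: on_line_def algebra_simps)
  have p: "x1^2 + \<beta> * x1 + \<gamma> = c * y1" "x2^2 + \<beta> * x2 + \<gamma> = c * y2"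
    "x3^2 + \<beta> * x3 + \<gamma> = c * y3" "x4^2 + \<beta> * x4 + \<gamma> = c * y4"
    and q: "c^2 - 2 * \<beta> = x1 + x2 + x3 + x4"
    "\<beta>^2 + 2 * \<gamma> - c^2 * a2 W = x1*x2 + x1*x3 + x1*x4 + x2*x3 + x2*x4 + x3*x4"
    "c^2 * a4 W - 2 * \<beta> * \<gamma> = x1*x2*x3 + x1*x2*x4 + x1*x3*x4 + x2*x3*x4"
    "\<gamma>^2 - c^2 * a6 W = x1*x2*x3*x4"
    using par by (auto simp: on_parabola_def)
  \<comment> \<open>The parabola meets the first two points with the same multiplicities as the
    line. If they coincide, the tangency is encoded in the coefficients of the quartic.\<close>
  have b: "\<beta> = c * l - (x1 + x2)"
  proof (cases "x1 = x2")
    case True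
    then have "y1 + y2 \<noteq> 0" "y2 = y1" using n y by simp_all
    then have "y1 \<noteq> 0" by auto
    have q': "c^2 = 2 * \<beta> + 2 * x1 + x3 + x4"
      "c^2 * a4 W = 2 * \<beta> * \<gamma> + x1^2*(x3+x4) + 2*x1*x3*x4"
      "c^2 * a2 W = \<beta>^2 + 2 * \<gamma> - (x1^2 + 2*x1*(x3+x4) + x3*x4)"
      using q True by (auto simp: algebra_simps power2_eq_square)
    have "2 * (x1^2 + \<beta> * x1 + \<gamma>) * (2 * x1 + \<beta>) = c^2 * (3 * x1^2 + 2 * a2 W * x1 + a4 W)"
      using q' by Groebner_Basis.algebra
    moreover have "3 * x1^2 + 2 * a2 W * x1 + a4 W = 2 * l * y1"
      unfolding y(1) s(1,2) True[symmetric] by (simp add: power2_eq_square algebra_simps)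
    ultimately have "2 * c * y1 * (2 * x1 + \<beta> - c * l) = 0" using p(1) by Groebner_Basis.algebra
    then have "2 * x1 + \<beta> - c * l = 0" using c \<open>y1 \<noteq> 0\<close> by simp
    then show ?thesis using True by (simp add: algebra_simps)
  next
    case False
    have "(x1 - x2) * (\<beta> - (c * l - (x1 + x2))) = 0" using p y by Groebner_Basis.algebra
    then show ?thesis using False by simp
  qed
  have g: "\<gamma> = c * m + x1 * x2" using b p(1) y(1) by Groebner_Basis.algebra
  have v1: "x3 + x4 = x1 + x2 + c^2 - 2 * c * l" using q(1) b by Groebner_Basis.algebra
  have v2: "x3 * x4 = 2 * c * m + x1 * x2 + c^2 * x5"
    using q(2) b g v1 s(1) by Groebner_Basis.algebra
  define l' m' where "l' = (\<beta> + x3 + x4) / c" and "m' = (\<gamma> - x3 * x4) / c"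
  have "c * l' = \<beta> + (x3 + x4)" using c by (simp add: l'_def)
  also have "\<dots> = c * (c - l)" unfolding b v1 by (simp add: algebra_simps power2_eq_square)
  finally have "c * l' = c * (c - l)" .
  then have l': "l' = c - l" using c by simp
  have "c * m' = \<gamma> - x3 * x4" using c by (simp add: m'_def)
  also have "\<dots> = c * (- m - c * x5)"
    unfolding g v2 by (simp add: algebra_simps power2_eq_square)
  finally have "c * m' = c * (- m - c * x5)" .
  then have m': "m' = - m - c * x5" using c by simp
  have "on_line W l' m' (x3, y3) (x4, y4) (x5, - y5)"
  proof -
    have "c * y3 = c * (l' * x3 + m')" "c * y4 = c * (l' * x4 + m')"
      using p(3,4) v1 v2 b g l' m' by Groebner_Basis.algebra+
    then have 1: "y3 = l' * x3 + m'" "y4 = l' * x4 + m'" using c by simp_all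
    have 2: "- y5 = l' * x5 + m'" using y(3) l' m' by Groebner_Basis.algebra
    have 3: "x3 + x4 + x5 = l'^2 - a2 W" using v1 l' s(1) by Groebner_Basis.algebra
    have 4: "x3 * x4 + x3 * x5 + x4 * x5 = a4 W - 2 * l' * m'" using v1 v2 l' m' s by Groebner_Basis.algebra
    have 5: "x3 * x4 * x5 = m'^2 - a6 W" using v1 v2 l' m' s by Groebner_Basis.algebra
    show ?thesis using 1 2 3 4 5 by (simp add: on_line_def)
  qed
  from on_line_add[OF W this] show ?thesis using add by simp
qed

text \<open>Multiply the equations of the two lines and reduce modulo the curve. Since the lines
  pass through the opposite points \<open>(x5, y5)\<close> and \<open>(x5, - y5)\<close>, the result
  is divisible by \<open>x - x5\<close>, and the quotient is this parabola.\<close>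

lemma on_lines_parabola:
  assumes "on_line W l m (x1, y1) (x2, y2) (x5, y5)"
    "on_line W l' m' (x3, y3) (x4, y4) (x5, - y5)"
  shows "on_parabola (l + l') ((l + l') * l - (x1 + x2)) ((l + l') * m + x1 * x2)
    (x1, y1) (x2, y2) (x3, y3) (x4, y4)"
proof -
  have 1: "y1 = l * x1 + m" "y2 = l * x2 + m" "y5 = l * x5 + m"
    "a2 W = l^2 - (x1 + x2 + x5)" "a4 W = x1 * x2 + x1 * x5 + x2 * x5 + 2 * l * m"
    "a6 W = m^2 - x1 * x2 * x5" using assms(1) by (auto simp: on_line_def algebra_simps)
  have 2: "y3 = l' * x3 + m'" "y4 = l' * x4 + m'" "- y5 = l' * x5 + m'"
    "x3 + x4 + x5 = l'^2 - a2 W" "x3 * x4 + x3 * x5 + x4 * x5 = a4 W - 2 * l' * m'"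
    "x3 * x4 * x5 = m'^2 - a6 W" using assms(2) by (auto simp: on_line_def)
  have m': "m' = - m - (l + l') * x5" using 1(3) 2(3) by Groebner_Basis.algebra
  have v1: "x3 + x4 = x1 + x2 + (l + l')^2 - 2 * (l + l') * l" using 1 2 by Groebner_Basis.algebra
  have v2: "x3 * x4 = 2 * (l + l') * m + x1 * x2 + (l + l')^2 * x5"
    using 2(5) v1 m' 1(4,5) by Groebner_Basis.algebra
  show ?thesis
    unfolding on_parabola_def prod.case
  proof (intro conjI)
    show "x1^2 + ((l + l') * l - (x1 + x2)) * x1 + ((l + l') * m + x1 * x2) = (l + l') * y1"
      "x2^2 + ((l + l') * l - (x1 + x2)) * x2 + ((l + l') * m + x1 * x2) = (l + l') * y2"
      using 1 by Groebner_Basis.algebra+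
    show "x3^2 + ((l + l') * l - (x1 + x2)) * x3 + ((l + l') * m + x1 * x2) = (l + l') * y3"
      "x4^2 + ((l + l') * l - (x1 + x2)) * x4 + ((l + l') * m + x1 * x2) = (l + l') * y4"
      using 2(1,2) v1 v2 m' by Groebner_Basis.algebra+
    show "(l + l')^2 - 2 * ((l + l') * l - (x1 + x2)) = x1 + x2 + x3 + x4" using v1 by Groebner_Basis.algebra
    show "((l + l') * l - (x1 + x2))^2 + 2 * ((l + l') * m + x1 * x2) - (l + l')^2 * a2 W =
      x1*x2 + x1*x3 + x1*x4 + x2*x3 + x2*x4 + x3*x4" using v1 v2 1(4) by Groebner_Basis.algebra
    show "(l + l')^2 * a4 W - 2 * ((l + l') * l - (x1 + x2)) * ((l + l') * m + x1 * x2) =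
      x1*x2*x3 + x1*x2*x4 + x1*x3*x4 + x2*x3*x4" using v1 v2 1(5) by Groebner_Basis.algebra
    show "((l + l') * m + x1 * x2)^2 - (l + l')^2 * a6 W = x1*x2*x3*x4" using v1 v2 1(6) by Groebner_Basis.algebra
  qed
qed

text \<open>In the generic case \<open>P1\<close>, \<open>P2\<close>, \<open>P3\<close> and the
  opposite of their sum lie on one parabola. That condition is invariant under rotation of the four
  points, whereas the two bracketings correspond to two ways of pairing them off.\<close>

lemma ec_add_assoc:
  assumes P: "P1 \<in> points W UNIV" and Q: "P2 \<in> points W UNIV" and R: "P3 \<in> points W UNIV"
  shows "ec_add W (ec_add W P1 P2) P3 = ec_add W P1 (ec_add W P2 P3)"
proof -
  note comm = ec_add_comm[where W = W]
  consider "P1 = None \<or> P2 = None \<or> P3 = None" | "P2 = ec_neg P1" | "P3 = ec_neg P2"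
    | "P3 = ec_neg (ec_add W P1 P2)" | "ec_neg P1 = ec_add W P2 P3"
    | "P1 \<noteq> None" "P2 \<noteq> None" "P3 \<noteq> None" "P2 \<noteq> ec_neg P1" "P3 \<noteq> ec_neg P2"
      "P3 \<noteq> ec_neg (ec_add W P1 P2)" "ec_neg P1 \<noteq> ec_add W P2 P3" by blast
  then show ?thesis
  proof cases
    case 1
    then show ?thesis by auto
  next
    case 2
    have "ec_add W P1 (ec_add W (ec_neg P1) P3) = ec_add W (ec_add W P3 (ec_neg P1)) P1"
      using P R comm by simp
    also have "\<dots> = P3" using ec_add_cancel[of P3 "ec_neg P1"] P R by simp
    finally show ?thesis using 2 by simp
  next
    case 3
    then show ?thesis using ec_add_cancel[of P1 P2] P Q by simp
  next
    case 4
    have "ec_add W P2 P3 = ec_neg P1" by (rule ec_add_rotate) (use P Q 4 in auto)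
    then show ?thesis using 4 by simp
  next
    case 5
    have "ec_add W P3 P1 = ec_neg P2" by (rule ec_add_rotate[OF Q R 5[symmetric]])
    then have "ec_add W P1 P2 = ec_neg P3" by (rule ec_add_rotate[OF R P])
    then show ?thesis using 5[symmetric] by simp
  next
    case 6
    obtain x1 y1 x2 y2 x3 y3 where e: "P1 = Some (x1, y1)" "P2 = Some (x2, y2)"
      "P3 = Some (x3, y3)" using 6 by auto
    have "\<not> (x1 = x2 \<and> y1 + y2 = 0)" using 6 by (auto simp: e add_eq_0_iff)
    then obtain l m x5 y5 where l: "on_line W l m (x1, y1) (x2, y2) (x5, y5)"
      and a12: "ec_add W P1 P2 = Some (x5, - y5)"
      using ec_add_on_line[of x1 y1 W x2 y2] P Q by (auto simp: e)
    have p5: "Some (x5, - y5) \<in> points W UNIV" using a12 P Q ec_add_points by metis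
    have "\<not> (x5 = x3 \<and> - y5 + y3 = 0)" using 6 a12 by (auto simp: e)
    then obtain l' m' x4 y4 where l': "on_line W l' m' (x5, - y5) (x3, y3) (x4, y4)"
      and a123: "ec_add W (ec_add W P1 P2) P3 = Some (x4, - y4)"
      using ec_add_on_line[OF p5 R[unfolded e]] unfolding e(3) a12 by blast
    have l2: "on_line W l' m' (x3, y3) (x4, y4) (x5, - y5)" using on_line_rotate[OF l'] .
    have p4: "Some (x4, y4) \<in> points W UNIV" using on_line_points[OF on_line_rotate[OF l2]] .
    have n23: "\<not> (x2 = x3 \<and> y2 + y3 = 0)" using 6 by (auto simp: e add_eq_0_iff)
    show ?thesis
    proof (cases "l + l' = 0")
      case False
      have "on_parabola (l + l') ((l + l') * l - (x1 + x2)) ((l + l') * m + x1 * x2)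
        (x2, y2) (x3, y3) (x4, y4) (x1, y1)"
        by (rule on_parabola_rotate[OF on_lines_parabola[OF l l2]])
      then have "ec_add W (Some (x4, y4)) P1 = ec_neg (ec_add W P2 P3)"
        using on_parabola_add[OF _ _ n23 False] Q R by (simp only: e)
      then have "ec_add W P2 P3 = ec_add W (ec_neg (Some (x4, y4))) (ec_neg P1)"
        by (simp only: ec_add_neg_neg ec_neg_neg)
      moreover have "ec_add W P1 (ec_add W (ec_neg (Some (x4, y4))) (ec_neg P1)) =
          ec_add W (ec_add W (ec_neg (Some (x4, y4))) (ec_neg P1)) P1"
        using P p4 by (intro comm) (simp_all del: ec_neg.simps)
      moreover have "\<dots> = ec_neg (Some (x4, y4))"
        using ec_add_cancel[of "ec_neg (Some (x4, y4))" "ec_neg P1"] P p4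
        by (simp del: ec_neg.simps)
      ultimately show ?thesis using a123 by simp
    next
      \<comment> \<open>Here the parabola degenerates to a pair of vertical lines, so
        \<open>P3\<close> is opposite to \<open>P1\<close> or to \<open>P2\<close>.\<close>
      case True
      then have l'l: "l' = - l" by (simp add: eq_neg_iff_add_eq_0 add.commute)
      have 1: "y1 = l * x1 + m" "y2 = l * x2 + m" "y5 = l * x5 + m"
        "x1 + x2 + x5 = l^2 - a2 W" "x1 * x2 + x1 * x5 + x2 * x5 = a4 W - 2 * l * m"
        using l by (auto simp: on_line_def)
      have 2: "y3 = l' * x3 + m'" "y4 = l' * x4 + m'" "- y5 = l' * x5 + m'"
        "x3 + x4 + x5 = l'^2 - a2 W" "x3 * x4 + x3 * x5 + x4 * x5 = a4 W - 2 * l' * m'"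
        using l2 by (auto simp: on_line_def)
      have m': "m' = - m" using 1(3) 2(3) l'l by Groebner_Basis.algebra
      have s: "x3 + x4 = x1 + x2" using 1(4) 2(4) l'l by Groebner_Basis.algebra
      have "x3 * x4 = x1 * x2" using 1(4,5) 2(4,5) l'l m' by Groebner_Basis.algebra
      then have "(x3 - x1) * (x3 - x2) = 0" using s by Groebner_Basis.algebra
      then consider "x3 = x1" | "x3 = x2" by auto
      then show ?thesis
      proof cases
        case 1
        have "P3 = ec_neg P1" using 1 \<open>y1 = l * x1 + m\<close> 2(1) l'l m' by (simp add: e)
        moreover have "ec_add W (ec_add W P1 P2) (ec_neg P1) = P2"
          using ec_add_cancel[OF Q P] comm[OF P Q] by simp
        moreover have "ec_add W P1 (ec_add W P2 (ec_neg P1)) = P2"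
          using ec_add_cancel[of P2 "ec_neg P1"] comm[of P1 "ec_add W P2 (ec_neg P1)"] P Q by simp
        ultimately show ?thesis by simp
      next
        case c2: 2
        have "P3 = ec_neg P2" using c2 1(2) 2(1) l'l m' by (simp add: e)
        then show ?thesis using 6 by simp
      qed
    qed
  qed
qed

lemma ec_add_left_commute:
  "P \<in> points W UNIV \<Longrightarrow> Q \<in> points W UNIV \<Longrightarrow> R \<in> points W UNIV \<Longrightarrow>
    ec_add W P (ec_add W Q R) = ec_add W Q (ec_add W P R)"
  using ec_add_assoc ec_add_comm by metis

end

subsection \<open>The Galois action on points\<close>

definition defined_over :: "complex set \<Rightarrow> weierstrass \<Rightarrow> bool" where
  "defined_over F W \<longleftrightarrow> a2 W \<in> F \<and> a4 W \<in> F \<and> a6 W \<in> F"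

lemma defined_over_mono: "F \<subseteq> L \<Longrightarrow> defined_over F W \<Longrightarrow> defined_over L W"
  by (auto simp: defined_over_def)

lemma points_UNIV: "P \<in> points W F \<Longrightarrow> P \<in> points W UNIV"
  using points_mono[of F UNIV W] by auto

lemma ec_neg_points_over:
  assumes "complex_subfield F" "P \<in> points W F"
  shows "ec_neg P \<in> points W F"
  using assms by (cases P) (auto simp: Some_points intro: subfield_intros)

lemma ec_add_points_over:
  assumes F: "complex_subfield F" and W: "defined_over F W"
    and P: "P \<in> points W F" and Q: "Q \<in> points W F"
  shows "ec_add W P Q \<in> points W F"
proof (cases "P = None \<or> Q = None")
  case True
  then show ?thesis using assms by auto
next
  case False
  then obtain x1 y1 x2 y2 where e: "P = Some (x1, y1)" "Q = Some (x2, y2)" by auto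
  note i = subfield_intros[OF F]
  have m: "x1 \<in> F" "y1 \<in> F" "x2 \<in> F" "y2 \<in> F" "a2 W \<in> F" "a4 W \<in> F"
    using P Q W by (auto simp: e Some_points defined_over_def)
  have "ec_add W P Q \<in> points W UNIV" using P Q points_UNIV ec_add_points by blast
  moreover have "(if x1 = x2 then (3 * x1^2 + 2 * a2 W * x1 + a4 W) / (2 * y1)
      else (y2 - y1) / (x2 - x1)) \<in> F" (is "?l \<in> F")
    using m by (auto intro!: i)
  then have "?l^2 - a2 W - x1 - x2 \<in> F" "?l * (x1 - (?l^2 - a2 W - x1 - x2)) - y1 \<in> F"
    using m by (blast intro: i)+
  ultimately show ?thesis by (auto simp: e Some_points Let_def)
qed

lemma galD:
  assumes "\<sigma> \<in> gal F"
  shows "\<sigma> \<in> extensional (alg_cl F)" "bij_betw \<sigma> (alg_cl F) (alg_cl F)"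
    "x \<in> alg_cl F \<Longrightarrow> y \<in> alg_cl F \<Longrightarrow> \<sigma> (x + y) = \<sigma> x + \<sigma> y"
    "x \<in> alg_cl F \<Longrightarrow> y \<in> alg_cl F \<Longrightarrow> \<sigma> (x * y) = \<sigma> x * \<sigma> y"
    "x \<in> F \<Longrightarrow> \<sigma> x = x" "x \<in> alg_cl F \<Longrightarrow> \<sigma> x \<in> alg_cl F"
    "x \<in> alg_cl F \<Longrightarrow> y \<in> alg_cl F \<Longrightarrow> \<sigma> x = \<sigma> y \<longleftrightarrow> x = y"
  using assms by (auto simp: gal_def bij_betw_def inj_on_def)

context
  fixes F :: "complex set"
  assumes F: "complex_subfield F"
begin

lemmas alg_cl_intros = subfield_intros[OF complex_subfield_alg_cl[OF F]]

context
  fixes \<sigma> :: "complex \<Rightarrow> complex"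
  assumes \<sigma>: "\<sigma> \<in> gal F"
begin

lemma gal_consts [simp]: "\<sigma> 0 = 0" "\<sigma> 1 = 1" "\<sigma> (numeral k) = numeral k" "\<sigma> (of_int j) = of_int j"
  "\<sigma> (of_nat n) = of_nat n"
  by (rule galD(5)[OF \<sigma>], rule subfield_intros[OF F])+

lemma gal_uminus: "x \<in> alg_cl F \<Longrightarrow> \<sigma> (- x) = - \<sigma> x"
  using galD(3)[OF \<sigma>, of x "- x"] alg_cl_intros(5)[of x] by (simp add: eq_neg_iff_add_eq_0 add.commute)

lemma gal_diff: "x \<in> alg_cl F \<Longrightarrow> y \<in> alg_cl F \<Longrightarrow> \<sigma> (x - y) = \<sigma> x - \<sigma> y"
  using galD(3)[OF \<sigma>, of x "- y"] alg_cl_intros(5)[of y] by (simp add: gal_uminus)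

lemma gal_inverse: "x \<in> alg_cl F \<Longrightarrow> \<sigma> (inverse x) = inverse (\<sigma> x)"
proof (cases "x = 0")
  case False
  assume x: "x \<in> alg_cl F"
  have "\<sigma> x * \<sigma> (inverse x) = \<sigma> (x * inverse x)"
    by (rule galD(4)[OF \<sigma>, symmetric]) (use x alg_cl_intros(6) in auto)
  then have "\<sigma> x * \<sigma> (inverse x) = 1" using False by simp
  then show ?thesis by (simp add: inverse_unique)
qed simp

lemma gal_divide: "x \<in> alg_cl F \<Longrightarrow> y \<in> alg_cl F \<Longrightarrow> \<sigma> (x / y) = \<sigma> x / \<sigma> y"
  using galD(4)[OF \<sigma>, of x "inverse y"] alg_cl_intros(6)[of y]
  by (simp add: divide_inverse gal_inverse)

lemma gal_power: "x \<in> alg_cl F \<Longrightarrow> \<sigma> (x ^ n) = \<sigma> x ^ n"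
  by (induction n) (auto simp: galD(4)[OF \<sigma>] alg_cl_intros)

lemmas gal_hom = galD(3,4)[OF \<sigma>] gal_uminus gal_diff gal_inverse gal_divide gal_power

lemma act_points:
  assumes W: "defined_over F W" and P: "P \<in> points W (alg_cl F)"
  shows "act \<sigma> P \<in> points W (alg_cl F)"
proof (cases P)
  case None
  then show ?thesis by (simp add: act_def)
next
  case (Some p)
  obtain x y where p: "p = (x, y)" by (cases p)
  have xy: "x \<in> alg_cl F" "y \<in> alg_cl F"
    and e: "y^2 = x^3 + a2 W * x^2 + a4 W * x + a6 W" using P Some p by (auto simp: Some_points)
  have w: "a2 W \<in> alg_cl F" "a4 W \<in> alg_cl F" "a6 W \<in> alg_cl F"
    and s: "\<sigma> (a2 W) = a2 W" "\<sigma> (a4 W) = a4 W" "\<sigma> (a6 W) = a6 W"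
    using W alg_cl_superset[OF F] galD(5)[OF \<sigma>] by (auto simp: defined_over_def)
  have "\<sigma> y ^ 2 = \<sigma> (y^2)" using xy by (simp add: gal_hom)
  also have "\<dots> = \<sigma> x ^ 3 + a2 W * \<sigma> x ^ 2 + a4 W * \<sigma> x + a6 W"
    unfolding e using xy w s by (simp add: gal_hom alg_cl_intros)
  finally show ?thesis using xy galD(6)[OF \<sigma>] by (simp add: Some p act_def Some_points)
qed

lemma act_neg: "P \<in> points W (alg_cl F) \<Longrightarrow> act \<sigma> (ec_neg P) = ec_neg (act \<sigma> P)"
  by (cases P) (auto simp: act_def Some_points gal_uminus)

lemma act_add:
  assumes W: "defined_over F W" and P: "P \<in> points W (alg_cl F)" and Q: "Q \<in> points W (alg_cl F)"
  shows "act \<sigma> (ec_add W P Q) = ec_add W (act \<sigma> P) (act \<sigma> Q)"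
proof (cases "P = None \<or> Q = None")
  case True
  then show ?thesis by (auto simp: act_def)
next
  case False
  then obtain x1 y1 x2 y2 where e: "P = Some (x1, y1)" "Q = Some (x2, y2)" by auto
  have m: "x1 \<in> alg_cl F" "y1 \<in> alg_cl F" "x2 \<in> alg_cl F" "y2 \<in> alg_cl F"
    using P Q by (auto simp: e Some_points)
  have w: "a2 W \<in> alg_cl F" "a4 W \<in> alg_cl F"
    and s: "\<sigma> (a2 W) = a2 W" "\<sigma> (a4 W) = a4 W"
    using W alg_cl_superset[OF F] galD(5)[OF \<sigma>] by (auto simp: defined_over_def)
  have c1: "\<sigma> x1 = \<sigma> x2 \<longleftrightarrow> x1 = x2" using galD(7)[OF \<sigma>] m by blast
  have c2: "\<sigma> y1 + \<sigma> y2 = 0 \<longleftrightarrow> y1 + y2 = 0"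
    using galD(3,7)[OF \<sigma>, of "y1" y2] galD(7)[OF \<sigma>, of "y1 + y2" 0] m alg_cl_intros by simp
  define l where "l = (if x1 = x2 then (3 * x1^2 + 2 * a2 W * x1 + a4 W) / (2 * y1)
      else (y2 - y1) / (x2 - x1))"
  have lm: "l \<in> alg_cl F" using m w by (auto simp: l_def intro!: alg_cl_intros)
  have l\<sigma>: "\<sigma> l = (if \<sigma> x1 = \<sigma> x2 then (3 * \<sigma> x1^2 + 2 * a2 W * \<sigma> x1 + a4 W) / (2 * \<sigma> y1)
      else (\<sigma> y2 - \<sigma> y1) / (\<sigma> x2 - \<sigma> x1))"
    unfolding c1 using m w s by (auto simp: l_def gal_hom alg_cl_intros)
  have x\<sigma>: "\<sigma> (l^2 - a2 W - x1 - x2) = (\<sigma> l)^2 - a2 W - \<sigma> x1 - \<sigma> x2"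
    using m w s lm by (simp add: gal_hom alg_cl_intros)
  have y\<sigma>: "\<sigma> (l * (x1 - (l^2 - a2 W - x1 - x2)) - y1) =
      \<sigma> l * (\<sigma> x1 - ((\<sigma> l)^2 - a2 W - \<sigma> x1 - \<sigma> x2)) - \<sigma> y1"
    using m w s lm by (simp add: gal_hom alg_cl_intros)
  show ?thesis
  proof (cases "x1 = x2 \<and> y1 + y2 = 0")
    case True
    then show ?thesis using c1 c2 by (auto simp: e act_def)
  next
    case n: False
    then have n': "\<not> (\<sigma> x1 = \<sigma> x2 \<and> \<sigma> y1 + \<sigma> y2 = 0)" using c1 c2 by simp
    have "ec_add W P Q = Some (l^2 - a2 W - x1 - x2, l * (x1 - (l^2 - a2 W - x1 - x2)) - y1)"
      unfolding e by (subst ec_add.simps, subst if_not_P[OF n]) (simp only: Let_def l_def)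
    moreover have "ec_add W (act \<sigma> P) (act \<sigma> Q) = Some ((\<sigma> l)^2 - a2 W - \<sigma> x1 - \<sigma> x2,
        \<sigma> l * (\<sigma> x1 - ((\<sigma> l)^2 - a2 W - \<sigma> x1 - \<sigma> x2)) - \<sigma> y1)"
      unfolding e act_def option.map map_prod_simp
      by (subst ec_add.simps, subst if_not_P[OF n']) (simp only: Let_def l\<sigma>)
    ultimately show ?thesis using x\<sigma> y\<sigma> by (simp add: act_def)
  qed
qed

end

lemma act_fixed: "P \<in> points W F \<Longrightarrow> \<sigma> \<in> gal F \<Longrightarrow> act \<sigma> P = P"
  by (cases P) (auto simp: act_def Some_points galD(5))

lemma act_fixed_imp:
  assumes "P \<in> points W (alg_cl F)" "\<And>\<sigma>. \<sigma> \<in> gal F \<Longrightarrow> act \<sigma> P = P"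
  shows "P \<in> points W F"
proof (cases P)
  case None
  then show ?thesis by simp
next
  case (Some p)
  obtain x y where p: "p = (x, y)" by (cases p)
  have xy: "x \<in> alg_cl F" "y \<in> alg_cl F" using assms(1) Some p by (auto simp: Some_points)
  have "\<sigma> x = x" "\<sigma> y = y" if "\<sigma> \<in> gal F" for \<sigma>
    using assms(2)[OF that] by (auto simp: Some p act_def)
  then have "x \<in> F" "y \<in> F" using gal_fixed[OF F] xy by blast+
  then show ?thesis using assms(1) by (auto simp: Some p Some_points)
qed

lemma gal_compose:
  assumes "\<sigma> \<in> gal F" "\<tau> \<in> gal F"
  shows "compose (alg_cl F) \<sigma> \<tau> \<in> gal F"
proof -
  have b: "bij_betw (compose (alg_cl F) \<sigma> \<tau>) (alg_cl F) (alg_cl F)"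
    using bij_betw_trans[OF galD(2)[OF assms(2)] galD(2)[OF assms(1)]]
    by (subst bij_betw_cong[where g = "\<sigma> \<circ> \<tau>"]) (auto simp: compose_eq)
  show ?thesis
    unfolding gal_def
  proof (intro CollectI conjI ballI)
    fix x y assume "x \<in> alg_cl F" "y \<in> alg_cl F"
    then show "compose (alg_cl F) \<sigma> \<tau> (x + y) = compose (alg_cl F) \<sigma> \<tau> x + compose (alg_cl F) \<sigma> \<tau> y"
      "compose (alg_cl F) \<sigma> \<tau> (x * y) = compose (alg_cl F) \<sigma> \<tau> x * compose (alg_cl F) \<sigma> \<tau> y"
      using galD(3,4,6)[OF assms(1)] galD(3,4,6)[OF assms(2)]
      by (simp_all add: compose_eq alg_cl_intros)
  next
    fix x assume "x \<in> F"
    then show "compose (alg_cl F) \<sigma> \<tau> x = x"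
      using alg_cl_superset[OF F] galD(5)[OF assms(1)] galD(5)[OF assms(2)]
      by (auto simp: compose_eq subsetD)
  qed (use b in auto)
qed

lemma act_compose:
  assumes "P \<in> points W (alg_cl F)"
  shows "act (compose (alg_cl F) \<sigma> \<tau>) P = act \<sigma> (act \<tau> P)"
  using assms by (cases P) (auto simp: act_def Some_points compose_eq)

text \<open>The restriction maps the smaller closure onto itself by
  \<open>coeffs_in_finite_roots\<close>, because an automorphism over \<open>L\<close> sends roots
  of a polynomial over \<open>F\<close> to roots.\<close>

lemma gal_restrict:
  assumes L: "complex_subfield L" "F \<subseteq> L" and \<sigma>: "\<sigma> \<in> gal L"
  shows "restrict \<sigma> (alg_cl F) \<in> gal F"
proof -
  note sub = subsetD[OF alg_cl_mono[OF L(2)]]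
  have "inj_on \<sigma> (alg_cl F)"
    using galD(7)[OF \<sigma>] sub by (auto simp: inj_on_def)
  moreover have "poly p (\<sigma> x) = 0" if "coeffs_in F p" "x \<in> alg_cl F" "poly p x = 0" for p x
  proof -
    have "poly p (\<sigma> x) = \<sigma> (poly p x)" if "coeffs_in F p" for p
      using that
    proof (induction p)
      case 0
      then show ?case using \<sigma> L by (simp add: galD(5) subfield_0)
    next
      case (pCons c p)
      have c: "c \<in> L" using pCons.prems L(2) by (auto simp: coeffs_in_def coeff_pCons split: nat.splits)
      have p: "coeffs_in F p"
        unfolding coeffs_in_def
      proof
        fix i show "Polynomial.coeff p i \<in> F"
          using pCons.prems[unfolded coeffs_in_def, rule_format, of "Suc i"] by simp
      qed
      have "coeffs_in (alg_cl L) p"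
        using p alg_cl_superset[OF L(1)] L(2) by (auto simp: coeffs_in_def)
      then have "poly p x \<in> alg_cl L"
        using subfield_poly[OF complex_subfield_alg_cl[OF L(1)]] sub \<open>x \<in> alg_cl F\<close> by blast
      then show ?case
        using pCons.IH[OF p] c sub[OF \<open>x \<in> alg_cl F\<close>] subsetD[OF alg_cl_superset[OF L(1)] c]
          subfield_mult[OF complex_subfield_alg_cl[OF L(1)]] by (simp add: galD(3,4,5)[OF \<sigma>])
    qed
    then show ?thesis using that \<sigma> L by (simp add: galD(5) subfield_0)
  qed
  ultimately have "\<sigma> ` alg_cl F = alg_cl F" by (rule coeffs_in_finite_roots)
  then have "bij_betw (restrict \<sigma> (alg_cl F)) (alg_cl F) (alg_cl F)"
    using \<open>inj_on \<sigma> (alg_cl F)\<close> by (simp add: bij_betw_def inj_on_def)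
  then show ?thesis
    using galD(3,4,5)[OF \<sigma>] sub L(2) alg_cl_superset[OF F]
    by (auto simp: gal_def alg_cl_intros subsetD)
qed

lemma openin_krull_value:
  assumes "x \<in> alg_cl F"
  shows "openin (krull_topology F) {\<sigma> \<in> gal F. \<sigma> x \<in> A}"
proof -
  have c: "continuous_map (product_topology (\<lambda>_. discrete_topology (alg_cl F)) (alg_cl F))
      (discrete_topology (alg_cl F)) (\<lambda>\<sigma>. \<sigma> x)"
    using continuous_map_product_projection[OF assms] by fast
  have "openin (product_topology (\<lambda>_. discrete_topology (alg_cl F)) (alg_cl F))
      {\<sigma> \<in> topspace (product_topology (\<lambda>_. discrete_topology (alg_cl F)) (alg_cl F)). \<sigma> x \<in> A \<inter> alg_cl F}"
    by (rule openin_continuous_map_preimage[OF c]) simp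
  then have "openin (krull_topology F)
      ({\<sigma> \<in> topspace (product_topology (\<lambda>_. discrete_topology (alg_cl F)) (alg_cl F)). \<sigma> x \<in> A \<inter> alg_cl F} \<inter> gal F)"
    unfolding krull_topology_def by (rule openin_subtopology_Int)
  also have "{\<sigma> \<in> topspace (product_topology (\<lambda>_. discrete_topology (alg_cl F)) (alg_cl F)). \<sigma> x \<in> A \<inter> alg_cl F} \<inter> gal F
      = {\<sigma> \<in> gal F. \<sigma> x \<in> A}"
    using galD(1,6) assms by (auto simp: PiE_def)
  finally show ?thesis .
qed

lemma topspace_krull [simp]: "topspace (krull_topology F) = gal F"
  using galD(1,6) by (auto simp: krull_topology_def PiE_def)

end

subsection \<open>The isogeny\<close>

lemma E_simps [simp]:
  "a2 (E a b) = of_int a" "a4 (E a b) = - 2 * of_int a * of_int b" "a6 (E a b) = of_int a * of_int b^2"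
  by (simp_all add: E_def)

lemma Ehat_simps [simp]:
  "a2 (Ehat a b) = - 27 * of_int a" "a4 (Ehat a b) = 54 * of_int a * (4 * of_int a + 27 * of_int b)"
  "a6 (Ehat a b) = - 27 * of_int a * (4 * of_int a + 27 * of_int b)^2"
  by (simp_all add: Ehat_def)

lemma defined_over_E: "complex_subfield F \<Longrightarrow> defined_over F (E a b)"
  by (auto simp: defined_over_def intro!: subfield_intros)

lemma nonsingular_E:
  assumes "a * b * (4 * a + 27 * b) \<noteq> 0"
  shows "nonsingular (E a b)"
  unfolding nonsingular_def
proof (intro allI impI notI)
  fix x :: complex
  define A B where "A = complex_of_int a" and "B = complex_of_int b"
  have n: "A \<noteq> 0" "B \<noteq> 0" "4 * A + 27 * B \<noteq> 0"
  proof -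
    show "A \<noteq> 0" "B \<noteq> 0" using assms by (auto simp: A_def B_def)
    have "4 * A + 27 * B = of_int (4 * a + 27 * b)" by (simp add: A_def B_def)
    then show "4 * A + 27 * B \<noteq> 0" using assms by (metis mult_zero_right of_int_eq_0_iff)
  qed
  assume f: "x^3 + a2 (E a b) * x^2 + a4 (E a b) * x + a6 (E a b) = 0"
    and d: "3 * x^2 + 2 * a2 (E a b) * x + a4 (E a b) = 0"
  have f': "x^3 + A * (x - B)^2 = 0" and d': "3 * x^2 + 2 * A * (x - B) = 0"
    using f d by (simp_all add: A_def B_def power2_eq_square algebra_simps)
  have "A * (x - B) * (x - 3 * B) = 0" using f' d' by Groebner_Basis.algebra
  then consider "x = B" | "x = 3 * B" using n(1) by auto
  then show False
  proof cases
    case 1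
    then show False using f' n(2) by simp
  next
    case 2
    then have "B^2 * (4 * A + 27 * B) = 0" using f' by Groebner_Basis.algebra
    then show False using n by simp
  qed
qed

lemma nonsingular_Ehat:
  assumes "a * b * (4 * a + 27 * b) \<noteq> 0"
  shows "nonsingular (Ehat a b)"
proof -
  have "4 * (- 27 * a) + 27 * (4 * a + 27 * b) = 729 * b" by simp
  then show ?thesis unfolding Ehat_def using assms by (intro nonsingular_E) auto
qed

text \<open>The curve equation eliminates \<open>x^3\<close>. In the variables
  \<open>v = y/x\<close> and \<open>w = 1 - 3 b/x\<close> the isogeny becomes homogeneous, and its
  first coordinate \<open>9 v^2 + 3 a w^2\<close> splits over a square root of \<open>- 3 a\<close>,
  which is the origin of the diagonal coordinates.\<close>

lemma psi_Some:
  assumes "Some (x, y) \<in> points (E a b) F" "x \<noteq> 0"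
  shows "psi a b (Some (x, y)) =
    Some (9 * (y / x)^2 + 3 * of_int a * (1 - 3 * of_int b / x)^2,
      27 * (y / x) * ((y / x)^2 - of_int a * (1 - 3 * of_int b / x)^2))"
proof -
  define A B where "A = complex_of_int a" and "B = complex_of_int b"
  have e: "x^3 = y^2 - A * (x - B)^2" using assms(1) by (simp add: points_E A_def B_def)
  have w: "1 - 3 * B / x = (x - 3 * B) / x" using assms(2) by (simp add: field_simps)
  have 1: "9 * (x^3 + 4/3 * A * x^2 - 4 * A * B * x + 4 * A * B^2) = 9 * y^2 + 3 * A * (x - 3 * B)^2"
    unfolding e by (simp add: power2_eq_square field_simps)
  have 2: "x^3 + 4 * A * B * x - 8 * A * B^2 = y^2 - A * (x - 3 * B)^2"
    unfolding e by (simp add: power2_eq_square algebra_simps)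
  have "9 * (x^3 + 4/3 * A * x^2 - 4 * A * B * x + 4 * A * B^2) / x^2 =
      9 * (y / x)^2 + 3 * A * (1 - 3 * B / x)^2"
    unfolding 1 w by (simp add: power_divide add_divide_distrib)
  moreover have "27 * y * (x^3 + 4 * A * B * x - 8 * A * B^2) / x^3 =
      27 * (y / x) * ((y / x)^2 - A * (1 - 3 * B / x)^2)"
    unfolding 2 w using assms(2) by (simp add: power_divide field_simps power2_eq_square power3_eq_cube)
  ultimately show ?thesis using assms(2) by (simp add: Let_def A_def B_def)
qed

lemma psi_zero [simp]: "psi a b (Some (0, y)) = None"
  by simp

declare psi.simps(2) [simp del]

lemma psi_eq_None: "psi a b P = None \<longleftrightarrow> P = None \<or> (\<exists>y. P = Some (0, y))"
  by (cases "(a, b, P)" rule: psi.cases) (auto simp: Let_def psi.simps(2))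

lemma psi_neg: "psi a b (ec_neg P) = ec_neg (psi a b P)"
  by (cases "(a, b, P)" rule: psi.cases) (auto simp: Let_def psi.simps(2))

lemma psi_points: "P \<in> points (E a b) UNIV \<Longrightarrow> psi a b P \<in> points (Ehat a b) UNIV"
  by (rule psi_maps_to_Ehat)

lemma psi_points_over:
  assumes F: "complex_subfield F" and P: "P \<in> points (E a b) F"
  shows "psi a b P \<in> points (Ehat a b) F"
proof (cases "psi a b P")
  case None
  then show ?thesis by simp
next
  case (Some p)
  have "psi a b P \<in> points (Ehat a b) UNIV" using P points_UNIV psi_points by blast
  moreover obtain x y where xy: "P = Some (x, y)" "x \<noteq> 0"
    using Some by (cases "(a, b, P)" rule: psi.cases) (auto simp: psi.simps(2) split: if_splits)
  ultimately show ?thesis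
    using P psi_Some[of x y a b F] by (auto simp: points_E points_Ehat intro!: subfield_intros[OF F])
qed

text \<open>In terms of \<open>u = 1/x\<close> the slope \<open>y/x\<close> is \<open>l + m u\<close> on the line, and \<open>X\<close> is a quadratic
  polynomial in \<open>u\<close>. The image of the line is the norm of its equation.\<close>

lemma psi_on_line:
  assumes l: "on_line (E a b) l m (x1, y1) (x2, y2) (x3, y3)"
    and nz: "x1 \<noteq> 0" "x2 \<noteq> 0" "x3 \<noteq> 0"
  shows "\<exists>l' m' Q1 Q2 Q3. psi a b (Some (x1, y1)) = Some Q1 \<and> psi a b (Some (x2, y2)) = Some Q2 \<and>
    psi a b (Some (x3, y3)) = Some Q3 \<and> on_line (Ehat a b) l' m' Q1 Q2 Q3"
proof -
  define A B where "A = complex_of_int a" and "B = complex_of_int b"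
  define e1 e2 e3 where "e1 = l^2 - A" and "e2 = - 2 * A * B - 2 * l * m" and "e3 = m^2 - A * B^2"
  have y: "y1 = l * x1 + m" "y2 = l * x2 + m" "y3 = l * x3 + m"
    and s: "x1 + x2 + x3 = e1" "x1 * x2 + x1 * x3 + x2 * x3 = e2" "x1 * x2 * x3 = e3"
    using l by (auto simp: on_line_def e1_def e2_def e3_def A_def B_def)
  have e30: "e3 \<noteq> 0" using s(3) nz by auto
  define u1 u2 u3 where "u1 = 1 / x1" and "u2 = 1 / x2" and "u3 = 1 / x3"
  have ux: "u1 * x1 = 1" "u2 * x2 = 1" "u3 * x3 = 1" using nz by (simp_all add: u1_def u2_def u3_def)
  have f1: "(u1 + u2 + u3) * e3 = e2" and f2: "(u1 * u2 + u1 * u3 + u2 * u3) * e3 = e1"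
    and f3: "u1 * u2 * u3 * e3 = 1"
    unfolding s[symmetric] using ux by Groebner_Basis.algebra+
  \<comment> \<open>The coefficients of the first coordinate of the isogeny as a polynomial in
    \<open>u = 1/x\<close> along the line.\<close>
  define c0 c1 c2 where "c0 = 9 * l^2 + 3 * A" and "c1 = 18 * (l * m - A * B)"
    and "c2 = 9 * (m^2 + 3 * A * B^2)"
  define px where "px = (\<lambda>u. c0 + c1 * u + c2 * u^2)"
  define py where "py = (\<lambda>u. 27 * (l + m * u) * ((l + m * u)^2 - A * (1 - 3 * B * u)^2))"
  have XY: "psi a b (Some (x, y)) = Some (px u, py u)"
    if "y = l * x + m" "u * x = 1" "Some (x, y) \<in> points (E a b) UNIV" for x y u
  proof -
    have "x \<noteq> 0" using that(2) by auto
    moreover from this have "u = 1 / x" using that(2) by (simp add: eq_divide_eq)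
    moreover from calculation have "y / x = l + m * u" using that(1) by (simp add: field_simps)
    moreover have "9 * (l + m * u)^2 + 3 * A * (1 - 3 * B * u)^2 = px u"
      by (simp add: px_def c0_def c1_def c2_def power2_eq_square algebra_simps)
    ultimately show ?thesis using psi_Some[OF that(3)] by (simp add: py_def A_def B_def)
  qed
  have on: "Some (x1, y1) \<in> points (E a b) UNIV" "Some (x2, y2) \<in> points (E a b) UNIV"
    "Some (x3, y3) \<in> points (E a b) UNIV"
    using on_line_points[OF l] on_line_points[OF on_line_rotate[OF l]]
      on_line_points[OF on_line_rotate[OF on_line_rotate[OF l]]] by auto
  \<comment> \<open>These come from division with remainder: modulo the cubic with the roots
    \<open>1/x1\<close>, \<open>1/x2\<close>, \<open>1/x3\<close> the polynomial
    \<open>e3 * py\<close> leaves \<open>L * px + M\<close>.\<close>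
  define L M where "L = 3 * (l * (m^2 + 3 * A * B^2) + 4 * A * B * m)"
    and "M = 27 * l * (l^2 - A) * e3 - L * c0 + 27 * m * (m^2 - 9 * A * B^2)"
  define l' m' where "l' = L / e3" and "m' = M / e3"
  have l'm': "l' * e3 = L" "m' * e3 = M" using e30 by (simp_all add: l'_def m'_def)
  have py: "py u = l' * px u + m'" if u: "e3 * u^3 - e2 * u^2 + e1 * u - 1 = 0" for u
  proof -
    have "e3 * py u - L * px u - M = 27 * m * (m^2 - 9 * A * B^2) * (e3 * u^3 - e2 * u^2 + e1 * u - 1)"
      unfolding px_def py_def M_def L_def c0_def c1_def c2_def e1_def e2_def e3_def
      by Groebner_Basis.algebra
    then have "e3 * py u - (l' * e3) * px u - m' * e3 = 0" unfolding l'm' u by simp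
    then have "e3 * (py u - (l' * px u + m')) = 0" by (simp add: algebra_simps)
    then show ?thesis using e30 by simp
  qed
  have "e3 * u1^3 - (u1 + u2 + u3) * e3 * u1^2 + (u1 * u2 + u1 * u3 + u2 * u3) * e3 * u1 - u1 * u2 * u3 * e3 = 0"
    "e3 * u2^3 - (u1 + u2 + u3) * e3 * u2^2 + (u1 * u2 + u1 * u3 + u2 * u3) * e3 * u2 - u1 * u2 * u3 * e3 = 0"
    "e3 * u3^3 - (u1 + u2 + u3) * e3 * u3^2 + (u1 * u2 + u1 * u3 + u2 * u3) * e3 * u3 - u1 * u2 * u3 * e3 = 0"
    by (simp_all add: power2_eq_square power3_eq_cube algebra_simps)
  then have r: "e3 * u1^3 - e2 * u1^2 + e1 * u1 - 1 = 0" "e3 * u2^3 - e2 * u2^2 + e1 * u2 - 1 = 0"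
    "e3 * u3^3 - e2 * u3^2 + e1 * u3 - 1 = 0"
    unfolding f1 f2 f3 .
  define g1 g2 g3 where "g1 = u1 + u2 + u3" and "g2 = u1 * u2 + u1 * u3 + u2 * u3"
    and "g3 = u1 * u2 * u3"
  have g: "g1 * e3 = e2" "g2 * e3 = e1" "g3 * e3 = 1" using f1 f2 f3 by (simp_all add: g1_def g2_def g3_def)
  \<comment> \<open>The symmetric functions of the three image abscissas are expressed through those
    of \<open>u1\<close>, \<open>u2\<close>, \<open>u3\<close>; multiplication by
    \<open>e3^2\<close> then removes all denominators.\<close>
  have S1: "px u1 + px u2 + px u3 = 3 * c0 + c1 * g1 + c2 * (g1^2 - 2 * g2)"
    unfolding px_def g1_def g2_def by (simp add: power2_eq_square algebra_simps)
  have S2: "px u1 * px u2 + px u1 * px u3 + px u2 * px u3 = 3 * c0^2 + 2 * c0 * c1 * g1 +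
      2 * c0 * c2 * (g1^2 - 2 * g2) + c1^2 * g2 + c1 * c2 * (g1 * g2 - 3 * g3) + c2^2 * (g2^2 - 2 * g1 * g3)"
    unfolding px_def g1_def g2_def g3_def by (simp add: power2_eq_square algebra_simps)
  have S3: "px u1 * px u2 * px u3 = c0^3 + c0^2 * c1 * g1 + c0^2 * c2 * (g1^2 - 2 * g2) + c0 * c1^2 * g2 +
      c0 * c1 * c2 * (g1 * g2 - 3 * g3) + c0 * c2^2 * (g2^2 - 2 * g1 * g3) + c1^3 * g3 +
      c1^2 * c2 * g1 * g3 + c1 * c2^2 * g2 * g3 + c2^3 * g3^2"
    unfolding px_def g1_def g2_def g3_def by (simp add: power2_eq_square power3_eq_cube algebra_simps)
  define D where "D = 4 * A + 27 * B"
  have T1: "px u1 + px u2 + px u3 = l'^2 - a2 (Ehat a b)"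
  proof -
    have "(px u1 + px u2 + px u3) * e3^2 = 3 * c0 * e3^2 + c1 * e2 * e3 + c2 * (e2^2 - 2 * e1 * e3)"
      unfolding S1 g[symmetric] by (simp add: power2_eq_square algebra_simps)
    also have "\<dots> = L^2 + 27 * A * e3^2"
      unfolding L_def c0_def c1_def c2_def e1_def e2_def e3_def by Groebner_Basis.algebra
    also have "\<dots> = (l'^2 + 27 * A) * e3^2" unfolding l'm'[symmetric] by (simp add: power2_eq_square algebra_simps)
    finally show ?thesis using e30 by (simp add: A_def)
  qed
  have T2: "px u1 * px u2 + px u1 * px u3 + px u2 * px u3 = a4 (Ehat a b) - 2 * l' * m'"
  proof -
    have "(px u1 * px u2 + px u1 * px u3 + px u2 * px u3) * e3^2 =
      3 * c0^2 * e3^2 + 2 * c0 * c1 * (g1 * e3) * e3 +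
      2 * c0 * c2 * ((g1 * e3)^2 - 2 * (g2 * e3) * e3) + c1^2 * (g2 * e3) * e3 +
      c1 * c2 * ((g1 * e3) * (g2 * e3) - 3 * (g3 * e3) * e3) +
      c2^2 * ((g2 * e3)^2 - 2 * (g1 * e3) * (g3 * e3))"
      unfolding S2 by (simp add: power2_eq_square algebra_simps)
    also have "\<dots> = 3 * c0^2 * e3^2 + 2 * c0 * c1 * e2 * e3 +
      2 * c0 * c2 * (e2^2 - 2 * e1 * e3) + c1^2 * e1 * e3 + c1 * c2 * (e2 * e1 - 3 * e3) + c2^2 * (e1^2 - 2 * e2)"
      unfolding g by simp
    also have "\<dots> = 54 * A * D * e3^2 - 2 * L * M"
      unfolding D_def M_def L_def c0_def c1_def c2_def e1_def e2_def e3_def by Groebner_Basis.algebra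
    also have "\<dots> = (54 * A * D - 2 * l' * m') * e3^2"
      unfolding l'm'[symmetric] by (simp add: power2_eq_square algebra_simps)
    finally show ?thesis using e30 by (simp add: A_def B_def D_def)
  qed
  have T3: "px u1 * px u2 * px u3 = m'^2 - a6 (Ehat a b)"
  proof -
    have "(px u1 * px u2 * px u3) * e3^2 = c0^3 * e3^2 + c0^2 * c1 * (g1 * e3) * e3 +
      c0^2 * c2 * ((g1 * e3)^2 - 2 * (g2 * e3) * e3) + c0 * c1^2 * (g2 * e3) * e3 +
      c0 * c1 * c2 * ((g1 * e3) * (g2 * e3) - 3 * (g3 * e3) * e3) +
      c0 * c2^2 * ((g2 * e3)^2 - 2 * (g1 * e3) * (g3 * e3)) + c1^3 * (g3 * e3) * e3 +
      c1^2 * c2 * (g1 * e3) * (g3 * e3) + c1 * c2^2 * (g2 * e3) * (g3 * e3) + c2^3 * (g3 * e3)^2"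
      unfolding S3 by (simp add: power2_eq_square algebra_simps)
    also have "\<dots> = c0^3 * e3^2 + c0^2 * c1 * e2 * e3 +
      c0^2 * c2 * (e2^2 - 2 * e1 * e3) + c0 * c1^2 * e1 * e3 + c0 * c1 * c2 * (e2 * e1 - 3 * e3) +
      c0 * c2^2 * (e1^2 - 2 * e2) + c1^3 * e3 + c1^2 * c2 * e2 + c1 * c2^2 * e1 + c2^3"
      unfolding g by simp
    also have "\<dots> = M^2 + 27 * A * D^2 * e3^2"
      unfolding D_def M_def L_def c0_def c1_def c2_def e1_def e2_def e3_def by Groebner_Basis.algebra
    also have "\<dots> = (m'^2 + 27 * A * D^2) * e3^2"
      unfolding l'm'[symmetric] by (simp add: power2_eq_square algebra_simps)
    finally show ?thesis using e30 by (simp add: A_def B_def D_def)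
  qed
  have "on_line (Ehat a b) l' m' (px u1, py u1) (px u2, py u2) (px u3, py u3)"
    unfolding on_line_def prod.case using py[OF r(1)] py[OF r(2)] py[OF r(3)] T1 T2 T3 by blast
  then show ?thesis
    using XY[OF y(1) ux(1) on(1)] XY[OF y(2) ux(2) on(2)] XY[OF y(3) ux(3) on(3)] by blast
qed


text \<open>The third point lies in the kernel, so the first two are opposite up to translation by a
  kernel point. With \<open>a = c^2\<close> this translation is the affine relation
  \<open>2 c (U + V) = c - l\<close> between \<open>U = b/x1\<close> and
  \<open>V = b/x2\<close>.\<close>

lemma psi_on_line_zero:
  assumes ab: "a \<noteq> 0" "b \<noteq> 0" and l: "on_line (E a b) l m (x1, y1) (x2, y2) (0, y3)"
  shows "psi a b (Some (x2, y2)) = ec_neg (psi a b (Some (x1, y1)))"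
proof -
  define A B where "A = complex_of_int a" and "B = complex_of_int b"
  have n: "A \<noteq> 0" "B \<noteq> 0" using ab by (simp_all add: A_def B_def)
  define c where "c = m / B"
  have m: "m = c * B" using n by (simp add: c_def)
  have y: "y1 = l * x1 + m" "y2 = l * x2 + m"
    and s: "x1 + x2 = l^2 - A" "x1 * x2 = - 2 * A * B - 2 * l * m" and "m^2 = A * B^2"
    using l by (auto simp: on_line_def A_def B_def)
  then have A: "A = c^2" using n(2) by (simp add: m power2_eq_square)
  then have c: "c \<noteq> 0" using n by auto
  have s2: "x1 * x2 = - 2 * c * B * (c + l)" using s(2) unfolding A m by (simp add: power2_eq_square algebra_simps)
  have on: "Some (x1, y1) \<in> points (E a b) UNIV" "Some (x2, y2) \<in> points (E a b) UNIV"
    using on_line_points[OF l] on_line_points[OF on_line_rotate[OF l]] by auto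
  show ?thesis
  proof (cases "c + l = 0")
    \<comment> \<open>The line is the inflectional tangent at the kernel point, and all three points
      coincide with it.\<close>
    case True
    then have "x1 + x2 = 0" "x1 * x2 = 0" using s(1) s2 A by (auto simp: add_eq_0_iff)
    then have "x1 = 0" "x2 = 0" by auto
    then show ?thesis by simp
  next
    case False
    then have nz: "x1 \<noteq> 0" "x2 \<noteq> 0" using s2 c n by auto
    define U V where "U = B / x1" and "V = B / x2"
    have "2 * c * (c + l) * (x1 * x2) * (U + V) = 2 * c * (c + l) * B * (x1 + x2)"
      using nz by (simp add: U_def V_def field_simps)
    also have "\<dots> = (c - l) * (c + l) * (- 2 * c * B * (c + l))"
      unfolding s(1) A by (simp add: power2_eq_square algebra_simps)
    finally have "(c + l) * (x1 * x2) * (2 * c * (U + V) - (c - l)) = 0"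
      unfolding s2[symmetric] by (simp add: algebra_simps)
    then have UV: "2 * c * (U + V) = c - l" using False nz by simp
    have v: "y1 / x1 = l + c * U" "y2 / x2 = l + c * V"
      using nz y m by (simp_all add: U_def V_def field_simps)
    have w: "1 - 3 * B / x1 = 1 - 3 * U" "1 - 3 * B / x2 = 1 - 3 * V"
      by (simp_all add: U_def V_def)
    have "9 * (l + c * V)^2 + 3 * c^2 * (1 - 3 * V)^2 = 9 * (l + c * U)^2 + 3 * c^2 * (1 - 3 * U)^2"
      using UV by Groebner_Basis.algebra
    moreover have "27 * (l + c * V) * ((l + c * V)^2 - c^2 * (1 - 3 * V)^2) =
        - (27 * (l + c * U) * ((l + c * U)^2 - c^2 * (1 - 3 * U)^2))"
    proof -
      have "216 * ((l + c * V) * ((l + c * V)^2 - c^2 * (1 - 3 * V)^2) +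
        (l + c * U) * ((l + c * U)^2 - c^2 * (1 - 3 * U)^2)) = 0"
        using UV by Groebner_Basis.algebra
      then have "(l + c * V) * ((l + c * V)^2 - c^2 * (1 - 3 * V)^2) =
          - ((l + c * U) * ((l + c * U)^2 - c^2 * (1 - 3 * U)^2))"
        by (simp only: mult_eq_0_iff zero_neq_numeral[symmetric] simp_thms eq_neg_iff_add_eq_0)
      then show ?thesis by (simp only: mult.assoc mult_minus_right)
    qed
    ultimately show ?thesis
      using psi_Some[OF on(1) nz(1)] psi_Some[OF on(2) nz(2)]
      unfolding A_def[symmetric] B_def[symmetric] v w A by simp
  qed
qed

context
  fixes a b :: int
  assumes ab: "a * b * (4 * a + 27 * b) \<noteq> 0"
begin

lemma psi_collinear:
  assumes l: "on_line (E a b) l m P Q R"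
  shows "ec_add (Ehat a b) (psi a b (Some P)) (psi a b (Some Q)) = ec_neg (psi a b (Some R))"
proof -
  note l2 = on_line_rotate[OF l]
  note l3 = on_line_rotate[OF l2]
  have n: "a \<noteq> 0" "b \<noteq> 0" using ab by auto
  obtain x1 y1 x2 y2 x3 y3 where e: "P = (x1, y1)" "Q = (x2, y2)" "R = (x3, y3)"
    by (cases P, cases Q, cases R)
  consider "x1 = 0" | "x2 = 0" | "x3 = 0" | "x1 \<noteq> 0" "x2 \<noteq> 0" "x3 \<noteq> 0" by blast
  then show ?thesis
  proof cases
    case 1
    then show ?thesis using psi_on_line_zero[OF n, of l m x2 y2 x3 y3 y1] l2 by (simp add: e)
  next
    case 2
    then show ?thesis using psi_on_line_zero[OF n, of l m x3 y3 x1 y1 y2] l3 by (simp add: e)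
  next
    case 3
    then show ?thesis using psi_on_line_zero[OF n, of l m x1 y1 x2 y2 y3] l by (simp add: e)
  next
    case 4
    then obtain l' m' Q1 Q2 Q3 where "psi a b (Some (x1, y1)) = Some Q1"
      "psi a b (Some (x2, y2)) = Some Q2" "psi a b (Some (x3, y3)) = Some Q3"
      "on_line (Ehat a b) l' m' Q1 Q2 Q3"
      using psi_on_line[of a b l m x1 y1 x2 y2 x3 y3] l unfolding e by blast
    then show ?thesis using on_line_add[OF nonsingular_Ehat[OF ab]] by (simp only: e)
  qed
qed

lemma psi_add:
  assumes P: "P \<in> points (E a b) UNIV" and Q: "Q \<in> points (E a b) UNIV"
  shows "psi a b (ec_add (E a b) P Q) = ec_add (Ehat a b) (psi a b P) (psi a b Q)"
proof (cases "P = None \<or> Q = None")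
  case True
  then show ?thesis by auto
next
  case False
  then obtain x1 y1 x2 y2 where e: "P = Some (x1, y1)" "Q = Some (x2, y2)" by auto
  show ?thesis
  proof (cases "x1 = x2 \<and> y1 + y2 = 0")
    case True
    then have "Q = ec_neg P" by (simp add: e eq_neg_iff_add_eq_0 add.commute)
    then show ?thesis by (simp add: psi_neg)
  next
    case n: False
    obtain l m x3 y3 where l: "on_line (E a b) l m (x1, y1) (x2, y2) (x3, y3)"
      "ec_add (E a b) P Q = Some (x3, - y3)"
      using ec_add_on_line[OF P[unfolded e] Q[unfolded e] n] unfolding e by blast
    have "psi a b (ec_add (E a b) P Q) = ec_neg (psi a b (Some (x3, y3)))"
      using psi_neg[of a b "Some (x3, y3)"] by (simp add: l(2))
    then show ?thesis using psi_collinear[OF l(1)] by (simp add: e)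
  qed
qed

lemma psi_eq_iff:
  assumes P: "P \<in> points (E a b) UNIV" and Q: "Q \<in> points (E a b) UNIV"
  shows "psi a b P = psi a b Q \<longleftrightarrow> psi a b (ec_add (E a b) P (ec_neg Q)) = None"
  using psi_add[OF P, of "ec_neg Q"] Q by (auto simp: psi_neg ec_add_eq_None)

text \<open>The points with \<open>x = 0\<close> are inflection points: the square of the tangent
  slope is \<open>a\<close>, so the double of such a point again has \<open>x = 0\<close>.\<close>

lemma triple_of_psi_None:
  assumes P: "P \<in> points (E a b) UNIV" and k: "psi a b P = None"
  shows "ec_triple (E a b) P = None"
proof (cases "P = None")
  case True
  then show ?thesis by (simp add: ec_triple_def)
next
  case False
  then obtain y where e: "P = Some (0, y)" using k by (auto simp: psi_eq_None)
  define A B where "A = complex_of_int a" and "B = complex_of_int b"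
  have n: "A \<noteq> 0" "B \<noteq> 0" using ab by (auto simp: A_def B_def)
  have y2: "y^2 = A * B^2" using P by (simp add: e Some_points A_def B_def)
  then have y: "y \<noteq> 0" using n by auto
  have "(A * B / y)^2 = A"
    using y2 n y by (simp add: power_divide power_mult_distrib) (simp add: power2_eq_square)
  then have "ec_add (E a b) P P = Some (0, - y)"
    using y by (simp add: e Let_def A_def[symmetric] B_def[symmetric])
  then show ?thesis by (simp add: ec_triple_def e)
qed

text \<open>The 3-division polynomial has the factor \<open>x\<close>, which belongs to the kernel
  of the isogeny. By the curve equation the remaining cubic factor is
  \<open>3 y^2 + a (x - 3 b)^2\<close>, whose vanishing exhibits a square root of
  \<open>- 3 a\<close>.\<close>

lemma triple_None_cases:
  assumes P: "Some (x, y) \<in> points (E a b) UNIV" and t: "ec_triple (E a b) (Some (x, y)) = None"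
  shows "y \<noteq> 0 \<and> (x = 0 \<or> 3 * y^2 + of_int a * (x - 3 * of_int b)^2 = 0)"
proof -
  define A B where "A = complex_of_int a" and "B = complex_of_int b"
  have n: "\<not> (x = x \<and> y + y = 0)" using t by (auto simp: ec_triple_def)
  obtain l m x3 y3 where l: "on_line (E a b) l m (x, y) (x, y) (x3, y3)"
    and d: "ec_add (E a b) (Some (x, y)) (Some (x, y)) = Some (x3, - y3)"
    using ec_add_on_line[OF P P n] by blast
  have "Some (x3, - y3) = ec_neg (Some (x, y))"
    using t unfolding ec_triple_def d ec_add_eq_None .
  then have "x3 = x" "y3 = y" by auto
  then have e: "y = l * x + m" "3 * x = l^2 - A" "3 * x^2 = - 2 * A * B - 2 * l * m"
    "x^3 = m^2 - A * B^2" using l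
    by (auto simp: on_line_def A_def B_def power2_eq_square power3_eq_cube algebra_simps)
  have c: "y^2 = x^3 + A * (x - B)^2" using P by (simp add: points_E A_def B_def)
  have "4 * l^2 * m^2 = (2 * l * m)^2" by (simp add: power_mult_distrib)
  moreover have "l^2 = 3 * x + A" "m^2 = x^3 + A * B^2" "2 * l * m = - 2 * A * B - 3 * x^2"
    using e by simp_all
  ultimately have "4 * (3 * x + A) * (x^3 + A * B^2) = (- 2 * A * B - 3 * x^2)^2" by simp
  then have "x * (3 * y^2 + A * (x - 3 * B)^2) = 0" using c by Groebner_Basis.algebra
  then show ?thesis using n by (auto simp: A_def B_def)
qed

text \<open>A nontrivial 3-torsion point over \<open>F\<close> would yield a square root of
  \<open>a\<close> in \<open>F\<close>: \<open>y / b\<close> if it lies in the kernel of the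
  isogeny, and \<open>\<theta> y / (x - 3 b)\<close> otherwise.\<close>

lemma no_3_torsion:
  assumes F: "complex_subfield F" and th: "\<theta> \<in> F" "\<theta>^2 = - 3"
    and ns: "\<And>s. s \<in> F \<Longrightarrow> s^2 \<noteq> of_int a"
    and P: "P \<in> points (E a b) F" and t: "ec_triple (E a b) P = None"
  shows "P = None"
proof (rule ccontr)
  assume "P \<noteq> None"
  then obtain x y where e: "P = Some (x, y)" by auto
  define A B where "A = complex_of_int a" and "B = complex_of_int b"
  have n: "A \<noteq> 0" "B \<noteq> 0" using ab by (auto simp: A_def B_def)
  note i = subfield_intros[OF F]
  have xy: "x \<in> F" "y \<in> F" "A \<in> F" "B \<in> F" and c: "y^2 = x^3 + A * (x - B)^2"
    using P by (auto simp: e points_E A_def B_def intro: i)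
  have y: "y \<noteq> 0" "x = 0 \<or> 3 * y^2 + A * (x - 3 * B)^2 = 0"
    using triple_None_cases[of x y] P[THEN points_UNIV] t by (auto simp: e A_def B_def)
  from y(2) show False
  proof
    assume "x = 0"
    then have "(y / B)^2 = A" using c n by (simp add: power_divide)
    then show False using ns[of "y / B"] xy by (auto simp: A_def intro: i)
  next
    assume *: "3 * y^2 + A * (x - 3 * B)^2 = 0"
    then have x: "x - 3 * B \<noteq> 0" using y(1) by auto
    have "(\<theta> * y / (x - 3 * B))^2 = - 3 * y^2 / (x - 3 * B)^2"
      by (simp add: power_divide power_mult_distrib th)
    also have "- 3 * y^2 = A * (x - 3 * B)^2" using * by Groebner_Basis.algebra
    finally have "(\<theta> * y / (x - 3 * B))^2 = A" using x by simp
    moreover have "\<theta> * y / (x - 3 * B) \<in> F" using xy th by (auto intro!: i)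
    ultimately show False using ns by (auto simp: A_def)
  qed
qed

end

lemma act_psi:
  assumes F: "complex_subfield F" and \<sigma>: "\<sigma> \<in> gal F" and P: "P \<in> points (E a b) (alg_cl F)"
  shows "psi a b (act \<sigma> P) = act \<sigma> (psi a b P)"
proof (cases P)
  case None
  then show ?thesis by (simp add: act_def)
next
  case (Some p)
  obtain x y where p: "p = (x, y)" by (cases p)
  have xy: "x \<in> alg_cl F" "y \<in> alg_cl F" using P by (auto simp: Some p points_E)
  have "\<sigma> x = 0 \<longleftrightarrow> x = 0" using galD(7)[OF \<sigma> xy(1), of 0] gal_consts(1)[OF F \<sigma>] alg_cl_intros(1)[OF F] by simp
  then show ?thesis
    unfolding Some p act_def option.map map_prod_simp psi.simps(2) Let_def
    using xy by (simp add: gal_hom[OF F \<sigma>] alg_cl_intros[OF F] gal_consts[OF F \<sigma>])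
qed

subsection \<open>Diagonal coordinates\<close>

text \<open>With \<open>\<kappa>\<^sup>2 = - 3 a\<close> put \<open>z = (3 y + \<kappa> (x - 3 b)) / x\<close> and \<open>t = (3 y - \<kappa> (x - 3 b)) / x\<close>.
  The curve becomes \<open>z\<^sup>3 - t\<^sup>3 = 6 \<kappa> (z t - d)\<close>, the isogeny becomes \<open>(z t, (z\<^sup>3 + t\<^sup>3) / 2)\<close>, and
  translation by a point of its kernel becomes multiplication by cube roots of unity.\<close>

definition zt_coords :: "complex \<Rightarrow> int \<Rightarrow> complex \<Rightarrow> complex \<Rightarrow> complex \<times> complex" where
  "zt_coords \<kappa> b x y = (3 * (y / x) + \<kappa> * (1 - 3 * of_int b / x), 3 * (y / x) - \<kappa> * (1 - 3 * of_int b / x))"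

text \<open>The inverse of \<open>zt_coords\<close>: the denominator
  \<open>2 * \<kappa> - z + t\<close> equals \<open>6 * \<kappa> * b / x\<close>.\<close>

definition zt_point :: "complex \<Rightarrow> int \<Rightarrow> complex \<Rightarrow> complex \<Rightarrow> complex \<times> complex" where
  "zt_point \<kappa> b z t = (6 * \<kappa> * of_int b / (2 * \<kappa> - z + t), (z + t) * (\<kappa> * of_int b / (2 * \<kappa> - z + t)))"

lemma zt_coords_inject:
  assumes "x \<noteq> 0" "x' \<noteq> 0" "\<kappa> \<noteq> 0" "b \<noteq> 0" "zt_coords \<kappa> b x y = zt_coords \<kappa> b x' y'"
  shows "x = x' \<and> y = y'"
proof -
  define p q p' q' where "p = 3 * (y / x)" "q = \<kappa> * (1 - 3 * of_int b / x)"
    "p' = 3 * (y' / x')" "q' = \<kappa> * (1 - 3 * of_int b / x')"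
  have pq: "p + q = p' + q'" "p - q = p' - q'"
    using assms(5) by (simp_all add: zt_coords_def p_q_p'_q'_def)
  have "2 * p = (p + q) + (p - q)" by simp
  also have "\<dots> = 2 * p'" unfolding pq by simp
  finally have "p = p'" "q = q'" using pq by auto
  then have "1 - 3 * of_int b / x = 1 - 3 * of_int b / x'" using assms(3) by (simp add: p_q_p'_q'_def)
  then have "of_int b / x = (of_int b :: complex) / x'" by simp
  then have "x = x'" using assms(1,2,4) by (simp add: field_simps)
  then show ?thesis using \<open>p = p'\<close> assms(1) by (simp add: p_q_p'_q'_def)
qed

context
  fixes a b :: int and \<kappa> :: complex
  assumes ab: "a * b * (4 * a + 27 * b) \<noteq> 0" and \<kappa>: "\<kappa>^2 = - 3 * of_int a"
begin

lemma psi_zt: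
  assumes "Some (x, y) \<in> points (E a b) F" "x \<noteq> 0" "zt_coords \<kappa> b x y = (z, t)"
  shows "psi a b (Some (x, y)) = Some (z * t, (z^3 + t^3) / 2)"
proof -
  define v w where "v = y / x" and "w = 1 - 3 * of_int b / x"
  have zt: "z = 3 * v + \<kappa> * w" "t = 3 * v - \<kappa> * w"
    using assms(3) by (auto simp: zt_coords_def v_def w_def)
  define A where "A = complex_of_int a"
  have k: "\<kappa> * \<kappa> = - 3 * A" using \<kappa> by (simp add: power2_eq_square A_def)
  have 1: "z * t = 9 * v^2 + 3 * A * w^2"
    unfolding zt using k by Groebner_Basis.algebra
  have "z^3 + t^3 = 2 * (27 * v * (v^2 - A * w^2))"
    unfolding zt using k by Groebner_Basis.algebra
  then show ?thesis using psi_Some[OF assms(1,2)] 1 by (simp add: v_def w_def A_def)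
qed

lemma zt_point:
  assumes zt: "z^3 - t^3 = 6 * \<kappa> * (z * t - of_int (4 * a + 27 * b))"
    and p: "zt_point \<kappa> b z t = (x, y)"
  shows "x \<noteq> 0" "Some (x, y) \<in> points (E a b) UNIV" "zt_coords \<kappa> b x y = (z, t)"
proof -
  define A B where "A = complex_of_int a" and "B = complex_of_int b"
  have n: "A \<noteq> 0" "B \<noteq> 0" using ab by (auto simp: A_def B_def)
  have k: "\<kappa>^2 = - 3 * A" using \<kappa> by (simp add: A_def)
  have k0: "\<kappa> \<noteq> 0" using k n by auto
  have zt': "z^3 - t^3 = 6 * \<kappa> * (z * t - (4 * A + 27 * B))" using zt by (simp add: A_def B_def)
  define \<delta> where "\<delta> = 2 * \<kappa> - z + t"
  \<comment> \<open>The denominator could vanish only for infinite \<open>x\<close>. On the cubic,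
    \<open>z = 2 \<kappa> + t\<close> leads to \<open>8 \<kappa>^2 + 6 d = 0\<close>, and with
    \<open>\<kappa>^2 = - 3 a\<close> to \<open>162 b = 0\<close>.\<close>
  have \<delta>: "\<delta> \<noteq> 0"
  proof
    assume "\<delta> = 0"
    then have "z = 2 * \<kappa> + t" by (simp add: \<delta>_def algebra_simps)
    then have "162 * \<kappa> * B = 0" using zt' k by Groebner_Basis.algebra
    then show False using k0 n by simp
  qed
  have x: "x = 6 * \<kappa> * B / \<delta>" and "y = (z + t) * (\<kappa> * B / \<delta>)"
    using p by (auto simp: zt_point_def \<delta>_def B_def)
  then have y: "y = (z + t) * x / 6" by simp
  show x0: "x \<noteq> 0" using k0 n \<delta> by (simp add: x)
  have v: "y / x = (z + t) / 6" using x0 by (simp add: y)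
  have w: "1 - 3 * B / x = (z - t) / (2 * \<kappa>)"
    using k0 n \<delta> by (simp add: x field_simps) (simp add: \<delta>_def algebra_simps)
  show "zt_coords \<kappa> b x y = (z, t)"
    unfolding zt_coords_def B_def[symmetric] v w using k0 by (simp add: field_simps)
  have xd: "x * \<delta> = 6 * \<kappa> * B" using \<delta> by (simp add: x)
  have t: "t = \<delta> - 2 * \<kappa> + z" by (simp add: \<delta>_def)
  have "\<kappa> * \<delta>^3 * (y^2 - (x^3 + A * (x - B)^2)) = 0"
  proof -
    have y6: "6 * y = (z + t) * x" by (simp add: y)
    have "36 * \<kappa> * \<delta>^3 * (y^2 - (x^3 + A * (x - B)^2)) =
       \<kappa> * \<delta> * (x * \<delta>)^2 * (z + t)^2 - 36 * \<kappa> * (x * \<delta>)^3 - 36 * \<kappa> * A * \<delta> * (x * \<delta> - B * \<delta>)^2"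
      using y6 by Groebner_Basis.algebra
    also have "\<dots> = 0" unfolding xd using zt' k t by Groebner_Basis.algebra
    finally show ?thesis by simp
  qed
  then show "Some (x, y) \<in> points (E a b) UNIV" using k0 \<delta> by (simp add: points_E A_def B_def)
qed

text \<open>On the target curve
  \<open>(y' + 3 \<kappa> (x' - d)) (y' - 3 \<kappa> (x' - d)) = x'^3\<close>. Cube roots
  \<open>z\<close> and \<open>t\<close> of the two factors with \<open>z t = x'\<close> are the
  diagonal coordinates of a preimage.\<close>

lemma psi_surj:
  assumes F: "complex_subfield F" and R: "R \<in> points (Ehat a b) (alg_cl F)"
  shows "\<exists>Q\<in>points (E a b) (alg_cl F). psi a b Q = R"
proof (cases R)
  case None
  then show ?thesis by (intro bexI[of _ None]) auto
next
  case (Some r)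
  obtain x' y' where r: "r = (x', y')" by (cases r)
  note i = alg_cl_intros[OF F]
  have cl: "c \<in> alg_cl F" if "c ^ n \<in> alg_cl F" "n > 0" for c n
    using alg_cl_root[OF F that] .
  define D where "D = complex_of_int (4 * a + 27 * b)"
  have xy: "x' \<in> alg_cl F" "y' \<in> alg_cl F" and e: "y'^2 = x'^3 + 9 * \<kappa>^2 * (x' - D)^2"
    using R unfolding Some r points_Ehat D_def \<kappa> by auto
  have k: "\<kappa> \<in> alg_cl F" by (rule cl[of _ 2]) (auto simp: \<kappa> intro!: i)
  define p q where "p = y' + 3 * \<kappa> * (x' - D)" and "q = y' - 3 * \<kappa> * (x' - D)"
  have pq: "p \<in> alg_cl F" "q \<in> alg_cl F" using xy k by (auto simp: p_def q_def D_def intro!: i)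
  have m: "p * q = x'^3" using e unfolding p_def q_def by Groebner_Basis.algebra
  have "\<exists>z t. z^3 = p \<and> t^3 = q \<and> z * t = x'"
  proof -
    have root: "\<exists>z. z ^ 3 = c" for c :: complex
      using exists_complex_root[of 3 c] by auto
    show ?thesis
    proof (cases "p = 0")
      case True
      then have "x' = 0" using m by simp
      moreover obtain t where "t^3 = q" using root by blast
      ultimately show ?thesis using True by (intro exI[of _ "0::complex"] exI[of _ t]) simp
    next
      case False
      obtain z where z: "z^3 = p" using root by blast
      have z0: "z \<noteq> 0" using z False by auto
      have "z^3 * (x' / z)^3 = x'^3" using z0 by (simp add: power_divide)
      then have "p * (x' / z)^3 = x'^3" unfolding z .
      then have "(x' / z)^3 = q" using m False by (metis mult_left_cancel)
      then show ?thesis using z z0 by (intro exI[of _ z] exI[of _ "x' / z"]) simp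
    qed
  qed
  then obtain z t where zt: "z^3 = p" "t^3 = q" "z * t = x'" by blast
  have ztF: "z \<in> alg_cl F" "t \<in> alg_cl F"
    by (rule cl[of _ 3], auto simp: zt pq)+
  have eq: "z^3 - t^3 = 6 * \<kappa> * (z * t - of_int (4 * a + 27 * b))"
    unfolding zt p_def q_def D_def by (simp add: algebra_simps)
  obtain x y where P: "zt_point \<kappa> b z t = (x, y)" by (cases "zt_point \<kappa> b z t")
  note Q = zt_point[OF eq P]
  have "x \<in> alg_cl F" "y \<in> alg_cl F"
    using P ztF k by (auto simp: zt_point_def intro!: i)
  then have "Some (x, y) \<in> points (E a b) (alg_cl F)" using Q(2) by (auto simp: points_E)
  moreover have "psi a b (Some (x, y)) = R"
    using psi_zt[OF Q(2,1,3)] unfolding zt Some r by (simp add: p_def q_def)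
  ultimately show ?thesis by blast
qed

text \<open>Here \<open>\<omega>\<close> is a primitive cube root of unity, and
  \<open>\<kappa> b = \<theta> \<tau>\<close> fixes which of the two nontrivial kernel points
  multiplies \<open>z\<close> by \<open>\<omega>\<close> rather than by its inverse.\<close>

lemma translate_zt:
  assumes th: "\<theta>^2 = - 3" "\<omega> = (\<theta> - 1) / 2" "\<kappa> * of_int b = \<theta> * \<tau>"
    and P: "Some (x, y) \<in> points (E a b) UNIV" "x \<noteq> 0" "zt_coords \<kappa> b x y = (z, t)"
    and P': "Some (x', y') \<in> points (E a b) UNIV" "x' \<noteq> 0" "zt_coords \<kappa> b x' y' = (\<omega> * z, \<omega>^2 * t)"
  shows "ec_add (E a b) (Some (x, y)) (Some (0, \<tau>)) = Some (x', y')"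
proof -
  define A B where "A = complex_of_int a" and "B = complex_of_int b"
  have n: "A \<noteq> 0" "B \<noteq> 0" using ab by (auto simp: A_def B_def)
  have k: "\<kappa>^2 = - 3 * A" using \<kappa> by (simp add: A_def)
  then have k0: "\<kappa> \<noteq> 0" using n by auto
  define c where "c = \<tau> / B"
  have \<tau>: "\<tau> = c * B" using n by (simp add: c_def)
  have kc: "\<kappa> = \<theta> * c" using th(3) n by (simp add: c_def B_def field_simps)
  have "- 3 * (A - c^2) = 0" using k th(1) unfolding kc by Groebner_Basis.algebra
  then have A: "A = c^2" by simp
  have c0: "c \<noteq> 0" using A n by auto
  have T: "Some (0, \<tau>) \<in> points (E a b) UNIV"
    using A by (simp add: points_E A_def[symmetric] B_def[symmetric] \<tau> power_mult_distrib)
  have "\<not> (x = 0 \<and> y + \<tau> = 0)" using P(2) by simp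
  then obtain l m x3 y3 where l: "on_line (E a b) l m (x, y) (0, \<tau>) (x3, y3)"
    and add: "ec_add (E a b) (Some (x, y)) (Some (0, \<tau>)) = Some (x3, - y3)"
    using ec_add_on_line[OF P(1) T] by blast
  have y: "y = l * x + c * B" "y3 = l * x3 + c * B"
    and s: "x + x3 = l^2 - c^2" "x * x3 = - 2 * c * B * (c + l)"
    using l by (auto simp: on_line_def A_def[symmetric] B_def[symmetric] A \<tau> power2_eq_square algebra_simps)
  have lc: "c + l \<noteq> 0"
  proof
    assume "c + l = 0"
    then have "l^2 = c^2" by (simp add: add_eq_0_iff)
    then have "x3 = - x" using s(1) by (simp add: add_eq_0_iff)
    moreover have "x3 = 0" using s(2) \<open>c + l = 0\<close> P(2) by simp
    ultimately show False using P(2) by simp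
  qed
  have x3: "x3 \<noteq> 0" using s(2) lc c0 n by auto
  define U V where "U = B / x" and "V = B / x3"
  have "2 * c * (c + l) * (x * x3) * (U + V) = 2 * c * (c + l) * B * (x + x3)"
    using P(2) x3 by (simp add: U_def V_def field_simps)
  also have "\<dots> = (c - l) * (c + l) * (- 2 * c * B * (c + l))"
    unfolding s(1) A by (simp add: power2_eq_square algebra_simps)
  finally have "(c + l) * (x * x3) * (2 * c * (U + V) - (c - l)) = 0"
    unfolding s(2)[symmetric] by (simp add: algebra_simps)
  then have UV: "2 * c * (U + V) = c - l" using lc P(2) x3 by simp
  have v: "y / x = l + c * U" "- y3 / x3 = - (l + c * V)"
    using P(2) x3 y by (simp_all add: U_def V_def field_simps)
  have w: "1 - 3 * B / x = 1 - 3 * U" "1 - 3 * B / x3 = 1 - 3 * V"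
    by (simp_all add: U_def V_def)
  have zt: "z = 3 * (l + c * U) + \<theta> * c * (1 - 3 * U)" "t = 3 * (l + c * U) - \<theta> * c * (1 - 3 * U)"
    using P(3) unfolding zt_coords_def B_def[symmetric] v w kc by auto
  have o: "2 * \<omega> = \<theta> - 1" "2 * \<omega>^2 = - \<theta> - 1"
  proof -
    show "2 * \<omega> = \<theta> - 1" by (simp add: th(2))
    then have "2 * (2 * \<omega>^2) = 2 * (- \<theta> - 1)" using th(1) by Groebner_Basis.algebra
    then show "2 * \<omega>^2 = - \<theta> - 1" by (simp only: mult_cancel_left) simp
  qed
  have "2 * (3 * (- (l + c * V)) + \<theta> * c * (1 - 3 * V)) = 2 * (\<omega> * z)"
    unfolding zt using UV o(1) th(1) by Groebner_Basis.algebra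
  moreover have "2 * (3 * (- (l + c * V)) - \<theta> * c * (1 - 3 * V)) = 2 * (\<omega>^2 * t)"
    unfolding zt using UV o(2) th(1) by Groebner_Basis.algebra
  ultimately have "3 * (- (l + c * V)) + \<theta> * c * (1 - 3 * V) = \<omega> * z"
      "3 * (- (l + c * V)) - \<theta> * c * (1 - 3 * V) = \<omega>^2 * t"
    by (simp_all only: mult_cancel_left) simp_all
  then have "zt_coords \<kappa> b x3 (- y3) = (\<omega> * z, \<omega>^2 * t)"
    unfolding zt_coords_def B_def[symmetric] v w kc by simp
  then have "x3 = x' \<and> - y3 = y'"
    using zt_coords_inject[OF x3 P'(2) k0, of b "- y3" y'] n P'(3) by (auto simp: B_def)
  then show ?thesis using add by simp
qed

end

subsection \<open>Cohomology groups\<close>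

lemma continuous_map_discrete_iff:
  "continuous_map S (discrete_topology D) f \<longleftrightarrow>
    (\<forall>x\<in>topspace S. f x \<in> D) \<and> (\<forall>d\<in>D. openin S {x \<in> topspace S. f x = d})"
proof
  assume f: "continuous_map S (discrete_topology D) f"
  have "openin S {x \<in> topspace S. f x = d}" if "d \<in> D" for d
    using openin_continuous_map_preimage[OF f, of "{d}"] that by simp
  then show "(\<forall>x\<in>topspace S. f x \<in> D) \<and> (\<forall>d\<in>D. openin S {x \<in> topspace S. f x = d})"
    using f by (auto simp: continuous_map_def)
next
  assume f: "(\<forall>x\<in>topspace S. f x \<in> D) \<and> (\<forall>d\<in>D. openin S {x \<in> topspace S. f x = d})"
  have "openin S {x \<in> topspace S. f x \<in> U}" if "U \<subseteq> D" for U
  proof -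
    have "{x \<in> topspace S. f x \<in> U} = (\<Union>d\<in>U. {x \<in> topspace S. f x = d})" by auto
    then show ?thesis using f that by (auto intro!: openin_Union)
  qed
  then show "continuous_map S (discrete_topology D) f" using f by (auto simp: continuous_map_def)
qed

lemma the_elem_image_const:
  assumes "x \<in> S" "\<And>y. y \<in> S \<Longrightarrow> g y = c"
  shows "the_elem (g ` S) = c"
proof -
  have "g ` S = {c}" using assms by force
  then show ?thesis by simp
qed

lemma ec_add_swap:
  assumes "nonsingular W" "P \<in> points W UNIV" "Q \<in> points W UNIV" "R \<in> points W UNIV" "S \<in> points W UNIV"
  shows "ec_add W (ec_add W P Q) (ec_add W R S) = ec_add W (ec_add W P R) (ec_add W Q S)"
  using assms ec_add_assoc[OF assms(1)] ec_add_left_commute[OF assms(1)] by simp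

text \<open>Cohomology sees an isogeny only through its kernel and its fibres. These axioms hold for
  \<open>psi\<close> and for multiplication by 3, so the two Selmer groups are treated at once; the
  target curve enters only with the local conditions.\<close>

locale isogeny =
  fixes W :: weierstrass and \<phi> :: "point \<Rightarrow> point"
  assumes W: "nonsingular W"
    and W_over: "complex_subfield F \<Longrightarrow> defined_over F W"
    and \<phi>_None: "\<phi> None = None"
    and \<phi>_eq_iff: "P \<in> points W UNIV \<Longrightarrow> Q \<in> points W UNIV \<Longrightarrow>
      \<phi> P = \<phi> Q \<longleftrightarrow> \<phi> (ec_add W P (ec_neg Q)) = None"
    and act_\<phi>: "complex_subfield F \<Longrightarrow> \<sigma> \<in> gal F \<Longrightarrow> P \<in> points W (alg_cl F) \<Longrightarrow>
      \<phi> (act \<sigma> P) = act \<sigma> (\<phi> P)"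
begin

abbreviation add (infixl "+\<^sub>W" 65) where "P +\<^sub>W Q \<equiv> ec_add W P Q"

lemmas assoc = ec_add_assoc[OF W] and comm = ec_add_comm[where W = W]
  and lcomm = ec_add_left_commute[OF W]

lemma ker_UNIV: "P \<in> ker_pts W \<phi> M \<Longrightarrow> P \<in> points W UNIV"
  using points_UNIV by (auto simp: ker_pts_def)

lemma ker_None: "None \<in> ker_pts W \<phi> M"
  by (simp add: ker_pts_def \<phi>_None)

context
  fixes F :: "complex set"
  assumes F: "complex_subfield F"
begin

lemmas A = complex_subfield_alg_cl[OF F]

lemma ker_neg: "P \<in> ker_pts W \<phi> (alg_cl F) \<Longrightarrow> ec_neg P \<in> ker_pts W \<phi> (alg_cl F)"
  using \<phi>_eq_iff[of None P] points_UNIV[of P W "alg_cl F"] ec_neg_points_over[OF A, of P W]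
  by (auto simp: ker_pts_def \<phi>_None)

lemma ker_add:
  assumes "P \<in> ker_pts W \<phi> (alg_cl F)" "Q \<in> ker_pts W \<phi> (alg_cl F)"
  shows "P +\<^sub>W Q \<in> ker_pts W \<phi> (alg_cl F)"
  using \<phi>_eq_iff[of P "ec_neg Q"] ker_UNIV[OF assms(1)] ker_UNIV[OF assms(2)] assms ker_neg[OF assms(2)]
    ec_add_points_over[OF A W_over[OF A], of P Q]
  by (auto simp: ker_pts_def)

lemma ker_act:
  assumes "\<sigma> \<in> gal F" "P \<in> ker_pts W \<phi> (alg_cl F)"
  shows "act \<sigma> P \<in> ker_pts W \<phi> (alg_cl F)"
  using assms act_\<phi>[OF F assms(1), of P] act_points[OF F assms(1) W_over[OF F], of P]
  by (auto simp: ker_pts_def act_def)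

lemma Z1_iff: "f \<in> carrier (Z1 W \<phi> F) \<longleftrightarrow> f \<in> extensional (gal F) \<and>
    (\<forall>\<sigma>\<in>gal F. f \<sigma> \<in> ker_pts W \<phi> (alg_cl F)) \<and> (\<forall>d. openin (krull_topology F) {\<sigma> \<in> gal F. f \<sigma> = d}) \<and>
    (\<forall>\<sigma>\<in>gal F. \<forall>\<tau>\<in>gal F. f (compose (alg_cl F) \<sigma> \<tau>) = f \<sigma> +\<^sub>W act \<sigma> (f \<tau>))"
proof -
  have "(\<forall>d\<in>ker_pts W \<phi> (alg_cl F). openin (krull_topology F) {\<sigma> \<in> gal F. f \<sigma> = d}) \<longleftrightarrow>
      (\<forall>d. openin (krull_topology F) {\<sigma> \<in> gal F. f \<sigma> = d})"
    if k: "\<forall>\<sigma>\<in>gal F. f \<sigma> \<in> ker_pts W \<phi> (alg_cl F)"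
  proof -
    have "{\<sigma> \<in> gal F. f \<sigma> = d} = {}" if "d \<notin> ker_pts W \<phi> (alg_cl F)" for d
      using k that by auto
    then show ?thesis by (metis openin_empty)
  qed
  then show ?thesis
    unfolding Z1_def by (auto simp: continuous_map_discrete_iff topspace_krull[OF F])
qed

lemma Z1D:
  assumes "f \<in> carrier (Z1 W \<phi> F)"
  shows "f \<in> extensional (gal F)" "\<sigma> \<in> gal F \<Longrightarrow> f \<sigma> \<in> ker_pts W \<phi> (alg_cl F)"
    "openin (krull_topology F) {\<sigma> \<in> gal F. f \<sigma> = d}"
    "\<sigma> \<in> gal F \<Longrightarrow> \<tau> \<in> gal F \<Longrightarrow> f (compose (alg_cl F) \<sigma> \<tau>) = f \<sigma> +\<^sub>W act \<sigma> (f \<tau>)"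
  using assms by (auto simp: Z1_iff)

lemma Z1_UNIV: "f \<in> carrier (Z1 W \<phi> F) \<Longrightarrow> \<sigma> \<in> gal F \<Longrightarrow> f \<sigma> \<in> points W UNIV"
  using Z1D(2) ker_UNIV by blast

lemma Z1_simps [simp]: "f \<otimes>\<^bsub>Z1 W \<phi> F\<^esub> g = (\<lambda>\<sigma>\<in>gal F. f \<sigma> +\<^sub>W g \<sigma>)"
  "\<one>\<^bsub>Z1 W \<phi> F\<^esub> = (\<lambda>\<sigma>\<in>gal F. None)"
  by (simp_all add: Z1_def)

lemma act_UNIV:
  assumes "\<sigma> \<in> gal F" "P \<in> points W (alg_cl F)"
  shows "act \<sigma> P \<in> points W UNIV"
  using act_points[OF F assms(1) W_over[OF F] assms(2)] points_UNIV by blast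

lemma Z1_mult:
  assumes f: "f \<in> carrier (Z1 W \<phi> F)" and g: "g \<in> carrier (Z1 W \<phi> F)"
  shows "f \<otimes>\<^bsub>Z1 W \<phi> F\<^esub> g \<in> carrier (Z1 W \<phi> F)"
  unfolding Z1_iff Z1_simps
proof (intro conjI ballI allI)
  fix d
  have "{\<sigma> \<in> gal F. (\<lambda>\<sigma>\<in>gal F. f \<sigma> +\<^sub>W g \<sigma>) \<sigma> = d} =
      (\<Union>p\<in>{p. fst p +\<^sub>W snd p = d}. {\<sigma> \<in> gal F. f \<sigma> = fst p} \<inter> {\<sigma> \<in> gal F. g \<sigma> = snd p})"
    by auto
  moreover have "openin (krull_topology F) \<dots>"
    by (intro openin_Union) (auto intro!: openin_Int Z1D(3)[OF f] Z1D(3)[OF g])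
  ultimately show "openin (krull_topology F) {\<sigma> \<in> gal F. (\<lambda>\<sigma>\<in>gal F. f \<sigma> +\<^sub>W g \<sigma>) \<sigma> = d}" by simp
next
  fix \<sigma> \<tau> assume st: "\<sigma> \<in> gal F" "\<tau> \<in> gal F"
  have p: "f \<tau> \<in> points W (alg_cl F)" "g \<tau> \<in> points W (alg_cl F)"
    using Z1D(2)[OF f st(2)] Z1D(2)[OF g st(2)] by (auto simp: ker_pts_def)
  show "(\<lambda>\<sigma>\<in>gal F. f \<sigma> +\<^sub>W g \<sigma>) (compose (alg_cl F) \<sigma> \<tau>) =
      (\<lambda>\<sigma>\<in>gal F. f \<sigma> +\<^sub>W g \<sigma>) \<sigma> +\<^sub>W act \<sigma> ((\<lambda>\<sigma>\<in>gal F. f \<sigma> +\<^sub>W g \<sigma>) \<tau>)"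
    using st p gal_compose[OF F st] act_UNIV[OF st(1)] Z1_UNIV[OF f] Z1_UNIV[OF g]
    by (simp add: Z1D(4)[OF f st] Z1D(4)[OF g st] act_add[OF F st(1) W_over[OF F]] ec_add_swap[OF W])
qed (auto intro!: ker_add Z1D(2)[OF f] Z1D(2)[OF g])

lemma Z1_one: "\<one>\<^bsub>Z1 W \<phi> F\<^esub> \<in> carrier (Z1 W \<phi> F)"
proof -
  have "{\<sigma> \<in> gal F. (\<lambda>\<sigma>\<in>gal F. None) \<sigma> = d} = (if d = None then topspace (krull_topology F) else {})"
    for d :: point by (auto simp: topspace_krull[OF F])
  then have "openin (krull_topology F) {\<sigma> \<in> gal F. (\<lambda>\<sigma>\<in>gal F. None) \<sigma> = d}" for d :: point
    by simp
  then show ?thesis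
    unfolding Z1_iff Z1_simps using ker_None gal_compose[OF F] by (auto simp: act_def)
qed

lemma Z1_neg:
  assumes f: "f \<in> carrier (Z1 W \<phi> F)"
  shows "(\<lambda>\<sigma>\<in>gal F. ec_neg (f \<sigma>)) \<in> carrier (Z1 W \<phi> F)"
  unfolding Z1_iff
proof (intro conjI ballI allI)
  fix d
  have "{\<sigma> \<in> gal F. (\<lambda>\<sigma>\<in>gal F. ec_neg (f \<sigma>)) \<sigma> = d} = {\<sigma> \<in> gal F. f \<sigma> = ec_neg d}" by auto
  then show "openin (krull_topology F) {\<sigma> \<in> gal F. (\<lambda>\<sigma>\<in>gal F. ec_neg (f \<sigma>)) \<sigma> = d}"
    using Z1D(3)[OF f] by simp
next
  fix \<sigma> \<tau> assume st: "\<sigma> \<in> gal F" "\<tau> \<in> gal F"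
  have p: "f \<tau> \<in> points W (alg_cl F)"
    using Z1D(2)[OF f st(2)] by (auto simp: ker_pts_def)
  show "(\<lambda>\<sigma>\<in>gal F. ec_neg (f \<sigma>)) (compose (alg_cl F) \<sigma> \<tau>) =
      (\<lambda>\<sigma>\<in>gal F. ec_neg (f \<sigma>)) \<sigma> +\<^sub>W act \<sigma> ((\<lambda>\<sigma>\<in>gal F. ec_neg (f \<sigma>)) \<tau>)"
    using st gal_compose[OF F st]
    by (simp add: Z1D(4)[OF f st] act_neg[OF F st(1) p] ec_add_neg_neg)
qed (auto intro!: ker_neg Z1D(2)[OF f])

lemma comm_group_Z1: "comm_group (Z1 W \<phi> F)"
proof (rule comm_groupI)
  fix f g h assume "f \<in> carrier (Z1 W \<phi> F)" "g \<in> carrier (Z1 W \<phi> F)" "h \<in> carrier (Z1 W \<phi> F)"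
  then show "f \<otimes>\<^bsub>Z1 W \<phi> F\<^esub> g \<otimes>\<^bsub>Z1 W \<phi> F\<^esub> h = f \<otimes>\<^bsub>Z1 W \<phi> F\<^esub> (g \<otimes>\<^bsub>Z1 W \<phi> F\<^esub> h)"
    by (auto simp: Z1_UNIV assoc fun_eq_iff)
next
  fix f g assume "f \<in> carrier (Z1 W \<phi> F)" "g \<in> carrier (Z1 W \<phi> F)"
  then show "f \<otimes>\<^bsub>Z1 W \<phi> F\<^esub> g = g \<otimes>\<^bsub>Z1 W \<phi> F\<^esub> f"
    by (auto simp: fun_eq_iff restrict_def Z1_UNIV intro!: comm)
next
  fix f assume f: "f \<in> carrier (Z1 W \<phi> F)"
  show "\<one>\<^bsub>Z1 W \<phi> F\<^esub> \<otimes>\<^bsub>Z1 W \<phi> F\<^esub> f = f"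
    using Z1D(1)[OF f] by (auto simp: fun_eq_iff extensional_def)
  show "\<exists>g\<in>carrier (Z1 W \<phi> F). g \<otimes>\<^bsub>Z1 W \<phi> F\<^esub> f = \<one>\<^bsub>Z1 W \<phi> F\<^esub>"
    by (rule bexI[OF _ Z1_neg[OF f]]) (auto simp: fun_eq_iff)
qed (use Z1_mult Z1_one in auto)

text \<open>The point \<open>Q\<close> need not lie in the kernel, as is typical for the Kummer map.
  Continuity holds because \<open>\<sigma> Q\<close> depends only on the values of
  \<open>\<sigma>\<close> at two coordinates.\<close>

lemma coboundary_Z1:
  assumes Q: "Q \<in> points W (alg_cl F)"
    and k: "\<And>\<sigma>. \<sigma> \<in> gal F \<Longrightarrow> \<phi> (act \<sigma> Q +\<^sub>W ec_neg Q) = None"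
  shows "coboundary W F Q \<in> carrier (Z1 W \<phi> F)"
  unfolding Z1_iff
proof (intro conjI ballI allI)
  fix d
  show "openin (krull_topology F) {\<sigma> \<in> gal F. coboundary W F Q \<sigma> = d}"
  proof (cases Q)
    case None
    then have "{\<sigma> \<in> gal F. coboundary W F Q \<sigma> = d} = (if d = None then topspace (krull_topology F) else {})"
      by (auto simp: coboundary_def act_def topspace_krull[OF F])
    then show ?thesis by simp
  next
    case (Some q)
    obtain x y where q: "q = (x, y)" by (cases q)
    have xy: "x \<in> alg_cl F" "y \<in> alg_cl F" using Q by (auto simp: Some q Some_points)
    have "{\<sigma> \<in> gal F. coboundary W F Q \<sigma> = d} =
        (\<Union>p\<in>{p. Some p +\<^sub>W ec_neg Q = d}. {\<sigma> \<in> gal F. \<sigma> x \<in> {fst p}} \<inter> {\<sigma> \<in> gal F. \<sigma> y \<in> {snd p}})"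
      by (auto simp: coboundary_def act_def Some q simp del: ec_add.simps ec_neg.simps)
    moreover have "openin (krull_topology F) \<dots>"
      by (intro openin_Union) (auto intro!: openin_Int openin_krull_value[OF F, of _ "{_}", simplified] xy)
    ultimately show ?thesis by simp
  qed
next
  fix \<sigma> \<tau> assume st: "\<sigma> \<in> gal F" "\<tau> \<in> gal F"
  have p: "act \<tau> Q \<in> points W (alg_cl F)" by (rule act_points[OF F st(2) W_over[OF F] Q])
  have pp: "act \<sigma> (act \<tau> Q) \<in> points W UNIV" "act \<sigma> Q \<in> points W UNIV" "Q \<in> points W UNIV"
    by (rule act_UNIV[OF st(1) p], rule act_UNIV[OF st(1) Q], rule points_UNIV[OF Q])
  have "act \<sigma> (act \<tau> Q +\<^sub>W ec_neg Q) = act \<sigma> (act \<tau> Q) +\<^sub>W ec_neg (act \<sigma> Q)"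
    by (simp add: act_add[OF F st(1) W_over[OF F] p] ec_neg_points_over[OF A Q] act_neg[OF F st(1) Q])
  moreover have "(act \<sigma> Q +\<^sub>W ec_neg Q) +\<^sub>W (act \<sigma> (act \<tau> Q) +\<^sub>W ec_neg (act \<sigma> Q)) =
      act \<sigma> (act \<tau> Q) +\<^sub>W ec_neg Q"
  proof -
    have "act \<sigma> Q +\<^sub>W (ec_neg (act \<sigma> Q) +\<^sub>W act \<sigma> (act \<tau> Q)) = act \<sigma> (act \<tau> Q)"
      using assoc[of "act \<sigma> Q" "ec_neg (act \<sigma> Q)" "act \<sigma> (act \<tau> Q)"] pp by simp
    then show ?thesis using pp by (simp add: assoc comm lcomm)
  qed
  ultimately show "coboundary W F Q (compose (alg_cl F) \<sigma> \<tau>) =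
      coboundary W F Q \<sigma> +\<^sub>W act \<sigma> (coboundary W F Q \<tau>)"
    using st gal_compose[OF F st] by (simp add: coboundary_def act_compose[OF F Q])
next
  fix \<sigma> assume \<sigma>: "\<sigma> \<in> gal F"
  show "coboundary W F Q \<sigma> \<in> ker_pts W \<phi> (alg_cl F)"
    using \<sigma> k[OF \<sigma>] act_points[OF F \<sigma> W_over[OF F] Q] ec_neg_points_over[OF A Q]
      ec_add_points_over[OF A W_over[OF A]]
    by (auto simp: coboundary_def ker_pts_def)
qed (simp add: coboundary_def)

lemma coboundary_add:
  assumes Q: "Q \<in> points W (alg_cl F)" and R: "R \<in> points W (alg_cl F)"
  shows "coboundary W F (Q +\<^sub>W R) = coboundary W F Q \<otimes>\<^bsub>Z1 W \<phi> F\<^esub> coboundary W F R"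
proof -
  have "act \<sigma> (Q +\<^sub>W R) +\<^sub>W ec_neg (Q +\<^sub>W R) = (act \<sigma> Q +\<^sub>W ec_neg Q) +\<^sub>W (act \<sigma> R +\<^sub>W ec_neg R)"
    if \<sigma>: "\<sigma> \<in> gal F" for \<sigma>
    using act_UNIV[OF \<sigma> Q] act_UNIV[OF \<sigma> R] points_UNIV[OF Q] points_UNIV[OF R]
    by (simp add: act_add[OF F \<sigma> W_over[OF F] Q R] ec_add_neg_neg[symmetric] ec_add_swap[OF W])
  then show ?thesis by (auto simp: coboundary_def fun_eq_iff)
qed

lemma ker_act_diff:
  assumes "T \<in> ker_pts W \<phi> (alg_cl F)" "\<sigma> \<in> gal F"
  shows "\<phi> (act \<sigma> T +\<^sub>W ec_neg T) = None"
  using ker_add[OF ker_act[OF assms(2,1)] ker_neg[OF assms(1)]] by (simp add: ker_pts_def)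

lemma B1_Z1: "B1 W \<phi> F \<subseteq> carrier (Z1 W \<phi> F)"
  unfolding B1_def using ker_act_diff by (auto intro!: coboundary_Z1 simp: ker_pts_def)

lemma coboundary_None: "coboundary W F None = \<one>\<^bsub>Z1 W \<phi> F\<^esub>"
  by (auto simp: coboundary_def act_def fun_eq_iff)

lemma subgroup_B1: "subgroup (B1 W \<phi> F) (Z1 W \<phi> F)"
proof -
  interpret Z: comm_group "Z1 W \<phi> F" by (rule comm_group_Z1)
  show ?thesis
  proof (rule Z.subgroupI[OF B1_Z1])
    show "B1 W \<phi> F \<noteq> {}" using ker_None by (auto simp: B1_def)
    fix f assume "f \<in> B1 W \<phi> F"
    then obtain T where T: "T \<in> ker_pts W \<phi> (alg_cl F)" "f = coboundary W F T" by (auto simp: B1_def)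
    have T': "T \<in> points W (alg_cl F)" "ec_neg T \<in> points W (alg_cl F)"
      using T ker_neg by (auto simp: ker_pts_def)
    have "coboundary W F (ec_neg T) \<otimes>\<^bsub>Z1 W \<phi> F\<^esub> f = \<one>\<^bsub>Z1 W \<phi> F\<^esub>"
      using coboundary_add[OF T'(2,1)] coboundary_None by (simp only: T ec_add_neg')
    moreover have i: "coboundary W F (ec_neg T) \<in> B1 W \<phi> F" using ker_neg[OF T(1)] by (auto simp: B1_def)
    ultimately have "inv\<^bsub>Z1 W \<phi> F\<^esub> f = coboundary W F (ec_neg T)"
      using Z.inv_equality[OF _ subsetD[OF B1_Z1 \<open>f \<in> B1 W \<phi> F\<close>] subsetD[OF B1_Z1 i]] by blast
    then show "inv\<^bsub>Z1 W \<phi> F\<^esub> f \<in> B1 W \<phi> F" using i by simp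
  next
    fix f g assume "f \<in> B1 W \<phi> F" "g \<in> B1 W \<phi> F"
    then obtain S T where T: "S \<in> ker_pts W \<phi> (alg_cl F)" "f = coboundary W F S"
      "T \<in> ker_pts W \<phi> (alg_cl F)" "g = coboundary W F T" by (auto simp: B1_def)
    have "f \<otimes>\<^bsub>Z1 W \<phi> F\<^esub> g = coboundary W F (S +\<^sub>W T)"
      unfolding T(2,4) using T by (intro coboundary_add[symmetric]) (auto simp: ker_pts_def)
    then show "f \<otimes>\<^bsub>Z1 W \<phi> F\<^esub> g \<in> B1 W \<phi> F" using ker_add T by (auto simp: B1_def)
  qed
qed

lemma comm_group_H1: "comm_group (H1 W \<phi> F)"
  unfolding H1_def by (rule comm_group.abelian_FactGroup[OF comm_group_Z1 subgroup_B1])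

lemma carrier_H1: "carrier (H1 W \<phi> F) = H1_class W \<phi> F ` carrier (Z1 W \<phi> F)"
  by (auto simp: H1_def FactGroup_def RCOSETS_def H1_class_def)

lemma H1_class_mult:
  assumes "f \<in> carrier (Z1 W \<phi> F)" "g \<in> carrier (Z1 W \<phi> F)"
  shows "H1_class W \<phi> F f \<otimes>\<^bsub>H1 W \<phi> F\<^esub> H1_class W \<phi> F g = H1_class W \<phi> F (f \<otimes>\<^bsub>Z1 W \<phi> F\<^esub> g)"
proof -
  interpret Z: comm_group "Z1 W \<phi> F" by (rule comm_group_Z1)
  interpret N: normal "B1 W \<phi> F" "Z1 W \<phi> F" by (rule Z.subgroup_imp_normal[OF subgroup_B1])
  show ?thesis using N.rcos_sum[OF assms] by (simp add: H1_def FactGroup_def H1_class_def)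
qed

lemma H1_class_eq_iff:
  assumes f: "f \<in> carrier (Z1 W \<phi> F)" and g: "g \<in> carrier (Z1 W \<phi> F)"
  shows "H1_class W \<phi> F f = H1_class W \<phi> F g \<longleftrightarrow>
    (\<exists>T\<in>ker_pts W \<phi> (alg_cl F). f = coboundary W F T \<otimes>\<^bsub>Z1 W \<phi> F\<^esub> g)"
proof -
  interpret Z: comm_group "Z1 W \<phi> F" by (rule comm_group_Z1)
  have "H1_class W \<phi> F f = H1_class W \<phi> F g \<longleftrightarrow> f \<in> H1_class W \<phi> F g"
    unfolding H1_class_def using Z.repr_independence[OF _ g subgroup_B1, of f] Z.rcos_self[OF f subgroup_B1]
    by auto
  also have "\<dots> \<longleftrightarrow> (\<exists>T\<in>ker_pts W \<phi> (alg_cl F). f = coboundary W F T \<otimes>\<^bsub>Z1 W \<phi> F\<^esub> g)"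
    unfolding H1_class_def r_coset_def B1_def by blast
  finally show ?thesis .
qed

lemma mem_H1_class:
  "h \<in> H1_class W \<phi> F f \<longleftrightarrow> (\<exists>T\<in>ker_pts W \<phi> (alg_cl F). h = coboundary W F T \<otimes>\<^bsub>Z1 W \<phi> F\<^esub> f)"
  unfolding H1_class_def r_coset_def B1_def by blast

lemma coboundary_preimage:
  assumes Q: "Q \<in> points W (alg_cl F)" and k: "\<And>\<sigma>. \<sigma> \<in> gal F \<Longrightarrow> act \<sigma> (\<phi> Q) = \<phi> Q"
  shows "coboundary W F Q \<in> carrier (Z1 W \<phi> F)"
proof (rule coboundary_Z1[OF Q])
  fix \<sigma> assume \<sigma>: "\<sigma> \<in> gal F"
  have "\<phi> (act \<sigma> Q) = \<phi> Q" using act_\<phi>[OF F \<sigma> Q] k[OF \<sigma>] by simp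
  then show "\<phi> (act \<sigma> Q +\<^sub>W ec_neg Q) = None"
    using \<phi>_eq_iff[OF act_UNIV[OF \<sigma> Q] points_UNIV[OF Q]] by simp
qed

text \<open>Two preimages of one point differ by a kernel point, whose coboundary is trivial in
  \<open>H1\<close>; so the set to which \<open>the_elem\<close> is applied is a singleton.\<close>

lemma kummer_eq:
  assumes Q: "Q \<in> points W (alg_cl F)" and k: "\<And>\<sigma>. \<sigma> \<in> gal F \<Longrightarrow> act \<sigma> (\<phi> Q) = \<phi> Q"
  shows "kummer W \<phi> F (\<phi> Q) = H1_class W \<phi> F (coboundary W F Q)"
proof -
  have "H1_class W \<phi> F (coboundary W F R) = H1_class W \<phi> F (coboundary W F Q)"
    if R: "R \<in> points W (alg_cl F)" "\<phi> R = \<phi> Q" for R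
  proof -
    define T where "T = R +\<^sub>W ec_neg Q"
    have T: "T \<in> ker_pts W \<phi> (alg_cl F)"
      using \<phi>_eq_iff[OF points_UNIV[OF R(1)] points_UNIV[OF Q]] R(2)
        ec_add_points_over[OF A W_over[OF A] R(1) ec_neg_points_over[OF A Q]]
      by (simp add: T_def ker_pts_def)
    have "T +\<^sub>W Q = R"
      using ec_add_cancel[OF W points_UNIV[OF R(1)] ec_neg_points[OF points_UNIV[OF Q]]]
      by (simp add: T_def)
    then have "coboundary W F R = coboundary W F T \<otimes>\<^bsub>Z1 W \<phi> F\<^esub> coboundary W F Q"
      using coboundary_add[OF _ Q, of T] T by (simp add: ker_pts_def)
    moreover have "coboundary W F R \<in> carrier (Z1 W \<phi> F)" "coboundary W F Q \<in> carrier (Z1 W \<phi> F)"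
      using coboundary_preimage R Q k by auto
    ultimately show ?thesis using T H1_class_eq_iff by blast
  qed
  moreover have "Q \<in> {R \<in> points W (alg_cl F). \<phi> R = \<phi> Q}" using Q by simp
  ultimately show ?thesis unfolding kummer_def by (intro the_elem_image_const) blast+
qed

end

section \<open>Restriction to a larger field and the local conditions\<close>

context
  fixes F L :: "complex set"
  assumes F: "complex_subfield F" and L: "complex_subfield L" "F \<subseteq> L"
begin

lemma continuous_restrict:
  "continuous_map (krull_topology L) (krull_topology F) (\<lambda>\<sigma>. restrict \<sigma> (alg_cl F))"
proof -
  note sub = subsetD[OF alg_cl_mono[OF L(2)]]
  have "continuous_map (krull_topology L) (discrete_topology (alg_cl F)) (\<lambda>\<sigma>. restrict \<sigma> (alg_cl F) x)"
    if x: "x \<in> alg_cl F" for x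
  proof -
    have "restrict \<sigma> (alg_cl F) x \<in> alg_cl F" if "\<sigma> \<in> gal L" for \<sigma>
      using galD(6)[OF gal_restrict[OF F L that] x] .
    moreover have "openin (krull_topology L) {\<sigma> \<in> gal L. \<sigma> x = d}" for d
      using openin_krull_value[OF L(1) sub[OF x], of "{d}"] by simp
    ultimately show ?thesis using x
      by (simp add: continuous_map_discrete_iff topspace_krull[OF L(1)])
  qed
  then have "continuous_map (krull_topology L)
      (product_topology (\<lambda>_. discrete_topology (alg_cl F)) (alg_cl F)) (\<lambda>\<sigma>. restrict \<sigma> (alg_cl F))"
    by (subst continuous_map_componentwise) auto
  then show ?thesis
    unfolding krull_topology_def[of F]
    by (rule continuous_map_into_subtopology) (auto simp: topspace_krull[OF L(1)] gal_restrict[OF F L])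
qed

lemma act_restrict: "P \<in> points W (alg_cl F) \<Longrightarrow> act (restrict \<sigma> (alg_cl F)) P = act \<sigma> P"
  by (cases P) (auto simp: act_def Some_points)

lemma ker_mono: "ker_pts W \<phi> (alg_cl F) \<subseteq> ker_pts W \<phi> (alg_cl L)"
  using points_mono[OF alg_cl_mono[OF L(2)]] by (auto simp: ker_pts_def)

lemma res_Z1:
  assumes f: "f \<in> carrier (Z1 W \<phi> F)"
  shows "res_cocycle F L f \<in> carrier (Z1 W \<phi> L)"
proof -
  have c: "restrict (compose (alg_cl L) \<sigma> \<tau>) (alg_cl F) =
      compose (alg_cl F) (restrict \<sigma> (alg_cl F)) (restrict \<tau> (alg_cl F))"
    if "\<tau> \<in> gal L" for \<sigma> \<tau>
    using subsetD[OF alg_cl_mono[OF L(2)]] galD(6)[OF gal_restrict[OF F L that]]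
    by (auto simp: fun_eq_iff compose_def)
  show ?thesis
    unfolding Z1_iff[OF L(1)]
  proof (intro conjI ballI allI)
    fix d
    have "openin (krull_topology L) {\<sigma> \<in> topspace (krull_topology L).
        restrict \<sigma> (alg_cl F) \<in> {\<sigma> \<in> gal F. f \<sigma> = d}}"
      by (rule openin_continuous_map_preimage[OF continuous_restrict Z1D(3)[OF F f]])
    also have "{\<sigma> \<in> topspace (krull_topology L). restrict \<sigma> (alg_cl F) \<in> {\<sigma> \<in> gal F. f \<sigma> = d}} =
        {\<sigma> \<in> gal L. res_cocycle F L f \<sigma> = d}"
      using gal_restrict[OF F L] by (auto simp: topspace_krull[OF L(1)] res_cocycle_def)
    finally show "openin (krull_topology L) {\<sigma> \<in> gal L. res_cocycle F L f \<sigma> = d}" .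
  next
    fix \<sigma> assume "\<sigma> \<in> gal L"
    then show "res_cocycle F L f \<sigma> \<in> ker_pts W \<phi> (alg_cl L)"
      using Z1D(2)[OF F f gal_restrict[OF F L]] ker_mono by (auto simp: res_cocycle_def)
  next
    fix \<sigma> \<tau> assume st: "\<sigma> \<in> gal L" "\<tau> \<in> gal L"
    have "f (restrict \<tau> (alg_cl F)) \<in> points W (alg_cl F)"
      using Z1D(2)[OF F f gal_restrict[OF F L st(2)]] by (simp add: ker_pts_def)
    then show "res_cocycle F L f (compose (alg_cl L) \<sigma> \<tau>) =
        res_cocycle F L f \<sigma> +\<^sub>W act \<sigma> (res_cocycle F L f \<tau>)"
      using st gal_compose[OF L(1) st]
        Z1D(4)[OF F f gal_restrict[OF F L st(1)] gal_restrict[OF F L st(2)]]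
      by (simp add: res_cocycle_def c act_restrict)
  qed (simp add: res_cocycle_def)
qed

lemma res_mult:
  "res_cocycle F L (f \<otimes>\<^bsub>Z1 W \<phi> F\<^esub> g) = res_cocycle F L f \<otimes>\<^bsub>Z1 W \<phi> L\<^esub> res_cocycle F L g"
  using gal_restrict[OF F L] by (auto simp: res_cocycle_def fun_eq_iff Z1_def)

lemma res_coboundary:
  "T \<in> points W (alg_cl F) \<Longrightarrow> res_cocycle F L (coboundary W F T) = coboundary W L T"
  using gal_restrict[OF F L] act_restrict by (auto simp: res_cocycle_def coboundary_def fun_eq_iff)

text \<open>Representatives of one class differ by the coboundary of a kernel point, and restriction
  turns it into the coboundary of the same point over \<open>L\<close>.\<close>

lemma H1_res_class:
  assumes f: "f \<in> carrier (Z1 W \<phi> F)"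
  shows "H1_res W \<phi> F L (H1_class W \<phi> F f) = H1_class W \<phi> L (res_cocycle F L f)"
proof -
  interpret ZF: comm_group "Z1 W \<phi> F" by (rule comm_group_Z1[OF F])
  have "H1_class W \<phi> L (res_cocycle F L h) = H1_class W \<phi> L (res_cocycle F L f)"
    if h: "h \<in> H1_class W \<phi> F f" for h
  proof -
    obtain T where T: "T \<in> ker_pts W \<phi> (alg_cl F)" "h = coboundary W F T \<otimes>\<^bsub>Z1 W \<phi> F\<^esub> f"
      using h mem_H1_class[OF F] by auto
    have "coboundary W F T \<in> carrier (Z1 W \<phi> F)" using B1_Z1[OF F] T(1) by (auto simp: B1_def)
    then have hZ: "h \<in> carrier (Z1 W \<phi> F)" using f T(2) Z1_mult[OF F] by simp
    have "res_cocycle F L h = coboundary W L T \<otimes>\<^bsub>Z1 W \<phi> L\<^esub> res_cocycle F L f"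
      using T res_coboundary[of T] by (simp only: T(2) res_mult) (simp add: ker_pts_def)
    moreover have "T \<in> ker_pts W \<phi> (alg_cl L)" using T(1) ker_mono by blast
    ultimately show ?thesis
      unfolding H1_class_eq_iff[OF L(1) res_Z1[OF hZ] res_Z1[OF f]] by (rule bexI)
  qed
  moreover have "f \<in> H1_class W \<phi> F f"
    unfolding H1_class_def by (rule ZF.rcos_self[OF f subgroup_B1[OF F]])
  ultimately show ?thesis unfolding H1_res_def by (intro the_elem_image_const)
qed

end

text \<open>The local condition on classes is reduced to an equality of cocycles for one explicit
  point \<open>Q\<close>.\<close>

lemma selmerI:
  assumes F: "complex_subfield F" and f: "f \<in> carrier (Z1 W \<phi> F)"
    and loc: "\<And>v L w. finite_prime F v \<Longrightarrow> completion_of F v L w \<Longrightarrow>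
      \<exists>Q\<in>points W (alg_cl L). \<phi> Q \<in> points W' L \<and> res_cocycle F L f = coboundary W L Q"
  shows "H1_class W \<phi> F f \<in> selmer W W' \<phi> F"
  unfolding selmer_def
proof (intro CollectI conjI allI impI)
  show "H1_class W \<phi> F f \<in> carrier (H1 W \<phi> F)" using f by (simp add: carrier_H1[OF F])
  fix v L w assume vL: "finite_prime F v" "completion_of F v L w"
  then have L: "complex_subfield L" "F \<subseteq> L" by (auto simp: completion_of_def)
  obtain Q where Q: "Q \<in> points W (alg_cl L)" "\<phi> Q \<in> points W' L"
    "res_cocycle F L f = coboundary W L Q" using loc[OF vL] by blast
  have "kummer W \<phi> L (\<phi> Q) = H1_class W \<phi> L (coboundary W L Q)"
    by (rule kummer_eq[OF L(1) Q(1)]) (rule act_fixed[OF L(1) Q(2)])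
  then have "H1_res W \<phi> F L (H1_class W \<phi> F f) = kummer W \<phi> L (\<phi> Q)"
    by (simp add: H1_res_class[OF F L f] Q(3))
  then show "H1_res W \<phi> F L (H1_class W \<phi> F f) \<in> kummer W \<phi> L ` points W' L" using Q(2) by blast
qed

text \<open>The converse of \<open>selmerI\<close>: the cocycles differ by the coboundary of a
  kernel point \<open>T\<close>, and replacing \<open>Q\<close> by \<open>T + Q\<close> absorbs it
  without changing the image.\<close>

lemma selmerD:
  assumes F: "complex_subfield F" and f: "f \<in> carrier (Z1 W \<phi> F)"
    and sel: "H1_class W \<phi> F f \<in> selmer W W' \<phi> F"
    and vL: "finite_prime F v" "completion_of F v L w"
    and surj: "\<And>R. R \<in> points W' L \<Longrightarrow> \<exists>Q\<in>points W (alg_cl L). \<phi> Q = R"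
  shows "\<exists>Q\<in>points W (alg_cl L). \<phi> Q \<in> points W' L \<and> res_cocycle F L f = coboundary W L Q"
proof -
  have L: "complex_subfield L" "F \<subseteq> L" using vL by (auto simp: completion_of_def)
  obtain R where R: "R \<in> points W' L" "H1_res W \<phi> F L (H1_class W \<phi> F f) = kummer W \<phi> L R"
  proof -
    have "H1_res W \<phi> F L (H1_class W \<phi> F f) \<in> kummer W \<phi> L ` points W' L"
      using sel vL unfolding selmer_def by blast
    then show ?thesis using that by blast
  qed
  obtain Q where Q: "Q \<in> points W (alg_cl L)" "\<phi> Q = R" using surj[OF R(1)] by blast
  have fixed: "act \<sigma> (\<phi> Q) = \<phi> Q" if "\<sigma> \<in> gal L" for \<sigma>
    using act_fixed[OF L(1) R(1) that] Q(2) by simp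
  have "H1_class W \<phi> L (res_cocycle F L f) = H1_class W \<phi> L (coboundary W L Q)"
    using R(2) H1_res_class[OF F L f] kummer_eq[OF L(1) Q(1) fixed] Q(2) by simp
  then obtain T where T: "T \<in> ker_pts W \<phi> (alg_cl L)"
    "res_cocycle F L f = coboundary W L T \<otimes>\<^bsub>Z1 W \<phi> L\<^esub> coboundary W L Q"
    using H1_class_eq_iff[OF L(1) res_Z1[OF F L f] coboundary_preimage[OF L(1) Q(1) fixed]] by blast
  have T': "T \<in> points W (alg_cl L)" using T(1) by (simp add: ker_pts_def)
  note A = complex_subfield_alg_cl[OF L(1)]
  have TQ: "T +\<^sub>W Q \<in> points W (alg_cl L)" by (rule ec_add_points_over[OF A W_over[OF A] T' Q(1)])
  have "(T +\<^sub>W Q) +\<^sub>W ec_neg Q = T" by (rule ec_add_cancel[OF W points_UNIV[OF T'] points_UNIV[OF Q(1)]])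
  then have "\<phi> (T +\<^sub>W Q) = \<phi> Q"
    using \<phi>_eq_iff[OF points_UNIV[OF TQ] points_UNIV[OF Q(1)]] T(1) by (simp add: ker_pts_def)
  then show ?thesis
    using TQ Q(2) R(1) T(2) coboundary_add[OF L(1) T' Q(1)] by metis
qed

end

subsection \<open>Comparison of dimensions\<close>

lemma hom_finprod_comm_group:
  assumes G: "comm_group G" and H: "comm_group H" and j: "j \<in> hom G H"
    and f: "\<And>i. i \<in> I \<Longrightarrow> f i \<in> carrier G"
  shows "j (finprod G f I) = finprod H (\<lambda>i. j (f i)) I"
proof -
  interpret G: comm_group G by (rule G)
  interpret H: comm_group H by (rule H)
  interpret j: group_hom G H j by unfold_locales (rule j)
  show ?thesis using f
  proof (induction I rule: infinite_finite_induct)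
    case (insert i I)
    then have "f i \<in> carrier G" "f \<in> I \<rightarrow> carrier G" by auto
    with insert show ?case by (simp add: Pi_iff)
  qed auto
qed

text \<open>Independence is tested by relations in the ambient group, and an injective homomorphism
  neither creates nor destroys relations.\<close>

lemma F3_dim_mono:
  assumes G: "comm_group G" and H: "comm_group H" and j: "j \<in> hom G H" and inj: "inj_on j (carrier G)"
    and V: "V \<subseteq> carrier G" "j ` V \<subseteq> V'"
  shows "F3_dim G V \<le> F3_dim H V'"
  unfolding F3_dim_def
proof (rule SUP_mono)
  interpret G: comm_group G by (rule G)
  interpret H: comm_group H by (rule H)
  interpret j: group_hom G H j by unfold_locales (rule j)
  fix S assume "S \<in> {S. finite S \<and> S \<subseteq> V \<and> F3_independent G S}"
  then have S: "finite S" "S \<subseteq> V" "F3_independent G S" by auto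
  have SG: "S \<subseteq> carrier G" using S V by auto
  have injS: "inj_on j S" using inj SG by (rule inj_on_subset)
  have "F3_independent H (j ` S)"
    unfolding F3_independent_def
  proof (intro allI impI)
    fix m assume m: "finprod H (\<lambda>s. s [^]\<^bsub>H\<^esub> (m s :: int)) (j ` S) = \<one>\<^bsub>H\<^esub>"
    have "finprod H (\<lambda>s. s [^]\<^bsub>H\<^esub> m s) (j ` S) = finprod H (\<lambda>s. j s [^]\<^bsub>H\<^esub> m (j s)) S"
      using SG by (intro H.finprod_reindex injS) auto
    also have "\<dots> = finprod H (\<lambda>s. j (s [^]\<^bsub>G\<^esub> m (j s))) S"
      using SG by (intro H.finprod_cong') (auto simp: j.hom_int_pow)
    also have "\<dots> = j (finprod G (\<lambda>s. s [^]\<^bsub>G\<^esub> m (j s)) S)"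
      using SG by (intro hom_finprod_comm_group[OF G H j, symmetric]) auto
    finally have "j (finprod G (\<lambda>s. s [^]\<^bsub>G\<^esub> m (j s)) S) = j \<one>\<^bsub>G\<^esub>" using m by simp
    moreover have "finprod G (\<lambda>s. s [^]\<^bsub>G\<^esub> m (j s)) S \<in> carrier G"
      using SG by (intro G.finprod_closed) auto
    ultimately have "finprod G (\<lambda>s. s [^]\<^bsub>G\<^esub> m (j s)) S = \<one>\<^bsub>G\<^esub>"
      using inj by (meson G.one_closed inj_onD)
    then show "\<forall>s\<in>j ` S. 3 dvd m s"
      using S(3)[unfolded F3_independent_def, rule_format, of "\<lambda>s. m (j s)"] by auto
  qed
  then show "\<exists>S'\<in>{S. finite S \<and> S \<subseteq> V' \<and> F3_independent H S}. enat (card S) \<le> enat (card S')"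
    using S V injS by (intro bexI[of _ "j ` S"]) (auto simp: card_image)
qed

text \<open>Independence is demanded of an indexed family, which also forces its members to be
  distinct, so that counting indices is legitimate.\<close>

lemma F3_dim_ge_card:
  assumes G: "comm_group G" and I: "finite I" and c: "c ` I \<subseteq> V" "V \<subseteq> carrier G"
    and ind: "\<And>m :: 'b \<Rightarrow> int. finprod G (\<lambda>i. c i [^]\<^bsub>G\<^esub> m i) I = \<one>\<^bsub>G\<^esub> \<Longrightarrow> \<forall>i\<in>I. 3 dvd m i"
  shows "F3_dim G V \<ge> enat (card I)"
proof -
  interpret G: comm_group G by (rule G)
  have cG: "c i \<in> carrier G" if "i \<in> I" for i using c that by auto
  have inj: "inj_on c I"
  proof (rule inj_onI, rule ccontr)
    fix i j assume ij: "i \<in> I" "j \<in> I" "c i = c j" "i \<noteq> j"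
    \<comment> \<open>Two equal members would satisfy the relation with the coefficients
      \<open>1\<close> and \<open>- 1\<close>.\<close>
    define m where "m = (\<lambda>k. if k = i then 1 else if k = j then - 1 else 0 :: int)"
    define I' where "I' = I - {i, j}"
    have I': "I = insert i (insert j I')" "finite I'" "i \<notin> insert j I'" "j \<notin> I'"
      using ij I by (auto simp: I'_def)
    have "finprod G (\<lambda>k. c k [^]\<^bsub>G\<^esub> m k) I' = finprod G (\<lambda>k. \<one>\<^bsub>G\<^esub>) I'"
      by (intro G.finprod_cong') (auto simp: m_def I'_def)
    then have "finprod G (\<lambda>k. c k [^]\<^bsub>G\<^esub> m k) I' = \<one>\<^bsub>G\<^esub>" by simp
    moreover have "(\<lambda>k. c k [^]\<^bsub>G\<^esub> m k) \<in> I' \<rightarrow> carrier G" using cG by (auto simp: I'_def)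
    ultimately have "finprod G (\<lambda>k. c k [^]\<^bsub>G\<^esub> m k) I = \<one>\<^bsub>G\<^esub>"
      unfolding I'(1) using I'(2-4) ij cG
      by (simp add: Pi_iff m_def G.int_pow_neg G.int_pow_1)
    then have "3 dvd m i" using ind ij by blast
    then show False by (simp add: m_def)
  qed
  have "F3_independent G (c ` I)"
    unfolding F3_independent_def
  proof (intro allI impI)
    fix m assume m: "finprod G (\<lambda>s. s [^]\<^bsub>G\<^esub> (m s :: int)) (c ` I) = \<one>\<^bsub>G\<^esub>"
    have "finprod G (\<lambda>s. s [^]\<^bsub>G\<^esub> m s) (c ` I) = finprod G (\<lambda>i. c i [^]\<^bsub>G\<^esub> m (c i)) I"
      using cG by (intro G.finprod_reindex inj) auto
    then show "\<forall>s\<in>c ` I. 3 dvd m s" using ind[of "\<lambda>i. m (c i)"] m by auto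
  qed
  then have "enat (card (c ` I)) \<le> F3_dim G V"
    unfolding F3_dim_def using I c by (intro SUP_upper) auto
  then show ?thesis by (simp add: card_image[OF inj])
qed

subsection \<open>From the isogeny to multiplication by 3\<close>

lemma isogeny_psi:
  assumes "a * b * (4 * a + 27 * b) \<noteq> 0"
  shows "isogeny (E a b) (psi a b)"
  using assms by unfold_locales (auto simp: nonsingular_E defined_over_E psi_eq_iff act_psi)

context
  fixes W assumes W: "nonsingular W"
begin

lemma ec_triple_points [simp]: "P \<in> points W UNIV \<Longrightarrow> ec_triple W P \<in> points W UNIV"
  by (simp add: ec_triple_def)

lemma ec_triple_add:
  assumes "P \<in> points W UNIV" "Q \<in> points W UNIV"
  shows "ec_triple W (ec_add W P Q) = ec_add W (ec_triple W P) (ec_triple W Q)"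
  using assms unfolding ec_triple_def by (simp add: ec_add_swap[OF W])

lemma ec_triple_neg: "ec_triple W (ec_neg P) = ec_neg (ec_triple W P)"
  unfolding ec_triple_def by (simp add: ec_add_neg_neg)

lemma ec_triple_eq_iff:
  assumes "P \<in> points W UNIV" "Q \<in> points W UNIV"
  shows "ec_triple W P = ec_triple W Q \<longleftrightarrow> ec_triple W (ec_add W P (ec_neg Q)) = None"
  using assms by (auto simp: ec_triple_add ec_triple_neg ec_add_eq_None)

end

lemma act_ec_triple:
  assumes "complex_subfield F" "\<sigma> \<in> gal F" "defined_over F W" "P \<in> points W (alg_cl F)"
  shows "ec_triple W (act \<sigma> P) = act \<sigma> (ec_triple W P)"
proof -
  have "defined_over (alg_cl F) W"
    using defined_over_mono[OF alg_cl_superset[OF assms(1)] assms(3)] .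
  then have "ec_add W P P \<in> points W (alg_cl F)"
    using ec_add_points_over[OF complex_subfield_alg_cl[OF assms(1)]] assms(4) by blast
  then show ?thesis unfolding ec_triple_def by (simp add: act_add[OF assms(1-3)] assms(4))
qed

lemma isogeny_triple:
  assumes "a * b * (4 * a + 27 * b) \<noteq> 0"
  shows "isogeny (E a b) (ec_triple (E a b))"
proof -
  note W = nonsingular_E[OF assms]
  show ?thesis
    using W ec_triple_eq_iff[OF W] act_ec_triple defined_over_E
    by unfold_locales (auto simp: ec_triple_def)
qed

lemma psi_triple:
  assumes ab: "a * b * (4 * a + 27 * b) \<noteq> 0" and P: "P \<in> points (E a b) UNIV"
  shows "psi a b (ec_triple (E a b) P) = ec_triple (Ehat a b) (psi a b P)"
  using P unfolding ec_triple_def by (simp add: psi_add[OF ab])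

text \<open>If no nontrivial 3-torsion point of the target curve is rational, the inclusion of the kernel of
  the isogeny into the 3-torsion is injective on cohomology. Locally a point \<open>Q\<close> over \<open>\<psi> Q = P\<close>
  also lies over the rational point \<open>3 Q\<close>, which is fixed because \<open>\<sigma> Q - Q\<close> is killed by 3.\<close>

theorem F3_dim_selmer_le:
  assumes ab: "a * b * (4 * a + 27 * b) \<noteq> 0" and F: "complex_subfield F"
    and tors: "\<And>P. P \<in> points (Ehat a b) F \<Longrightarrow> ec_triple (Ehat a b) P = None \<Longrightarrow> P = None"
  shows "F3_dim (H1 (E a b) (psi a b) F) (selmer (E a b) (Ehat a b) (psi a b) F) \<le>
    F3_dim (H1 (E a b) (ec_triple (E a b)) F) (selmer (E a b) (E a b) (ec_triple (E a b)) F)"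
proof -
  define W where "W = E a b"
  define \<phi> where "\<phi> = psi a b"
  define \<tau> where "\<tau> = ec_triple W"
  interpret p: isogeny W \<phi> unfolding W_def \<phi>_def by (rule isogeny_psi[OF ab])
  interpret t: isogeny W \<tau> unfolding W_def \<tau>_def by (rule isogeny_triple[OF ab])
  note A = complex_subfield_alg_cl[OF F]
  have ker: "ker_pts W \<phi> M \<subseteq> ker_pts W \<tau> M" for M
    using triple_of_psi_None[OF ab] points_UNIV by (auto simp: ker_pts_def W_def \<phi>_def \<tau>_def)
  have Z: "f \<in> carrier (Z1 W \<tau> M)" if "complex_subfield M" "f \<in> carrier (Z1 W \<phi> M)" for f M
    using that ker unfolding p.Z1_iff[OF that(1)] t.Z1_iff[OF that(1)] by blast
  have mult: "f \<otimes>\<^bsub>Z1 W \<phi> F\<^esub> g = f \<otimes>\<^bsub>Z1 W \<tau> F\<^esub> g" for f g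
    by (simp add: Z1_def)
  \<comment> \<open>The map on cohomology induced by the inclusion of the kernels, defined through a
    chosen representative; the next fact shows that the choice does not matter.\<close>
  define j where "j = (\<lambda>c. H1_class W \<tau> F (SOME f. f \<in> carrier (Z1 W \<phi> F) \<and> H1_class W \<phi> F f = c))"
  have j: "j (H1_class W \<phi> F f) = H1_class W \<tau> F f" if f: "f \<in> carrier (Z1 W \<phi> F)" for f
  proof -
    define g where "g = (SOME g. g \<in> carrier (Z1 W \<phi> F) \<and> H1_class W \<phi> F g = H1_class W \<phi> F f)"
    have g: "g \<in> carrier (Z1 W \<phi> F)" "H1_class W \<phi> F g = H1_class W \<phi> F f"
      using someI[of "\<lambda>g. g \<in> carrier (Z1 W \<phi> F) \<and> H1_class W \<phi> F g = H1_class W \<phi> F f" f] f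
      by (auto simp: g_def)
    then obtain T where "T \<in> ker_pts W \<phi> (alg_cl F)" "g = coboundary W F T \<otimes>\<^bsub>Z1 W \<phi> F\<^esub> f"
      using p.H1_class_eq_iff[OF F g(1) f] by blast
    then have "H1_class W \<tau> F g = H1_class W \<tau> F f"
      using t.H1_class_eq_iff[OF F Z[OF F g(1)] Z[OF F f]] ker mult by (metis subsetD)
    then show ?thesis by (simp add: j_def g_def)
  qed
  have carr: "c \<in> carrier (H1 W \<phi> F) \<Longrightarrow> \<exists>f\<in>carrier (Z1 W \<phi> F). c = H1_class W \<phi> F f" for c
    unfolding p.carrier_H1[OF F] by blast
  have hom: "j \<in> hom (H1 W \<phi> F) (H1 W \<tau> F)"
  proof (rule homI)
    fix c assume "c \<in> carrier (H1 W \<phi> F)"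
    then obtain f where f: "f \<in> carrier (Z1 W \<phi> F)" "c = H1_class W \<phi> F f" using carr by blast
    then show "j c \<in> carrier (H1 W \<tau> F)" unfolding t.carrier_H1[OF F] using j Z[OF F] by auto
    fix c' assume "c' \<in> carrier (H1 W \<phi> F)"
    then obtain f' where f': "f' \<in> carrier (Z1 W \<phi> F)" "c' = H1_class W \<phi> F f'" using carr by blast
    have "j (c \<otimes>\<^bsub>H1 W \<phi> F\<^esub> c') = j (H1_class W \<phi> F (f \<otimes>\<^bsub>Z1 W \<phi> F\<^esub> f'))"
      unfolding f(2) f'(2) p.H1_class_mult[OF F f(1) f'(1)] ..
    also have "\<dots> = H1_class W \<tau> F (f \<otimes>\<^bsub>Z1 W \<tau> F\<^esub> f')"
      using j[OF p.Z1_mult[OF F f(1) f'(1)]] by (simp only: mult)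
    also have "\<dots> = j c \<otimes>\<^bsub>H1 W \<tau> F\<^esub> j c'"
      unfolding f(2) f'(2) j[OF f(1)] j[OF f'(1)]
      by (rule t.H1_class_mult[OF F Z[OF F f(1)] Z[OF F f'(1)], symmetric])
    finally show "j (c \<otimes>\<^bsub>H1 W \<phi> F\<^esub> c') = j c \<otimes>\<^bsub>H1 W \<tau> F\<^esub> j c'" .
  qed
  have inj: "inj_on j (carrier (H1 W \<phi> F))"
  proof (rule inj_onI)
    fix c c' assume "c \<in> carrier (H1 W \<phi> F)" "c' \<in> carrier (H1 W \<phi> F)" and eq: "j c = j c'"
    then obtain f g where f: "f \<in> carrier (Z1 W \<phi> F)" "c = H1_class W \<phi> F f"
      and g: "g \<in> carrier (Z1 W \<phi> F)" "c' = H1_class W \<phi> F g" using carr by meson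
    obtain T where T: "T \<in> ker_pts W \<tau> (alg_cl F)" "f = coboundary W F T \<otimes>\<^bsub>Z1 W \<tau> F\<^esub> g"
      using eq t.H1_class_eq_iff[OF F Z[OF F f(1)] Z[OF F g(1)]] by (auto simp: f(2) g(2) j f(1) g(1))
    have TA: "T \<in> points W (alg_cl F)" using T(1) by (simp add: ker_pts_def)
    \<comment> \<open>Here \<open>\<sigma> T - T\<close> is the difference of two cocycles with
      values in the kernel of \<open>\<phi>\<close>. Hence \<open>\<phi> T\<close> is Galois
      invariant, a rational 3-torsion point of the target curve.\<close>
    have "act \<sigma> (\<phi> T) = \<phi> T" if \<sigma>: "\<sigma> \<in> gal F" for \<sigma>
    proof -
      have u: "act \<sigma> T \<in> points W UNIV" by (rule t.act_UNIV[OF F \<sigma> TA])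
      define D where "D = ec_add W (act \<sigma> T) (ec_neg T)"
      have D: "D \<in> points W UNIV" using u points_UNIV[OF TA] by (simp add: D_def)
      have "f \<sigma> = ec_add W D (g \<sigma>)"
        using \<sigma> unfolding T(2) D_def by (simp add: Z1_def coboundary_def)
      then have "ec_add W (f \<sigma>) (ec_neg (g \<sigma>)) = D"
        using ec_add_cancel[OF p.W D p.Z1_UNIV[OF F g(1) \<sigma>]] by simp
      then have "D \<in> ker_pts W \<phi> (alg_cl F)"
        using p.ker_add[OF F p.Z1D(2)[OF F f(1) \<sigma>] p.ker_neg[OF F p.Z1D(2)[OF F g(1) \<sigma>]]] by simp
      then have "\<phi> (act \<sigma> T) = \<phi> T"
        using p.\<phi>_eq_iff[OF u points_UNIV[OF TA]] by (simp add: D_def ker_pts_def)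
      then show ?thesis using p.act_\<phi>[OF F \<sigma> TA] by simp
    qed
    moreover have "\<phi> T \<in> points (Ehat a b) (alg_cl F)"
      using psi_points_over[OF A] TA by (simp add: W_def \<phi>_def)
    ultimately have "\<phi> T \<in> points (Ehat a b) F" by (intro act_fixed_imp[OF F])
    moreover have "ec_triple (Ehat a b) (\<phi> T) = None"
      using psi_triple[OF ab, of T] T(1) points_UNIV[OF TA] by (simp add: W_def \<phi>_def \<tau>_def ker_pts_def)
    ultimately have "\<phi> T = None" by (rule tors)
    then have "T \<in> ker_pts W \<phi> (alg_cl F)" using TA by (simp add: ker_pts_def)
    then show "c = c'"
      using p.H1_class_eq_iff[OF F f(1) g(1)] T(2) mult by (metis f(2) g(2))
  qed
  have sel: "j ` selmer W (Ehat a b) \<phi> F \<subseteq> selmer W W \<tau> F"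
  proof (clarify)
    fix c assume c: "c \<in> selmer W (Ehat a b) \<phi> F"
    then have "c \<in> carrier (H1 W \<phi> F)" by (simp add: selmer_def)
    then obtain f where f: "f \<in> carrier (Z1 W \<phi> F)" "c = H1_class W \<phi> F f" using carr by blast
    have "H1_class W \<tau> F f \<in> selmer W W \<tau> F"
    proof (rule t.selmerI[OF F Z[OF F f(1)]])
      fix v L w assume vL: "finite_prime F v" "completion_of F v L w"
      then have L: "complex_subfield L" "F \<subseteq> L" by (auto simp: completion_of_def)
      obtain \<kappa> where \<kappa>: "\<kappa>^2 = - 3 * complex_of_int a" by (metis power2_csqrt)
      have "\<exists>Q\<in>points W (alg_cl L). \<phi> Q \<in> points (Ehat a b) L \<and> res_cocycle F L f = coboundary W L Q"
      proof (rule p.selmerD[OF F f(1) c[unfolded f(2)] vL])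
        fix R assume "R \<in> points (Ehat a b) L"
        then have "R \<in> points (Ehat a b) (alg_cl L)"
          using points_mono[OF alg_cl_superset[OF L(1)]] by blast
        then show "\<exists>Q\<in>points W (alg_cl L). \<phi> Q = R"
          using psi_surj[OF ab \<kappa> L(1)] by (simp add: W_def \<phi>_def)
      qed
      then obtain Q where Q: "Q \<in> points W (alg_cl L)" "\<phi> Q \<in> points (Ehat a b) L"
        "res_cocycle F L f = coboundary W L Q" by blast
      note AL = complex_subfield_alg_cl[OF L(1)]
      have "\<tau> Q \<in> points W (alg_cl L)"
        using Q(1) ec_add_points_over[OF AL p.W_over[OF AL]] by (simp add: \<tau>_def ec_triple_def)
      moreover have "act \<sigma> (\<tau> Q) = \<tau> Q" if \<sigma>: "\<sigma> \<in> gal L" for \<sigma>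
      proof -
        have u: "act \<sigma> Q \<in> points W UNIV" by (rule t.act_UNIV[OF L(1) \<sigma> Q(1)])
        have "\<phi> (act \<sigma> Q) = \<phi> Q"
          using p.act_\<phi>[OF L(1) \<sigma> Q(1)] act_fixed[OF L(1) Q(2) \<sigma>] by simp
        then have "\<phi> (ec_add W (act \<sigma> Q) (ec_neg Q)) = None"
          using p.\<phi>_eq_iff[OF u points_UNIV[OF Q(1)]] by simp
        then have "\<tau> (ec_add W (act \<sigma> Q) (ec_neg Q)) = None"
          using triple_of_psi_None[OF ab] u points_UNIV[OF Q(1)] by (simp add: W_def \<phi>_def \<tau>_def)
        then have "\<tau> (act \<sigma> Q) = \<tau> Q"
          using t.\<phi>_eq_iff[OF u points_UNIV[OF Q(1)]] by simp
        then show ?thesis using t.act_\<phi>[OF L(1) \<sigma> Q(1)] by simp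
      qed
      ultimately have "\<tau> Q \<in> points W L" by (intro act_fixed_imp[OF L(1)])
      then show "\<exists>Q\<in>points W (alg_cl L). \<tau> Q \<in> points W L \<and> res_cocycle F L f = coboundary W L Q"
        using Q by blast
    qed
    then show "j c \<in> selmer W W \<tau> F" using j[OF f(1)] f(2) by simp
  qed
  have "selmer W (Ehat a b) \<phi> F \<subseteq> carrier (H1 W \<phi> F)" by (auto simp: selmer_def)
  then have "F3_dim (H1 W \<phi> F) (selmer W (Ehat a b) \<phi> F) \<le> F3_dim (H1 W \<tau> F) (selmer W W \<tau> F)"
    by (rule F3_dim_mono[OF p.comm_group_H1[OF F] t.comm_group_H1[OF F] hom inj _ sel])
  then show ?thesis by (simp add: W_def \<phi>_def \<tau>_def)
qed

subsection \<open>The family of curves\<close>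

definition \<rho> :: complex where "\<rho> = complex_of_real (sqrt 6)"

definition \<theta> :: complex where "\<theta> = 2 * zeta3 + 1"

text \<open>Since 243 is \<open>3^5\<close>, \<open>- 3 a\<close> is the square of
  \<open>27 \<rho>^(N - 2)\<close>. The exponent is a truncated subtraction, which is why
  \<open>N \<ge> 2\<close> is assumed below.\<close>

definition curve_a :: "nat \<Rightarrow> int" where "curve_a N = - 243 * 6 ^ (N - 2)"

definition \<kappa> :: "nat \<Rightarrow> complex" where "\<kappa> N = 9 / 2 * \<rho> ^ N"

text \<open>A square root of \<open>curve_a N\<close>, so that \<open>(0, \<tau> N)\<close> and
  \<open>(0, - \<tau> N)\<close> are the nontrivial kernel points. The division by
  \<open>\<theta>\<close> is the normalisation that \<open>translate_zt\<close> requires.\<close>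

definition \<tau> :: "nat \<Rightarrow> complex" where "\<tau> N = \<kappa> N / \<theta>"

definition unit_u :: "nat \<Rightarrow> complex" where "unit_u e = (1 + \<rho> ^ e) / (1 - \<rho> ^ e)"

lemma rho2: "\<rho>^2 = 6"
  by (simp add: \<rho>_def flip: of_real_power)

lemma rho_nonzero [simp]: "\<rho> \<noteq> 0"
  using rho2 by auto

lemma rho_odd_power:
  assumes "odd n"
  shows "\<rho> ^ n = 6 ^ ((n - 1) div 2) * \<rho>"
proof -
  have "n = 2 * ((n - 1) div 2) + 1" using assms by (auto elim: oddE)
  then have "\<rho> ^ n = \<rho> ^ (2 * ((n - 1) div 2) + 1)" by simp
  also have "\<dots> = 6 ^ ((n - 1) div 2) * \<rho>" by (simp add: power_mult rho2)
  finally show ?thesis .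
qed

lemma rho_square_power: "(\<rho> ^ n)^2 = 6 ^ n"
  by (metis power_mult mult.commute rho2)

lemma zeta3_square: "zeta3^2 = - zeta3 - 1"
proof -
  have s: "complex_of_real (sqrt 3) * complex_of_real (sqrt 3) = 3"
    by (simp flip: of_real_mult)
  have "2 * zeta3 + 1 = \<i> * complex_of_real (sqrt 3)" by (simp add: zeta3_def diff_divide_distrib add_divide_distrib)
  then have "(2 * zeta3 + 1)^2 = (\<i> * complex_of_real (sqrt 3))^2" by simp
  also have "\<dots> = - 3" by (simp only: power_mult_distrib power2_eq_square[of "complex_of_real _"] s) simp
  finally have "4 * zeta3^2 = 4 * (- zeta3 - 1)" by Groebner_Basis.algebra
  then show ?thesis by (simp only: mult_cancel_left) simp
qed

lemma zeta3_cube: "zeta3^3 = 1"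
  using zeta3_square by Groebner_Basis.algebra

lemma zeta3_neq: "zeta3 \<noteq> 1" "zeta3 \<noteq> 0" "zeta3^2 \<noteq> 1" "zeta3^2 \<noteq> zeta3"
proof -
  show 1: "zeta3 \<noteq> 1" using zeta3_square by auto
  show 0: "zeta3 \<noteq> 0" using zeta3_square by auto
  show "zeta3^2 \<noteq> zeta3" using 0 1 by (simp add: power2_eq_square)
  show "zeta3^2 \<noteq> 1" using 1 zeta3_cube by (auto simp: power3_eq_cube power2_eq_square)
qed

lemma theta2: "\<theta>^2 = - 3"
  unfolding \<theta>_def using zeta3_square by Groebner_Basis.algebra

lemma theta_nonzero [simp]: "\<theta> \<noteq> 0"
  using theta2 by auto

lemma zeta3_theta: "zeta3 = (\<theta> - 1) / 2"
  by (simp add: \<theta>_def)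

lemma cube_root_of_unity:
  assumes "y^3 = (1::complex)"
  shows "y = 1 \<or> y = zeta3 \<or> y = zeta3^2"
proof -
  have "(y - 1) * ((y - zeta3) * (y - zeta3^2)) = y^3 - 1"
    using zeta3_square by Groebner_Basis.algebra
  then show ?thesis using assms by auto
qed

lemma complex_subfield_K: "complex_subfield K"
  unfolding complex_subfield_def
proof (intro conjI ballI)
  have I: "of_rat r + of_rat s * zeta3 \<in> K" for r s by (auto simp: K_def)
  show "0 \<in> K" using I[of 0 0] by simp
  show "1 \<in> K" using I[of 1 0] by simp
  fix x y assume "x \<in> K" "y \<in> K"
  then obtain r s r' s' where xy: "x = of_rat r + of_rat s * zeta3" "y = of_rat r' + of_rat s' * zeta3"
    by (auto simp: K_def)
  show "x + y \<in> K" using I[of "r + r'" "s + s'"] by (simp add: xy of_rat_add algebra_simps)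
  have "x * y = of_rat (r * r' - s * s') + of_rat (r * s' + s * r' - s * s') * zeta3"
    unfolding xy of_rat_add of_rat_mult of_rat_diff using zeta3_square by Groebner_Basis.algebra
  then show "x * y \<in> K" using I by simp
next
  have I: "of_rat r + of_rat s * zeta3 \<in> K" for r s by (auto simp: K_def)
  fix x assume "x \<in> K"
  then obtain r s where x: "x = of_rat r + of_rat s * zeta3" by (auto simp: K_def)
  show "- x \<in> K" using I[of "- r" "- s"] by (simp add: x of_rat_minus)
  define n where "n = r^2 - r * s + s^2"
  define x' where "x' = of_rat (r - s) + of_rat (- s) * zeta3"
  have xx: "x * x' = of_rat n"
    unfolding x x'_def n_def of_rat_add of_rat_mult of_rat_diff of_rat_power of_rat_minus
    using zeta3_square by Groebner_Basis.algebra
  show "inverse x \<in> K"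
  proof (cases "n = 0")
    case True
    have "4 * n = (2 * r - s)^2 + 3 * s^2" by (simp add: n_def power2_eq_square algebra_simps)
    then have "(2 * r - s)^2 + 3 * s^2 = 0" using True by simp
    moreover have "(2 * r - s)^2 \<ge> 0" "3 * s^2 \<ge> 0" by simp_all
    ultimately have "3 * s^2 = 0" "(2 * r - s)^2 = 0" by linarith+
    then have "s = 0" "r = 0" by simp_all
    then show ?thesis using I[of 0 0] by (simp add: x)
  next
    case False
    have "x * (x' / of_rat n) = 1" using xx False by simp
    then have "inverse x = x' / of_rat n" by (rule inverse_unique)
    also have "\<dots> = of_rat ((r - s) / n) + of_rat ((- s) / n) * zeta3"
      by (simp only: x'_def of_rat_divide add_divide_distrib times_divide_eq_left)
    finally show ?thesis using I by simp
  qed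
qed

lemmas K_intros = subfield_intros[OF complex_subfield_K]

lemma zeta3_K: "zeta3 \<in> K"
proof -
  have "of_rat 0 + of_rat 1 * zeta3 \<in> K" unfolding K_def by blast
  then show ?thesis by simp
qed

lemma theta_K: "\<theta> \<in> K"
  by (auto simp: \<theta>_def intro!: K_intros zeta3_K)

lemma rho_alg_cl: "\<rho> \<in> alg_cl K"
  by (rule alg_cl_root[OF complex_subfield_K, of _ 2])
    (use alg_cl_superset[OF complex_subfield_K] in \<open>auto simp: rho2 intro: K_intros\<close>)

text \<open>A real element of \<open>K\<close> is rational, and 6 is not the square of a rational
  number by parity.\<close>

lemma rho_not_K: "\<rho> \<notin> K" 
proof
  assume "\<rho> \<in> K"
  then obtain r s where rs: "\<rho> = of_rat r + of_rat s * zeta3" by (auto simp: K_def)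
  have "Im \<rho> = 0" by (simp add: \<rho>_def)
  moreover have "Im \<rho> = of_rat s * (sqrt 3 / 2)"
  proof -
    have "complex_of_real (of_rat q) = of_rat q" for q :: rat by (cases q) (simp add: of_rat_rat)
    then have "\<rho> = complex_of_real (of_rat r) + complex_of_real (of_rat s) * zeta3" using rs by simp
    then have "Im \<rho> = Im (complex_of_real (of_rat r) + complex_of_real (of_rat s) * zeta3)"
      by (rule arg_cong)
    moreover have "Im zeta3 = sqrt 3 / 2" by (simp add: zeta3_def)
    ultimately show ?thesis by simp
  qed
  ultimately have "s = 0" by simp
  then have "(of_rat r :: complex)^2 = of_rat 6" using rs rho2 by simp
  then have "of_rat (r^2) = (of_rat 6 :: complex)" by (simp add: of_rat_power)
  then have r6: "r^2 = 6" by (simp only: of_rat_eq_iff)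
  obtain p q where pq: "r = Rat.Fract p q" "q > 0" "coprime p q" by (cases r)
  have "p^2 = 6 * q^2"
  proof -
    have "(rat_of_int p)^2 = 6 * (rat_of_int q)^2"
      using r6 pq(1,2) by (simp add: Fract_of_int_quotient power_divide field_simps)
    then have "rat_of_int (p^2) = rat_of_int (6 * q^2)" by simp
    then show ?thesis by (simp only: of_int_eq_iff)
  qed
  then have "even (p^2)" by (metis dvd_mult2 dvd_triv_left even_numeral)
  then have "even p" by (simp only: even_power)
  then obtain p' where p': "p = 2 * p'" by (elim evenE)
  then have "2 * p'^2 = 3 * q^2" using \<open>p^2 = 6 * q^2\<close> by (simp add: power_mult_distrib)
  then have "even (3 * q^2)" by (metis dvd_triv_left)
  then have "even q" by (simp add: even_mult_iff)
  then have "is_unit (2::int)" using coprime_common_divisor[OF pq(3) \<open>even p\<close>] by blast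
  then show False by simp
qed

lemma sigma_rho:
  assumes "\<sigma> \<in> gal K"
  shows "\<sigma> \<rho> = \<rho> \<or> \<sigma> \<rho> = - \<rho>"
proof -
  have "\<sigma> \<rho> ^ 2 = \<sigma> (\<rho>^2)" using gal_power[OF complex_subfield_K assms rho_alg_cl] by simp
  also have "\<dots> = \<rho>^2" using gal_consts(3)[OF complex_subfield_K assms] by (simp add: rho2)
  finally show ?thesis by (simp add: power2_eq_iff)
qed

lemma kappa_square: "\<kappa> N ^ 2 = - 3 * of_int (curve_a N)" if "N \<ge> 2"
proof -
  define M where "M = N - 2"
  then have M: "N = M + 2" using that by simp
  show ?thesis
    unfolding \<kappa>_def power_mult_distrib rho_square_power by (simp add: M curve_a_def power_divide)
qed

lemma curve_d: "4 * curve_a N + 27 = 27 * (1 - 6 ^ N)" if "N \<ge> 2"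
proof -
  define M where "M = N - 2"
  then have M: "N = M + 2" using that by simp
  show ?thesis by (simp add: M curve_a_def)
qed

lemma curve_a_nonzero: "curve_a N * 1 * (4 * curve_a N + 27 * 1) \<noteq> 0" if "N \<ge> 2"
proof -
  have "(6::int) ^ N > 1" using that by (intro one_less_power) auto
  then show ?thesis using curve_d[OF that] by (simp add: curve_a_def)
qed

lemma kappa_K: "odd N \<Longrightarrow> \<kappa> N = 9 / 2 * 6 ^ ((N - 1) div 2) * \<rho>"
  by (simp add: \<kappa>_def rho_odd_power)

lemma kappa_theta_tau: "\<kappa> N * of_int 1 = \<theta> * \<tau> N"
  by (simp add: \<tau>_def)

lemma kappa_nonzero: "\<kappa> N \<noteq> 0"
  by (simp add: \<kappa>_def)

lemma tau_square: "\<tau> N ^ 2 = of_int (curve_a N)" if "N \<ge> 2"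
  using kappa_square[OF that] by (simp add: \<tau>_def power_divide theta2)

text \<open>For odd \<open>N\<close> the square root \<open>3 * \<kappa> N\<close> is a nonzero
  element of \<open>K\<close> times \<open>\<rho>\<close>. This is the condition of
  \<open>no_3_torsion\<close> for the target curve, whose first parameter is
  \<open>- 27 * a\<close>.\<close>

lemma not_square_K:
  assumes "N \<ge> 2" "odd N" "s \<in> K"
  shows "s^2 \<noteq> of_int (- 27 * curve_a N)"
proof
  assume "s^2 = of_int (- 27 * curve_a N)"
  also have "\<dots> = (3 * \<kappa> N)^2" using kappa_square[OF assms(1)] by (simp add: power_mult_distrib)
  finally have "s = 3 * \<kappa> N \<or> s = - (3 * \<kappa> N)" by (simp only: power2_eq_iff)
  then have "3 * \<kappa> N \<in> K" using assms(3) K_intros(5)[of s] by auto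
  then have "(3 * \<kappa> N) / (3 * (9 / 2 * 6 ^ ((N - 1) div 2))) \<in> K"
    by (rule subfield_divide[OF complex_subfield_K]) (intro K_intros)
  moreover have "(3 * \<kappa> N) / (3 * (9 / 2 * 6 ^ ((N - 1) div 2))) = \<rho>"
    by (simp add: kappa_K[OF assms(2)])
  ultimately show False using rho_not_K by simp
qed

lemma not_square_K':
  assumes "N \<ge> 2" "odd N" "s \<in> K"
  shows "s^2 \<noteq> of_int (curve_a N)"
proof
  assume "s^2 = of_int (curve_a N)"
  then have "(3 * \<theta> * s)^2 = of_int (- 27 * curve_a N)" by (simp add: power_mult_distrib theta2)
  then show False using not_square_K[OF assms(1,2), of "3 * \<theta> * s"] assms(3) theta_K by (auto intro!: K_intros)
qed

subsection \<open>Kummer classes\<close>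

text \<open>The isomorphism from the cube roots of unity onto the kernel. It is meaningful only for
  such roots, where the last branch stands for \<open>zeta3^2\<close>.\<close>

definition tors :: "nat \<Rightarrow> complex \<Rightarrow> point" where
  "tors N y = (if y = 1 then None else if y = zeta3 then Some (0, \<tau> N) else Some (0, - \<tau> N))"

text \<open>The value at \<open>\<sigma>\<close> is determined by \<open>\<sigma> z = (y z)\<^sup>\<plusminus>\<^sup>1\<close>, with the sign of \<open>\<sigma> \<rho> = \<plusminus>\<rho>\<close>.\<close>

definition twist :: "complex \<Rightarrow> (complex \<Rightarrow> complex) \<Rightarrow> complex" where
  "twist z \<sigma> = (if \<sigma> \<rho> = \<rho> then \<sigma> z else inverse (\<sigma> z)) / z"

definition kcocycle :: "nat \<Rightarrow> complex \<Rightarrow> (complex \<Rightarrow> complex) \<Rightarrow> point" where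
  "kcocycle N z = (\<lambda>\<sigma>\<in>gal K. tors N (twist z \<sigma>))"

section \<open>The kernel as a quadratic twist of the cube roots of unity\<close>

context
  fixes N :: nat
  assumes N: "N \<ge> 2" "odd N"
begin

abbreviation (input) "W \<equiv> E (curve_a N) 1"

interpretation iso: isogeny W "psi (curve_a N) 1"
  by (rule isogeny_psi[OF curve_a_nonzero[OF N(1)]])

lemma T_point: "Some (0, \<tau> N) \<in> points W UNIV" "Some (0, - \<tau> N) \<in> points W UNIV"
  using tau_square[OF N(1)] by (simp_all add: points_E)

lemma T_double: "ec_add W (Some (0, \<tau> N)) (Some (0, \<tau> N)) = Some (0, - \<tau> N)"
proof -
  have "ec_triple W (Some (0, \<tau> N)) = None"
    by (rule triple_of_psi_None[OF curve_a_nonzero[OF N(1)] T_point(1)]) simp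
  then show ?thesis by (simp only: ec_triple_def ec_add_eq_None) (metis ec_neg.simps(2) ec_neg_neg)
qed

lemma T_double': "ec_add W (Some (0, - \<tau> N)) (Some (0, - \<tau> N)) = Some (0, \<tau> N)"
  using T_double ec_add_neg_neg[of W "Some (0, \<tau> N)" "Some (0, \<tau> N)"] by (simp del: ec_add.simps)

lemma tors_mult:
  assumes "y^3 = 1" "y'^3 = 1"
  shows "tors N (y * y') = ec_add W (tors N y) (tors N y')"
proof -
  have c: "zeta3 * (zeta3 * zeta3) = 1" using zeta3_cube by (simp only: power3_eq_cube mult.assoc)
  have z: "zeta3 * zeta3 = zeta3^2" "zeta3 * zeta3^2 = 1" "zeta3^2 * zeta3 = 1" "zeta3^2 * zeta3^2 = zeta3"
    by (simp_all add: power2_eq_square mult.assoc c)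
  show ?thesis
  proof -
    have t: "tors N 1 = None" "tors N zeta3 = Some (0, \<tau> N)" "tors N (zeta3^2) = Some (0, - \<tau> N)"
      using zeta3_neq by (simp_all add: tors_def)
    have n: "ec_add W (Some (0, \<tau> N)) (Some (0, - \<tau> N)) = None"
      "ec_add W (Some (0, - \<tau> N)) (Some (0, \<tau> N)) = None" by simp_all
    show ?thesis
      using cube_root_of_unity[OF assms(1)] cube_root_of_unity[OF assms(2)]
      by (elim disjE)
        (simp_all only: z t n T_double T_double' ec_add.simps(1) ec_add_None mult_1_left mult_1_right)
  qed
qed

lemma tors_inverse: "y^3 = 1 \<Longrightarrow> tors N (inverse y) = ec_neg (tors N y)"
proof -
  assume y: "y^3 = 1"
  have "zeta3 * zeta3^2 = 1" using zeta3_square by Groebner_Basis.algebra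
  then have "inverse zeta3 = zeta3^2" "inverse (zeta3^2) = zeta3"
    by (simp_all add: inverse_unique mult.commute)
  then show ?thesis using cube_root_of_unity[OF y] zeta3_neq by (auto simp: tors_def)
qed

lemma tors_points: "tors N y \<in> points W UNIV"
  using T_point by (simp add: tors_def)

lemma psi_tors: "psi (curve_a N) 1 (tors N y) = None"
  by (simp add: tors_def)

context
  fixes L :: "complex set"
  assumes L: "complex_subfield L" "K \<subseteq> L"
begin

lemma kappa_alg: "\<kappa> N \<in> alg_cl L" and tau_alg: "\<tau> N \<in> alg_cl L" and rho_alg: "\<rho> \<in> alg_cl L"
proof -
  have "\<rho> \<in> alg_cl L" using rho_alg_cl alg_cl_mono[OF L(2)] by blast
  moreover have "\<theta> \<in> alg_cl L" using theta_K L(2) alg_cl_superset[OF L(1)] by blast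
  ultimately show "\<kappa> N \<in> alg_cl L" "\<tau> N \<in> alg_cl L" "\<rho> \<in> alg_cl L"
    by (auto simp: \<kappa>_def \<tau>_def intro!: alg_cl_intros[OF L(1)])
qed

lemma sigma_kappa:
  assumes "\<sigma> \<in> gal L"
  shows "\<sigma> \<rho> = \<rho> \<Longrightarrow> \<sigma> (\<kappa> N) = \<kappa> N \<and> \<sigma> (\<tau> N) = \<tau> N"
    "\<sigma> \<rho> = - \<rho> \<Longrightarrow> \<sigma> (\<kappa> N) = - \<kappa> N \<and> \<sigma> (\<tau> N) = - \<tau> N"
proof -
  note i = alg_cl_intros[OF L(1)]
  have th: "\<sigma> \<theta> = \<theta>" "\<theta> \<in> alg_cl L"
    using galD(5)[OF assms] theta_K L(2) alg_cl_superset[OF L(1)] by blast+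
  have k: "\<sigma> (\<kappa> N) = 9 / 2 * \<sigma> \<rho> ^ N"
    unfolding \<kappa>_def using rho_alg by (simp add: gal_hom[OF L(1) assms] i gal_consts[OF L(1) assms])
  have t: "\<sigma> (\<tau> N) = \<sigma> (\<kappa> N) / \<theta>"
    unfolding \<tau>_def using kappa_alg th by (simp add: gal_hom[OF L(1) assms])
  have m: "9 / 2 * (- \<rho>) ^ N = - (9 / 2 * \<rho> ^ N)" using N(2) by simp
  show "\<sigma> \<rho> = \<rho> \<Longrightarrow> \<sigma> (\<kappa> N) = \<kappa> N \<and> \<sigma> (\<tau> N) = \<tau> N"
    "\<sigma> \<rho> = - \<rho> \<Longrightarrow> \<sigma> (\<kappa> N) = - \<kappa> N \<and> \<sigma> (\<tau> N) = - \<tau> N"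
    unfolding t k unfolding \<tau>_def \<kappa>_def by (simp_all only: m minus_divide_left simp_thms)
qed

text \<open>As \<open>\<theta>\<close> lies in \<open>K\<close> and \<open>N\<close> is odd,
  \<open>\<sigma>\<close> changes the sign of \<open>\<tau> N\<close> exactly as that of
  \<open>\<rho>\<close>. This sign is the whole Galois action on the kernel.\<close>

lemma act_tors:
  assumes "\<sigma> \<in> gal L" "y^3 = 1"
  shows "\<sigma> \<rho> = \<rho> \<Longrightarrow> act \<sigma> (tors N y) = tors N y"
    "\<sigma> \<rho> = - \<rho> \<Longrightarrow> act \<sigma> (tors N y) = tors N (inverse y)"
  using sigma_kappa[OF assms(1)] gal_consts(1)[OF L(1) assms(1)] gal_uminus[OF L(1) assms(1) tau_alg]
  by (auto simp: tors_inverse[OF assms(2)]) (auto simp: tors_def act_def)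

end

context
  fixes z u :: complex
  assumes z: "z^3 = u" "u \<noteq> 0" and u_alg: "u \<in> alg_cl K"
    and u_pos: "\<And>\<sigma>. \<sigma> \<in> gal K \<Longrightarrow> \<sigma> \<rho> = \<rho> \<Longrightarrow> \<sigma> u = u"
    and u_neg: "\<And>\<sigma>. \<sigma> \<in> gal K \<Longrightarrow> \<sigma> \<rho> = - \<rho> \<Longrightarrow> \<sigma> u = inverse u"
begin

lemma z_nonzero: "z \<noteq> 0" using z by auto

lemma z_alg: "z \<in> alg_cl K"
  by (rule alg_cl_root[OF complex_subfield_K, of _ 3]) (simp_all add: z u_alg)

lemma twist_cube:
  assumes \<sigma>: "\<sigma> \<in> gal K"
  shows "twist z \<sigma> ^ 3 = 1"
proof -
  have s: "\<sigma> z ^ 3 = \<sigma> u" using gal_power[OF complex_subfield_K \<sigma> z_alg, of 3] z by simp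
  show ?thesis
  proof (cases "\<sigma> \<rho> = \<rho>")
    case True
    then show ?thesis using s u_pos[OF \<sigma>] z by (simp add: twist_def power_divide)
  next
    case False
    then have "\<sigma> u = inverse u" using sigma_rho[OF \<sigma>] u_neg[OF \<sigma>] by blast
    then show ?thesis using s z False by (simp add: twist_def power_divide power_inverse)
  qed
qed

lemma sigma_z:
  assumes \<sigma>: "\<sigma> \<in> gal K"
  shows "\<sigma> \<rho> = \<rho> \<Longrightarrow> \<sigma> z = twist z \<sigma> * z" "\<sigma> \<rho> = - \<rho> \<Longrightarrow> \<sigma> z = inverse (twist z \<sigma> * z)"
  using z_nonzero by (auto simp: twist_def)

text \<open>The cocycle identity for \<open>twist\<close>. Its values are cube roots of unity, which
  lie in \<open>K\<close> and are fixed by \<open>\<sigma>\<close>, so only the signs of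
  \<open>\<sigma> \<rho>\<close> and \<open>\<sigma>' \<rho>\<close> matter; a negative sign
  inverts, as in \<open>act_tors\<close>.\<close>

lemma twist_compose:
  assumes st: "\<sigma> \<in> gal K" "\<sigma>' \<in> gal K"
  shows "twist z (compose (alg_cl K) \<sigma> \<sigma>') =
    twist z \<sigma> * (if \<sigma> \<rho> = \<rho> then twist z \<sigma>' else inverse (twist z \<sigma>'))"
proof -
  have nz: "twist z \<sigma> \<noteq> 0" "twist z \<sigma>' \<noteq> 0" using twist_cube st by force+
  have "twist z \<sigma>' \<in> K"
    using cube_root_of_unity[OF twist_cube[OF st(2)]] zeta3_K by (auto intro: K_intros)
  then have t: "\<sigma> (twist z \<sigma>') = twist z \<sigma>'" "twist z \<sigma>' \<in> alg_cl K"
    using galD(5)[OF st(1)] alg_cl_superset[OF complex_subfield_K] by auto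
  note h = gal_hom[OF complex_subfield_K st(1)]
  have r: "\<sigma> (- \<rho>) = - \<sigma> \<rho>" using h(3) rho_alg_cl by blast
  have c: "compose (alg_cl K) \<sigma> \<sigma>' z = \<sigma> (\<sigma>' z)" "compose (alg_cl K) \<sigma> \<sigma>' \<rho> = \<sigma> (\<sigma>' \<rho>)"
    using z_alg rho_alg_cl by (simp_all add: compose_eq)
  have m: "\<sigma> (twist z \<sigma>' * z) = twist z \<sigma>' * \<sigma> z" "\<sigma> (inverse (twist z \<sigma>' * z)) = inverse (twist z \<sigma>' * \<sigma> z)"
    using t z_alg by (simp_all add: h alg_cl_intros[OF complex_subfield_K])
  have rr: "- \<rho> \<noteq> \<rho>" by (simp add: neg_equal_iff_equal)
  consider "\<sigma> \<rho> = \<rho>" "\<sigma>' \<rho> = \<rho>" | "\<sigma> \<rho> = \<rho>" "\<sigma>' \<rho> = - \<rho>" | "\<sigma> \<rho> = - \<rho>" "\<sigma>' \<rho> = \<rho>"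
    | "\<sigma> \<rho> = - \<rho>" "\<sigma>' \<rho> = - \<rho>"
    using sigma_rho[OF st(1)] sigma_rho[OF st(2)] by blast
  then show ?thesis
  proof cases
    case 1
    then have "twist z (compose (alg_cl K) \<sigma> \<sigma>') = \<sigma> (\<sigma>' z) / z" by (simp add: twist_def c)
    then show ?thesis using 1 sigma_z(1)[OF st(2)] sigma_z(1)[OF st(1)] m z_nonzero by simp
  next
    case 2
    then have "twist z (compose (alg_cl K) \<sigma> \<sigma>') = inverse (\<sigma> (\<sigma>' z)) / z" using rr r by (simp add: twist_def c)
    then show ?thesis using 2 sigma_z(2)[OF st(2)] sigma_z(1)[OF st(1)] m z_nonzero by simp
  next
    case 3
    then have "twist z (compose (alg_cl K) \<sigma> \<sigma>') = inverse (\<sigma> (\<sigma>' z)) / z" using rr r by (simp add: twist_def c)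
    then show ?thesis using 3 rr sigma_z(1)[OF st(2)] sigma_z(2)[OF st(1)] m z_nonzero by simp
  next
    case 4
    then have "twist z (compose (alg_cl K) \<sigma> \<sigma>') = \<sigma> (\<sigma>' z) / z" using r by (simp add: twist_def c)
    then show ?thesis using 4 rr sigma_z(2)[OF st(2)] sigma_z(2)[OF st(1)] m z_nonzero by simp
  qed
qed

lemma kcocycle_Z1: "kcocycle N z \<in> carrier (Z1 W (psi (curve_a N) 1) K)"
  unfolding iso.Z1_iff[OF complex_subfield_K]
proof (intro conjI ballI allI)
  show "kcocycle N z \<in> extensional (gal K)" by (simp add: kcocycle_def)
next
  fix d
  define g where "g = (\<lambda>p. tors N ((if fst p = \<rho> then snd p else inverse (snd p)) / z))"
  \<comment> \<open>The value depends only on \<open>\<sigma> \<rho>\<close> and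
    \<open>\<sigma> z\<close>, so each fibre is a union of open sets.\<close>
  have "{\<sigma> \<in> gal K. kcocycle N z \<sigma> = d} =
      (\<Union>p\<in>{p. g p = d}. {\<sigma> \<in> gal K. \<sigma> \<rho> \<in> {fst p}} \<inter> {\<sigma> \<in> gal K. \<sigma> z \<in> {snd p}})"
    by (auto simp: kcocycle_def twist_def g_def)
  moreover have "openin (krull_topology K) \<dots>"
    using openin_krull_value[OF complex_subfield_K rho_alg_cl] openin_krull_value[OF complex_subfield_K z_alg]
    by (intro openin_Union ballI) (clarsimp simp only: image_iff openin_Int)
  ultimately show "openin (krull_topology K) {\<sigma> \<in> gal K. kcocycle N z \<sigma> = d}" by simp
next
  fix \<sigma> assume "\<sigma> \<in> gal K"
  then show "kcocycle N z \<sigma> \<in> ker_pts W (psi (curve_a N) 1) (alg_cl K)"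
    using psi_tors tors_points[of "twist z \<sigma>"] tau_alg[OF complex_subfield_K order_refl]
      alg_cl_intros[OF complex_subfield_K]
    by (auto simp: kcocycle_def ker_pts_def tors_def points_E)
next
  fix \<sigma> \<sigma>' assume st: "\<sigma> \<in> gal K" "\<sigma>' \<in> gal K"
  have y: "twist z \<sigma> ^ 3 = 1" "twist z \<sigma>' ^ 3 = 1" "inverse (twist z \<sigma>') ^ 3 = 1"
    using twist_cube[OF st(1)] twist_cube[OF st(2)] by (simp_all add: power_inverse)
  have "act \<sigma> (tors N (twist z \<sigma>')) =
      tors N (if \<sigma> \<rho> = \<rho> then twist z \<sigma>' else inverse (twist z \<sigma>'))"
    using act_tors[OF complex_subfield_K order_refl st(1) y(2)] sigma_rho[OF st(1)] by auto
  then show "kcocycle N z (compose (alg_cl K) \<sigma> \<sigma>') =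
      ec_add W (kcocycle N z \<sigma>) (act \<sigma> (kcocycle N z \<sigma>'))"
    using st gal_compose[OF complex_subfield_K st] y
    by (simp add: kcocycle_def twist_compose tors_mult)
qed

text \<open>A local point on the torsor \<open>u \<zeta>\<^sup>3 - t\<^sup>3 / u = 6 \<kappa> (\<zeta> t - d)\<close> whose coordinates are conjugate
  over \<open>L(\<rho>)\<close> trivialises the class modulo the local Kummer image.\<close>

lemma kcocycle_local:
  assumes L: "complex_subfield L" "K \<subseteq> L" and ab: "\<alpha> \<in> L" "\<beta> \<in> L"
    and u: "c1 \<in> L" "c2 \<in> L" "u = c1 + c2 * \<rho>" "inverse u = c1 - c2 * \<rho>"
    and zt: "\<zeta> = \<alpha> + \<beta> * \<rho>" "t = \<alpha> - \<beta> * \<rho>"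
    and eq: "u * \<zeta>^3 - inverse u * t^3 = 6 * \<kappa> N * (\<zeta> * t - of_int (4 * curve_a N + 27))"
  shows "\<exists>Q\<in>points W (alg_cl L). psi (curve_a N) 1 Q \<in> points (Ehat (curve_a N) 1) L \<and>
    res_cocycle K L (kcocycle N z) = coboundary W L Q"
proof -
  note i = alg_cl_intros[OF L(1)]
  have LA: "x \<in> L \<Longrightarrow> x \<in> alg_cl L" for x using alg_cl_superset[OF L(1)] by blast
  have zL: "z \<in> alg_cl L" using z_alg alg_cl_mono[OF L(2)] by blast
  have z0: "z \<noteq> 0" by (rule z_nonzero)
  \<comment> \<open>Absorbing the cube root \<open>z\<close> of \<open>u\<close> turns the torsor
    into the curve itself in diagonal coordinates, and so gives a point \<open>Q\<close> over the
    algebraic closure.\<close>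
  define zq tq where "zq = z * \<zeta>" and "tq = inverse z * t"
  have zt_alg: "\<zeta> \<in> alg_cl L" "t \<in> alg_cl L"
    unfolding zt by (rule i(3) i(7), rule LA[OF ab(1)], rule i(4)[OF LA[OF ab(2)] rho_alg[OF L]])+
  have zq_alg: "zq \<in> alg_cl L" "tq \<in> alg_cl L"
    using zt_alg zL by (auto simp: zq_def tq_def intro!: i)
  have cubes: "zq^3 = u * \<zeta>^3" "tq^3 = inverse u * t^3" "zq * tq = \<zeta> * t"
    using z z0 by (simp_all add: zq_def tq_def power_mult_distrib power_inverse)
  have eq': "zq^3 - tq^3 = 6 * \<kappa> N * (zq * tq - of_int (4 * curve_a N + 27 * 1))"
    using eq by (simp add: cubes)
  obtain x y where Q: "zt_point (\<kappa> N) 1 zq tq = (x, y)" by force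
  note Q' = zt_point[OF curve_a_nonzero[OF N(1)] kappa_square[OF N(1)] eq' Q]
  have xy: "x \<in> alg_cl L" "y \<in> alg_cl L"
    using Q zq_alg kappa_alg[OF L] by (auto simp: zt_point_def intro!: i)
  have Qp: "Some (x, y) \<in> points W (alg_cl L)" using Q'(2) xy by (auto simp: points_E)
  have psiQ: "psi (curve_a N) 1 (Some (x, y)) = Some (\<zeta> * t, (u * \<zeta>^3 + inverse u * t^3) / 2)"
    using psi_zt[OF curve_a_nonzero[OF N(1)] kappa_square[OF N(1)] Q'(2,1,3)] cubes by simp
  \<comment> \<open>Both coordinates of the image are invariant under the change of sign of
    \<open>\<rho>\<close>. They are therefore polynomials in \<open>\<rho>^2 = 6\<close> and lie in
    \<open>L\<close>, whether or not \<open>\<rho>\<close> does.\<close>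
  have "\<zeta> * t = \<alpha>^2 - \<rho>^2 * \<beta>^2" unfolding zt by (simp add: power2_eq_square algebra_simps)
  then have "\<zeta> * t = \<alpha>^2 - 6 * \<beta>^2" unfolding rho2 .
  moreover have "u * \<zeta>^3 + inverse u * t^3 =
      2 * (c1 * (\<alpha>^3 + 3 * 6 * \<alpha> * \<beta>^2) + 6 * c2 * (3 * \<alpha>^2 * \<beta> + 6 * \<beta>^3))"
  proof -
    have "(c1 + c2 * \<rho>) * \<zeta>^3 + (c1 - c2 * \<rho>) * t^3 =
        2 * (c1 * (\<alpha>^3 + 3 * \<rho>^2 * \<alpha> * \<beta>^2) + \<rho>^2 * c2 * (3 * \<alpha>^2 * \<beta> + \<rho>^2 * \<beta>^3))"
      unfolding zt by (simp add: power2_eq_square power3_eq_cube algebra_simps)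
    then show ?thesis unfolding u(3)[symmetric] u(4)[symmetric] rho2 .
  qed
  ultimately have "\<zeta> * t \<in> L" "(u * \<zeta>^3 + inverse u * t^3) / 2 \<in> L"
    using ab u(1,2) by (auto intro!: subfield_intros[OF L(1)])
  then have "psi (curve_a N) 1 (Some (x, y)) \<in> points (Ehat (curve_a N) 1) L"
    using psi_points[OF Q'(2)] psiQ by (auto simp: points_Ehat)
  moreover have "res_cocycle K L (kcocycle N z) = coboundary W L (Some (x, y))"
  proof -
    have "tors N (twist z (restrict \<sigma> (alg_cl K))) = ec_add W (act \<sigma> (Some (x, y))) (ec_neg (Some (x, y)))"
      if \<sigma>: "\<sigma> \<in> gal L" for \<sigma>
    proof -
      define \<sigma>' where "\<sigma>' = restrict \<sigma> (alg_cl K)"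
      have \<sigma>': "\<sigma>' \<in> gal K" unfolding \<sigma>'_def by (rule gal_restrict[OF complex_subfield_K L \<sigma>])
      have e: "\<sigma>' \<rho> = \<sigma> \<rho>" "\<sigma>' z = \<sigma> z" using rho_alg_cl z_alg by (simp_all add: \<sigma>'_def)
      define y' where "y' = twist z \<sigma>'"
      have y3: "y'^3 = 1" unfolding y'_def by (rule twist_cube[OF \<sigma>'])
      then have y0: "y' \<noteq> 0" by auto
      have yi: "inverse y' = y'^2"
        using y3 by (intro inverse_unique) (simp add: power2_eq_square power3_eq_cube mult.assoc)
      have fix_ab: "\<sigma> \<alpha> = \<alpha>" "\<sigma> \<beta> = \<beta>" using galD(5)[OF \<sigma>] ab by auto
      note h = gal_hom[OF L(1) \<sigma>] and c = gal_consts[OF L(1) \<sigma>]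
      define x' y'' where "x' = \<sigma> x" and "y'' = \<sigma> y"
      have act: "act \<sigma> (Some (x, y)) = Some (x', y'')" by (simp add: act_def x'_def y''_def)
      have on: "Some (x', y'') \<in> points W UNIV"
        using act_points[OF L(1) \<sigma> defined_over_E[OF L(1)] Qp] points_UNIV unfolding act by blast
      have x'0: "x' \<noteq> 0"
        using galD(7)[OF \<sigma> xy(1), of 0] Q'(1) c(1) i(1) by (simp add: x'_def)
      have coords: "3 * (y / x) + \<kappa> N * (1 - 3 * of_int 1 / x) = zq"
        "3 * (y / x) - \<kappa> N * (1 - 3 * of_int 1 / x) = tq"
        using Q'(3) by (auto simp: zt_coords_def)
      have k: "\<kappa> N \<in> alg_cl L" by (rule kappa_alg[OF L])
      have sc: "3 * (y'' / x') + \<sigma> (\<kappa> N) * (1 - 3 * of_int 1 / x') = \<sigma> zq"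
        "3 * (y'' / x') - \<sigma> (\<kappa> N) * (1 - 3 * of_int 1 / x') = \<sigma> tq"
        unfolding coords[symmetric] x'_def y''_def using xy k by (simp_all add: h i c)
      have sz: "\<sigma> zq = \<sigma> z * \<sigma> \<zeta>" "\<sigma> tq = inverse (\<sigma> z) * \<sigma> t"
        unfolding zq_def tq_def using zL zt_alg by (simp_all add: h i)
      have szt: "\<sigma> \<zeta> = \<alpha> + \<beta> * \<sigma> \<rho>" "\<sigma> t = \<alpha> - \<beta> * \<sigma> \<rho>"
        unfolding zt using ab LA rho_alg[OF L] fix_ab by (simp_all add: h i)
      \<comment> \<open>If \<open>\<sigma>\<close> changes the sign of \<open>\<rho>\<close>, it
        also changes that of \<open>\<kappa> N\<close>, so the two diagonal coordinates are
        exchanged. The inverse in the definition of \<open>twist\<close> compensates for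
        this.\<close>
      have "zt_coords (\<kappa> N) 1 x' y'' = (y' * zq, y'^2 * tq)"
      proof (cases "\<sigma> \<rho> = \<rho>")
        case True
        have z': "\<sigma> z = y' * z" using sigma_z(1)[OF \<sigma>'] True by (simp add: e y'_def)
        have "\<sigma> zq = y' * zq" "\<sigma> tq = y'^2 * tq"
          unfolding sz szt True z' unfolding zq_def tq_def zt yi[symmetric] by simp_all
        then show ?thesis using sc sigma_kappa(1)[OF L \<sigma> True] by (simp add: zt_coords_def)
      next
        case False
        then have m: "\<sigma> \<rho> = - \<rho>" using sigma_rho[OF \<sigma>'] by (simp add: e)
        have z': "\<sigma> z = inverse (y' * z)" using sigma_z(2)[OF \<sigma>'] m by (simp add: e y'_def)
        have "\<sigma> tq = y' * zq" "\<sigma> zq = y'^2 * tq"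
          unfolding sz szt m z' unfolding zq_def tq_def zt yi[symmetric] by simp_all
        then show ?thesis using sc sigma_kappa(2)[OF L \<sigma> m] by (simp add: zt_coords_def)
      qed
      note zc = this
      note tr = translate_zt[OF curve_a_nonzero[OF N(1)] kappa_square[OF N(1)] theta2 zeta3_theta kappa_theta_tau]
      have "Some (x', y'') = ec_add W (tors N y') (Some (x, y))"
      proof -
        consider "y' = 1" | "y' = zeta3" | "y' = zeta3^2" using cube_root_of_unity[OF y3] by blast
        then show ?thesis
        proof cases
          case 1
          then have "zt_coords (\<kappa> N) 1 x' y'' = zt_coords (\<kappa> N) 1 x y" using zc Q'(3) by simp
          then have "x' = x \<and> y'' = y"
            by (intro zt_coords_inject[OF x'0 Q'(1) kappa_nonzero]) auto
          then show ?thesis using 1 by (simp add: tors_def)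
        next
          case 2
          have "ec_add W (Some (x, y)) (Some (0, \<tau> N)) = Some (x', y'')"
            by (rule tr[OF Q'(2,1,3) on x'0]) (use zc 2 in simp)
          moreover have "tors N y' = Some (0, \<tau> N)" using 2 zeta3_neq by (simp add: tors_def)
          ultimately show ?thesis using ec_add_comm[OF Q'(2) T_point(1)] by simp
        next
          case 3
          \<comment> \<open>\<open>translate_zt\<close> covers only the factor \<open>zeta3\<close>;
            for \<open>zeta3^2\<close> it is applied backwards, from \<open>\<sigma> Q\<close> to
            \<open>Q\<close>.\<close>
          have "zeta3 * (zeta3^2 * zq) = zq" "zeta3^2 * ((zeta3^2)^2 * tq) = tq"
            using zeta3_cube by (simp_all add: power2_eq_square power3_eq_cube)
              (metis mult.assoc mult.left_neutral)+
          then have "ec_add W (Some (x', y'')) (Some (0, \<tau> N)) = Some (x, y)"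
            by (intro tr[OF on x'0 zc Q'(2,1)]) (use Q'(3) 3 in simp)
          then have "ec_add W (Some (x, y)) (Some (0, - \<tau> N)) = Some (x', y'')"
            using ec_add_cancel[OF iso.W on T_point(1)] by simp
          moreover have "tors N y' = Some (0, - \<tau> N)" using 3 zeta3_neq by (simp add: tors_def)
          ultimately show ?thesis using ec_add_comm[OF Q'(2) T_point(2)] by simp
        qed
      qed
      then show ?thesis
        using ec_add_cancel[OF iso.W tors_points Q'(2)] unfolding act
        by (simp add: y'_def \<sigma>'_def del: ec_neg.simps)
    qed
    then show ?thesis
      using gal_restrict[OF complex_subfield_K L]
      by (auto simp: res_cocycle_def coboundary_def kcocycle_def fun_eq_iff simp del: ec_neg.simps ec_add.simps)
  qed
  ultimately show ?thesis using Qp by blast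
qed

end

end

subsection \<open>Complete non-archimedean fields\<close>

locale nonarch_field =
  fixes L :: "complex set" and w :: "complex \<Rightarrow> real"
  assumes L: "complex_subfield L" and w: "nonarch_abs L w"
begin

lemmas L_intros = subfield_intros[OF L]

lemma w_nonneg: "x \<in> L \<Longrightarrow> w x \<ge> 0" and w_eq_0: "x \<in> L \<Longrightarrow> w x = 0 \<longleftrightarrow> x = 0"
  and w_mult: "x \<in> L \<Longrightarrow> y \<in> L \<Longrightarrow> w (x * y) = w x * w y"
  and w_add: "x \<in> L \<Longrightarrow> y \<in> L \<Longrightarrow> w (x + y) \<le> max (w x) (w y)"
  using w by (auto simp: nonarch_abs_def)

lemma w_0 [simp]: "w 0 = 0"
  using w_eq_0[of 0] L_intros(1) by simp

lemma w_1 [simp]: "w 1 = 1"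
  using w_mult[of 1 1] w_eq_0[of 1] L_intros(2) by simp

lemma w_uminus: "x \<in> L \<Longrightarrow> w (- x) = w x"
proof -
  assume x: "x \<in> L"
  have m: "- 1 \<in> L" using L_intros(5)[of 1] L_intros(2) by simp
  have "w (- 1) * w (- 1) = 1" using w_mult[OF m m] by simp
  then have "w (- 1) = 1" using w_nonneg[OF m] by (simp add: square_eq_1_iff)
  then show ?thesis using w_mult[OF m x] by simp
qed

lemma w_diff: "x \<in> L \<Longrightarrow> y \<in> L \<Longrightarrow> w (x - y) \<le> max (w x) (w y)"
  using w_add[of x "- y"] w_uminus[of y] L_intros(5)[of y] by simp

lemma w_inverse: "x \<in> L \<Longrightarrow> w (inverse x) = inverse (w x)"
proof (cases "x = 0")
  case False
  assume x: "x \<in> L"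
  have "w x * w (inverse x) = 1"
    using w_mult[OF x L_intros(6)[OF x]] False by simp
  then show ?thesis by (simp add: inverse_unique)
qed simp

lemma w_divide: "x \<in> L \<Longrightarrow> y \<in> L \<Longrightarrow> w (x / y) = w x / w y"
  using w_mult[of x "inverse y"] w_inverse[of y] L_intros(6)[of y] by (simp add: divide_inverse)

lemma w_power: "x \<in> L \<Longrightarrow> w (x ^ n) = w x ^ n"
  by (induction n) (auto simp: w_mult L_intros(9))

text \<open>The valuation ring, followed by its maximal ideal \<open>vm\<close>.\<close>

definition vr :: "complex set" where "vr = {x \<in> L. w x \<le> 1}"

definition vm :: "complex set" where "vm = {x \<in> L. w x < 1}"

lemma vr_L: "x \<in> vr \<Longrightarrow> x \<in> L" and vm_vr: "x \<in> vm \<Longrightarrow> x \<in> vr"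
  by (auto simp: vr_def vm_def)

lemma vr_0 [simp]: "0 \<in> vr" and vr_1 [simp]: "1 \<in> vr"
  by (simp_all add: vr_def L_intros)

lemma vr_add: "x \<in> vr \<Longrightarrow> y \<in> vr \<Longrightarrow> x + y \<in> vr"
  using w_add[of x y] by (auto simp: vr_def intro: L_intros)

lemma vr_diff: "x \<in> vr \<Longrightarrow> y \<in> vr \<Longrightarrow> x - y \<in> vr"
  using w_diff[of x y] by (auto simp: vr_def intro: L_intros)

lemma vr_uminus: "x \<in> vr \<Longrightarrow> - x \<in> vr"
  using w_uminus[of x] by (auto simp: vr_def intro: L_intros)

lemma vr_mult: "x \<in> vr \<Longrightarrow> y \<in> vr \<Longrightarrow> x * y \<in> vr"
  by (auto simp: vr_def w_mult w_nonneg mult_le_one intro: L_intros)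

lemma vr_power: "x \<in> vr \<Longrightarrow> x ^ n \<in> vr"
  by (induction n) (auto intro: vr_mult)

lemma vr_of_nat [simp]: "of_nat n \<in> vr"
  by (induction n) (auto intro: vr_add)

lemma vr_numeral [simp]: "numeral n \<in> vr"
  using vr_of_nat[of "numeral n"] by simp

lemma vr_of_int [simp]: "of_int n \<in> vr"
  by (cases n rule: int_cases) (auto intro: vr_uminus simp del: of_nat_Suc)

lemmas vr_intros = vr_0 vr_1 vr_add vr_diff vr_uminus vr_mult vr_power vr_of_nat vr_numeral vr_of_int

lemma vm_0 [simp]: "0 \<in> vm" by (simp add: vm_def L_intros)

lemma vm_1 [simp]: "1 \<notin> vm" by (simp add: vm_def)

lemma vm_add: "x \<in> vm \<Longrightarrow> y \<in> vm \<Longrightarrow> x + y \<in> vm"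
  using w_add[of x y] by (auto simp: vm_def intro: L_intros)

lemma vm_diff: "x \<in> vm \<Longrightarrow> y \<in> vm \<Longrightarrow> x - y \<in> vm"
  using w_diff[of x y] by (auto simp: vm_def intro: L_intros)

lemma vm_uminus: "x \<in> vm \<Longrightarrow> - x \<in> vm"
  using w_uminus[of x] by (auto simp: vm_def intro: L_intros)

lemma vm_mult: "x \<in> vr \<Longrightarrow> y \<in> vm \<Longrightarrow> x * y \<in> vm"
proof -
  assume *: "x \<in> vr" "y \<in> vm"
  have "w x * w y \<le> 1 * w y" using * by (intro mult_right_mono) (auto simp: vr_def vm_def w_nonneg)
  then show ?thesis using * by (auto simp: vr_def vm_def w_mult intro: L_intros)
qed

lemma vm_mult': "x \<in> vm \<Longrightarrow> y \<in> vr \<Longrightarrow> x * y \<in> vm"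
  using vm_mult[of y x] by (simp add: mult.commute)

lemma unit_iff: "x \<in> vr \<Longrightarrow> x \<notin> vm \<longleftrightarrow> w x = 1"
  by (auto simp: vr_def vm_def)

lemma vm_mult_iff: "x \<in> vr \<Longrightarrow> y \<in> vr \<Longrightarrow> x * y \<in> vm \<longleftrightarrow> x \<in> vm \<or> y \<in> vm"
  using unit_iff[of x] unit_iff[of y] unit_iff[of "x * y"] vr_mult[of x y] w_mult[of x y]
    vm_mult[of x y] vm_mult'[of x y] by (auto simp: vr_L)

lemma vm_power_iff: "x \<in> vr \<Longrightarrow> n > 0 \<Longrightarrow> x ^ n \<in> vm \<longleftrightarrow> x \<in> vm"
proof (induction n)
  case (Suc n)
  then show ?case by (cases "n = 0") (auto simp: vm_mult_iff vr_power)
qed simp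

lemma unit_mult: "x \<in> vr \<Longrightarrow> y \<in> vr \<Longrightarrow> x \<notin> vm \<Longrightarrow> y \<notin> vm \<Longrightarrow> x * y \<notin> vm"
  by (simp add: vm_mult_iff)

lemma unit_inverse: "x \<in> vr \<Longrightarrow> x \<notin> vm \<Longrightarrow> inverse x \<in> vr \<and> inverse x \<notin> vm"
  by (auto simp: unit_iff vr_def w_inverse vm_def intro: L_intros)

lemma unit_nonzero: "x \<notin> vm \<Longrightarrow> x \<noteq> 0"
  by auto

lemma unit_add_vm: "x \<notin> vm \<Longrightarrow> y \<in> vm \<Longrightarrow> x + y \<notin> vm"
  using vm_diff[of "x + y" y] by auto

lemma unit_divide: "x \<in> vr \<Longrightarrow> y \<in> vr \<Longrightarrow> y \<notin> vm \<Longrightarrow> x / y \<in> vr"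
  using unit_inverse[of y] vr_mult[of x "inverse y"] by (simp add: divide_inverse)

text \<open>Congruence modulo the maximal ideal. Integrality of both sides is part of it, so that
  calculations in the residue field carry it along.\<close>

definition ceq :: "complex \<Rightarrow> complex \<Rightarrow> bool" (infix "\<doteq>" 50) where
  "x \<doteq> y \<longleftrightarrow> x \<in> vr \<and> y \<in> vr \<and> x - y \<in> vm"

lemma ceqD: "x \<doteq> y \<Longrightarrow> x \<in> vr" "x \<doteq> y \<Longrightarrow> y \<in> vr" "x \<doteq> y \<Longrightarrow> x - y \<in> vm"
  by (auto simp: ceq_def)

lemma ceq_refl [simp]: "x \<in> vr \<Longrightarrow> x \<doteq> x" by (simp add: ceq_def)

lemma ceq_sym: "x \<doteq> y \<Longrightarrow> y \<doteq> x"
  using vm_uminus[of "x - y"] by (auto simp: ceq_def)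

lemma ceq_trans [trans]: "x \<doteq> y \<Longrightarrow> y \<doteq> z \<Longrightarrow> x \<doteq> z"
  using vm_add[of "x - y" "y - z"] by (auto simp: ceq_def)

lemma ceq_add: "x \<doteq> y \<Longrightarrow> x' \<doteq> y' \<Longrightarrow> x + x' \<doteq> y + y'"
  using vm_add[of "x - y" "x' - y'"] by (auto simp: ceq_def intro: vr_add) (simp add: algebra_simps)

lemma ceq_diff: "x \<doteq> y \<Longrightarrow> x' \<doteq> y' \<Longrightarrow> x - x' \<doteq> y - y'"
  using vm_diff[of "x - y" "x' - y'"] by (auto simp: ceq_def intro: vr_diff) (simp add: algebra_simps)

lemma ceq_mult: "x \<doteq> y \<Longrightarrow> x' \<doteq> y' \<Longrightarrow> x * x' \<doteq> y * y'"
proof -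
  assume *: "x \<doteq> y" "x' \<doteq> y'"
  have "x * x' - y * y' = x * (x' - y') + (x - y) * y'" by (simp add: algebra_simps)
  moreover have "\<dots> \<in> vm" using * by (intro vm_add vm_mult vm_mult') (auto dest: ceqD)
  ultimately show ?thesis using * by (auto simp: ceq_def intro: vr_mult)
qed

lemma ceq_power: "x \<doteq> y \<Longrightarrow> x ^ n \<doteq> y ^ n"
  by (induction n) (auto intro: ceq_mult)

lemma ceq_0: "x \<in> vr \<Longrightarrow> x \<doteq> 0 \<longleftrightarrow> x \<in> vm" by (simp add: ceq_def)

lemma ceq_vm: "x \<doteq> y \<Longrightarrow> x \<in> vm \<longleftrightarrow> y \<in> vm"
  using vm_add[of "x - y" y] vm_diff[of x "x - y"] by (auto simp: ceq_def)

lemma ceq_cancel: "c * x \<doteq> c * y \<Longrightarrow> c \<in> vr \<Longrightarrow> c \<notin> vm \<Longrightarrow> x \<in> vr \<Longrightarrow> y \<in> vr \<Longrightarrow> x \<doteq> y"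
  using vm_mult_iff[of c "x - y"] vr_diff[of x y] by (auto simp: ceq_def right_diff_distrib)

lemmas ceq_intros = ceq_add ceq_diff ceq_mult ceq_power

end

locale complete_nonarch_field = nonarch_field +
  assumes complete: "Metric_space.mcomplete L (abs_dist L w)"
begin

text \<open>The root is the limit of the contracting iteration \<open>x \<mapsto> - (c0 + c2 x\<^sup>2 + c3 x\<^sup>3) / c1\<close>.\<close>

lemma hensel_cubic:
  assumes c: "c0 \<in> vm" "c1 \<in> vr" "c1 \<notin> vm" "c2 \<in> vr" "c3 \<in> vr"
  shows "\<exists>x\<in>vm. c3 * x^3 + c2 * x^2 + c1 * x + c0 = 0"
proof -
  interpret MS: Metric_space L "abs_dist L w" by (rule Metric_space_abs_dist[OF L w])
  define f where "f = (\<lambda>x. - (c0 + c2 * x^2 + c3 * x^3) / c1)"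
  define q where "q = w c0"
  have q: "0 \<le> q" "q < 1" using c(1) w_nonneg by (auto simp: q_def vm_def)
  have c1: "w c1 = 1" "c1 \<noteq> 0" "c1 \<in> L" using c unit_iff vr_L by auto
  \<comment> \<open>The iteration maps the ball of radius \<open>q = w c0 < 1\<close> to itself and
    contracts it by the factor \<open>q\<close>, because \<open>c2 x^2 + c3 x^3\<close> has no
    linear term.\<close>
  define B where "B = {x \<in> L. w x \<le> q}"
  have Bvr: "x \<in> vr" if "x \<in> B" for x using that q by (auto simp: B_def vr_def)
  have small: "w (c * x) \<le> w x" if "c \<in> vr" "x \<in> L" for c x
    using that mult_right_mono[of "w c" 1 "w x"] by (auto simp: vr_def w_mult w_nonneg)
  have fB: "f x \<in> B" if x: "x \<in> B" for x
  proof -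
    have xL: "x \<in> L" and xq: "w x \<le> q" using x by (auto simp: B_def)
    have cL: "c0 \<in> L" "c2 \<in> L" "c3 \<in> L" using c by (auto simp: vr_def vm_def)
    have "w (c2 * x^2) \<le> w (x^2)" "w (c3 * x^3) \<le> w (x^3)"
      using small c xL by (auto intro: L_intros)
    moreover have "w (x^2) \<le> q" "w (x^3) \<le> q"
    proof -
      have "w x ^ 2 \<le> w x ^ 1" "w x ^ 3 \<le> w x ^ 1"
        using xL xq q w_nonneg by (intro power_decreasing; force)+
      then show "w (x^2) \<le> q" "w (x^3) \<le> q" using xq by (auto simp: w_power[OF xL])
    qed
    moreover have "w (c0 + c2 * x^2 + c3 * x^3) \<le> max (max (w c0) (w (c2 * x^2))) (w (c3 * x^3))"
      using cL xL by (intro order.trans[OF w_add] max.mono w_add) (auto intro!: L_intros)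
    ultimately have "w (c0 + c2 * x^2 + c3 * x^3) \<le> q" by (simp add: q_def)
    moreover have "c0 + c2 * x^2 + c3 * x^3 \<in> L" using cL xL by (auto intro!: L_intros)
    ultimately show ?thesis
      using c1 w_divide[of "- (c0 + c2 * x^2 + c3 * x^3)" c1] w_uminus[of "c0 + c2 * x^2 + c3 * x^3"]
      by (simp add: f_def B_def L_intros(5,8) del: minus_add_distrib)
  qed
  have contr: "w (f x - f y) \<le> q * w (x - y)" if x: "x \<in> B" and y: "y \<in> B" for x y
  proof -
    have xy: "x \<in> L" "y \<in> L" "w x \<le> q" "w y \<le> q" using x y by (auto simp: B_def)
    note xyv = Bvr[OF x] Bvr[OF y]
    define g where "g = - (c2 * (x + y) + c3 * (x * (x + y) + y * y)) / c1"
    have "f x - f y = g * (x - y)"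
      using c1(2) by (simp add: f_def g_def field_simps power2_eq_square power3_eq_cube)
    moreover have "w g \<le> q"
    proof -
      have s: "w (x + y) \<le> q" "x + y \<in> L" using w_add[OF xy(1,2)] xy by (auto intro: L_intros)
      have "w (c2 * (x + y)) \<le> q" using small[OF c(4) s(2)] s(1) by simp
      moreover have "w (x * (x + y) + y * y) \<le> q"
        using small[OF xyv(1) s(2)] small[OF xyv(2) xy(2)] s(1) xy(4)
          w_add[of "x * (x + y)" "y * y"] xy(1,2) s(2) by (fastforce intro: L_intros)
      then have "w (c3 * (x * (x + y) + y * y)) \<le> q"
        using small[OF c(5), of "x * (x + y) + y * y"] xy(1,2) by (fastforce intro: L_intros)
      ultimately have "w (c2 * (x + y) + c3 * (x * (x + y) + y * y)) \<le> q"
        using w_add[of "c2 * (x + y)" "c3 * (x * (x + y) + y * y)"] c xy(1,2)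
        by (fastforce simp: vr_L intro: L_intros)
      moreover have "c2 * (x + y) + c3 * (x * (x + y) + y * y) \<in> L"
        using c xy(1,2) by (auto simp: vr_L intro!: L_intros)
      ultimately show ?thesis
        using c1 w_divide[of "- (c2 * (x + y) + c3 * (x * (x + y) + y * y))" c1]
          w_uminus[of "c2 * (x + y) + c3 * (x * (x + y) + y * y)"]
        by (simp add: g_def L_intros(5) del: minus_add_distrib)
    qed
    moreover have "g \<in> L" unfolding g_def using c xy(1,2) c1 by (auto simp: vr_L intro!: L_intros)
    ultimately show ?thesis
      using xy w_nonneg[of "x - y"] by (simp add: w_mult L_intros(7) mult_right_mono)
  qed
  define s where "s = (\<lambda>n. (f ^^ n) 0)"
  have sB: "s n \<in> B" for n
  proof (induction n)
    case 0
    then show ?case using q by (simp add: s_def B_def L_intros(1))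
  next
    case (Suc n)
    then show ?case using fB by (simp add: s_def)
  qed
  have sL: "s n \<in> L" for n using sB by (auto simp: B_def)
  have step: "w (s (n + k) - s n) \<le> q ^ n" for n k
  proof (induction n)
    case 0
    have "s 0 = 0" by (simp add: s_def)
    then show ?case using sB[of k] q by (auto simp: B_def)
  next
    case (Suc n)
    have "w (s (Suc n + k) - s (Suc n)) = w (f (s (n + k)) - f (s n))" by (simp add: s_def)
    also have "\<dots> \<le> q * w (s (n + k) - s n)" by (rule contr[OF sB sB])
    also have "\<dots> \<le> q * q ^ n" using Suc q by (intro mult_left_mono)
    finally show ?case by simp
  qed
  have dist: "abs_dist L w a b = w (a - b)" if "a \<in> L" "b \<in> L" for a b
    using that by (simp add: abs_dist_def)
  have qlim: "\<exists>N. \<forall>n\<ge>N. q ^ n < e" if "e > 0" for e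
  proof -
    have "(\<lambda>n. q ^ n) \<longlonglongrightarrow> 0" using q by (intro LIMSEQ_realpow_zero)
    then show ?thesis using LIMSEQ_D[of _ 0 e] that q by fastforce
  qed
  have "MS.MCauchy s"
    unfolding MS.MCauchy_def
  proof (intro conjI allI impI)
    show "range s \<subseteq> L" using sL by auto
    fix e :: real assume "e > 0"
    then obtain N where N: "\<And>n. n \<ge> N \<Longrightarrow> q ^ n < e" using qlim by blast
    have "abs_dist L w (s n) (s n') < e" if "N \<le> n" "N \<le> n'" for n n'
    proof -
      have a: "w (s n'' - s N) < e" if "N \<le> n''" for n''
      proof -
        have "w (s (N + (n'' - N)) - s N) \<le> q ^ N" by (rule step)
        then show ?thesis using N[of N] \<open>N \<le> n''\<close> by simp
      qed
      have "w (s n - s n') = w ((s n - s N) - (s n' - s N))" by simp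
      also have "\<dots> \<le> max (w (s n - s N)) (w (s n' - s N))"
        by (intro w_diff L_intros(7) sL)
      finally have "w (s n - s n') < e" using a[of n] a[of n'] \<open>N \<le> n\<close> \<open>N \<le> n'\<close> by simp
      then show ?thesis by (simp add: dist sL)
    qed
    then show "\<exists>N. \<forall>n n'. N \<le> n \<longrightarrow> N \<le> n' \<longrightarrow> abs_dist L w (s n) (s n') < e" by blast
  qed
  then obtain x where "limitin MS.mtopology s x sequentially" using complete MS.mcomplete_def by blast
  then have x: "x \<in> L" and lim: "\<And>e. e > 0 \<Longrightarrow> \<exists>N. \<forall>n\<ge>N. w (s n - x) < e"
    unfolding MS.limit_metric_sequentially by (auto simp: dist sL)
  \<comment> \<open>By the ultrametric inequality the limit stays in the ball, so that the
    contraction estimate applies to it as well.\<close>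
  have xB: "x \<in> B"
  proof (rule ccontr)
    assume "x \<notin> B"
    then have "w x > q" using x by (simp add: B_def)
    then have "w x > 0" using q by simp
    then obtain n where n: "w (s n - x) < w x" using lim by blast
    have "w x = w (s n - (s n - x))" by simp
    also have "\<dots> \<le> max (w (s n)) (w (s n - x))" by (intro w_diff sL L_intros(7) x)
    finally show False using sB[of n] n \<open>w x > q\<close> by (auto simp: B_def)
  qed
  have "w (x - f x) = 0"
  proof (rule ccontr)
    assume "w (x - f x) \<noteq> 0"
    have fx: "f x \<in> L" using fB[OF xB] by (simp add: B_def)
    then have pos: "w (x - f x) > 0" using \<open>w (x - f x) \<noteq> 0\<close> w_nonneg[of "x - f x"] x L_intros(7) by force
    then obtain N where N: "\<And>n. n \<ge> N \<Longrightarrow> w (s n - x) < w (x - f x)" using lim by blast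
    have "w (f (s N) - f x) \<le> q * w (s N - x)" by (rule contr[OF sB xB])
    also have "\<dots> \<le> 1 * w (s N - x)"
      using q w_nonneg[of "s N - x"] sL x L_intros(7) by (intro mult_right_mono) auto
    finally have a: "w (s (Suc N) - f x) < w (x - f x)" using N[of N] by (simp add: s_def)
    have "w (x - f x) = w ((s (Suc N) - f x) - (s (Suc N) - x))" by simp
    also have "\<dots> \<le> max (w (s (Suc N) - f x)) (w (s (Suc N) - x))"
      by (intro w_diff L_intros(7) sL fx x)
    finally show False using a N[of "Suc N"] by simp
  qed
  then have "x = f x" using w_eq_0[of "x - f x"] fB[OF xB] x L_intros(7) by (force simp: B_def)
  then have "c1 * x = - (c0 + c2 * x^2 + c3 * x^3)" using c1 by (simp add: f_def field_simps)
  then have "c3 * x^3 + c2 * x^2 + c1 * x + c0 = 0" by (simp add: algebra_simps)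
  moreover have "x \<in> vm" using xB q by (auto simp: B_def vm_def)
  ultimately show ?thesis by blast
qed

text \<open>Taylor expansion at the approximate root \<open>x0\<close>, where the derivative is a
  unit. With \<open>c3 = 0\<close> the lemma also serves quadratic equations.\<close>

lemma hensel_cubic_shift:
  assumes "c0 \<in> vr" "c1 \<in> vr" "c2 \<in> vr" "c3 \<in> vr" "x0 \<in> vr"
    and "c3 * x0^3 + c2 * x0^2 + c1 * x0 + c0 \<in> vm"
    and "3 * c3 * x0^2 + 2 * c2 * x0 + c1 \<notin> vm"
  shows "\<exists>x\<in>vr. x - x0 \<in> vm \<and> c3 * x^3 + c2 * x^2 + c1 * x + c0 = 0"
proof -
  have "\<exists>y\<in>vm. c3 * y^3 + (3 * c3 * x0 + c2) * y^2 + (3 * c3 * x0^2 + 2 * c2 * x0 + c1) * y +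
      (c3 * x0^3 + c2 * x0^2 + c1 * x0 + c0) = 0"
    using assms by (intro hensel_cubic) (auto intro!: vr_intros)
  then obtain y where y: "y \<in> vm" "c3 * y^3 + (3 * c3 * x0 + c2) * y^2 +
      (3 * c3 * x0^2 + 2 * c2 * x0 + c1) * y + (c3 * x0^3 + c2 * x0^2 + c1 * x0 + c0) = 0" by blast
  have "c3 * (x0 + y)^3 + c2 * (x0 + y)^2 + c1 * (x0 + y) + c0 = 0"
    using y(2) by Groebner_Basis.algebra
  then show ?thesis using y(1) assms(5) by (intro bexI[of _ "x0 + y"]) (auto intro: vr_add vm_vr)
qed

end

text \<open>A completion of \<open>K\<close> has a finite residue field, because every element of \<open>K\<close> satisfies an
  integral quadratic equation which does not vanish modulo the residue characteristic.\<close>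

locale K_completion = complete_nonarch_field +
  fixes v
  assumes prime: "finite_prime K v" and compl: "completion_of K v L w"
begin

lemma K_sub: "K \<subseteq> L" and w_eq_v: "x \<in> K \<Longrightarrow> w x = v x"
  using compl by (auto simp: completion_of_def)

lemma K_dense: "x \<in> L \<Longrightarrow> e > 0 \<Longrightarrow> \<exists>y\<in>K. w (x - y) < e"
proof -
  interpret MS: Metric_space L "abs_dist L w" by (rule Metric_space_abs_dist[OF L w])
  assume "x \<in> L" "e > 0"
  then have "x \<in> MS.mtopology closure_of K" using compl by (simp add: completion_of_def)
  then have "\<exists>y\<in>K. y \<in> MS.mball x e" using \<open>e > 0\<close> unfolding MS.metric_closure_of by blast
  then show ?thesis using K_sub by (auto simp: MS.in_mball abs_dist_def)
qed

lemma K_quadratic: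
  assumes "x \<in> K"
  shows "\<exists>n m l :: int. n > 0 \<and> of_int n * x^2 + of_int m * x + of_int l = 0"
proof -
  obtain r s where x: "x = of_rat r + of_rat s * zeta3" using assms by (auto simp: K_def)
  obtain a b where r: "r = of_int a / of_int b" "b > 0" by (metis quotient_of_div quotient_of_denom_pos surj_pair)
  obtain c d where s: "s = of_int c / of_int d" "d > 0" by (metis quotient_of_div quotient_of_denom_pos surj_pair)
  define n where "n = b * d"
  define A C where "A = a * d" and "C = c * b"
  have n: "n > 0" using r s by (simp add: n_def)
  have nx: "of_int n * x = of_int A + of_int C * zeta3"
  proof -
    have *: "of_int a = complex_of_int b * of_rat r" "of_int c = complex_of_int d * of_rat s"
      using r s by (simp_all add: of_rat_divide)
    show ?thesis unfolding x n_def A_def C_def of_int_mult * by (simp add: algebra_simps)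
  qed
  have "(of_int n * x)^2 - (2 * of_int A - of_int C) * (of_int n * x) +
      (of_int A^2 - of_int A * of_int C + of_int C^2) = 0"
    unfolding nx using zeta3_square by Groebner_Basis.algebra
  then have "of_int (n^2) * x^2 + of_int (- (2 * A - C) * n) * x + of_int (A^2 - A * C + C^2) = 0"
    by (simp add: power_mult_distrib algebra_simps)
  moreover have "n^2 > 0" using n by simp
  ultimately show ?thesis by blast
qed

text \<open>If every nonzero integer were a unit, the quadratic equation of an element of
  \<open>K\<close> would bound its absolute value by 1. Applied to the inverse as well, this would
  make \<open>v\<close> trivial.\<close>

lemma residue_char: "\<exists>p::nat. p > 0 \<and> of_nat p \<in> vm"
proof (rule ccontr)
  assume no: "\<not> ?thesis"
  have unit: "w (of_int n) = 1" if "n \<noteq> 0" for n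
  proof -
    have "nat \<bar>n\<bar> > 0" using that by simp
    then have "of_nat (nat \<bar>n\<bar>) \<notin> vm" using no by blast
    then have "w (of_nat (nat \<bar>n\<bar>)) = 1" using unit_iff[OF vr_of_nat] by blast
    moreover have "w (of_nat (nat \<bar>n\<bar>)) = w (of_int n)"
      using w_uminus[of "of_int n"] L_intros(12) by (cases "n \<ge> 0") auto
    ultimately show ?thesis by simp
  qed
  then have le1: "w (of_int n) \<le> 1" for n by (cases "n = 0") auto
  have K1: "w x \<le> 1" if x: "x \<in> K" for x
  proof (rule ccontr)
    assume "\<not> w x \<le> 1"
    then have g: "w x > 1" by simp
    have xL: "x \<in> L" using x K_sub by blast
    obtain n m l :: int where n: "n > 0" and e: "of_int n * x^2 + of_int m * x + of_int l = 0"
      using K_quadratic[OF x] by blast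
    have "of_int n * x^2 = - (of_int m * x + of_int l)" using e by (simp only: eq_neg_iff_add_eq_0 add.assoc)
    then have "w (of_int n * x^2) = w (of_int m * x + of_int l)"
      using w_uminus[of "of_int m * x + of_int l"] xL L_intros by simp
    also have "\<dots> \<le> max (w (of_int m * x)) (w (of_int l))" using xL by (intro w_add L_intros)
    also have "\<dots> \<le> w x"
    proof -
      have "w (of_int m) * w x \<le> 1 * w x" using le1 xL w_nonneg by (intro mult_right_mono) auto
      then show ?thesis using le1[of l] g xL by (simp add: w_mult L_intros(12))
    qed
    finally have "w x ^ 2 \<le> w x" using unit[of n] n xL by (simp add: w_mult w_power L_intros)
    then show False using g by (simp add: power2_eq_square mult_le_cancel_left1)
  qed
  obtain x where x: "x \<in> K" "x \<noteq> 0" "w x \<noteq> 1"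
    using prime w_eq_v unfolding finite_prime_def by metis
  have "w (inverse x) \<le> 1" by (rule K1) (use x K_intros in auto)
  then have "inverse (w x) \<le> 1" using x K_sub w_inverse[of x] by auto
  moreover have "w x \<le> 1" "w x > 0" using K1[OF x(1)] x w_nonneg[of x] w_eq_0[of x] K_sub by force+
  ultimately show False using x(3) by (simp add: inverse_le_1_iff)
qed

text \<open>The choice depends only on the residue class, so equality of representatives is
  congruence. The set \<open>k0\<close> then plays the role of the residue field, and its elements
  can be counted.\<close>

definition rep :: "complex \<Rightarrow> complex" where "rep x = (SOME y. x \<doteq> y)"

definition k0 :: "complex set" where "k0 = rep ` vr"

lemma rep: "x \<in> vr \<Longrightarrow> x \<doteq> rep x"
  unfolding rep_def by (rule someI[of _ x]) simp

lemma rep_vr: "x \<in> vr \<Longrightarrow> rep x \<in> vr"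
  using rep ceqD by blast

lemma rep_eq_iff: "x \<in> vr \<Longrightarrow> y \<in> vr \<Longrightarrow> rep x = rep y \<longleftrightarrow> x \<doteq> y"
proof
  assume "x \<in> vr" "y \<in> vr" "rep x = rep y"
  then show "x \<doteq> y" using rep[of x] rep[of y] ceq_sym ceq_trans by metis
next
  assume "x \<doteq> y"
  then have "(\<lambda>z. x \<doteq> z) = (\<lambda>z. y \<doteq> z)" using ceq_sym ceq_trans by blast
  then show "rep x = rep y" by (simp add: rep_def)
qed

lemma rep_k0: "x \<in> vr \<Longrightarrow> rep x \<in> k0" by (simp add: k0_def)

lemma k0_vr: "x \<in> k0 \<Longrightarrow> x \<in> vr"
  using rep_vr by (auto simp: k0_def)

lemma k0_eq: "x \<in> k0 \<Longrightarrow> y \<in> k0 \<Longrightarrow> x \<doteq> y \<Longrightarrow> x = y"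
proof -
  assume "x \<in> k0" "y \<in> k0" and xy: "x \<doteq> y"
  then obtain a b where ab: "a \<in> vr" "x = rep a" "b \<in> vr" "y = rep b" by (auto simp: k0_def)
  have "a \<doteq> b"
    using ceq_trans[OF rep[OF ab(1)]] ceq_trans[OF xy ceq_sym[OF rep[OF ab(3)], folded ab(4)]] ab(2) by blast
  then show ?thesis using ab rep_eq_iff by simp
qed

lemma rep_in_k0: "x \<in> k0 \<Longrightarrow> rep x = x"
  using k0_eq[OF rep_k0[OF k0_vr]] ceq_sym[OF rep[OF k0_vr]] by blast

text \<open>By density every residue class contains an element of \<open>K\<close>. Reducing its
  equation leaves finitely many nonzero coefficient triples, each with at most two roots in
  \<open>k0\<close>.\<close>

theorem finite_k0: "finite k0"
proof -
  \<comment> \<open>Minimality makes every integer strictly between 0 and \<open>p\<close> a unit,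
    which takes the place of primality.\<close>
  define p where "p = (LEAST p::nat. p > 0 \<and> of_nat p \<in> vm)"
  have p: "p > 0" "of_nat p \<in> vm"
    using LeastI_ex[OF residue_char] by (auto simp: p_def)
  have pmin: "of_nat n \<notin> vm" if "0 < n" "n < p" for n
    using not_less_Least[of n "\<lambda>p. p > 0 \<and> of_nat p \<in> vm"] that by (auto simp: p_def)
  define T where "T = {0..<p} \<times> {0..<p} \<times> {0..<p} - {(0, 0, 0)}"
  define Z where "Z = (\<lambda>(a, b, c). {r \<in> k0. of_nat a * r^2 + of_nat b * r + of_nat c \<in> vm})"
  have "k0 \<subseteq> (\<Union>t\<in>T. Z t)"
  proof
    fix r assume r: "r \<in> k0"
    have rL: "r \<in> vr" "r \<in> L" using k0_vr[OF r] vr_L by auto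
    obtain x where x: "x \<in> K" "w (r - x) < 1" using K_dense[OF rL(2), of 1] by auto
    then have rx: "r - x \<in> vm" using rL K_sub by (auto simp: vm_def intro: L_intros)
    then have "x \<in> vr" using vr_diff[OF rL(1) vm_vr[OF rx]] by simp
    then have rx': "r \<doteq> x" using rL rx by (simp add: ceq_def)
    define P where "P = (\<lambda>n::nat. n > 0 \<and> (\<exists>m l :: int. of_nat n * x^2 + of_int m * x + of_int l = 0))"
    have "\<exists>n. P n"
    proof -
      obtain n m l :: int where n: "n > 0" "of_int n * x^2 + of_int m * x + of_int l = 0"
        using K_quadratic[OF x(1)] by blast
      then have "P (nat n)" unfolding P_def by auto
      then show ?thesis by blast
    qed
    \<comment> \<open>With the least positive leading coefficient the three coefficients cannot all
      be divisible by \<open>p\<close>.\<close>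
    define n where "n = (LEAST n. P n)"
    have "P n" using LeastI_ex[OF \<open>\<exists>n. P n\<close>] by (simp add: n_def)
    then obtain m l :: int where n: "n > 0" and e: "of_nat n * x^2 + of_int m * x + of_int l = 0"
      by (auto simp: P_def)
    define a b c where "a = n mod p" and "b = nat (m mod int p)" and "c = nat (l mod int p)"
    have abc: "(a, b, c) \<in> T"
    proof -
      have "(a, b, c) \<noteq> (0, 0, 0)"
      proof
        assume "(a, b, c) = (0, 0, 0)"
        then have 0: "n mod p = 0" "m mod int p = 0" "l mod int p = 0"
          using pos_mod_sign[of "int p"] p(1) unfolding a_def b_def c_def
          by (auto simp: order.antisym)
        then obtain n' m' l' where d: "n = p * n'" "m = int p * m'" "l = int p * l'"
          by (auto simp: mod_eq_0_iff_dvd dvd_def)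
        have "of_nat p * (of_nat n' * x^2 + of_int m' * x + of_int l') = 0"
          using e unfolding d by (simp add: algebra_simps)
        then have "of_nat n' * x^2 + of_int m' * x + of_int l' = 0" using p(1) by simp
        moreover have "n' > 0" using n d by (cases n') auto
        ultimately have "P n'" by (auto simp: P_def)
        then have "n \<le> n'" unfolding n_def by (rule Least_le)
        moreover have "p > 1"
        proof (rule ccontr)
          assume "\<not> p > 1"
          then have "p = 1" using p(1) by simp
          then show False using p(2) by simp
        qed
        ultimately show False using d(1) \<open>n' > 0\<close> by simp
      qed
      moreover have "a < p" "b < p" "c < p" using p(1) by (auto simp: a_def b_def c_def nat_less_iff)
      ultimately show ?thesis by (simp add: T_def)
    qed
    have ca: "of_nat a \<doteq> of_nat n" "of_nat b \<doteq> of_int m" "of_nat c \<doteq> of_int l"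
    proof -
      have "(of_nat n :: complex) = of_nat (p * (n div p) + n mod p)" by simp
      also have "\<dots> = of_nat p * of_nat (n div p) + of_nat (n mod p)" by (simp only: of_nat_add of_nat_mult)
      finally have "of_nat a - of_nat n = - (of_nat p * of_nat (n div p) :: complex)" by (simp add: a_def)
      then show "of_nat a \<doteq> of_nat n" using p(2) by (simp add: ceq_def vm_uminus vm_mult')
      have *: "of_nat (nat (i mod int p)) \<doteq> of_int i" for i
      proof -
        have "(of_int i :: complex) = of_int (int p * (i div int p) + i mod int p)" by simp
        also have "\<dots> = of_nat p * of_int (i div int p) + of_int (i mod int p)"
          by (simp only: of_int_add of_int_mult of_int_of_nat_eq)
        finally have "of_nat (nat (i mod int p)) - of_int i = - (of_nat p * of_int (i div int p) :: complex)"
          using p(1) by simp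
        then show ?thesis using p(2) by (simp add: ceq_def vm_uminus vm_mult')
      qed
      show "of_nat b \<doteq> of_int m" "of_nat c \<doteq> of_int l" unfolding b_def c_def by (rule *)+
    qed
    have "of_nat a * r^2 + of_nat b * r + of_nat c \<doteq> of_nat n * x^2 + of_int m * x + of_int l"
      by (intro ceq_intros ca rx')
    then have "of_nat a * r^2 + of_nat b * r + of_nat c \<in> vm" unfolding e by (simp add: ceq_def)
    then show "r \<in> (\<Union>t\<in>T. Z t)" using abc r by (auto simp: Z_def intro!: bexI[of _ "(a, b, c)"])
  qed
  moreover have "finite (Z t)" if t: "t \<in> T" for t
  proof (rule ccontr)
    obtain a b c where abc: "t = (a, b, c)" by (cases t)
    assume "infinite (Z t)"
    then obtain S where S: "finite S" "card S = 3" "S \<subseteq> Z t" using infinite_arbitrarily_large by metis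
    then obtain r s u where rs: "S = {r, s, u}" "r \<noteq> s" "s \<noteq> u" "r \<noteq> u" using card_3_iff by metis
    define A B C :: complex where "A = of_nat a" and "B = of_nat b" and "C = of_nat c"
    have ABC: "A \<in> vr" "B \<in> vr" "C \<in> vr" by (simp_all add: A_def B_def C_def)
    have k: "r \<in> k0" "s \<in> k0" "u \<in> k0" and z: "A * r^2 + B * r + C \<in> vm" "A * s^2 + B * s + C \<in> vm"
      "A * u^2 + B * u + C \<in> vm" using S(3) by (auto simp: rs Z_def abc A_def B_def C_def)
    note kv = k0_vr[OF k(1)] k0_vr[OF k(2)] k0_vr[OF k(3)]
    have d: "r - s \<notin> vm" "r - u \<notin> vm" "s - u \<notin> vm"
      using k0_eq k rs kv by (auto simp: ceq_def)
    \<comment> \<open>Divided differences at three incongruent roots force \<open>A\<close>,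
      \<open>B\<close> and \<open>C\<close> into \<open>vm\<close>.\<close>
    have "(r - s) * (A * (r + s) + B) = (A * r^2 + B * r + C) - (A * s^2 + B * s + C)"
      by (simp add: power2_eq_square algebra_simps)
    then have 1: "A * (r + s) + B \<in> vm"
      using vm_diff[OF z(1,2)] d(1) kv ABC vm_mult_iff[of "r - s" "A * (r + s) + B"] by (auto intro!: vr_intros)
    have "(r - u) * (A * (r + u) + B) = (A * r^2 + B * r + C) - (A * u^2 + B * u + C)"
      by (simp add: power2_eq_square algebra_simps)
    then have 2: "A * (r + u) + B \<in> vm"
      using vm_diff[OF z(1,3)] d(2) kv ABC vm_mult_iff[of "r - u" "A * (r + u) + B"] by (auto intro!: vr_intros)
    have "A * (s - u) = (A * (r + s) + B) - (A * (r + u) + B)" by (simp add: algebra_simps)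
    then have A: "A \<in> vm" using vm_diff[OF 1 2] d(3) kv ABC vm_mult_iff[of A "s - u"] by (auto intro!: vr_intros)
    have "B = (A * (r + s) + B) - A * (r + s)" by simp
    then have B: "B \<in> vm" using vm_diff[OF 1 vm_mult'[OF A vr_add[OF kv(1,2)]]] by simp
    have "C = (A * r^2 + B * r + C) - (A * r^2 + B * r)" by simp
    then have C: "C \<in> vm"
      using vm_diff[OF z(1) vm_add[OF vm_mult'[OF A vr_power[OF kv(1), of 2]] vm_mult'[OF B kv(1)]]] by simp
    have "a < p" "b < p" "c < p" "(a, b, c) \<noteq> (0, 0, 0)" using t by (auto simp: T_def abc)
    then show False using A B C pmin by (auto simp: A_def B_def C_def)
  qed
  ultimately show ?thesis using finite_subset[of k0 "\<Union>t\<in>T. Z t"] by (auto simp: T_def)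
qed

end

subsection \<open>Counting points over the residue field\<close>

context K_completion
begin

lemma theta_vr: "\<theta> \<in> vr" and zeta3_vr: "zeta3 \<in> vr"
proof -
  have "zeta3 \<in> L" "\<theta> \<in> L" using zeta3_K theta_K K_sub by auto
  have "w zeta3 ^ 3 = 1" using w_power[OF \<open>zeta3 \<in> L\<close>, of 3] zeta3_cube by simp
  then have "w zeta3 = 1"
    using w_nonneg[OF \<open>zeta3 \<in> L\<close>] power_eq_iff_eq_base[of 3 "w zeta3" 1] by simp
  then show "zeta3 \<in> vr" using \<open>zeta3 \<in> L\<close> by (simp add: vr_def)
  then show "\<theta> \<in> vr" by (auto simp: \<theta>_def intro!: vr_intros)
qed

lemma ceq_rep: "x \<in> vr \<Longrightarrow> rep x \<doteq> x"
  using ceq_sym[OF rep] .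

lemma ceq_trans2: "x \<doteq> f \<Longrightarrow> y \<doteq> f \<Longrightarrow> x \<doteq> y"
  using ceq_trans[OF _ ceq_sym] .

lemma sum_card_fibers:
  assumes "\<And>y. y \<in> k0 \<Longrightarrow> P y \<in> vr"
  shows "(\<Sum>f\<in>k0. card {y \<in> k0. P y \<doteq> f}) = card k0"
proof -
  have "card (\<Union>f\<in>k0. {y \<in> k0. P y \<doteq> f}) = (\<Sum>f\<in>k0. card {y \<in> k0. P y \<doteq> f})"
  proof (rule card_UN_disjoint)
    show "\<forall>i\<in>k0. \<forall>j\<in>k0. i \<noteq> j \<longrightarrow> {y \<in> k0. P y \<doteq> i} \<inter> {y \<in> k0. P y \<doteq> j} = {}"
    proof (intro ballI impI)
      fix i j assume ij: "i \<in> k0" "j \<in> k0" "i \<noteq> j"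
      have False if "P y \<doteq> i" "P y \<doteq> j" for y
        using k0_eq[OF ij(1,2) ceq_trans[OF ceq_sym[OF that(1)] that(2)]] ij(3) by blast
      then show "{y \<in> k0. P y \<doteq> i} \<inter> {y \<in> k0. P y \<doteq> j} = {}" by blast
    qed
  qed (use finite_k0 in auto)
  moreover have "(\<Union>f\<in>k0. {y \<in> k0. P y \<doteq> f}) = k0"
  proof -
    have "\<exists>f\<in>k0. P y \<doteq> f" if "y \<in> k0" for y
      using rep[OF assms[OF that]] rep_k0[OF assms[OF that]] by blast
    then show ?thesis by auto
  qed
  ultimately show ?thesis by simp
qed

lemma sum_eq_bound:
  fixes g :: "'x \<Rightarrow> nat"
  assumes "finite A" "\<And>f. f \<in> A \<Longrightarrow> g f \<le> c" "sum g A = c * card A" "f \<in> A"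
  shows "g f = c"
proof (rule ccontr)
  assume "g f \<noteq> c"
  then have "g f < c" using assms(2,4) by (simp add: order.not_eq_order_implies_strict)
  then have "sum g A < (\<Sum>f\<in>A. c)" using assms by (intro sum_strict_mono_ex1) auto
  then show False using assms(3) by (simp add: mult.commute)
qed

lemma card_le_1_k0: "A \<subseteq> k0 \<inter> vm \<Longrightarrow> card A \<le> 1"
proof -
  assume A: "A \<subseteq> k0 \<inter> vm"
  have "x = y" if "x \<in> A" "y \<in> A" for x y
    using A that k0_eq[of x y] vm_vr vm_diff[of x y] by (auto simp: ceq_def)
  then show ?thesis by (metis card_le_Suc0_iff_eq card.infinite One_nat_def zero_le_one)
qed

lemma ceq_div_square:
  assumes "\<delta> * y'^n \<doteq> y^n" "y' \<notin> vm" "y' \<in> vr" "y \<in> vr" "\<delta> \<in> vr"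
  shows "(y / y')^n \<doteq> \<delta>"
proof -
  have i: "inverse y' \<in> vr" using unit_inverse[OF assms(3,2)] by simp
  have "(y / y')^n \<doteq> inverse y' ^ n * (\<delta> * y'^n)"
    using ceq_mult[OF ceq_refl[OF vr_power[OF i]] ceq_sym[OF assms(1)], of n]
    by (simp add: divide_inverse power_mult_distrib mult.commute)
  moreover have "inverse y' ^ n * (\<delta> * y'^n) = \<delta>"
    using unit_nonzero[OF assms(2)] by (simp add: power_inverse)
  ultimately show ?thesis by simp
qed

text \<open>Over a nonzero residue at most one of \<open>y^3\<close>, \<open>u y^3\<close>,
  \<open>u^2 y^3\<close> has a nonempty fibre, and this fibre has at most three elements; over zero
  each fibre has at most one. Since the three counts add up to 3 on average, the bound is attained
  everywhere.\<close>

lemma cubes_cover: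
  assumes u: "u \<in> vr" "u \<notin> vm" and nc: "\<And>y. y \<in> vr \<Longrightarrow> \<not> y^3 \<doteq> u" and f: "f \<in> vr"
  shows "\<exists>y\<in>vr. y^3 \<doteq> f \<or> u * y^3 \<doteq> f \<or> u^2 * y^3 \<doteq> f"
proof -
  define C where "C = (\<lambda>c f. {y \<in> k0. c * y^3 \<doteq> f})"
  have fin: "finite (C c f)" for c f using finite_k0 by (simp add: C_def)
  have small: "card (C c f) \<le> 1" if "c \<in> vr" "c \<notin> vm" "f \<in> vm" for c f
  proof (rule card_le_1_k0, rule subsetI)
    fix y assume y: "y \<in> C c f"
    have "c * y^3 \<in> vm" using y ceq_vm[of "c * y^3" f] that(3) by (simp add: C_def)
    then have "y \<in> vm" using that y k0_vr[of y] by (simp add: C_def vm_mult_iff vm_power_iff vr_power)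
    then show "y \<in> k0 \<inter> vm" using y by (simp add: C_def)
  qed
  have three: "card (C c f) \<le> 3" if c: "c \<in> vr" "c \<notin> vm" for c f
  proof (cases "C c f = {}")
    case False
    then obtain y where y: "y \<in> k0" "c * y^3 \<doteq> f" by (auto simp: C_def)
    have yv: "y \<in> vr" using k0_vr y by blast
    have "C c f \<subseteq> {y, rep (zeta3 * y), rep (zeta3^2 * y)}"
    proof
      fix x assume x: "x \<in> C c f"
      then have xk: "x \<in> k0" "x \<in> vr" using k0_vr by (auto simp: C_def)
      have "c * x^3 \<doteq> c * y^3"
        using x ceq_trans2[OF _ y(2)] by (simp add: C_def)
      then have "x^3 \<doteq> y^3" using c xk yv by - (rule ceq_cancel[of c], auto intro: vr_power)
      moreover have "x^3 - y^3 = (x - y) * ((x - zeta3 * y) * (x - zeta3^2 * y))"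
        using zeta3_square by Groebner_Basis.algebra
      ultimately have "(x - y) * ((x - zeta3 * y) * (x - zeta3^2 * y)) \<in> vm" by (simp add: ceq_def)
      then consider "x - y \<in> vm" | "x - zeta3 * y \<in> vm" | "x - zeta3^2 * y \<in> vm"
        using xk yv zeta3_vr by (auto simp: vm_mult_iff vr_mult vr_diff vr_power)
      then show "x \<in> {y, rep (zeta3 * y), rep (zeta3^2 * y)}"
      proof cases
        case 1
        then show ?thesis using k0_eq[OF xk(1) y(1)] xk yv by (simp add: ceq_def)
      next
        case 2
        then have "rep x = rep (zeta3 * y)"
          using xk yv zeta3_vr by (simp add: rep_eq_iff ceq_def vr_mult)
        then show ?thesis using rep_in_k0[OF xk(1)] by simp
      next
        case 3
        then have "rep x = rep (zeta3^2 * y)"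
          using xk yv zeta3_vr by (simp add: rep_eq_iff ceq_def vr_mult vr_power)
        then show ?thesis using rep_in_k0[OF xk(1)] by simp
      qed
    qed
    then have "card (C c f) \<le> card {y, rep (zeta3 * y), rep (zeta3^2 * y)}" by (intro card_mono) auto
    also have "\<dots> \<le> 3" by (simp add: card_insert_if)
    finally show ?thesis .
  qed simp
  have u2: "u^2 \<in> vr" "u^2 \<notin> vm" using u by (simp_all add: vr_power vm_power_iff)
  have disj: "C 1 f = {} \<or> C u f = {}" "C 1 f = {} \<or> C (u^2) f = {}" "C u f = {} \<or> C (u^2) f = {}"
    if f: "f \<in> vr" "f \<notin> vm" for f
  proof -
    have unit: "y \<notin> vm" "y \<in> vr" if "y \<in> C c f" "c \<in> vr" for c y
    proof -
      show "y \<in> vr" using that k0_vr by (auto simp: C_def)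
      show "y \<notin> vm"
      proof
        assume "y \<in> vm"
        then have "c * y^3 \<in> vm" using that(2) vm_vr by (auto simp: vm_mult_iff vm_power_iff vr_power)
        then show False using that(1) f ceq_vm[of "c * y^3" f] by (simp add: C_def)
      qed
    qed
    have no: False if "y \<in> C c f" "y' \<in> C (c * u) f" "c \<in> vr" "c \<notin> vm" for y y' c
    proof -
      have "c * (u * y'^3) \<doteq> c * y^3"
        using that(1,2) ceq_trans2[of "c * u * y'^3" f "c * y^3"] by (simp add: C_def mult.assoc)
      then have "u * y'^3 \<doteq> y^3"
        using that unit[OF that(1)] unit[OF that(2)] u by - (rule ceq_cancel[of c], auto intro: vr_mult vr_power)
      then have "(y / y')^3 \<doteq> u"
        using ceq_div_square unit[OF that(1,3)] unit[OF that(2)] u that(3) vr_mult by blast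
      then show False
        using nc unit_divide[of y y'] unit[OF that(1,3)] unit[OF that(2)] u that(3) vr_mult by blast
    qed
    show "C 1 f = {} \<or> C u f = {}" using no[of _ 1] by auto
    show "C u f = {} \<or> C (u^2) f = {}" using no[of _ u] u by (auto simp: power2_eq_square)
    show "C 1 f = {} \<or> C (u^2) f = {}"
    proof (rule ccontr)
      assume "\<not> ?thesis"
      then obtain y y' where y: "y \<in> C 1 f" "y' \<in> C (u^2) f" by auto
      then have "y^3 \<doteq> u^2 * y'^3" 
        using ceq_trans2[of "1 * y^3" f "u^2 * y'^3"] by (simp add: C_def)
      then have "u * y^3 \<doteq> u * (u^2 * y'^3)" using u by (intro ceq_mult) auto
      then have "u * y^3 \<doteq> (u * y')^3" by (simp add: power_mult_distrib power2_eq_square power3_eq_cube mult.assoc mult.left_commute)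
      then have "(u * y' / y)^3 \<doteq> u"
        using unit[OF y(1)] unit[OF y(2)] u u2 by (intro ceq_div_square) (auto intro: vr_mult)
      moreover have "u * y' / y \<in> vr"
        using unit[OF y(1)] unit[OF y(2)] u u2 by (intro unit_divide) (auto intro: vr_mult)
      ultimately show False using nc by blast
    qed
  qed
  have bound: "card (C 1 f) + card (C u f) + card (C (u^2) f) \<le> 3" if "f \<in> k0" for f
  proof (cases "f \<in> vm")
    case True
    then show ?thesis using small[of 1 f] small[of u f] small[of "u^2" f] u u2 by simp
  next
    case False
    then show ?thesis
      using disj[OF k0_vr[OF that]] three[of 1 f] three[of u f] three[of "u^2" f] u u2 by auto
  qed
  have "(\<Sum>f\<in>k0. card (C 1 f) + card (C u f) + card (C (u^2) f)) = 3 * card k0"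
    unfolding C_def using u u2
    by (simp add: sum.distrib sum_card_fibers k0_vr vr_mult vr_power)
  then have "card (C 1 (rep f)) + card (C u (rep f)) + card (C (u^2) (rep f)) = 3"
    by (rule sum_eq_bound[OF finite_k0 bound, rotated]) (use rep_k0[OF f] in auto)
  then have "C 1 (rep f) \<noteq> {} \<or> C u (rep f) \<noteq> {} \<or> C (u^2) (rep f) \<noteq> {}" by force
  then obtain y where y: "y \<in> k0" "1 * y^3 \<doteq> rep f \<or> u * y^3 \<doteq> rep f \<or> u^2 * y^3 \<doteq> rep f"
    unfolding C_def by blast
  then have "y^3 \<doteq> f \<or> u * y^3 \<doteq> f \<or> u^2 * y^3 \<doteq> f"
    using ceq_trans[OF _ ceq_rep[OF f]] by auto
  then show ?thesis using k0_vr[OF y(1)] by blast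
qed

section \<open>Curves over a residue field of characteristic prime to 6\<close>

context
  assumes six: "6 \<notin> vm"
begin

lemma two_unit: "2 \<notin> vm" and three_unit: "3 \<notin> vm"
  using six vm_mult_iff[of 2 3] by auto

lemma theta_unit: "\<theta> \<notin> vm"
  using vm_power_iff[OF theta_vr, of 2] theta2 vm_uminus[of "-3"] three_unit by auto

text \<open>The argument of \<open>cubes_cover\<close> for squares: no nonzero residue is both a
  square and \<open>\<delta>\<close> times a square, and the two counts add up to 2 on
  average.\<close>

lemma twist_fiber:
  assumes d: "\<delta> \<in> vr" and ns: "\<And>y. y \<in> vr \<Longrightarrow> \<not> y^2 \<doteq> \<delta>" and f: "f \<in> vr"
  shows "card {y \<in> k0. 1 * y^2 \<doteq> f} + card {y \<in> k0. \<delta> * y^2 \<doteq> f} = 2"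
proof -
  define C where "C = (\<lambda>c f. {y \<in> k0. c * y^2 \<doteq> f})"
  have fin: "finite (C c f)" for c f using finite_k0 by (simp add: C_def)
  have du: "\<delta> \<notin> vm" using ns[of 0] d by (auto simp: ceq_def vm_uminus)
  have small: "card (C c f) \<le> 1" if "c \<in> vr" "c \<notin> vm" "f \<in> vm" for c f
  proof (rule card_le_1_k0, rule subsetI)
    fix y assume y: "y \<in> C c f"
    have "c * y^2 \<in> vm" using y ceq_vm[of "c * y^2" f] that(3) by (simp add: C_def)
    then have "y \<in> vm" using that y k0_vr[of y] by (simp add: C_def vm_mult_iff vm_power_iff vr_power)
    then show "y \<in> k0 \<inter> vm" using y by (simp add: C_def)
  qed
  have two: "card (C c f) \<le> 2" if c: "c \<in> vr" "c \<notin> vm" for c f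
  proof (cases "C c f = {}")
    case False
    then obtain y where y: "y \<in> k0" "c * y^2 \<doteq> f" by (auto simp: C_def)
    have yv: "y \<in> vr" using k0_vr y by blast
    have "C c f \<subseteq> {y, rep (- y)}"
    proof
      fix x assume x: "x \<in> C c f"
      then have xk: "x \<in> k0" "x \<in> vr" using k0_vr by (auto simp: C_def)
      have "c * x^2 \<doteq> c * y^2"
        using x ceq_trans2[OF _ y(2)] by (simp add: C_def)
      then have "x^2 \<doteq> y^2" using c xk yv by - (rule ceq_cancel[of c], auto intro: vr_power)
      moreover have "x^2 - y^2 = (x - y) * (x - (- y))" by (simp add: power2_eq_square algebra_simps)
      ultimately have "(x - y) * (x - (- y)) \<in> vm" by (simp only: ceq_def)
      then consider "x - y \<in> vm" | "x - (- y) \<in> vm"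
        using xk yv vm_mult_iff[of "x - y" "x - (- y)"] vr_diff vr_uminus by blast
      then show "x \<in> {y, rep (- y)}"
      proof cases
        case 1
        then show ?thesis using k0_eq[OF xk(1) y(1)] xk yv by (simp add: ceq_def)
      next
        case 2
        then have "rep x = rep (- y)"
          using xk yv by (simp add: rep_eq_iff ceq_def vr_uminus)
        then show ?thesis using rep_in_k0[OF xk(1)] by simp
      qed
    qed
    then have "card (C c f) \<le> card {y, rep (- y)}" by (intro card_mono) auto
    also have "\<dots> \<le> 2" by (simp add: card_insert_if)
    finally show ?thesis .
  qed simp
  have disj: "C 1 f = {} \<or> C \<delta> f = {}" if f: "f \<in> vr" "f \<notin> vm" for f
  proof (rule ccontr)
    assume "\<not> ?thesis"
    then obtain y y' where y: "y \<in> C 1 f" "y' \<in> C \<delta> f" by auto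
    have v: "y \<in> vr" "y' \<in> vr" using y k0_vr by (auto simp: C_def)
    have "y' \<notin> vm"
    proof
      assume "y' \<in> vm"
      then have "\<delta> * y'^2 \<in> vm" using d v by (auto simp: vm_mult_iff vm_power_iff vr_power)
      then show False using y(2) f ceq_vm[of "\<delta> * y'^2" f] by (simp add: C_def)
    qed
    moreover have "\<delta> * y'^2 \<doteq> y^2" 
      using y ceq_trans2[of "\<delta> * y'^2" f "1 * y^2"] by (simp add: C_def)
    ultimately show False using ceq_div_square[of \<delta> y' 2 y] ns[of "y / y'"] unit_divide[of y y'] v d by blast
  qed
  have bound: "card (C 1 f) + card (C \<delta> f) \<le> 2" if "f \<in> k0" for f
  proof (cases "f \<in> vm")
    case True
    then show ?thesis using small[of 1 f] small[of \<delta> f] d du by simp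
  next
    case False
    then show ?thesis using disj[OF k0_vr[OF that]] two[of 1 f] two[of \<delta> f] d du by auto
  qed
  have "(\<Sum>f\<in>k0. card (C 1 f) + card (C \<delta> f)) = 2 * card k0"
    unfolding C_def using d by (simp add: sum.distrib sum_card_fibers k0_vr vr_mult vr_power)
  then have "card (C 1 (rep f)) + card (C \<delta> (rep f)) = 2"
    by (rule sum_eq_bound[OF finite_k0 bound, rotated]) (use rep_k0[OF f] in auto)
  moreover have "C c (rep f) = C c f" for c
    using ceq_trans[OF _ ceq_rep[OF f]] ceq_trans[OF _ rep[OF f]] by (auto simp: C_def)
  ultimately show ?thesis unfolding C_def by (simp only:)
qed

text \<open>Otherwise squaring would be a surjective, hence injective map on the finite set
  \<open>k0\<close>, but it identifies 1 and \<open>- 1\<close>.\<close>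

lemma nonsquare_exists: "\<exists>\<delta>\<in>vr. \<forall>y\<in>vr. \<not> y^2 \<doteq> \<delta>"
proof (rule ccontr)
  assume "\<not> ?thesis"
  then have all: "\<exists>y\<in>vr. y^2 \<doteq> \<delta>" if "\<delta> \<in> vr" for \<delta> using that by blast
  have "(\<lambda>y. rep (y^2)) ` k0 = k0"
  proof
    show "(\<lambda>y. rep (y^2)) ` k0 \<subseteq> k0" using rep_k0 k0_vr vr_power by blast
    show "k0 \<subseteq> (\<lambda>y. rep (y^2)) ` k0"
    proof
      fix d assume d: "d \<in> k0"
      then obtain y where y: "y \<in> vr" "y^2 \<doteq> d" using all k0_vr by blast
      have "(rep y)^2 \<doteq> d" using ceq_trans[OF ceq_power[OF ceq_rep[OF y(1)]] y(2)] .
      then have "rep ((rep y)^2) = rep d"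
        using rep_eq_iff[OF vr_power[OF rep_vr[OF y(1)]] k0_vr[OF d]] by simp
      then show "d \<in> (\<lambda>y. rep (y^2)) ` k0" using rep_in_k0[OF d] rep_k0[OF y(1)] by force
    qed
  qed
  then have inj: "inj_on (\<lambda>y. rep (y^2)) k0" using finite_k0 by (simp add: eq_card_imp_inj_on)
  have m1: "- 1 \<in> vr" by (intro vr_intros)
  have "(rep 1)^2 \<doteq> 1" "(rep (- 1))^2 \<doteq> 1"
    using ceq_power[OF ceq_rep[OF vr_1], of 2] ceq_power[OF ceq_rep[OF m1], of 2] by simp_all
  then have "(rep 1)^2 \<doteq> (rep (- 1))^2" by (rule ceq_trans2)
  then have "rep ((rep 1)^2) = rep ((rep (- 1))^2)"
    using rep_eq_iff[OF vr_power[OF rep_vr[OF vr_1]] vr_power[OF rep_vr[OF m1]]] by blast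
  then have "rep 1 = rep (- 1)" using inj rep_k0 vr_uminus by (auto dest!: inj_onD)
  then have "1 \<doteq> - 1" using rep_eq_iff[of 1 "- 1"] vr_uminus by simp
  then show False using two_unit by (simp add: ceq_def)
qed

text \<open>The affine points over the residue field of the quadratic twist by
  \<open>\<delta>\<close>, with \<open>\<delta> = 1\<close> for the curve itself. The point at
  infinity is left out on all curves alike, so comparisons of the counts are not affected.\<close>

definition cpoints :: "complex \<Rightarrow> complex \<Rightarrow> complex \<Rightarrow> (complex \<times> complex) set" where
  "cpoints a b \<delta> = {(x, y). x \<in> k0 \<and> y \<in> k0 \<and> \<delta> * y^2 \<doteq> x^3 + a * (x - b)^2}"

lemma finite_cpoints: "finite (cpoints a b \<delta>)"
proof -
  have "cpoints a b \<delta> \<subseteq> k0 \<times> k0" by (auto simp: cpoints_def)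
  then show ?thesis using finite_k0 finite_subset by blast
qed

text \<open>Each abscissa carries exactly two points on the curve and its twist together.\<close>

lemma card_cpoints_twist:
  assumes "\<delta> \<in> vr" "\<And>y. y \<in> vr \<Longrightarrow> \<not> y^2 \<doteq> \<delta>" "a \<in> vr" "b \<in> vr"
  shows "card (cpoints a b 1) + card (cpoints a b \<delta>) = 2 * card k0"
proof -
  have "cpoints a b c = (SIGMA x:k0. {y \<in> k0. c * y^2 \<doteq> x^3 + a * (x - b)^2})" for c
    by (auto simp: cpoints_def)
  then have "card (cpoints a b c) = (\<Sum>x\<in>k0. card {y \<in> k0. c * y^2 \<doteq> x^3 + a * (x - b)^2})" for c
    using finite_k0 by simp
  then have "card (cpoints a b 1) + card (cpoints a b \<delta>) = (\<Sum>x\<in>k0.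
      card {y \<in> k0. 1 * y^2 \<doteq> x^3 + a * (x - b)^2} + card {y \<in> k0. \<delta> * y^2 \<doteq> x^3 + a * (x - b)^2})"
    by (simp add: sum.distrib)
  also have "\<dots> = (\<Sum>x\<in>k0. 2)"
    using assms k0_vr by (intro sum.cong twist_fiber) (auto intro!: vr_intros)
  finally show ?thesis by (simp add: mult.commute)
qed

text \<open>On a nontrivial quadratic twist the kernel of the isogeny has no rational points, so the isogeny
  is injective on points.\<close>

lemma card_cpoints_le:
  assumes ns: "\<delta> \<in> vr" "\<And>y. y \<in> vr \<Longrightarrow> \<not> y^2 \<doteq> \<delta>"
    and a: "a \<in> vr" "b \<in> vr" "b \<notin> vm" "4 * a + 27 * b \<notin> vm"
    and k: "k \<in> vr" "k \<notin> vm" "k^2 = - 3 * a"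
  shows "card (cpoints a b \<delta>) \<le> card (cpoints (- 27 * a) (4 * a + 27 * b) \<delta>)"
proof -
  define D where "D = 4 * a + 27 * b"
  define V where "V = (\<lambda>x y. y / x :: complex)"
  define U where "U = (\<lambda>x. 1 - 3 * b / x :: complex)"
  \<comment> \<open>The isogeny of \<open>psi_Some\<close> on the twist: substitute \<open>y\<close>
    times a square root of \<open>\<delta>\<close> for \<open>y\<close>, and cancel that square root
    in the second coordinate.\<close>
  define Xf where "Xf = (\<lambda>x y. 9 * (\<delta> * V x y^2) + 3 * a * U x^2)"
  define Yf where "Yf = (\<lambda>x y. 27 * V x y * (\<delta> * V x y^2 - a * U x^2))"
  note i3 = unit_inverse[OF vr_numeral[of "num.One"]]
  have nsq: False if "s \<in> vr" "r \<in> vr" "r \<notin> vm" "\<delta> * r^2 \<doteq> s^2" for r s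
    using ceq_div_square[OF that(4,3,2,1) ns(1)] ns(2) unit_divide[OF that(1,2,3)] by blast
  have pt: "x \<in> vr \<and> y \<in> vr \<and> x \<notin> vm \<and> V x y \<in> vr \<and> U x \<in> vr \<and>
      \<delta> * V x y^2 \<doteq> x + a * (1 - b / x)^2 \<and> b / x \<in> vr"
    if p: "(x, y) \<in> cpoints a b \<delta>" for x y
  proof -
    have xy: "x \<in> vr" "y \<in> vr" "\<delta> * y^2 \<doteq> x^3 + a * (x - b)^2"
      using p k0_vr by (auto simp: cpoints_def)
    \<comment> \<open>A point with \<open>x = 0\<close> would lie in the kernel. There
      \<open>\<delta> y^2\<close> equals \<open>a b^2\<close>, which is the square of the unit
      \<open>k b / \<theta>\<close>, and \<open>\<delta>\<close> would be a square.\<close>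
    have xn: "x \<notin> vm"
    proof
      assume x: "x \<in> vm"
      have "x \<doteq> 0" using x xy(1) by (simp add: ceq_0)
      then have "x^3 + a * (x - b)^2 \<doteq> 0^3 + a * (0 - b)^2" using a by (intro ceq_intros) auto
      then have 1: "\<delta> * y^2 \<doteq> a * b^2" using ceq_trans[OF xy(3)] by simp
      define s where "s = k * b / \<theta>"
      have s: "s \<in> vr" "s \<notin> vm" "s^2 = a * b^2"
      proof -
        show "s \<in> vr" unfolding s_def using k a theta_vr theta_unit by (intro unit_divide vr_mult)
        show s2: "s^2 = a * b^2" using k(3) theta2 by (simp add: s_def power_mult_distrib power_divide)
        have "- 3 * (a * b^2) = (k * b)^2" using k(3) by (simp add: power_mult_distrib)
        moreover have "(k * b)^2 \<notin> vm" using k a by (simp add: vm_power_iff vr_mult vm_mult_iff)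
        ultimately have "a * b^2 \<notin> vm" using vm_mult[of "- 3" "a * b^2"] vr_uminus[of 3] by auto
        then show "s \<notin> vm" using s2 \<open>s \<in> vr\<close> vm_power_iff[of s 2] by auto
      qed
      have "y \<notin> vm"
      proof
        assume "y \<in> vm"
        then have "\<delta> * y^2 \<in> vm" using xy ns by (simp add: vm_mult_iff vm_power_iff vr_power)
        then have "s^2 \<in> vm" using ceq_vm[OF 1] s(3) by simp
        then show False using s(1,2) by (simp add: vm_power_iff)
      qed
      then show False using nsq[OF s(1) xy(2)] 1 s(3) by simp
    qed
    have ix: "inverse x \<in> vr" "x \<noteq> 0" using unit_inverse[OF xy(1) xn] xn by auto
    have bx: "b / x \<in> vr" using unit_divide[OF a(2) xy(1) xn] .
    have Vv: "V x y \<in> vr" unfolding V_def using unit_divide[OF xy(2,1) xn] .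
    have "3 * b / x = 3 * (b / x)" by simp
    then have Uv: "U x \<in> vr" unfolding U_def using bx by (metis vr_diff vr_1 vr_mult vr_numeral)
    have "\<delta> * V x y^2 = (inverse x)^2 * (\<delta> * y^2)"
      by (simp add: V_def divide_inverse power_mult_distrib mult.commute mult.left_commute)
    moreover have "x + a * (1 - b / x)^2 = (inverse x)^2 * (x^3 + a * (x - b)^2)"
      using ix by (simp add: field_simps power2_eq_square power3_eq_cube)
    moreover have "(inverse x)^2 * (\<delta> * y^2) \<doteq> (inverse x)^2 * (x^3 + a * (x - b)^2)"
      by (rule ceq_mult[OF ceq_refl[OF vr_power[OF ix(1)]] xy(3)])
    ultimately have "\<delta> * V x y^2 \<doteq> x + a * (1 - b / x)^2" by (simp only:)
    then show ?thesis using xy(1,2) xn Vv Uv bx by blast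
  qed
  have XYv: "Xf x y \<in> vr \<and> Yf x y \<in> vr" if "(x, y) \<in> cpoints a b \<delta>" for x y
    using pt[OF that] a ns unfolding Xf_def Yf_def by (auto intro!: vr_intros)
  have mem: "(rep (Xf x y), rep (Yf x y)) \<in> cpoints (- 27 * a) D \<delta>" if p: "(x, y) \<in> cpoints a b \<delta>" for x y
  proof -
    note q = pt[OF p]
    define s where "s = x + a * (1 - b / x)^2"
    define m where "m = U x"
    have x0: "x \<noteq> 0" using q by auto
    have s: "\<delta> * V x y^2 \<doteq> s" "s \<in> vr" using q by (auto simp: s_def dest: ceqD)
    have mv: "m \<in> vr" using q by (simp add: m_def)
    have Dv: "D \<in> vr" using a by (auto simp: D_def intro!: vr_intros)
    have "\<delta> * Yf x y^2 = 729 * (\<delta> * V x y^2) * (\<delta> * V x y^2 - a * m^2)^2"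
      by (simp add: Yf_def m_def power_mult_distrib power2_eq_square algebra_simps)
    also have "\<dots> \<doteq> 729 * s * (s - a * m^2)^2"
      using s mv a by (intro ceq_intros ceq_refl) (auto intro!: vr_intros)
    also have "729 * s * (s - a * m^2)^2 = (9 * s + 3 * a * m^2)^3 + (- 27 * a) * ((9 * s + 3 * a * m^2) - D)^2"
    proof -
      define u where "u = 1 / x"
      have ux: "u * x = 1" using x0 by (simp add: u_def)
      have "m = 1 - 3 * b * u" "s = x + a * (1 - b * u)^2" by (simp_all add: m_def U_def s_def u_def)
      then show ?thesis unfolding D_def using ux by Groebner_Basis.algebra
    qed
    also have "(9 * s + 3 * a * m^2)^3 + (- 27 * a) * ((9 * s + 3 * a * m^2) - D)^2 \<doteq>
        Xf x y^3 + (- 27 * a) * (Xf x y - D)^2"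
      unfolding Xf_def m_def[symmetric] using s mv a Dv
      by (intro ceq_intros ceq_refl ceq_sym[OF s(1)]) (auto intro!: vr_intros)
    finally have e: "\<delta> * Yf x y^2 \<doteq> Xf x y^3 + (- 27 * a) * (Xf x y - D)^2" .
    have "\<delta> * rep (Yf x y)^2 \<doteq> \<delta> * Yf x y^2"
      using XYv[OF p] ns by (intro ceq_intros ceq_refl ceq_rep) auto
    also note e
    also have "Xf x y^3 + (- 27 * a) * (Xf x y - D)^2 \<doteq>
        rep (Xf x y)^3 + (- 27 * a) * (rep (Xf x y) - D)^2"
      using XYv[OF p] a Dv by (intro ceq_intros ceq_refl rep) (auto intro!: vr_intros)
    finally show ?thesis using XYv[OF p] rep_k0 by (simp add: cpoints_def)
  qed
  have inj: "x = x' \<and> y = y'"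
    if p: "(x, y) \<in> cpoints a b \<delta>" and p': "(x', y') \<in> cpoints a b \<delta>"
      and X: "Xf x y \<doteq> Xf x' y'" and Y: "Yf x y \<doteq> Yf x' y'" for x y x' y'
  proof -
    note q = pt[OF p] and q' = pt[OF p']
    \<comment> \<open>If \<open>r\<close> is a square root of \<open>\<delta>\<close>, the diagonal
      coordinates are \<open>r P + Q\<close> and \<open>r P - Q\<close>; their product is
      \<open>C\<close>, the first coordinate of the image.\<close>
    define P Q P' Q' where "P = 3 * V x y" and "Q = k * U x" and "P' = 3 * V x' y'" and "Q' = k * U x'"
    have v: "P \<in> vr" "Q \<in> vr" "P' \<in> vr" "Q' \<in> vr"
      using q q' k by (auto simp: P_def Q_def P'_def Q'_def intro!: vr_intros)
    define C C' where "C = \<delta> * P^2 - Q^2" and "C' = \<delta> * P'^2 - Q'^2"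
    have Cv: "C \<in> vr" "C' \<in> vr" using v ns by (auto simp: C_def C'_def intro!: vr_intros)
    have XC: "Xf x y = C" "Xf x' y' = C'"
      unfolding Xf_def C_def C'_def P_def Q_def P'_def Q'_def power_mult_distrib k(3) by simp_all
    have YB: "Yf x y = P * (4 * Q^2 + C)" "Yf x' y' = P' * (4 * Q'^2 + C')"
      unfolding Yf_def C_def C'_def P_def Q_def P'_def Q'_def power_mult_distrib k(3)
      by (simp_all add: power2_eq_square algebra_simps)
    \<comment> \<open>\<open>P = Q = 0\<close> would be a singular point of the reduced curve, with
      \<open>x = 3 b\<close> and \<open>4 a + 27 b = 0\<close>.\<close>
    have not0: False if "P2 \<in> vm" "Q2 \<in> vm" "P2 = 3 * V x2 y2" "Q2 = k * U x2" "(x2, y2) \<in> cpoints a b \<delta>"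
      for P2 Q2 x2 y2
    proof -
      note q2 = pt[OF that(5)]
      have x20: "x2 \<noteq> 0" using q2 by auto
      have V2: "V x2 y2 \<in> vm" using that(1,3) three_unit q2 by (simp add: vm_mult_iff)
      have U2: "U x2 \<in> vm" using that(2,4) k q2 by (simp add: vm_mult_iff)
      have s0: "\<delta> * V x2 y2^2 \<in> vm" using V2 ns q2 by (simp add: vm_mult_iff vm_power_iff vr_power)
      have s1: "\<delta> * V x2 y2^2 \<doteq> x2 + a * (1 - b / x2)^2" using q2 by blast
      have 1: "x2 + a * (1 - b / x2)^2 \<in> vm" using s0 ceq_vm[OF s1] by blast
      have "x2 * U x2 = x2 - 3 * b" using x20 by (simp add: U_def field_simps)
      then have 2: "x2 - 3 * b \<in> vm" using vm_mult[OF _ U2, of x2] q2 by simp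
      have "x2^2 * (x2 + a * (1 - b / x2)^2) = x2^3 + a * (x2 - b)^2"
        using x20 by (simp add: field_simps power2_eq_square power3_eq_cube)
      then have 3: "x2^3 + a * (x2 - b)^2 \<in> vm" using vm_mult[OF _ 1, of "x2^2"] q2 vr_power by simp
      have "x2 \<doteq> 3 * b" using 2 q2 a vr_mult by (simp add: ceq_def)
      then have "x2^3 + a * (x2 - b)^2 \<doteq> (3 * b)^3 + a * (3 * b - b)^2"
        using a by (intro ceq_intros) auto
      then have "(3 * b)^3 + a * (3 * b - b)^2 \<in> vm" using 3 ceq_vm by blast
      moreover have "(3 * b)^3 + a * (3 * b - b)^2 = b^2 * (4 * a + 27 * b)"
        by (simp add: power2_eq_square power3_eq_cube algebra_simps)
      ultimately show False using a by (simp add: vm_mult_iff vm_power_iff vr_power vr_add vr_mult)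
    qed
    have CC: "C \<doteq> C'" using X XC by simp
    \<comment> \<open>The cubic \<open>z^3 - t^3 = 6 k (z t - d)\<close> of the diagonal
      coordinates, rewritten in terms of \<open>Q\<close> and \<open>C\<close>.\<close>
    have Aeq: "4 * Q2^3 + 3 * Q2 * C2 \<doteq> 3 * k * (C2 - D)"
      if "P2 = 3 * V x2 y2" "Q2 = k * U x2" "C2 = \<delta> * P2^2 - Q2^2" "(x2, y2) \<in> cpoints a b \<delta>" for P2 Q2 C2 x2 y2
    proof -
      note q2 = pt[OF that(4)]
      define m where "m = U x2"
      define s where "s = x2 + a * (1 - b / x2)^2"
      have mv: "m \<in> vr" "s \<in> vr" "\<delta> * V x2 y2^2 \<doteq> s" using q2 by (auto simp: m_def s_def dest: ceqD)
      have x20: "x2 \<noteq> 0" using q2 by auto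
      have Dv: "D \<in> vr" using a by (auto simp: D_def intro!: vr_intros)
      have C2: "C2 = 9 * (\<delta> * V x2 y2^2) - (k * m)^2"
        unfolding that(1-3) m_def by (simp add: power_mult_distrib)
      have C2s: "C2 \<doteq> 9 * s - (k * m)^2"
        unfolding C2 using mv k by (intro ceq_intros ceq_refl) (auto intro!: vr_intros)
      have Q2: "Q2 = k * m" by (simp add: that(2) m_def)
      have "4 * Q2^3 + 3 * Q2 * C2 \<doteq> 4 * (k * m)^3 + 3 * (k * m) * (9 * s - (k * m)^2)"
        unfolding Q2 using mv k by (intro ceq_intros ceq_refl C2s) (auto intro!: vr_intros)
      also have "\<dots> = 3 * k * ((9 * s - (k * m)^2) - D)"
      proof -
        define u where "u = 1 / x2"
        have ux: "u * x2 = 1" using x20 by (simp add: u_def)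
        have "m = 1 - 3 * b * u" "s = x2 + a * (1 - b * u)^2" by (simp_all add: m_def U_def s_def u_def)
        then show ?thesis unfolding D_def using ux k(3) by Groebner_Basis.algebra
      qed
      also have "\<dots> \<doteq> 3 * k * (C2 - D)"
        using mv k Dv by (intro ceq_intros ceq_refl ceq_sym[OF C2s]) (auto intro!: vr_intros)
      finally show ?thesis .
    qed
    have QQ: "Q \<doteq> Q'"
    proof -
      have Dv: "D \<in> vr" using a by (auto simp: D_def intro!: vr_intros)
      have "4 * Q^3 + 3 * Q * C \<doteq> 3 * k * (C - D)" by (rule Aeq[OF P_def Q_def C_def p])
      also have "\<dots> \<doteq> 3 * k * (C' - D)" using CC k Dv by (intro ceq_intros ceq_refl) auto
      also have "\<dots> \<doteq> 4 * Q'^3 + 3 * Q' * C'" by (rule ceq_sym[OF Aeq[OF P'_def Q'_def C'_def p']])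
      finally have e1: "4 * Q^3 + 3 * Q * C \<doteq> 4 * Q'^3 + 3 * Q' * C'" .
      have "4 * Q'^3 + 3 * Q' * C' \<doteq> 4 * Q'^3 + 3 * Q' * C"
        using v CC by (intro ceq_intros ceq_refl ceq_sym[OF CC]) (auto intro!: vr_intros)
      then have "4 * Q^3 + 3 * Q * C - (4 * Q'^3 + 3 * Q' * C) \<in> vm" by (rule ceqD(3)[OF ceq_trans[OF e1]])
      moreover have "4 * Q^3 + 3 * Q * C - (4 * Q'^3 + 3 * Q' * C) =
          (Q - Q') * (4 * (Q^2 + Q * Q' + Q'^2) + 3 * C)"
        by (simp add: power2_eq_square power3_eq_cube algebra_simps)
      ultimately have "(Q - Q') * (4 * (Q^2 + Q * Q' + Q'^2) + 3 * C) \<in> vm" by simp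
      then consider "Q - Q' \<in> vm" | "4 * (Q^2 + Q * Q' + Q'^2) + 3 * C \<in> vm"
        using v Cv vm_mult_iff[of "Q - Q'" "4 * (Q^2 + Q * Q' + Q'^2) + 3 * C"] by (auto intro!: vr_intros)
      then show ?thesis
      proof cases
        case 1
        then show ?thesis using v by (simp add: ceq_def)
      next
        case 2
        \<comment> \<open>For either ordering of the pair the second factor is
          \<open>(Q2 + 2 Q3)^2 - \<delta> (\<theta> P2)^2\<close>, so a unit \<open>P2\<close> would
          make \<open>\<delta>\<close> a square.\<close>
        have sq: "P2 \<in> vm" if "4 * (Q^2 + Q * Q' + Q'^2) + 3 * (\<delta> * P2^2 - Q2^2) \<in> vm" "P2 \<in> vr"
          "{Q2, Q3} = {Q, Q'}" for P2 Q2 Q3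
        proof (rule ccontr)
          assume "P2 \<notin> vm"
          have vv: "Q2 \<in> vr" "Q3 \<in> vr" using that(3) v by (metis insertCI insertE singletonD)+
          have "Q^2 + Q * Q' + Q'^2 = Q2^2 + Q2 * Q3 + Q3^2"
            using that(3) by (auto simp: doubleton_eq_iff)
          then have "4 * (Q2^2 + Q2 * Q3 + Q3^2) + 3 * (\<delta> * P2^2 - Q2^2) \<in> vm" using that(1) by simp
          moreover have "4 * (Q2^2 + Q2 * Q3 + Q3^2) + 3 * (\<delta> * P2^2 - Q2^2) =
              (Q2 + 2 * Q3)^2 - \<delta> * (\<theta> * P2)^2"
            unfolding power_mult_distrib theta2 by (simp add: power2_eq_square algebra_simps)
          ultimately have "(Q2 + 2 * Q3)^2 \<doteq> \<delta> * (\<theta> * P2)^2"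
            using vv that(2) ns theta_vr by (auto simp: ceq_def intro!: vr_intros)
          then show False
            using nsq[of "Q2 + 2 * Q3" "\<theta> * P2"] ceq_sym vv that(2) theta_vr theta_unit \<open>P2 \<notin> vm\<close>
            by (auto simp: vm_mult_iff intro!: vr_intros)
        qed
        have P0: "P \<in> vm" using sq[of P Q Q'] 2 v by (simp add: C_def)
        have "4 * (Q^2 + Q * Q' + Q'^2) + 3 * C \<doteq> 4 * (Q^2 + Q * Q' + Q'^2) + 3 * C'"
          using v CC by (intro ceq_intros ceq_refl) (auto intro!: vr_intros)
        then have 3: "4 * (Q^2 + Q * Q' + Q'^2) + 3 * C' \<in> vm" using ceq_vm 2 by blast
        have P'0: "P' \<in> vm" using sq[of P' Q' Q] 3 v by (auto simp: C'_def insert_commute)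
        have dP: "\<delta> * P^2 \<in> vm" "\<delta> * P'^2 \<in> vm"
          using P0 P'0 ns v by (simp_all add: vm_mult_iff vm_power_iff vr_power)
        have "(Q - Q') * (Q + Q') = (\<delta> * P^2 - \<delta> * P'^2) - (C - C')"
          by (simp add: C_def C'_def power2_eq_square algebra_simps)
        then have "(Q - Q') * (Q + Q') \<in> vm" using vm_diff[OF vm_diff[OF dP] ceqD(3)[OF CC]] by (simp only:)
        then consider "Q - Q' \<in> vm" | "Q + Q' \<in> vm" using v vm_mult_iff[of "Q - Q'" "Q + Q'"] by (auto intro: vr_intros)
        then show ?thesis
        proof cases
          case 1
          then show ?thesis using v by (simp add: ceq_def)
        next
          case 2
          have "4 * (Q^2 + Q * Q' + Q'^2) + 3 * C - 3 * (\<delta> * P^2) - 4 * (Q + Q') * Q' = Q * Q"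
            by (simp add: C_def power2_eq_square algebra_simps)
          moreover have "4 * (Q^2 + Q * Q' + Q'^2) + 3 * C - 3 * (\<delta> * P^2) - 4 * (Q + Q') * Q' \<in> vm"
            using 2 dP v \<open>4 * (Q^2 + Q * Q' + Q'^2) + 3 * C \<in> vm\<close>
            by (intro vm_diff vm_mult[of 3] vm_mult'[of "4 * (Q + Q')"] vm_mult[of 4]) auto
          ultimately have "Q * Q \<in> vm" by simp
          then have "Q \<in> vm" using v by (simp add: vm_mult_iff)
          then show ?thesis using not0[OF P0 _ P_def Q_def p] by blast
        qed
      qed
    qed
    have PP: "P \<doteq> P'"
    proof -
      have Q2: "Q^2 \<doteq> Q'^2" by (rule ceq_power[OF QQ])
      have "\<delta> * P^2 \<doteq> \<delta> * P'^2"
        using ceq_add[OF CC Q2] by (simp add: C_def C'_def)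
      moreover have "\<delta> \<notin> vm" using ns(2)[of 0] ns(1) by (auto simp: ceq_def vm_uminus)
      ultimately have "P^2 \<doteq> P'^2" using v ns by - (rule ceq_cancel[of \<delta>], auto intro: vr_power)
      then have "(P - P') * (P + P') \<in> vm" by (simp add: ceq_def power2_eq_square algebra_simps)
      then consider "P - P' \<in> vm" | "P + P' \<in> vm" using v vm_mult_iff[of "P - P'" "P + P'"] by (auto intro: vr_intros)
      then show ?thesis
      proof cases
        case 1
        then show ?thesis using v by (simp add: ceq_def)
      next
        case 2
        \<comment> \<open>Opposite values of \<open>P\<close> with the same second coordinate force
          this coordinate to vanish. Then \<open>P = 0\<close>, or
          \<open>\<delta> P^2 = - 3 Q^2\<close>; with a unit \<open>P\<close> the latter would make
          \<open>\<delta>\<close> a square.\<close>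
        have "P' \<doteq> - P" using 2 v vr_uminus by (auto simp: ceq_def add.commute)
        then have "P' * (4 * Q'^2 + C') \<doteq> - P * (4 * Q^2 + C)"
          by (intro ceq_intros ceq_refl ceq_sym[OF Q2] ceq_sym[OF CC]) auto
        then have "P * (4 * Q^2 + C) \<doteq> - P * (4 * Q^2 + C)" by (rule ceq_trans[OF Y[unfolded YB]])
        then have "2 * (P * (4 * Q^2 + C)) \<in> vm" by (simp add: ceq_def)
        then have "P \<in> vm \<or> 4 * Q^2 + C \<in> vm"
          using two_unit v Cv by (auto simp: vm_mult_iff vr_mult vr_add vr_power)
        moreover have "P \<in> vm" if *: "4 * Q^2 + C \<in> vm"
        proof (rule ccontr)
          assume "P \<notin> vm"
          have "\<delta> * P^2 - (\<theta> * Q)^2 = 4 * Q^2 + C" unfolding power_mult_distrib theta2 C_def by simp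
          then have "\<delta> * P^2 \<doteq> (\<theta> * Q)^2" using * v ns theta_vr by (auto simp: ceq_def intro!: vr_intros)
          then show False using nsq[of "\<theta> * Q" P] v theta_vr \<open>P \<notin> vm\<close> vr_mult by blast
        qed
        ultimately have "P \<in> vm" by blast
        then have "P - P' \<in> vm" using vm_diff[OF vm_add[of P P] 2] by (simp add: algebra_simps)
        then show ?thesis using v by (simp add: ceq_def)
      qed
    qed
    have "k * U x \<doteq> k * U x'" using QQ by (simp add: Q_def Q'_def)
    then have "U x \<doteq> U x'" using k q q' by - (rule ceq_cancel[of k], auto)
    then have "1 - U x \<doteq> 1 - U x'" by (intro ceq_intros) auto
    then have "3 * (b / x) \<doteq> 3 * (b / x')" by (simp add: U_def)
    then have "b / x \<doteq> b / x'" using three_unit q q' by - (rule ceq_cancel[of 3], auto)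
    then have "(x * x') * (b / x) \<doteq> (x * x') * (b / x')" using q q' by (intro ceq_mult) (auto intro: vr_mult)
    moreover have "(x * x') * (b / x) = b * x'" "(x * x') * (b / x') = b * x" using q q' by auto
    ultimately have "b * x' \<doteq> b * x" by simp
    then have xx: "x' \<doteq> x" using a q q' by - (rule ceq_cancel[of b], auto)
    have "3 * V x y \<doteq> 3 * V x' y'" using PP by (simp add: P_def P'_def)
    then have "V x y \<doteq> V x' y'" using three_unit q q' by - (rule ceq_cancel[of 3], auto)
    then have "x * V x y \<doteq> x' * V x' y'" by (intro ceq_mult ceq_sym[OF xx])
    moreover have "x * V x y = y" "x' * V x' y' = y'" using q q' by (auto simp: V_def)
    ultimately have "y \<doteq> y'" by simp
    then show ?thesis using xx k0_eq p p' ceq_sym by (auto simp: cpoints_def)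
  qed
  have "inj_on (\<lambda>(x, y). (rep (Xf x y), rep (Yf x y))) (cpoints a b \<delta>)"
    using inj XYv by (intro inj_onI) (auto simp: rep_eq_iff split: prod.splits)
  moreover have "(\<lambda>(x, y). (rep (Xf x y), rep (Yf x y))) ` cpoints a b \<delta> \<subseteq> cpoints (- 27 * a) D \<delta>"
    using mem by auto
  ultimately show ?thesis unfolding D_def[symmetric] by (rule card_inj_on_le[OF _ _ finite_cpoints])
qed

end

end

section \<open>Cubic torsors of the isogeny over the residue field\<close>

context K_completion
begin

context
  fixes a b k :: complex
  assumes six: "6 \<notin> vm"
    and a: "a \<in> vr" and b: "b \<in> vr" "b \<notin> vm" and D: "4 * a + 27 * b \<notin> vm"
    and k: "k \<in> vr" "k \<notin> vm" "k^2 = - 3 * a"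
begin

lemma unit_27: "27 \<notin> vm"
  using vm_power_iff[of 3 3] three_unit[OF six] by simp

text \<open>Two applications of \<open>(a, b) \<mapsto> (- 27 a, 4 a + 27 b)\<close> lead to
  \<open>(729 a, 729 b)\<close>. This is the original curve with \<open>x\<close> rescaled by
  \<open>27^2\<close> and \<open>y\<close> by \<open>27^3\<close>.\<close>

lemma card_cpoints_scale:
  assumes d: "\<delta> \<in> vr"
  shows "card (cpoints (729 * a) (729 * b) \<delta>) \<le> card (cpoints a b \<delta>)"
proof -
  define i where "i = inverse (27::complex)"
  have i: "i \<in> vr" "i \<notin> vm" "27 * i = 1" using unit_inverse[OF vr_numeral unit_27] by (simp_all add: i_def)
  have mem: "(rep (i^2 * x), rep (i^3 * y)) \<in> cpoints a b \<delta>" if p: "(x, y) \<in> cpoints (729 * a) (729 * b) \<delta>" for x y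
  proof -
    have xy: "x \<in> vr" "y \<in> vr" "\<delta> * y^2 \<doteq> x^3 + 729 * a * (x - 729 * b)^2"
      using p k0_vr by (auto simp: cpoints_def[OF six])
    have v: "i^2 * x \<in> vr" "i^3 * y \<in> vr" using i xy by (auto intro!: vr_intros)
    have "i^6 * (\<delta> * y^2) \<doteq> i^6 * (x^3 + 729 * a * (x - 729 * b)^2)"
      by (rule ceq_mult[OF ceq_refl[OF vr_power[OF i(1)]] xy(3)])
    moreover have "i^6 * (\<delta> * y^2) = \<delta> * (i^3 * y)^2"
      by (simp add: power_mult_distrib flip: power_mult)
    moreover have "i^6 * (x^3 + 729 * a * (x - 729 * b)^2) = (i^2 * x)^3 + a * (i^2 * x - b)^2"
    proof -
      have "i^6 * (x^3 + 729 * a * (x - 729 * b)^2) =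
          (i^2 * x)^3 + a * ((27 * i) * (i^2 * x) - (27 * i)^3 * b)^2"
        by (simp add: power2_eq_square power3_eq_cube eval_nat_numeral algebra_simps)
      then show ?thesis unfolding i(3) by simp
    qed
    ultimately have "\<delta> * (i^3 * y)^2 \<doteq> (i^2 * x)^3 + a * (i^2 * x - b)^2" by (simp only:)
    have "\<delta> * rep (i^3 * y)^2 \<doteq> \<delta> * (i^3 * y)^2" by (intro ceq_intros ceq_refl ceq_rep d v)
    also have "\<dots> \<doteq> (i^2 * x)^3 + a * (i^2 * x - b)^2" by fact
    also have "\<dots> \<doteq> rep (i^2 * x)^3 + a * (rep (i^2 * x) - b)^2" by (intro ceq_intros ceq_refl rep v a b)
    finally show ?thesis using v rep_k0 by (simp add: cpoints_def[OF six])
  qed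
  have "inj_on (\<lambda>(x, y). (rep (i^2 * x), rep (i^3 * y))) (cpoints (729 * a) (729 * b) \<delta>)"
  proof (rule inj_onI, clarify)
    fix x y x' y' assume p: "(x, y) \<in> cpoints (729 * a) (729 * b) \<delta>" "(x', y') \<in> cpoints (729 * a) (729 * b) \<delta>"
      and e: "rep (i^2 * x) = rep (i^2 * x')" "rep (i^3 * y) = rep (i^3 * y')"
    have k: "x \<in> k0" "y \<in> k0" "x' \<in> k0" "y' \<in> k0" using p by (auto simp: cpoints_def[OF six])
    note v = k0_vr[OF k(1)] k0_vr[OF k(2)] k0_vr[OF k(3)] k0_vr[OF k(4)]
    have pw: "i^n \<in> vr" "i^n \<notin> vm" if "n > 0" for n using i that by (simp_all add: vr_power vm_power_iff)
    have "i^2 * x \<doteq> i^2 * x'" "i^3 * y \<doteq> i^3 * y'"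
      using e rep_eq_iff v pw(1)[of 2] pw(1)[of 3] by (simp_all add: vr_mult)
    then have "x \<doteq> x'" "y \<doteq> y'"
      using ceq_cancel[of "i^2" x x'] ceq_cancel[of "i^3" y y'] pw[of 2] pw[of 3] v by simp_all
    then show "x = x' \<and> y = y'" using k0_eq k by blast
  qed
  moreover have "(\<lambda>(x, y). (rep (i^2 * x), rep (i^3 * y))) ` cpoints (729 * a) (729 * b) \<delta> \<subseteq> cpoints a b \<delta>"
    using mem by auto
  ultimately show ?thesis by (rule card_inj_on_le[OF _ _ finite_cpoints[OF six]])
qed

text \<open>On a nontrivial twist the isogeny and its dual are both injective, so the twists have
  equally many points. Since a curve and its twist together have \<open>2 * card k0\<close> affine
  points, the same holds for the curves themselves.\<close>

lemma card_cpoints_eq: "card (cpoints a b 1) = card (cpoints (- 27 * a) (4 * a + 27 * b) 1)"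
proof -
  obtain \<delta> where d: "\<delta> \<in> vr" "\<And>y. y \<in> vr \<Longrightarrow> \<not> y^2 \<doteq> \<delta>" using nonsquare_exists[OF six] by blast
  have Dv: "4 * a + 27 * b \<in> vr" "- 27 * a \<in> vr" using a b by (auto intro!: vr_intros)
  have 1: "card (cpoints a b \<delta>) \<le> card (cpoints (- 27 * a) (4 * a + 27 * b) \<delta>)"
    by (rule card_cpoints_le[OF six d a b D k])
  \<comment> \<open>As \<open>k / \<theta>\<close> is a square root of \<open>a\<close>,
    \<open>k'\<close> is one of \<open>81 a = - 3 (- 27 a)\<close>.\<close>
  define k' where "k' = 9 * (k / \<theta>)"
  have th: "k / \<theta> \<in> vr" using unit_divide[OF k(1) theta_vr theta_unit[OF six]] .
  have "\<theta> * (k / \<theta>) = k" by simp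
  then have thu: "k / \<theta> \<notin> vm" using k(2) vm_mult[OF theta_vr, of "k / \<theta>"] by auto
  have nine: "9 \<notin> vm" using vm_power_iff[of 3 2] three_unit[OF six] by simp
  have k': "k' \<in> vr" "k' \<notin> vm"
    using vr_mult[OF vr_numeral th] unit_mult[OF vr_numeral th nine thu] unfolding k'_def by blast+
  have "k'^2 = - 3 * (- 27 * a)" using k(3) by (simp add: k'_def power_mult_distrib power_divide theta2)
  moreover have e: "4 * (- 27 * a) + 27 * (4 * a + 27 * b) = 729 * b" by (simp add: algebra_simps)
  moreover have "729 * b \<notin> vm"
    using vm_power_iff[of 3 6] three_unit[OF six] b vm_mult_iff[of 729 b] by simp
  ultimately have "card (cpoints (- 27 * a) (4 * a + 27 * b) \<delta>) \<le> card (cpoints (- 27 * (- 27 * a)) (729 * b) \<delta>)"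
    using card_cpoints_le[OF six d Dv(2,1) D _ k', unfolded e] by metis
  also have "- 27 * (- 27 * a) = 729 * a" by simp
  also have "card (cpoints (729 * a) (729 * b) \<delta>) \<le> card (cpoints a b \<delta>)" by (rule card_cpoints_scale[OF d(1)])
  finally have "card (cpoints a b \<delta>) = card (cpoints (- 27 * a) (4 * a + 27 * b) \<delta>)" using 1 by simp
  then show ?thesis
    using card_cpoints_twist[OF six d a b(1)] card_cpoints_twist[OF six d Dv(2,1)] by simp
qed

text \<open>The two curves have equally many points, but no point of the kernel is needed to reach the
  image of the isogeny. Hence some point of the target curve is not in the image.\<close>

lemma point_not_in_image:
  "\<exists>x y. (x, y) \<in> cpoints (- 27 * a) (4 * a + 27 * b) 1 \<and> \<not> (\<exists>\<zeta>\<in>vr. \<exists>t\<in>vr. \<zeta> * t \<doteq> x \<and>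
     \<zeta>^3 \<doteq> y + 3 * k * (x - (4 * a + 27 * b)) \<and> t^3 \<doteq> y - 3 * k * (x - (4 * a + 27 * b)))"
proof (rule ccontr)
  define d where "d = 4 * a + 27 * b"
  define S where "S = cpoints (- 27 * a) d 1"
  have dv: "d \<in> vr" using a b by (auto simp: d_def intro!: vr_intros)
  assume "\<not> ?thesis"
  then have "\<forall>p. p \<in> S \<longrightarrow> (\<exists>q. fst q \<in> vr \<and> snd q \<in> vr \<and> fst q * snd q \<doteq> fst p \<and>
      fst q^3 \<doteq> snd p + 3 * k * (fst p - d) \<and> snd q^3 \<doteq> snd p - 3 * k * (fst p - d))"
    unfolding S_def d_def by fastforce
  then obtain Q where Q: "\<And>p. p \<in> S \<Longrightarrow> fst (Q p) \<in> vr" "\<And>p. p \<in> S \<Longrightarrow> snd (Q p) \<in> vr"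
    "\<And>p. p \<in> S \<Longrightarrow> fst (Q p) * snd (Q p) \<doteq> fst p"
    "\<And>p. p \<in> S \<Longrightarrow> fst (Q p)^3 \<doteq> snd p + 3 * k * (fst p - d)"
    "\<And>p. p \<in> S \<Longrightarrow> snd (Q p)^3 \<doteq> snd p - 3 * k * (fst p - d)" by metis
  \<comment> \<open>The formula of \<open>zt_point\<close> over the residue field: preimages for all
    target points would define an injective map back to the curve.\<close>
  define del where "del = (\<lambda>p. 2 * k - fst (Q p) + snd (Q p))"
  define xq yq where "xq = (\<lambda>p. 6 * k * b / del p)" and "yq = (\<lambda>p. (fst (Q p) + snd (Q p)) * xq p / 6)"
  have key: "del p \<in> vr \<and> del p \<notin> vm \<and> xq p \<in> vr \<and> xq p \<notin> vm \<and> yq p \<in> vr \<and>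
      1 * yq p^2 \<doteq> xq p^3 + a * (xq p - b)^2" if p: "p \<in> S" for p
  proof -
    define z t where "z = fst (Q p)" and "t = snd (Q p)"
    have zt: "z \<in> vr" "t \<in> vr" using Q(1,2)[OF p] by (simp_all add: z_def t_def)
    have pv: "fst p \<in> vr" "snd p \<in> vr" using p k0_vr by (auto simp: S_def cpoints_def[OF six])
    \<comment> \<open>The error in the cubic equation of the diagonal coordinates. With it as an
      explicit term in \<open>vm\<close>, the computation of the lemma \<open>zt_point\<close> can
      be repeated as an exact identity.\<close>
    define Er where "Er = z^3 - t^3 - 6 * k * (z * t - d)"
    have "Er \<doteq> (snd p + 3 * k * (fst p - d)) - (snd p - 3 * k * (fst p - d)) - 6 * k * (fst p - d)"
      unfolding Er_def z_def t_def using Q[OF p] k dv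
      by (intro ceq_intros ceq_refl Q(3-5)[OF p]) (auto intro!: vr_intros)
    then have Er: "Er \<in> vm" by (simp add: ceq_def algebra_simps)
    define D' where "D' = del p"
    have D': "D' = 2 * k - z + t" by (simp add: D'_def del_def z_def t_def)
    have Dv: "D' \<in> vr" unfolding D' using zt k by (auto intro!: vr_intros)
    have Du: "D' \<notin> vm"
    proof
      assume "D' \<in> vm"
      have "8 * k^3 + 6 * k * d = 162 * (k * b)"
        using k(3) unfolding d_def by Groebner_Basis.algebra
      moreover have "8 * k^3 + 6 * k * d = Er + D' * (12 * k^2 - 6 * k * D' + D'^2 + 3 * (z * t))"
        unfolding Er_def D' by (simp add: power2_eq_square power3_eq_cube algebra_simps)
      moreover have "12 * k^2 - 6 * k * D' + D'^2 + 3 * (z * t) \<in> vr"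
        using zt k(1) Dv by (intro vr_intros)
      then have "Er + D' * (12 * k^2 - 6 * k * D' + D'^2 + 3 * (z * t)) \<in> vm"
        by (intro vm_add[OF Er] vm_mult'[OF \<open>D' \<in> vm\<close>])
      ultimately have "162 * (k * b) \<in> vm" by (simp only:)
      moreover have "162 \<notin> vm"
      proof -
        have "(162::complex) = 2 * 3^4" by simp
        then show ?thesis
          using two_unit[OF six] three_unit[OF six] by (metis unit_mult vm_power_iff vr_numeral vr_power zero_less_numeral)
      qed
      ultimately show False using k b by (simp add: vm_mult_iff vr_mult)
    qed
    define x y where "x = xq p" and "y = yq p"
    have xD: "x * D' = 6 * k * b" using unit_nonzero[OF Du] by (simp add: x_def xq_def D'_def)
    have x: "x \<in> vr" unfolding x_def xq_def D'_def[symmetric] using k b Dv Du by (intro unit_divide) (auto intro!: vr_intros)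
    have xu: "x \<notin> vm"
    proof
      assume "x \<in> vm"
      then have "6 * k * b \<in> vm" using vm_mult'[OF _ Dv] xD by metis
      then show False using six k b by (simp add: vm_mult_iff vr_mult)
    qed
    have y6: "6 * y = (z + t) * x" by (simp add: y_def yq_def x_def z_def t_def)
    have y: "y \<in> vr" unfolding y_def yq_def
      using zt x six by (intro unit_divide) (auto simp: z_def t_def x_def intro!: vr_intros)
    have cancel36: "v = w" if "36 * v = 36 * w" for v w :: complex using that by simp
    have "36 * (3 * D'^3 * (y^2 - (x^3 + a * (x - b)^2))) =
       3 * D' * (x * D')^2 * (z + t)^2 - 108 * (x * D')^3 - 108 * a * D' * (x * D' - b * D')^2"
      using y6 by Groebner_Basis.algebra
    also have "\<dots> = 36 * (- 4 * k^2 * b^2 * Er)"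
    proof -
      have zD: "z = 2 * k + t - D'" unfolding D' by simp
      show ?thesis unfolding xD Er_def d_def using k(3) zD by Groebner_Basis.algebra
    qed
    finally have "36 * (3 * D'^3 * (y^2 - (x^3 + a * (x - b)^2))) = 36 * (- 4 * k^2 * b^2 * Er)" .
    then have "3 * D'^3 * (y^2 - (x^3 + a * (x - b)^2)) = - 4 * k^2 * b^2 * Er"
      by (rule cancel36)
    moreover have "- 4 * k^2 * b^2 * Er \<in> vm" by (intro vm_mult Er vr_mult vr_power k(1) b(1) vr_uminus vr_numeral)
    ultimately have "3 * D'^3 * (y^2 - (x^3 + a * (x - b)^2)) \<in> vm" by simp
    moreover have "y^2 - (x^3 + a * (x - b)^2) \<in> vr"
      by (intro vr_diff vr_add vr_mult vr_power y x a b(1))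
    ultimately have "y^2 - (x^3 + a * (x - b)^2) \<in> vm"
      using three_unit[OF six] Dv Du vm_mult_iff[of "3 * D'^3" "y^2 - (x^3 + a * (x - b)^2)"]
      by (simp only: vm_mult_iff vm_power_iff vr_mult vr_power vr_numeral simp_thms zero_less_numeral)
    then have "1 * y^2 \<doteq> x^3 + a * (x - b)^2" using x y a b by (auto simp: ceq_def intro!: vr_intros)
    then show ?thesis using Dv Du x xu y by (simp add: D'_def x_def y_def)
  qed
  define f where "f = (\<lambda>p. (rep (xq p), rep (yq p)))"
  have fS: "f p \<in> cpoints a b 1" if p: "p \<in> S" for p
  proof -
    note q = key[OF p]
    have "1 * rep (yq p)^2 \<doteq> 1 * yq p^2" using q by (intro ceq_intros ceq_refl ceq_rep) auto
    also have "\<dots> \<doteq> xq p^3 + a * (xq p - b)^2" using q by blast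
    also have "\<dots> \<doteq> rep (xq p)^3 + a * (rep (xq p) - b)^2" using q a b by (intro ceq_intros ceq_refl rep) auto
    finally show ?thesis using q rep_k0 by (simp add: f_def cpoints_def[OF six])
  qed
  have "inj_on f S"
  proof (rule inj_onI)
    fix p p' assume p: "p \<in> S" and p': "p' \<in> S" and e: "f p = f p'"
    note q = key[OF p] and q' = key[OF p']
    have xx: "xq p \<doteq> xq p'" and yy: "yq p \<doteq> yq p'" using e q q' by (simp_all add: f_def rep_eq_iff)
    define z t z' t' where "z = fst (Q p)" and "t = snd (Q p)" and "z' = fst (Q p')" and "t' = snd (Q p')"
    have zt: "z \<in> vr" "t \<in> vr" "z' \<in> vr" "t' \<in> vr" using Q(1,2)[OF p] Q(1,2)[OF p'] by (simp_all add: z_def t_def z'_def t'_def)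
    have xD: "xq p * del p = 6 * k * b" "xq p' * del p' = 6 * k * b"
      using q q' unit_nonzero by (auto simp: xq_def)
    have "xq p * del p \<doteq> xq p' * del p'" unfolding xD using k b by (intro ceq_refl) (auto intro!: vr_intros)
    also have "\<dots> \<doteq> xq p * del p'" using q' by (intro ceq_mult ceq_sym[OF xx] ceq_refl) auto
    finally have dd: "del p \<doteq> del p'" by - (rule ceq_cancel[of "xq p"], use q q' in auto)
    have "2 * k - del p \<doteq> 2 * k - del p'" using k by (intro ceq_intros ceq_refl dd) auto
    then have m: "z - t \<doteq> z' - t'" by (simp add: del_def z_def t_def z'_def t'_def)
    have y6: "6 * yq p = (z + t) * xq p" "6 * yq p' = (z' + t') * xq p'"
      by (simp_all add: yq_def z_def t_def z'_def t'_def)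
    have "xq p * (z + t) \<doteq> xq p' * (z' + t')"
      using ceq_mult[OF ceq_refl[OF vr_numeral] yy, of "num.Bit0 (num.Bit1 num.One)"] unfolding y6 by (simp add: mult.commute)
    also have "\<dots> \<doteq> xq p * (z' + t')" using zt by (intro ceq_mult ceq_sym[OF xx] ceq_refl) (auto intro: vr_add)
    finally have s: "z + t \<doteq> z' + t'" by - (rule ceq_cancel[of "xq p"], use q q' zt in \<open>auto intro: vr_add\<close>)
    have "2 * z \<doteq> 2 * z'" using ceq_add[OF m s] by simp
    then have zz: "z \<doteq> z'" using two_unit[OF six] zt by - (rule ceq_cancel[of 2], auto)
    have "2 * t \<doteq> 2 * t'" using ceq_diff[OF s m] by simp
    then have tt: "t \<doteq> t'" using two_unit[OF six] zt by - (rule ceq_cancel[of 2], auto)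
    have k0p: "fst p \<in> k0" "snd p \<in> k0" "fst p' \<in> k0" "snd p' \<in> k0" using p p' by (auto simp: S_def cpoints_def[OF six])
    have "fst p \<doteq> z * t" using ceq_sym[OF Q(3)[OF p]] by (simp add: z_def t_def)
    also have "\<dots> \<doteq> z' * t'" by (rule ceq_mult[OF zz tt])
    also have "\<dots> \<doteq> fst p'" using Q(3)[OF p'] by (simp add: z'_def t'_def)
    finally have 1: "fst p = fst p'" using k0_eq k0p by blast
    have "snd p + 3 * k * (fst p - d) \<doteq> z^3" using ceq_sym[OF Q(4)[OF p]] by (simp add: z_def)
    also have "\<dots> \<doteq> z'^3" by (rule ceq_power[OF zz])
    also have "\<dots> \<doteq> snd p' + 3 * k * (fst p' - d)" using Q(4)[OF p'] by (simp add: z'_def)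
    finally have "snd p + 3 * k * (fst p - d) \<doteq> snd p' + 3 * k * (fst p - d)" unfolding 1 .
    then have "snd p - snd p' \<in> vm" by (simp add: ceq_def)
    then have "snd p \<doteq> snd p'" using k0p k0_vr by (simp add: ceq_def)
    then have "snd p = snd p'" using k0_eq k0p by blast
    then show "p = p'" using 1 by (simp add: prod_eq_iff)
  qed
  then have "card (f ` S) = card S" by (rule card_image)
  moreover have "f ` S \<subset> cpoints a b 1"
  proof -
    \<comment> \<open>The kernel point \<open>(0, k b / \<theta>)\<close> lies on the curve but
      outside the range of \<open>f\<close>, whose first coordinates are units.\<close>
    define \<tau>b where "\<tau>b = k / \<theta> * b"
    have tv: "\<tau>b \<in> vr" unfolding \<tau>b_def using unit_divide[OF k(1) theta_vr theta_unit[OF six]] b by (intro vr_mult)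
    have "\<tau>b^2 = a * b^2" using k(3) by (simp add: \<tau>b_def power_mult_distrib power_divide theta2)
    then have "1 * \<tau>b^2 \<doteq> 0^3 + a * (0 - b)^2" using a b by (simp add: vr_mult vr_power)
    have "1 * rep \<tau>b^2 \<doteq> 1 * \<tau>b^2" using tv by (intro ceq_intros ceq_refl ceq_rep) auto
    also have "\<dots> \<doteq> 0^3 + a * (0 - b)^2" by fact
    also have "\<dots> \<doteq> rep 0^3 + a * (rep 0 - b)^2" using a b by (intro ceq_intros ceq_refl rep) auto
    finally have "(rep 0, rep \<tau>b) \<in> cpoints a b 1" using tv rep_k0 by (simp add: cpoints_def[OF six])
    moreover have "(rep 0, rep \<tau>b) \<notin> f ` S"
    proof
      assume "(rep 0, rep \<tau>b) \<in> f ` S"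
      then obtain p where p: "p \<in> S" "rep (xq p) = rep 0" by (auto simp: f_def)
      then have "xq p \<doteq> 0" using key[OF p(1)] rep_eq_iff by simp
      then show False using key[OF p(1)] by (simp add: ceq_def)
    qed
    ultimately show ?thesis using fS by blast
  qed
  then have "card (f ` S) < card (cpoints a b 1)" by (rule psubset_card_mono[OF finite_cpoints[OF six]])
  ultimately show False using card_cpoints_eq by (simp add: S_def d_def)
qed

text \<open>If \<open>u\<close> is a cube modulo the prime, the given solution is rescaled.
  Otherwise choose a target point outside the image of the isogeny and write
  \<open>x^3 = p q\<close> as in \<open>psi_surj\<close>. A unit among \<open>p\<close> and
  \<open>q\<close> is a cube times \<open>1\<close>, \<open>u\<close> or \<open>u^2\<close>; the
  choice of the point excludes the first, and the other two solve the equation for \<open>u\<close>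
  or, after an exchange, for its inverse.\<close>

lemma residue_solution:
  assumes u: "u \<in> vr" "u \<notin> vm"
    and base: "z0 \<in> vr" "t0 \<in> vr" "z0^3 - t0^3 = 6 * k * (z0 * t0 - (4 * a + 27 * b))"
  shows "\<exists>\<zeta>\<in>vr. \<exists>t\<in>vr. u * \<zeta>^3 - inverse u * t^3 - 6 * k * (\<zeta> * t - (4 * a + 27 * b)) \<in> vm"
proof -
  define d where "d = 4 * a + 27 * b"
  have dv: "d \<in> vr" "d \<notin> vm" using a b D by (auto simp: d_def intro!: vr_intros)
  have iu: "inverse u \<in> vr" "inverse u \<notin> vm" "u * inverse u = 1" "u \<noteq> 0"
    using unit_inverse[OF u] unit_nonzero[OF u(2)] by auto
  have goal: ?thesis if "\<zeta> \<in> vr" "t \<in> vr" "u * \<zeta>^3 \<doteq> p" "inverse u * t^3 \<doteq> q" "\<zeta> * t \<doteq> x"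
    "p - q - 6 * k * (x - d) = 0" for \<zeta> t p q x
  proof -
    have "u * \<zeta>^3 - inverse u * t^3 - 6 * k * (\<zeta> * t - d) \<doteq> p - q - 6 * k * (x - d)"
      using k dv by (intro ceq_intros ceq_refl that) (auto intro!: vr_intros)
    then have "u * \<zeta>^3 - inverse u * t^3 - 6 * k * (\<zeta> * t - d) \<in> vm" unfolding that(6) by (simp add: ceq_def)
    then show ?thesis using that(1,2) by (auto simp: d_def)
  qed
  show ?thesis
  proof (cases "\<exists>y\<in>vr. y^3 \<doteq> u")
    case True
    then obtain y where y: "y \<in> vr" "y^3 \<doteq> u" by blast
    have yu: "y \<notin> vm" using ceq_vm[OF y(2)] u y(1) by (simp add: vm_power_iff)
    have iy: "inverse y \<in> vr" "y \<noteq> 0" using unit_inverse[OF y(1) yu] unit_nonzero[OF yu] by auto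
    have "u * (inverse y * z0)^3 \<doteq> y^3 * (inverse y * z0)^3"
      using iy base by (intro ceq_mult ceq_sym[OF y(2)] ceq_refl) (auto intro!: vr_intros)
    moreover have "y^3 * (inverse y * z0)^3 = z0^3" using iy by (simp add: power_mult_distrib power_inverse)
    moreover have "inverse u * (y * t0)^3 \<doteq> t0^3"
    proof -
      have "inverse u * (y^3 * t0^3) \<doteq> inverse u * (u * t0^3)"
        using iu base by (intro ceq_mult y(2) ceq_refl) (auto intro!: vr_intros)
      moreover have "inverse u * (u * t0^3) = t0^3" "inverse u * (y * t0)^3 = inverse u * (y^3 * t0^3)"
        using iu(4) by (simp_all add: power_mult_distrib)
      ultimately show ?thesis by (simp only:)
    qed
    moreover have "(inverse y * z0) * (y * t0) = z0 * t0" using iy by simp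
    then have "(inverse y * z0) * (y * t0) \<doteq> z0 * t0" using base by (simp only: ceq_refl vr_mult)
    ultimately show ?thesis
      using goal[of "inverse y * z0" "y * t0" "z0^3" "t0^3" "z0 * t0"] iy y base
      by (simp add: vr_mult d_def)
  next
    case False
    then have nc: "\<And>y. y \<in> vr \<Longrightarrow> \<not> y^3 \<doteq> u" by blast
    obtain x y where xy: "(x, y) \<in> cpoints (- 27 * a) d 1" and no: "\<not> (\<exists>\<zeta>\<in>vr. \<exists>t\<in>vr. \<zeta> * t \<doteq> x \<and>
      \<zeta>^3 \<doteq> y + 3 * k * (x - d) \<and> t^3 \<doteq> y - 3 * k * (x - d))"
      using point_not_in_image unfolding d_def by blast
    have v: "x \<in> vr" "y \<in> vr" and e: "1 * y^2 \<doteq> x^3 + (- 27 * a) * (x - d)^2"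
      using xy k0_vr by (auto simp: cpoints_def[OF six])
    define p q where "p = y + 3 * k * (x - d)" and "q = y - 3 * k * (x - d)"
    have pqv: "p \<in> vr" "q \<in> vr" using v k dv by (auto simp: p_def q_def intro!: vr_intros)
    have pqd: "p - q - 6 * k * (x - d) = 0" by (simp add: p_def q_def algebra_simps)
    have "p * q - x^3 = 1 * y^2 - (x^3 + (- 27 * a) * (x - d)^2)"
      using k(3) unfolding p_def q_def by Groebner_Basis.algebra
    moreover have "1 * y^2 - (x^3 + (- 27 * a) * (x - d)^2) \<in> vm" using e unfolding ceq_def by blast
    ultimately have "p * q - x^3 \<in> vm" by (simp only:)
    then have pq: "p * q \<doteq> x^3" unfolding ceq_def using v pqv by (simp only: vr_mult vr_power)
    \<comment> \<open>By \<open>p q = x^3\<close> the first diagonal coordinate determines the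
      second, as long as the first factor is a unit.\<close>
    have split: "\<exists>t\<in>vr. c' * t^3 \<doteq> s' \<and> r * t \<doteq> x"
      if "r \<in> vr" "c * r^3 \<doteq> s" "s \<notin> vm" "s * s' \<doteq> x^3" "c \<in> vr" "c' \<in> vr" "c * c' = 1" "s' \<in> vr" for r s s' c c'
    proof -
      have s: "s \<in> vr" using that(2) ceqD by blast
      have "c * r^3 \<notin> vm" using ceq_vm[OF that(2)] that(3) by blast
      then have ru: "r \<notin> vm" using that by (auto simp: vm_mult_iff vm_power_iff vr_power)
      have ir: "inverse r \<in> vr" "r \<noteq> 0" using unit_inverse[OF that(1) ru] unit_nonzero[OF ru] by auto
      define t where "t = x * inverse r"
      have t: "t \<in> vr" unfolding t_def using v ir vr_mult by blast
      have "s * (c' * t^3) \<doteq> (c * r^3) * (c' * t^3)"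
        using that t by (intro ceq_mult ceq_sym[OF that(2)] ceq_refl) (auto intro!: vr_intros)
      also have "(c * r^3) * (c' * t^3) = (c * c') * (r * t)^3" by (simp add: power_mult_distrib algebra_simps)
      also have "r * t = x" using ir(2) by (simp add: t_def)
      also have "c * c' * x^3 = x^3" using that(7) by simp
      also have "x^3 \<doteq> s * s'" by (rule ceq_sym[OF that(4)])
      finally have "c' * t^3 \<doteq> s'"
        using that s t by - (rule ceq_cancel[of s], auto intro!: vr_intros)
      moreover have "r * t = x" using ir(2) by (simp add: t_def)
      then have "r * t \<doteq> x" using v by (simp only: ceq_refl)
      ultimately show ?thesis using t by blast
    qed
    have "\<exists>c c' \<zeta> t. c * c' = 1 \<and> (c = 1 \<or> c = u \<or> c' = u) \<and> \<zeta> \<in> vr \<and> t \<in> vr \<and>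
        c * \<zeta>^3 \<doteq> p \<and> c' * t^3 \<doteq> q \<and> \<zeta> * t \<doteq> x"
    proof -
      have cover: "\<exists>c c' r. c * c' = 1 \<and> c \<in> vr \<and> c' \<in> vr \<and> (c = 1 \<or> c = u \<or> c' = u) \<and> r \<in> vr \<and> c * r^3 \<doteq> s"
        if s: "s \<in> vr" for s
      proof -
        obtain r where r: "r \<in> vr" "r^3 \<doteq> s \<or> u * r^3 \<doteq> s \<or> u^2 * r^3 \<doteq> s"
          using cubes_cover[OF u nc s] by blast
        from r(2) show ?thesis
        proof (elim disjE)
          assume "r^3 \<doteq> s"
          then show ?thesis using r(1) by (intro exI[of _ 1] exI[of _ r]) simp
        next
          assume "u * r^3 \<doteq> s"
          then show ?thesis using r(1) iu u by (intro exI[of _ u] exI[of _ "inverse u"] exI[of _ r]) simp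
        next
          assume u2: "u^2 * r^3 \<doteq> s"
          have "inverse u * (u * r)^3 = u^2 * r^3"
            using iu(4) by (simp add: power_mult_distrib power2_eq_square power3_eq_cube)
          then show ?thesis using r(1) iu u u2
            by (intro exI[of _ "inverse u"] exI[of _ u] exI[of _ "u * r"]) (simp add: vr_mult mult.commute)
        qed
      qed
      show ?thesis
      proof (cases "p \<in> vm")
        case False
        obtain c c' r where c: "c * c' = 1" "c \<in> vr" "c' \<in> vr" "c = 1 \<or> c = u \<or> c' = u" "r \<in> vr" "c * r^3 \<doteq> p"
          using cover[OF pqv(1)] by blast
        obtain t where t: "t \<in> vr" "c' * t^3 \<doteq> q" "r * t \<doteq> x"
          using split[OF c(5,6) False pq c(2,3,1) pqv(2)] by blast
        show ?thesis using c t by blast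
      next
        \<comment> \<open>If \<open>p\<close> and \<open>q\<close> were both in \<open>vm\<close>,
          then so would be \<open>x\<close>, and by \<open>p - q = 6 k (x - d)\<close> also the unit
          \<open>d\<close>. Hence \<open>q\<close> is a unit, and the roles are exchanged.\<close>
        case True
        have qu: "q \<notin> vm"
        proof
          assume "q \<in> vm"
          have "x^3 \<in> vm" using ceq_vm[OF pq] True pqv vm_mult' by blast
          then have "x \<in> vm" using v by (simp add: vm_power_iff)
          have "6 * k * d = 6 * k * x - (p - q)" using pqd by (simp add: algebra_simps)
          moreover have "6 * k * x - (p - q) \<in> vm"
            using True \<open>q \<in> vm\<close> \<open>x \<in> vm\<close> k by (intro vm_diff vm_mult) (auto intro!: vr_intros)
          ultimately have "6 * k * d \<in> vm" by simp
          then show False using six k dv by (simp add: vm_mult_iff vr_mult)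
        qed
        have qp: "q * p \<doteq> x^3" using pq by (simp add: mult.commute)
        obtain c c' r where c: "c * c' = 1" "c \<in> vr" "c' \<in> vr" "c = 1 \<or> c = u \<or> c' = u" "r \<in> vr" "c * r^3 \<doteq> q"
          using cover[OF pqv(2)] by blast
        obtain t where t: "t \<in> vr" "c' * t^3 \<doteq> p" "r * t \<doteq> x"
          using split[OF c(5,6) qu qp c(2,3,1) pqv(1)] by blast
        have "c' * c = 1" "t * r \<doteq> x" "c' = 1 \<or> c' = u \<or> c = u" using c t by (auto simp: mult.commute)
        then show ?thesis using c t by blast
      qed
    qed
    then obtain c c' \<zeta> t where c: "c * c' = 1" "c = 1 \<or> c = u \<or> c' = u"
      and zt: "\<zeta> \<in> vr" "t \<in> vr" "c * \<zeta>^3 \<doteq> p" "c' * t^3 \<doteq> q" "\<zeta> * t \<doteq> x" by blast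
    from c(2) show ?thesis
    proof (elim disjE)
      assume "c = 1"
      then have "c' = 1" using c(1) by simp
      then show ?thesis using no zt \<open>c = 1\<close> unfolding p_def q_def by auto
    next
      assume "c = u"
      then have "c' = inverse u" using c(1) by (metis inverse_unique)
      then show ?thesis using goal[OF zt(1,2) _ _ zt(5) pqd] zt(3,4) \<open>c = u\<close> by simp
    next
      \<comment> \<open>The map \<open>(\<zeta>, t) \<mapsto> (- t, - \<zeta>)\<close> identifies
        the torsor of the inverse of \<open>u\<close> with that of \<open>u\<close>.\<close>
      assume "c' = u"
      then have "c = inverse u" using c(1) by (metis inverse_unique mult.commute)
      have m: "u * (- t)^3 = - (u * t^3)" "inverse u * (- \<zeta>)^3 = - (inverse u * \<zeta>^3)" "(- t) * (- \<zeta>) = \<zeta> * t"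
        by (simp_all add: power3_eq_cube)
      have neg: "- r \<doteq> - s" if "r \<doteq> s" for r s
        using ceq_diff[OF ceq_refl[OF vr_0] that] by simp
      have "u * (- t)^3 \<doteq> - q" "inverse u * (- \<zeta>)^3 \<doteq> - p"
        unfolding m using neg[OF zt(4)] neg[OF zt(3)] \<open>c' = u\<close> \<open>c = inverse u\<close> by simp_all
      then show ?thesis
        using goal[of "- t" "- \<zeta>" "- q" "- p" x] zt(1,2,5) pqd m(3) by (simp add: vr_uminus mult.commute[of t])
    qed
  qed
qed

text \<open>The reduced torsor is smooth: one of the partial derivatives \<open>A\<close> and
  \<open>B\<close> is a unit at the given point, and Hensel's lemma is applied in that
  variable.\<close>

lemma lift_solution:
  assumes u: "u \<in> vr" "u \<notin> vm" and z: "z \<in> vr" "t \<in> vr"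
    and sol: "u * z^3 - inverse u * t^3 - 6 * k * (z * t - (4 * a + 27 * b)) \<in> vm"
  shows "\<exists>\<zeta>\<in>vr. \<exists>t\<in>vr. u * \<zeta>^3 - inverse u * t^3 = 6 * k * (\<zeta> * t - (4 * a + 27 * b))"
proof -
  define d where "d = 4 * a + 27 * b"
  have dv: "d \<in> vr" "d \<notin> vm" using a b D by (auto simp: d_def intro!: vr_intros)
  have iu: "inverse u \<in> vr" "u * inverse u = 1"
    using unit_inverse[OF u] unit_nonzero[OF u(2)] by auto
  define m where "m = inverse u"
  have um: "u * m = 1" "m \<in> vr" using iu by (simp_all add: m_def)
  define A where "A = 3 * u * z^2 - 6 * k * t"
  define B where "B = - (3 * m * t^2) - 6 * k * z"
  define Er where "Er = u * z^3 - m * t^3 - 6 * k * (z * t - d)"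
  have v: "A \<in> vr" "B \<in> vr" "Er \<in> vm"
    using u z k um dv sol by (auto simp: A_def B_def Er_def m_def d_def intro!: vr_intros)
  have "A \<notin> vm \<or> B \<notin> vm"
  proof (rule ccontr)
    assume "\<not> ?thesis"
    then have AB: "A \<in> vm" "B \<in> vm" by auto
    \<comment> \<open>If both derivatives vanish, an Euler relation gives \<open>z t = 3 d\<close>,
      and the product of the derivatives gives \<open>z t = 0\<close> or
      \<open>z t = - 4 k^2\<close>. The two cases contradict that \<open>d\<close> and
      \<open>b\<close> are units.\<close>
    have "6 * k * (3 * d - z * t) = 3 * Er - z * A - t * B"
      unfolding Er_def A_def B_def by (simp add: power2_eq_square power3_eq_cube algebra_simps)
    then have "6 * k * (3 * d - z * t) \<in> vm" using AB v z by (auto intro!: vm_diff vm_mult)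
    then have zt: "3 * d - z * t \<in> vm"
      using six k dv z vm_mult_iff[of "6 * k" "3 * d - z * t"] by (auto simp: vm_mult_iff intro!: vr_intros)
    have "9 * (z * t)^2 * (u * m) = (A + 6 * k * t) * (- B - 6 * k * z)"
      by (simp add: A_def B_def power2_eq_square algebra_simps)
    then have "(z * t) * (9 * (z * t) + 36 * k^2) = - (A * B) - 6 * k * z * A - 6 * k * t * B"
      unfolding um by (simp add: power2_eq_square algebra_simps)
    moreover have "- (A * B) - 6 * k * z * A - 6 * k * t * B \<in> vm"
      using AB v z k(1) by (intro vm_diff vm_uminus vm_mult) (auto intro!: vr_intros)
    ultimately have "(z * t) * (9 * (z * t) + 36 * k^2) \<in> vm" by simp
    moreover have "z * t \<in> vr" "9 * (z * t) + 36 * k^2 \<in> vr" using z k(1) by (auto intro!: vr_intros)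
    ultimately consider "z * t \<in> vm" | "9 * (z * t) + 36 * k^2 \<in> vm"
      using vm_mult_iff by blast
    then show False
    proof cases
      case 1
      then have "3 * d \<in> vm" using vm_add[OF zt 1] by simp
      then show False using three_unit[OF six] dv by (simp add: vm_mult_iff)
    next
      case 2
      have "9 * (z * t) + 36 * k^2 + 9 * (3 * d - z * t) = 729 * b"
        unfolding k(3) d_def by (simp add: algebra_simps)
      then have "729 * b \<in> vm" using vm_add[OF 2 vm_mult[OF vr_numeral zt, of "num.Bit1 (num.Bit0 (num.Bit0 num.One))"]] by simp
      moreover have "729 \<notin> vm" using vm_power_iff[of 3 6] three_unit[OF six] by simp
      ultimately show False using b by (simp add: vm_mult_iff)
    qed
  qed
  then consider "A \<notin> vm" | "B \<notin> vm" by blast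
  then have "\<exists>\<zeta>\<in>vr. \<exists>t\<in>vr. u * \<zeta>^3 - m * t^3 = 6 * k * (\<zeta> * t - d)"
  proof cases
    case 1
    have "\<exists>x\<in>vr. x - z \<in> vm \<and> u * x^3 + 0 * x^2 + (- 6 * k * t) * x + (6 * k * d - m * t^3) = 0"
    proof (rule hensel_cubic_shift)
      have "u * z^3 + 0 * z^2 + (- 6 * k * t) * z + (6 * k * d - m * t^3) = Er"
        by (simp add: Er_def algebra_simps)
      then show "u * z^3 + 0 * z^2 + (- 6 * k * t) * z + (6 * k * d - m * t^3) \<in> vm" using v by simp
      have "3 * u * z^2 + 2 * 0 * z + (- 6 * k * t) = A" by (simp add: A_def)
      then show "3 * u * z^2 + 2 * 0 * z + (- 6 * k * t) \<notin> vm" using 1 by simp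
    qed (use u z k(1) um dv in \<open>auto intro!: vr_intros\<close>)
    then obtain x where "x \<in> vr" "u * x^3 + 0 * x^2 + (- 6 * k * t) * x + (6 * k * d - m * t^3) = 0" by blast
    then show ?thesis using z(2) by (intro bexI[of _ x] bexI[of _ t]) (auto simp: algebra_simps)
  next
    case 2
    have "\<exists>x\<in>vr. x - t \<in> vm \<and> (- m) * x^3 + 0 * x^2 + (- 6 * k * z) * x + (6 * k * d + u * z^3) = 0"
    proof (rule hensel_cubic_shift)
      have "(- m) * t^3 + 0 * t^2 + (- 6 * k * z) * t + (6 * k * d + u * z^3) = Er"
        by (simp add: Er_def algebra_simps)
      then show "(- m) * t^3 + 0 * t^2 + (- 6 * k * z) * t + (6 * k * d + u * z^3) \<in> vm" using v by simp
      have "3 * (- m) * t^2 + 2 * 0 * t + (- 6 * k * z) = B" by (simp add: B_def)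
      then show "3 * (- m) * t^2 + 2 * 0 * t + (- 6 * k * z) \<notin> vm" using 2 by simp
    qed (use u z k(1) um dv in \<open>auto intro!: vr_intros\<close>)
    then obtain x where "x \<in> vr" "(- m) * x^3 + 0 * x^2 + (- 6 * k * z) * x + (6 * k * d + u * z^3) = 0" by blast
    then show ?thesis using z(1) by (intro bexI[of _ z] bexI[of _ x]) (auto simp: algebra_simps)
  qed
  then show ?thesis by (simp add: m_def d_def)
qed

end

subsection \<open>Local solubility\<close>

text \<open>Modulo the prime \<open>d\<close> vanishes and the torsor is a nodal cubic. On the line
  \<open>t = m \<zeta>\<close> with a sign \<open>m\<close> it has the simple root
  \<open>c m / A\<close>. A sign with unit \<open>A\<close> exists because the two candidates differ
  by \<open>2 / u\<close>.\<close>

lemma soluble_unit: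
  assumes two: "2 \<notin> vm" and u: "u \<in> vr" "u \<notin> vm" and c: "c \<in> vr" "c \<notin> vm" and d: "d \<in> vm"
  shows "\<exists>\<zeta>\<in>vr. \<exists>t\<in>vr. u * \<zeta>^3 - inverse u * t^3 = c * (\<zeta> * t - d)"
proof -
  have iu: "inverse u \<in> vr" "inverse u \<notin> vm" using unit_inverse[OF u] by auto
  have "\<exists>m. (m = 1 \<or> m = - 1) \<and> u - inverse u * m \<notin> vm"
  proof (rule ccontr)
    assume "\<not> ?thesis"
    then have "u - inverse u * 1 \<in> vm" "u - inverse u * (- 1) \<in> vm" by blast+
    from vm_diff[OF this(2,1)] have "2 * inverse u \<in> vm" by simp
    then show False using two iu by (simp add: vm_mult_iff)
  qed
  then obtain m where m: "m = 1 \<or> m = - 1" and A: "u - inverse u * m \<notin> vm" by blast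
  define A where "A = u - inverse u * m"
  have m2: "m^2 = 1" "m^3 = m" using m by auto
  have mv: "m \<in> vr" "m \<notin> vm" using m vm_uminus[of "- 1"] by (auto intro: vr_uminus)
  have Av: "A \<in> vr" "A \<notin> vm" using u iu mv A by (auto simp: A_def intro!: vr_intros)
  have cm: "c * m \<in> vr" "c * m \<notin> vm" using c mv by (simp_all add: vr_mult vm_mult_iff)
  define x0 where "x0 = c * m / A"
  have x0: "x0 \<in> vr" unfolding x0_def by (rule unit_divide[OF cm(1) Av])
  have Ax: "A * x0 = c * m" using unit_nonzero[OF Av(2)] by (simp add: x0_def)
  have x0u: "x0 \<notin> vm" using vm_mult[OF Av(1), of x0] Ax cm by auto
  have "\<exists>x\<in>vr. x - x0 \<in> vm \<and> A * x^3 + (- (c * m)) * x^2 + 0 * x + c * d = 0"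
  proof (rule hensel_cubic_shift)
    have "A * x0^3 + (- (c * m)) * x0^2 + 0 * x0 + c * d = x0^2 * (A * x0 - c * m) + c * d"
      by (simp add: power2_eq_square power3_eq_cube algebra_simps)
    then show "A * x0^3 + (- (c * m)) * x0^2 + 0 * x0 + c * d \<in> vm"
      using vm_mult[OF c(1) d] by (simp add: Ax)
    have "3 * A * x0^2 + 2 * (- (c * m)) * x0 + 0 = x0 * (3 * (A * x0) - 2 * (c * m))"
      by (simp add: power2_eq_square algebra_simps)
    also have "\<dots> = x0 * (c * m)" unfolding Ax by simp
    finally show "3 * A * x0^2 + 2 * (- (c * m)) * x0 + 0 \<notin> vm"
      using unit_mult[OF x0 cm(1) x0u cm(2)] by (simp only: simp_thms)
  qed (use Av x0 cm c vm_vr[OF d] in \<open>auto intro!: vr_intros\<close>)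
  then obtain x where x: "x \<in> vr" "A * x^3 + (- (c * m)) * x^2 + 0 * x + c * d = 0" by blast
  have "u * x^3 - inverse u * (m * x)^3 = A * x^3"
    by (simp add: A_def power_mult_distrib m2 algebra_simps)
  also have "\<dots> = c * (x * (m * x) - d)" using x(2) by (simp add: power2_eq_square algebra_simps)
  finally show ?thesis using x(1) mv vr_mult by blast
qed

text \<open>Put \<open>\<zeta> = 1\<close> and \<open>t = u x\<close>. Divided by \<open>u\<close>,
  the equation becomes \<open>u x^3 + c x = q\<close>, which is linear modulo the prime; this
  division is where \<open>u\<close> has to divide \<open>d\<close>.\<close>

lemma soluble_nonunit:
  assumes u: "u \<in> vm" "u \<noteq> 0" and c: "c \<in> vr" "c \<notin> vm" and d: "d / u \<in> vr"
  shows "\<exists>\<zeta>\<in>vr. \<exists>t\<in>vr. u * \<zeta>^3 - inverse u * t^3 = c * (\<zeta> * t - d)"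
proof -
  define q where "q = 1 + c * (d / u)"
  have q: "q \<in> vr" unfolding q_def by (intro vr_add vr_1 vr_mult c(1) d)
  define x0 where "x0 = q / c"
  have x0: "x0 \<in> vr" unfolding x0_def by (rule unit_divide[OF q c])
  have cx: "c * x0 = q" using unit_nonzero[OF c(2)] by (simp add: x0_def)
  have uv: "u \<in> vr" by (rule vm_vr[OF u(1)])
  have "\<exists>x\<in>vr. x - x0 \<in> vm \<and> (- u) * x^3 + 0 * x^2 + (- c) * x + q = 0"
  proof (rule hensel_cubic_shift)
    have "(- u) * x0^3 + 0 * x0^2 + (- c) * x0 + q = - (x0^3 * u)" by (simp add: cx)
    then show "(- u) * x0^3 + 0 * x0^2 + (- c) * x0 + q \<in> vm"
      using vm_uminus[OF vm_mult[OF vr_power[OF x0, of 3] u(1)]] by (simp only:)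
    have "3 * (- u) * x0^2 + 2 * 0 * x0 + (- c) = - (c + 3 * x0^2 * u)" by simp
    moreover have "3 * x0^2 * u \<in> vm" using x0 by (intro vm_mult u(1)) (auto intro!: vr_intros)
    then have "- (c + 3 * x0^2 * u) \<notin> vm"
      using unit_add_vm[OF c(2)] vm_uminus[of "- (c + 3 * x0^2 * u)"] by (simp only: minus_minus) blast
    ultimately show "3 * (- u) * x0^2 + 2 * 0 * x0 + (- c) \<notin> vm" by (simp only: simp_thms)
  qed (use uv c q x0 in \<open>auto intro!: vr_intros\<close>)
  then obtain x where x: "x \<in> vr" "(- u) * x^3 + 0 * x^2 + (- c) * x + q = 0" by blast
  have "u * 1^3 - inverse u * (u * x)^3 - c * (1 * (u * x) - d) =
      u * ((- u) * x^3 + 0 * x^2 + (- c) * x + q)"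
    using u(2) by (simp add: q_def field_simps power2_eq_square power3_eq_cube)
  then have "u * 1^3 - inverse u * (u * x)^3 = c * (1 * (u * x) - d)" unfolding x(2) by simp
  then show ?thesis using vr_mult[OF uv x(1)] vr_1 by blast
qed

lemma geometric_vr:
  assumes y: "y \<in> vr" and y1: "y \<noteq> 1"
  shows "(1 - y ^ n) / (1 - y) \<in> vr"
proof -
  have "(1 - y ^ n) / (1 - y) = (\<Sum>i<n. y ^ i)" using y1 by (simp add: sum_gp_strict)
  moreover have "(\<Sum>i<n. y ^ i) \<in> vr" by (induction n) (auto intro: vr_add vr_power y)
  ultimately show ?thesis by simp
qed

section \<open>Solubility of the torsor of \<open>unit_u e\<close> at every finite prime\<close>

context
  fixes N e :: nat
  assumes N: "N \<ge> 2" "odd N" and e: "odd e" "e \<ge> 5" "e dvd N"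
begin

text \<open>Coordinates of the form \<open>\<alpha> + \<beta> \<rho>\<close> and
  \<open>\<alpha> - \<beta> \<rho>\<close> allow one statement for completions with and without
  \<open>\<rho>\<close>.\<close>

definition soluble :: bool where
  "soluble \<longleftrightarrow> (\<exists>\<alpha>\<in>L. \<exists>\<beta>\<in>L. unit_u e * (\<alpha> + \<beta> * \<rho>)^3 - inverse (unit_u e) * (\<alpha> - \<beta> * \<rho>)^3 =
     6 * \<kappa> N * ((\<alpha> + \<beta> * \<rho>) * (\<alpha> - \<beta> * \<rho>) - of_int (4 * curve_a N + 27)))"

definition hh :: complex where "hh = 6 ^ ((e - 1) div 2)"

lemma rho_e: "\<rho> ^ e = hh * \<rho>"
  using rho_odd_power[OF e(1)] by (simp add: hh_def)

lemma d_eq: "of_int (4 * curve_a N + 27) = (27 * (1 - 6 ^ N) :: complex)"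
  using arg_cong[OF curve_d[OF N(1)], of complex_of_int] by simp

lemma six_power_neq: "(6::complex) ^ n \<noteq> 1" if "n > 0"
proof
  assume "(6::complex) ^ n = 1"
  then have "complex_of_nat (6 ^ n) = of_nat 1" by simp
  then have "(6::nat) ^ n = 1" by (simp only: of_nat_eq_iff)
  then show False using that by simp
qed

lemma rho_power_neq: "1 - \<rho> ^ n \<noteq> 0" "1 + \<rho> ^ n \<noteq> 0" if "n > 0"
proof -
  have "(1 - \<rho> ^ n) * (1 + \<rho> ^ n) = 1 - 6 ^ n"
    using rho_square_power[of n] by (simp add: power2_eq_square algebra_simps)
  then have "(1 - \<rho> ^ n) * (1 + \<rho> ^ n) \<noteq> 0" using six_power_neq[OF that] by simp
  then show "1 - \<rho> ^ n \<noteq> 0" "1 + \<rho> ^ n \<noteq> 0" by auto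
qed

text \<open>These are the diagonal coordinates of the rational point \<open>(1, 1)\<close> of the
  curve, which solve the torsor for \<open>u = 1\<close>.\<close>

lemma base_solution: "(3 - 2 * \<kappa> N)^3 - (3 + 2 * \<kappa> N)^3 =
    6 * \<kappa> N * ((3 - 2 * \<kappa> N) * (3 + 2 * \<kappa> N) - of_int (4 * curve_a N + 27))"
proof -
  define a where "a = complex_of_int (curve_a N)"
  have "\<kappa> N ^ 2 = - 3 * a" using kappa_square[OF N(1)] by (simp add: a_def)
  then have "(3 - 2 * \<kappa> N)^3 - (3 + 2 * \<kappa> N)^3 = 6 * \<kappa> N * ((3 - 2 * \<kappa> N) * (3 + 2 * \<kappa> N) - (4 * a + 27))"
    by Groebner_Basis.algebra
  then show ?thesis by (simp add: a_def)
qed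

text \<open>The cubic equation says that \<open>(1 + g \<rho>)^3\<close> is proportional over
  \<open>L\<close> to \<open>1 + \<rho>^e\<close>, so that \<open>unit_u e\<close> is the cube of
  \<open>(1 + g \<rho>) / (1 - g \<rho>)\<close>, an element of norm 1. Dividing the base solution
  by it solves the torsor; \<open>6 g^2 \<noteq> 1\<close> keeps the norm of
  \<open>1 + g \<rho>\<close> away from 0.\<close>

lemma soluble_root:
  assumes g: "g \<in> L" "6 * g^3 + 3 * g = hh * (1 + 18 * g^2)" "6 * g^2 \<noteq> 1"
  shows soluble
proof -
  define j where "j = (9::complex) * 6 ^ ((N - 1) div 2)"
  have kj: "2 * \<kappa> N = j * \<rho>" unfolding j_def kappa_K[OF N(2)] by simp
  define D where "D = 1 - 6 * g^2"
  have D: "D \<noteq> 0" using g(3) by (simp add: D_def)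
  have gg: "(1 - g * \<rho>) * (1 + g * \<rho>) = D"
    using rho2 by (simp add: D_def power2_eq_square algebra_simps)
  \<comment> \<open>\<open>p + q \<rho>\<close> is \<open>(1 - g \<rho>) / (1 + g \<rho>)\<close>,
    the inverse of the cube root of \<open>unit_u e\<close>.\<close>
  define p q where "p = (1 + 6 * g^2) / D" and "q = - 2 * g / D"
  have pq: "(p + q * \<rho>) * (1 + g * \<rho>) = 1 - g * \<rho>" "(p - q * \<rho>) * (1 - g * \<rho>) = 1 + g * \<rho>"
  proof -
    have "D * (p + q * \<rho>) = 1 + 6 * g^2 - 2 * g * \<rho>" using D by (simp add: p_def q_def field_simps)
    also have "\<dots> = (1 - g * \<rho>)^2" using rho2 by (simp add: power2_eq_square algebra_simps)
    finally have "(1 - g * \<rho>) * ((p + q * \<rho>) * (1 + g * \<rho>) - (1 - g * \<rho>)) = 0"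
      unfolding gg[symmetric] by (simp add: power2_eq_square algebra_simps)
    moreover have "1 - g * \<rho> \<noteq> 0" using gg D by auto
    ultimately show "(p + q * \<rho>) * (1 + g * \<rho>) = 1 - g * \<rho>" by simp
    have "D * (p - q * \<rho>) = 1 + 6 * g^2 + 2 * g * \<rho>" using D by (simp add: p_def q_def field_simps)
    also have "\<dots> = (1 + g * \<rho>)^2" using rho2 by (simp add: power2_eq_square algebra_simps)
    finally have "(1 + g * \<rho>) * ((p - q * \<rho>) * (1 - g * \<rho>) - (1 + g * \<rho>)) = 0"
      unfolding gg[symmetric] by (simp add: power2_eq_square algebra_simps)
    moreover have "1 + g * \<rho> \<noteq> 0" using gg D by auto
    ultimately show "(p - q * \<rho>) * (1 - g * \<rho>) = 1 + g * \<rho>" by simp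
  qed
  have e0: "e > 0" using e by simp
  have u: "unit_u e * (1 - \<rho> ^ e) = 1 + \<rho> ^ e" "inverse (unit_u e) * (1 + \<rho> ^ e) = 1 - \<rho> ^ e"
    using rho_power_neq[OF e0] by (simp_all add: unit_u_def)
  have cube: "(1 - g * \<rho>)^3 * (1 + \<rho> ^ e) = (1 + g * \<rho>)^3 * (1 - \<rho> ^ e)"
  proof -
    have "(1 - g * \<rho>)^3 * (1 + \<rho> ^ e) - (1 + g * \<rho>)^3 * (1 - \<rho> ^ e) =
        2 * \<rho> * (hh * (1 + 3 * g^2 * \<rho>^2) - (3 * g + g^3 * \<rho>^2))"
      unfolding rho_e by (simp add: power2_eq_square power3_eq_cube algebra_simps)
    also have "\<dots> = 0" unfolding rho2 using g(2) by (simp add: algebra_simps)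
    finally show ?thesis by simp
  qed
  have nz: "(1 + g * \<rho>)^3 * (1 - \<rho> ^ e) \<noteq> 0" "(1 - g * \<rho>)^3 * (1 + \<rho> ^ e) \<noteq> 0"
    using gg D rho_power_neq[OF e0] by auto
  have "unit_u e * (p + q * \<rho>)^3 * ((1 + g * \<rho>)^3 * (1 - \<rho> ^ e)) =
      (unit_u e * (1 - \<rho> ^ e)) * ((p + q * \<rho>) * (1 + g * \<rho>))^3"
    by (simp add: power_mult_distrib)
  also have "\<dots> = (1 + g * \<rho>)^3 * (1 - \<rho> ^ e)" unfolding u pq using cube by (simp add: mult.commute)
  finally have u1: "unit_u e * (p + q * \<rho>)^3 = 1" using nz(1) by simp
  have "inverse (unit_u e) * (p - q * \<rho>)^3 * ((1 - g * \<rho>)^3 * (1 + \<rho> ^ e)) =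
      (inverse (unit_u e) * (1 + \<rho> ^ e)) * ((p - q * \<rho>) * (1 - g * \<rho>))^3"
    by (simp add: power_mult_distrib)
  also have "\<dots> = (1 - g * \<rho>)^3 * (1 + \<rho> ^ e)" unfolding u pq using cube by (simp add: mult.commute)
  finally have u2: "inverse (unit_u e) * (p - q * \<rho>)^3 = 1" using nz(2) by simp
  have pq1: "(p + q * \<rho>) * (p - q * \<rho>) = 1"
  proof -
    have "((p + q * \<rho>) * (1 + g * \<rho>)) * ((p - q * \<rho>) * (1 - g * \<rho>)) = (1 - g * \<rho>) * (1 + g * \<rho>)"
      unfolding pq ..
    then have "((p + q * \<rho>) * (p - q * \<rho>)) * ((1 - g * \<rho>) * (1 + g * \<rho>)) = 1 * ((1 - g * \<rho>) * (1 + g * \<rho>))"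
      by (simp only: ac_simps mult_1_left mult_1_right)
    then show ?thesis unfolding gg using D by simp
  qed
  define \<alpha> \<beta> where "\<alpha> = 3 * p - 6 * q * j" and "\<beta> = 3 * q - p * j"
  have "j \<in> L" unfolding j_def by (intro L_intros)
  moreover have "p \<in> L" "q \<in> L" unfolding p_def q_def D_def using g(1) by (auto intro!: L_intros)
  ultimately have ab: "\<alpha> \<in> L" "\<beta> \<in> L" unfolding \<alpha>_def \<beta>_def by (auto intro!: L_intros)
  have z: "\<alpha> + \<beta> * \<rho> = (p + q * \<rho>) * (3 - 2 * \<kappa> N)" "\<alpha> - \<beta> * \<rho> = (p - q * \<rho>) * (3 + 2 * \<kappa> N)"
    unfolding kj \<alpha>_def \<beta>_def rho2[symmetric] by (simp_all add: power2_eq_square algebra_simps)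
  have "unit_u e * (\<alpha> + \<beta> * \<rho>)^3 = (3 - 2 * \<kappa> N)^3" "inverse (unit_u e) * (\<alpha> - \<beta> * \<rho>)^3 = (3 + 2 * \<kappa> N)^3"
    unfolding z power_mult_distrib mult.assoc[symmetric] u1 u2 by simp_all
  moreover have "(\<alpha> + \<beta> * \<rho>) * (\<alpha> - \<beta> * \<rho>) = (3 - 2 * \<kappa> N) * (3 + 2 * \<kappa> N)"
  proof -
    have "(\<alpha> + \<beta> * \<rho>) * (\<alpha> - \<beta> * \<rho>) = ((p + q * \<rho>) * (p - q * \<rho>)) * ((3 - 2 * \<kappa> N) * (3 + 2 * \<kappa> N))"
      unfolding z by (simp only: ac_simps)
    then show ?thesis by (simp only: pq1 mult_1_left)
  qed
  ultimately show ?thesis using ab base_solution unfolding soluble_def by metis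
qed

lemma soluble_pair:
  assumes r: "\<rho> \<in> L" and z: "\<zeta> \<in> L" "t \<in> L"
    "unit_u e * \<zeta>^3 - inverse (unit_u e) * t^3 = 6 * \<kappa> N * (\<zeta> * t - 27 * (1 - 6 ^ N))"
  shows soluble
proof -
  define \<alpha> \<beta> where "\<alpha> = (\<zeta> + t) / 2" and "\<beta> = (\<zeta> - t) / (2 * \<rho>)"
  have "\<alpha> \<in> L" "\<beta> \<in> L" using r z by (auto simp: \<alpha>_def \<beta>_def intro!: L_intros)
  moreover have "\<beta> * \<rho> = (\<zeta> - t) / 2" by (simp add: \<beta>_def)
  then have "\<alpha> + \<beta> * \<rho> = \<zeta>" "\<alpha> - \<beta> * \<rho> = t" by (simp_all add: \<alpha>_def field_simps)
  ultimately show ?thesis using z(3) d_eq unfolding soluble_def by metis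
qed

text \<open>For \<open>e \<ge> 5\<close> the number \<open>hh\<close> is a multiple of 36. The cubic
  of \<open>soluble_root\<close>, divided by 3, is therefore integral with linear coefficient 1 and
  constant term in \<open>vm\<close>, above 2 and above 3 alike.\<close>

lemma soluble_small:
  assumes six: "6 \<in> vm"
  shows soluble
proof -
  define k where "k = (e - 1) div 2 - 2"
  have "(e - 1) div 2 = k + 2" using e(1,2) by (auto simp: k_def elim!: oddE)
  then have hk: "hh = 3 * (12 * 6 ^ k)" by (simp add: hh_def)
  have hv: "hh \<in> vr" by (auto simp: hh_def intro!: vr_intros)
  have "- (12 * 6 ^ k) = - (2 * 6 ^ k * (6::complex))" by simp
  also have "\<dots> \<in> vm" by (intro vm_uminus vm_mult six) (auto intro!: vr_intros)
  finally have c0: "- (12 * 6 ^ k) \<in> vm" .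
  obtain g where g: "g \<in> vm" "2 * g^3 + (- 6 * hh) * g^2 + 1 * g + (- (12 * 6 ^ k)) = 0"
    using hensel_cubic[OF c0 vr_1 vm_1, of "- 6 * hh" 2] hv by (auto intro: vr_intros)
  have gv: "g \<in> vr" "g \<in> L" using g(1) vm_vr vr_L by auto
  have "6 * g^3 + 3 * g = hh * (1 + 18 * g^2)"
  proof -
    have "3 * (2 * g^3 + (- 6 * hh) * g^2 + 1 * g + (- (12 * 6 ^ k))) = 6 * g^3 + 3 * g - 18 * hh * g^2 - 3 * (12 * 6 ^ k)"
      by (simp add: algebra_simps)
    then show ?thesis unfolding g(2) hk[symmetric] by (simp add: algebra_simps)
  qed
  moreover have "6 * g^2 \<in> vm" using six vm_mult'[OF six vr_power[OF gv(1)]] by simp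
  then have "6 * g^2 \<noteq> 1" by auto
  ultimately show ?thesis by (rule soluble_root[OF gv(2)])
qed

text \<open>In the parameter \<open>g\<close> of \<open>(1 + g \<rho>) / (1 - g \<rho>)\<close>,
  cubing on elements of norm 1 is the function \<open>G\<close>. If the residue field has
  \<open>q\<close> elements, \<open>q - 1\<close> is divisible by 3 because of the cube roots of
  unity, and the group of norm 1 has order \<open>q + 1\<close>, prime to 3. In the proof this
  appears as injectivity of \<open>G\<close> on \<open>k0\<close>.\<close>

lemma soluble_inert:
  assumes six: "6 \<notin> vm" and r: "\<rho> \<notin> L"
  shows soluble
proof -
  note two = two_unit[OF six] and three = three_unit[OF six]
  \<comment> \<open>A square root of 6 in the residue field would lift to \<open>L\<close> by
    Hensel's lemma. The nonvanishing of the denominator of \<open>G\<close>, its injectivity and the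
    unit derivative are all derived from this.\<close>
  have ns: "x^2 - 6 \<notin> vm" if x: "x \<in> vr" for x
  proof
    assume v: "x^2 - 6 \<in> vm"
    have "x \<notin> vm"
    proof
      assume "x \<in> vm"
      then have "x^2 \<in> vm" using x by (simp add: vm_power_iff)
      then show False using six vm_diff[OF _ v, of "x^2"] by simp
    qed
    then have "2 * x \<notin> vm" using two x by (simp add: vm_mult_iff)
    then have "\<exists>y\<in>vr. y - x \<in> vm \<and> 0 * y^3 + 1 * y^2 + 0 * y + (- 6) = 0"
      using v x by (intro hensel_cubic_shift) (auto intro!: vr_intros)
    then obtain y where y: "y \<in> vr" "y^2 = 6" by auto
    then have "y^2 = \<rho>^2" by (simp add: rho2)
    then have "\<rho> = y \<or> \<rho> = - y" by (metis power2_eq_iff)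
    then show False using r vr_L[OF y(1)] L_intros(5)[of y] by auto
  qed
  have hv: "hh \<in> vr" by (auto simp: hh_def intro!: vr_intros)
  have den: "1 + 18 * g^2 \<notin> vm" if g: "g \<in> vr" for g
  proof
    assume v: "1 + 18 * g^2 \<in> vm"
    have "(6 * (\<theta> * g))^2 - 6 = - 6 * (1 + 18 * g^2)"
      by (simp add: power_mult_distrib theta2)
    moreover have "- 6 * (1 + 18 * g^2) \<in> vm" by (rule vm_mult[OF _ v]) (intro vr_uminus vr_numeral)
    ultimately have "(6 * (\<theta> * g))^2 - 6 \<in> vm" by (simp only:)
    then show False using ns[of "6 * (\<theta> * g)"] theta_vr g by (simp add: vr_mult)
  qed
  define G where "G = (\<lambda>g::complex. (3 * g + 6 * g^3) / (1 + 18 * g^2))"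
  have num: "3 * g + 6 * g^3 \<in> vr" "1 + 18 * g^2 \<in> vr" if "g \<in> vr" for g
    using that by (auto intro!: vr_intros)
  have Gv: "G g \<in> vr" if "g \<in> vr" for g
    unfolding G_def using unit_divide[OF num(1)[OF that] num(2)[OF that] den[OF that]] .
  have Geq: "G g * (1 + 18 * g^2) = 3 * g + 6 * g^3" if "g \<in> vr" for g
    unfolding G_def using unit_nonzero[OF den[OF that]] by simp
  have "inj_on (\<lambda>g. rep (G g)) k0"
  proof (rule inj_onI)
    fix g g' assume gk: "g \<in> k0" "g' \<in> k0" and eq: "rep (G g) = rep (G g')"
    note gv = k0_vr[OF gk(1)] k0_vr[OF gk(2)]
    have GG: "G g - G g' \<in> vm" using eq Gv gv by (simp add: rep_eq_iff ceq_def)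
    define d M where "d = g - g'" and "M = 1 - 6 * (g * g')"
    have dM: "d \<in> vr" "M \<in> vr" using gv by (auto simp: d_def M_def intro!: vr_intros)
    have "(G g - G g') * ((1 + 18 * g^2) * (1 + 18 * g'^2)) =
        (G g * (1 + 18 * g^2)) * (1 + 18 * g'^2) - (G g' * (1 + 18 * g'^2)) * (1 + 18 * g^2)"
      by (simp add: algebra_simps)
    also have "\<dots> = 3 * (d * (M^2 + 2 * d^2))"
      unfolding Geq[OF gv(1)] Geq[OF gv(2)] d_def M_def
      by (simp add: power2_eq_square power3_eq_cube algebra_simps)
    finally have "3 * (d * (M^2 + 2 * d^2)) \<in> vm"
      using vm_mult'[OF GG vr_mult[OF num(2)[OF gv(1)] num(2)[OF gv(2)]]] by simp
    then consider "d \<in> vm" | "d \<notin> vm" "M^2 + 2 * d^2 \<in> vm"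
      using three dM vm_mult_iff vr_mult vr_add vr_power vr_numeral by metis
    then show "g = g'"
    proof cases
      case 1
      then show ?thesis using k0_eq[OF gk] gv by (simp add: d_def ceq_def)
    next
      case 2
      have id: "inverse d \<in> vr" "d \<noteq> 0" using unit_inverse[OF dM(1) 2(1)] unit_nonzero[OF 2(1)] by auto
      have "(\<theta> * M * inverse d)^2 - 6 = (- 3 * (inverse d)^2) * (M^2 + 2 * d^2)"
        using id by (simp add: power_mult_distrib theta2 power_inverse field_simps)
      moreover have "- 3 * (inverse d)^2 \<in> vr" using id by (auto intro!: vr_intros)
      ultimately have "(\<theta> * M * inverse d)^2 - 6 \<in> vm" using vm_mult[OF _ 2(2)] by metis
      then show ?thesis using ns[of "\<theta> * M * inverse d"] theta_vr dM id vr_mult by blast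
    qed
  qed
  moreover have "(\<lambda>g. rep (G g)) ` k0 \<subseteq> k0" using Gv rep_k0 k0_vr by blast
  ultimately have "(\<lambda>g. rep (G g)) ` k0 = k0" by (intro endo_inj_surj finite_k0)
  then obtain g where g: "g \<in> k0" "rep (G g) = rep hh" using rep_k0[OF hv] by (metis imageE)
  note gv = k0_vr[OF g(1)]
  have Gh: "G g - hh \<in> vm" using g(2) Gv[OF gv] hv by (simp add: rep_eq_iff ceq_def)
  have u6: "1 - 6 * g^2 \<notin> vm"
  proof
    assume v: "1 - 6 * g^2 \<in> vm"
    have "(6 * g)^2 - 6 = - 6 * (1 - 6 * g^2)" by (simp add: power_mult_distrib)
    moreover have "- 6 * (1 - 6 * g^2) \<in> vm" by (rule vm_mult[OF _ v]) (intro vr_uminus vr_numeral)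
    ultimately have "(6 * g)^2 - 6 \<in> vm" by (simp only:)
    then show False using ns[of "6 * g"] gv by (simp add: vr_mult)
  qed
  have "\<exists>x\<in>vr. x - g \<in> vm \<and> 6 * x^3 + (- 18 * hh) * x^2 + 3 * x + (- hh) = 0"
  proof (rule hensel_cubic_shift)
    have "6 * g^3 + (- 18 * hh) * g^2 + 3 * g + (- hh) = (3 * g + 6 * g^3) - hh * (1 + 18 * g^2)"
      by (simp add: algebra_simps)
    also have "\<dots> = (G g - hh) * (1 + 18 * g^2)" unfolding Geq[OF gv, symmetric] by (simp add: algebra_simps)
    finally show "6 * g^3 + (- 18 * hh) * g^2 + 3 * g + (- hh) \<in> vm"
      using vm_mult'[OF Gh num(2)[OF gv]] by simp
    show "3 * 6 * g^2 + 2 * (- 18 * hh) * g + 3 \<notin> vm"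
    proof
      assume v: "3 * 6 * g^2 + 2 * (- 18 * hh) * g + 3 \<in> vm"
      \<comment> \<open>Up to a multiple of the cubic itself, its derivative times the denominator
        of \<open>G\<close> is \<open>3 (1 - 6 g^2)^2\<close>, a unit.\<close>
      have "3 * (1 - 6 * g^2)^2 = (3 * 6 * g^2 + 2 * (- 18 * hh) * g + 3) * (1 + 18 * g^2)
          - 36 * g * ((3 * g + 6 * g^3) - hh * (1 + 18 * g^2))"
        by (simp add: power2_eq_square power3_eq_cube algebra_simps)
      also have "(3 * g + 6 * g^3) - hh * (1 + 18 * g^2) = (G g - hh) * (1 + 18 * g^2)"
        unfolding Geq[OF gv, symmetric] by (simp add: algebra_simps)
      finally have "3 * (1 - 6 * g^2)^2 \<in> vm"
        using vm_diff[OF vm_mult'[OF v num(2)[OF gv]] vm_mult[OF vr_mult[OF vr_numeral gv] vm_mult'[OF Gh num(2)[OF gv]]]]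
        by (simp only:)
      moreover have "1 - 6 * g^2 \<in> vr" using gv by (auto intro!: vr_intros)
      ultimately show False using three u6 by (simp add: vm_mult_iff vm_power_iff vr_power)
    qed
  qed (use gv hv in \<open>auto intro!: vr_intros\<close>)
  then obtain x where x: "x \<in> vr" "6 * x^3 + (- 18 * hh) * x^2 + 3 * x + (- hh) = 0" by blast
  have "6 * x^3 + 3 * x = hh * (1 + 18 * x^2)" using x(2) by (simp add: algebra_simps)
  moreover have "6 * x^2 \<noteq> 1"
  proof
    assume "6 * x^2 = 1"
    then have h: "(6 * x)^2 - 6 = 0" by (simp add: power_mult_distrib)
    have "(6 * x)^2 - 6 \<notin> vm" by (intro ns vr_mult vr_numeral x(1))
    then have "(0::complex) \<notin> vm" unfolding h .
    then show False by simp
  qed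
  ultimately show ?thesis using vr_L[OF x(1)] by (intro soluble_root)
qed

text \<open>Numerator \<open>P\<close> and denominator \<open>M\<close> of \<open>unit_u e\<close>
  add up to 2, so at most one of them is a nonunit. As \<open>N\<close> is an odd multiple of
  \<open>e\<close>, both divide \<open>d\<close> in the valuation ring, which is what
  \<open>soluble_nonunit\<close> requires.\<close>

lemma soluble_split:
  assumes six: "6 \<notin> vm" and r: "\<rho> \<in> L"
  shows soluble
proof -
  note two = two_unit[OF six] and three = three_unit[OF six]
  have "w \<rho> ^ 2 = w 6" using w_power[OF r, of 2] rho2 by simp
  also have "w 6 = 1" using six unit_iff[of 6] by simp
  finally have "w \<rho> = 1" using w_nonneg[OF r] by (simp add: power2_eq_1_iff)
  then have rv: "\<rho> \<in> vr" "\<rho> \<notin> vm" using r by (auto simp: vr_def vm_def)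
  have rp: "\<rho> ^ n \<in> vr" "\<rho> ^ n \<notin> vm" for n
    using rv by (cases "n = 0"; simp add: vr_power vm_power_iff)+
  have e0: "e > 0" using e by simp
  define P M where "P = 1 + \<rho> ^ e" and "M = 1 - \<rho> ^ e"
  have PM: "P \<in> vr" "M \<in> vr" "P \<noteq> 0" "M \<noteq> 0"
    using rp[of e] rho_power_neq[OF e0] by (auto simp: P_def M_def intro!: vr_intros)
  define d :: complex where "d = 27 * (1 - 6 ^ N)"
  have dv: "d \<in> vr" by (auto simp: d_def intro!: vr_intros)
  obtain n where n: "N = e * n" using e(3) by (auto elim: dvdE)
  then have "odd n" using N(2) by simp
  have rN: "\<rho> ^ N = (\<rho> ^ e) ^ n" by (simp add: n power_mult)
  have d1: "d = 27 * ((1 - \<rho> ^ N) * (1 + \<rho> ^ N))"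
    using rho_square_power[of N] by (simp add: d_def power2_eq_square algebra_simps)
  have QM: "(1 - \<rho> ^ N) / M \<in> vr"
    unfolding M_def rN using geometric_vr[OF rp(1)[of e], of n] PM(4) by (simp add: M_def)
  have n1: "- (\<rho> ^ e) \<noteq> 1"
  proof
    assume h: "- (\<rho> ^ e) = 1"
    have "P = 0" unfolding P_def by (subst h[symmetric]) simp
    then show False using PM(3) by simp
  qed
  have QP: "(1 + \<rho> ^ N) / P \<in> vr"
    using geometric_vr[OF vr_uminus[OF rp(1)[of e]], of n] n1 \<open>odd n\<close>
    by (simp add: P_def rN)
  have dP: "d / P \<in> vr"
  proof -
    have "d / P = 27 * (1 - \<rho> ^ N) * ((1 + \<rho> ^ N) / P)" by (simp add: d1)
    also have "\<dots> \<in> vr" by (intro vr_mult QP vr_diff vr_1 vr_numeral rp)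
    finally show ?thesis .
  qed
  have dM: "d / M \<in> vr"
  proof -
    have "d / M = 27 * (1 + \<rho> ^ N) * ((1 - \<rho> ^ N) / M)" by (simp add: d1)
    also have "\<dots> \<in> vr" by (intro vr_mult QM vr_add vr_1 vr_numeral rp)
    finally show ?thesis .
  qed
  define u where "u = unit_u e"
  have u: "u = P / M" "inverse u = M / P" "u \<noteq> 0" using PM by (simp_all add: u_def unit_u_def P_def M_def)
  have kv: "\<kappa> N \<in> vr" "\<kappa> N \<notin> vm"
  proof -
    have "9 * \<rho> ^ N \<in> vr" "9 * \<rho> ^ N \<notin> vm"
      using rp[of N] vm_power_iff[of 3 2] three by (simp_all add: vr_mult vm_mult_iff)
    moreover have "\<kappa> N = 9 * \<rho> ^ N / 2" by (simp add: \<kappa>_def)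
    ultimately show "\<kappa> N \<in> vr" using unit_divide[OF _ vr_numeral two] by metis
    moreover have "2 * \<kappa> N = 9 * \<rho> ^ N" by (simp add: \<kappa>_def)
    ultimately show "\<kappa> N \<notin> vm" using vm_mult[OF vr_numeral, of "\<kappa> N" "num.Bit0 num.One"] \<open>9 * \<rho> ^ N \<notin> vm\<close> by auto
  qed
  have cv: "6 * \<kappa> N \<in> vr" "6 * \<kappa> N \<notin> vm" using kv six by (simp_all add: vr_mult vm_mult_iff)
  have fin: soluble if "\<zeta> \<in> vr" "t \<in> vr" "u * \<zeta>^3 - inverse u * t^3 = 6 * \<kappa> N * (\<zeta> * t - d)" for \<zeta> t
    using soluble_pair[OF r vr_L[OF that(1)] vr_L[OF that(2)]] that(3) by (simp add: u_def d_def)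
  have sumPM: "P + M = 2" by (simp add: P_def M_def)
  consider "P \<in> vm" "M \<notin> vm" | "M \<in> vm" "P \<notin> vm" | "P \<notin> vm" "M \<notin> vm"
    using sumPM two vm_add[of P M] by metis
  then show ?thesis
  proof cases
    case 1
    have iM: "inverse M \<in> vr" using unit_inverse[OF PM(2) 1(2)] by simp
    have "u \<in> vm" unfolding u(1) divide_inverse using vm_mult'[OF 1(1) iM] .
    moreover have "d / u = (d / P) * M" unfolding u(1) using PM by simp
    then have "d / u \<in> vr" using vr_mult[OF dP PM(2)] by simp
    ultimately show ?thesis using soluble_nonunit[OF _ u(3) cv] fin by blast
  next
    case 2
    have iP: "inverse P \<in> vr" using unit_inverse[OF PM(1) 2(2)] by simp
    have iu: "inverse u \<in> vm" unfolding u(2) divide_inverse using vm_mult'[OF 2(1) iP] .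
    have "d / inverse u = (d / M) * P" unfolding u(2) using PM by simp
    then have du: "d / inverse u \<in> vr" using vr_mult[OF dM PM(1)] by simp
    have mc: "- (6 * \<kappa> N) \<in> vr" "- (6 * \<kappa> N) \<notin> vm" using cv vm_uminus[of "- (6 * \<kappa> N)"] vr_uminus by auto
    \<comment> \<open>Exchanging the coordinates turns the equation for the inverse of
      \<open>u\<close> with coefficient \<open>- (6 * \<kappa> N)\<close> into the one for
      \<open>u\<close>.\<close>
    obtain \<zeta> t where zt: "\<zeta> \<in> vr" "t \<in> vr"
      "inverse u * \<zeta>^3 - inverse (inverse u) * t^3 = - (6 * \<kappa> N) * (\<zeta> * t - d)"
      using soluble_nonunit[OF iu _ mc du] u(3) by auto
    have "u * t^3 - inverse u * \<zeta>^3 = - (inverse u * \<zeta>^3 - inverse (inverse u) * t^3)" by simp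
    also have "\<dots> = 6 * \<kappa> N * (t * \<zeta> - d)" unfolding zt(3) by (simp add: mult.commute)
    finally show ?thesis using fin zt by blast
  next
    case 3
    have uv: "u \<in> vr" "u \<notin> vm"
    proof -
      show "u \<in> vr" unfolding u(1) by (rule unit_divide[OF PM(1,2) 3(2)])
      show "u \<notin> vm"
      proof
        assume "u \<in> vm"
        then have "u * M \<in> vm" using PM by (intro vm_mult')
        then show False using 3 PM by (simp add: u(1))
      qed
    qed
    show ?thesis
    proof (cases "d \<in> vm")
      case True
      then show ?thesis using soluble_unit[OF two uv cv] fin by blast
    next
      case False
      define a where "a = complex_of_int (curve_a N)"
      have av: "a \<in> vr" by (simp add: a_def)
      have da: "4 * a + 27 * 1 = d" using d_eq by (simp add: a_def d_def)
      have k2: "\<kappa> N ^ 2 = - 3 * a" using kappa_square[OF N(1)] by (simp add: a_def)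
      have D: "4 * a + 27 * 1 \<notin> vm" unfolding da by (rule False)
      have z: "3 - 2 * \<kappa> N \<in> vr" "3 + 2 * \<kappa> N \<in> vr" using kv by (auto intro!: vr_intros)
      have base: "(3 - 2 * \<kappa> N)^3 - (3 + 2 * \<kappa> N)^3 = 6 * \<kappa> N * ((3 - 2 * \<kappa> N) * (3 + 2 * \<kappa> N) - (4 * a + 27 * 1))"
        using base_solution by (simp add: a_def)
      obtain \<zeta>0 t0 where "\<zeta>0 \<in> vr" "t0 \<in> vr"
        "u * \<zeta>0^3 - inverse u * t0^3 - 6 * \<kappa> N * (\<zeta>0 * t0 - (4 * a + 27 * 1)) \<in> vm"
        using residue_solution[OF six av vr_1 vm_1 D kv k2 uv z base] by blast
      then obtain \<zeta> t where "\<zeta> \<in> vr" "t \<in> vr"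
        "u * \<zeta>^3 - inverse u * t^3 = 6 * \<kappa> N * (\<zeta> * t - (4 * a + 27 * 1))"
        using lift_solution[OF six av vr_1 vm_1 D kv k2 uv] by blast
      then show ?thesis using fin unfolding da by blast
    qed
  qed
qed

theorem locally_soluble: soluble
  using soluble_small soluble_inert soluble_split by blast

end

end

subsection \<open>Multiplicative independence modulo cubes\<close>

lemma sub_one_dvd_power: "(y::int) - 1 dvd y ^ n - 1"
  by (simp add: power_diff_1_eq)

text \<open>The prime 5 divides every \<open>6 ^ e - 1\<close> and has to be split off. The quotient
  \<open>S\<close> is congruent to \<open>e\<close> modulo 5, so a prime \<open>e > 5\<close> leaves
  no further factor 5.\<close>

lemma repunit_prime:
  assumes e: "Factorial_Ring.prime e" "e > (5::nat)"
  obtains p :: nat where "Factorial_Ring.prime p" "int p dvd 6 ^ e - 1" "\<not> int p dvd 5"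
    "\<not> 3 dvd multiplicity (int p) (6 ^ e - 1)"
proof -
  define S where "S = (\<Sum>i<e. 6 ^ i :: int)"
  have S5: "6 ^ e - 1 = 5 * S" by (simp add: S_def power_diff_1_eq)
  define k where "k = e - 2"
  have k: "e = Suc (Suc k)" using e(2) by (simp add: k_def)
  \<comment> \<open>Only \<open>1 + 6\<close> survives modulo 9, where cubes are 0, 1 or 8.\<close>
  have "S = 7 + 36 * (\<Sum>i<k. 6 ^ i)"
    by (simp add: S_def k sum.lessThan_Suc_shift sum_distrib_left del: sum.lessThan_Suc)
  then have "S mod 9 = (7 + 9 * (4 * (\<Sum>i<k. 6 ^ i))) mod 9" by simp
  then have S9: "S mod 9 = 7" by (simp only: mod_mult_self2) simp
  have "S \<ge> 0" by (simp add: S_def sum_nonneg)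
  then have S0: "S > 0" using S9 by (cases "S = 0") auto
  have "\<not> is_nth_power 3 S"
  proof
    assume "is_nth_power 3 S"
    then obtain y where "S = y ^ 3" by (auto simp: is_nth_power_def)
    then have "(y mod 9) ^ 3 mod 9 = 7" using S9 by (simp add: power_mod)
    moreover have "y mod 9 = 0 \<or> y mod 9 = 1 \<or> y mod 9 = 2 \<or> y mod 9 = 3 \<or> y mod 9 = 4 \<or>
        y mod 9 = 5 \<or> y mod 9 = 6 \<or> y mod 9 = 7 \<or> y mod 9 = 8" by presburger
    ultimately show False by auto
  qed
  then have "\<not> is_nth_power 3 (normalize S)" using S0 by simp
  then obtain q where q: "Factorial_Ring.prime q" "\<not> 3 dvd multiplicity q S"
    using is_nth_power_conv_multiplicity[of 3 S] by auto
  define p where "p = nat q"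
  have p: "q = int p" "Factorial_Ring.prime p" using q(1) prime_ge_0_int[OF q(1)] by (simp_all add: p_def)
  have qS: "q dvd S" 
  proof (rule ccontr)
    assume "\<not> q dvd S"
    then have "multiplicity q S = 0" by (rule not_dvd_imp_multiplicity_0)
    then show False using q(2) by simp
  qed
  have five: "\<not> q dvd 5"
  proof
    assume "q dvd 5"
    then have "q = 5" using q(1) primes_dvd_imp_eq[of q 5] by simp
    have "S - int e = (\<Sum>i<e. 6 ^ i - 1)" by (simp add: S_def sum_subtractf)
    also have "5 dvd \<dots>" using sub_one_dvd_power[of 6] by (intro dvd_sum) simp
    finally have "5 dvd S - int e" .
    moreover have "5 dvd S" using qS \<open>q = 5\<close> by simp
    ultimately have "5 dvd S - (S - int e)" by (metis dvd_diff)
    then have "int 5 dvd int e" by simp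
    then have "5 dvd e" by (simp only: int_dvd_int_iff)
    then show False using e by (auto dest: primes_dvd_imp_eq[rotated 2])
  qed
  have "multiplicity q (5 * S) = multiplicity q 5 + multiplicity q S"
    using q(1) S0 by (intro prime_elem_multiplicity_mult_distrib) auto
  then have "multiplicity q (6 ^ e - 1) = multiplicity q S"
    using not_dvd_imp_multiplicity_0[OF five] S5 by simp
  then show thesis using that[of p] p q five qS S5 by auto
qed

text \<open>With \<open>e x = e' y + 1\<close> the power \<open>6 ^ (e x)\<close> is congruent both
  to 1 and to 6 modulo \<open>p\<close>.\<close>

lemma common_repunit_prime:
  assumes e: "Factorial_Ring.prime e" "Factorial_Ring.prime e'" "e \<noteq> (e'::nat)" and d: "(p::int) dvd 6 ^ e - 1" "p dvd 6 ^ e' - 1"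
  shows "p dvd 5"
proof -
  have "coprime e e'" using e by (simp add: primes_coprime)
  moreover have "e' \<noteq> 1" using e(2) by auto
  ultimately obtain x y where xy: "e * x = e' * y + 1" using coprime_bezout_strong by blast
  have "p dvd (6 ^ e) ^ x - 1" "p dvd (6 ^ e') ^ y - 1" using d sub_one_dvd_power dvd_trans by blast+
  then have "p dvd ((6 ^ e) ^ x - 1) - 6 * ((6 ^ e') ^ y - 1)" using dvd_diff[OF _ dvd_mult] by blast
  also have "((6 ^ e) ^ x - 1) - 6 * ((6 ^ e') ^ y - 1) = (6::int) ^ (e * x) - 6 * 6 ^ (e' * y) + 5"
    by (simp add: power_mult algebra_simps)
  also have "\<dots> = 5" by (simp add: xy)
  finally show ?thesis .
qed

text \<open>Each further \<open>p\<close>-th power gains a factor \<open>p\<close>, because the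
  geometric sum has \<open>p\<close> terms congruent to 1. The lemma serves to find a square root of
  6 modulo a high power of \<open>p\<close>.\<close>

lemma prime_power_dvd_power_sub_one:
  assumes "int p dvd y - 1"
  shows "int p ^ Suc k dvd y ^ (p ^ k) - 1"
proof (induction k)
  case 0
  then show ?case using assms by simp
next
  case (Suc k)
  define z where "z = y ^ (p ^ k)"
  have "int p dvd z - 1" using Suc dvd_trans[of "int p" "int p ^ Suc k"] by (simp add: z_def)
  then have "int p dvd (\<Sum>i<p. z ^ i - 1)" by (intro dvd_sum) (metis sub_one_dvd_power dvd_trans)
  then have "int p dvd (\<Sum>i<p. z ^ i - 1) + int p" by simp
  then have "int p dvd (\<Sum>i<p. z ^ i)" by (simp add: sum_subtractf)
  then have "int p ^ Suc k * int p dvd (z - 1) * (\<Sum>i<p. z ^ i)"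
    using Suc by (intro mult_dvd_mono) (simp_all add: z_def)
  also have "\<dots> = z ^ p - 1" by (simp add: power_diff_1_eq)
  also have "z ^ p = y ^ (p ^ Suc k)" by (simp add: z_def power_mult[symmetric] mult.commute)
  finally show ?case by (simp add: mult.commute)
qed

lemma rho_independent:
  assumes "of_int a + of_int b * \<rho> = 0"
  shows "a = 0 \<and> b = 0"
proof -
  have "b = 0"
  proof (rule ccontr)
    assume "b \<noteq> 0"
    then have "\<rho> = - of_int a / of_int b" using assms by (simp add: field_simps eq_neg_iff_add_eq_0)
    moreover have "- of_int a / of_int b \<in> K" by (intro K_intros)
    ultimately show False using rho_not_K by simp
  qed
  then show ?thesis using assms by simp
qed

text \<open>The reduction of \<open>\<int>[\<rho>]\<close> modulo \<open>N\<close> that sends \<open>\<rho>\<close> to a square root \<open>r\<close> of \<open>6\<close> modulo \<open>N\<close>,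
  as a relation.\<close>

definition reduces :: "int \<Rightarrow> int \<Rightarrow> complex \<Rightarrow> int \<Rightarrow> bool" where
  "reduces N r z n \<longleftrightarrow> (\<exists>a b. z = of_int a + of_int b * \<rho> \<and> N dvd n - (a + b * r))"

context
  fixes N r :: int
  assumes r: "N dvd r^2 - 6"
begin

lemma reduces_of_int: "reduces N r (of_int a) a"
  unfolding reduces_def by (rule exI[of _ a], rule exI[of _ 0]) simp

lemma reduces_rho: "reduces N r \<rho> r"
  unfolding reduces_def by (rule exI[of _ 0], rule exI[of _ 1]) simp

lemma reduces_add:
  assumes "reduces N r z n" "reduces N r z' n'"
  shows "reduces N r (z + z') (n + n')"
proof -
  obtain a b a' b' where z: "z = of_int a + of_int b * \<rho>" "N dvd n - (a + b * r)"
    "z' = of_int a' + of_int b' * \<rho>" "N dvd n' - (a' + b' * r)"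
    using assms by (auto simp: reduces_def)
  have "n + n' - ((a + a') + (b + b') * r) = (n - (a + b * r)) + (n' - (a' + b' * r))"
    by (simp add: algebra_simps)
  then have "N dvd n + n' - ((a + a') + (b + b') * r)" using dvd_add[OF z(2,4)] by (simp only:)
  moreover have "z + z' = of_int (a + a') + of_int (b + b') * \<rho>" unfolding z by (simp add: algebra_simps)
  ultimately show ?thesis unfolding reduces_def by blast
qed

lemma reduces_mult:
  assumes "reduces N r z n" "reduces N r z' n'"
  shows "reduces N r (z * z') (n * n')"
proof -
  obtain a b a' b' where z: "z = of_int a + of_int b * \<rho>" "N dvd n - (a + b * r)"
    "z' = of_int a' + of_int b' * \<rho>" "N dvd n' - (a' + b' * r)"
    using assms by (auto simp: reduces_def)
  have "n * n' - ((a * a' + 6 * b * b') + (a * b' + a' * b) * r) =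
      (n - (a + b * r)) * n' + (a + b * r) * (n' - (a' + b' * r)) + b * b' * (r^2 - 6)"
    by (simp add: algebra_simps power2_eq_square)
  then have "N dvd n * n' - ((a * a' + 6 * b * b') + (a * b' + a' * b) * r)" using z(2,4) r by simp
  moreover have "z * z' = of_int (a * a') + of_int (b * b') * \<rho>^2 + of_int (a * b' + a' * b) * \<rho>"
    unfolding z by (simp add: algebra_simps power2_eq_square)
  then have "z * z' = of_int (a * a' + 6 * b * b') + of_int (a * b' + a' * b) * \<rho>"
    unfolding rho2 by (simp add: algebra_simps)
  ultimately show ?thesis unfolding reduces_def by blast
qed

lemma reduces_power: "reduces N r z n \<Longrightarrow> reduces N r (z ^ k) (n ^ k)"
  using reduces_of_int[of 1] by (induction k) (auto intro: reduces_mult)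

lemma reduces_prod: "(\<And>i. i \<in> I \<Longrightarrow> reduces N r (f i) (g i)) \<Longrightarrow> reduces N r (prod f I) (prod g I)"
  using reduces_of_int[of 1] by (induction I rule: infinite_finite_induct) (auto intro: reduces_mult)

lemma reduces_unique:
  assumes "reduces N r z n" "reduces N r z n'"
  shows "N dvd n - n'"
proof -
  obtain a b where z: "z = of_int a + of_int b * \<rho>" "N dvd n - (a + b * r)"
    using assms(1) unfolding reduces_def by blast
  obtain a' b' where z': "z = of_int a' + of_int b' * \<rho>" "N dvd n' - (a' + b' * r)"
    using assms(2) unfolding reduces_def by blast
  have "of_int (a - a') + of_int (b - b') * \<rho> = 0" using z(1) z'(1) by (simp add: algebra_simps)
  then have "a - a' = 0 \<and> b - b' = 0" by (rule rho_independent)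
  then have "n - n' = (n - (a + b * r)) - (n' - (a' + b' * r))" by simp
  then show ?thesis using dvd_diff[OF z(2) z'(2)] by (simp only:)
qed

end

text \<open>Complex conjugation fixes \<open>\<rho>\<close> and acts on \<open>K\<close>, so this is
  the norm from \<open>K(\<rho>)\<close> to the real quadratic field \<open>\<rat>(\<rho>)\<close>,
  where the independence question is settled.\<close>

lemma norm_K:
  assumes "x \<in> K" "y \<in> K"
  shows "\<exists>A B. (x + y * \<rho>) * cnj (x + y * \<rho>) = of_rat A + of_rat B * \<rho>"
proof -
  obtain r s r' s' where xy: "x = of_rat r + of_rat s * zeta3" "y = of_rat r' + of_rat s' * zeta3"
    using assms by (auto simp: K_def)
  have c [simp]: "cnj \<rho> = \<rho>" "cnj (of_rat q) = of_rat q" for q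
    by (simp add: \<rho>_def) (cases q, simp add: of_rat_rat)
  have cz: "cnj zeta3 = - 1 - zeta3" by (simp add: zeta3_def field_simps)
  define R S R' S' :: complex where "R = of_rat r" and "S = of_rat s" and "R' = of_rat r'" and "S' = of_rat s'"
  have "(x + y * \<rho>) * cnj (x + y * \<rho>) =
      ((R + R' * \<rho>) + (S + S' * \<rho>) * zeta3) * ((R + R' * \<rho>) + (S + S' * \<rho>) * (- 1 - zeta3))"
    by (simp add: xy cz R_def S_def R'_def S'_def algebra_simps)
  also have "\<dots> = (R + R' * \<rho>)^2 - (R + R' * \<rho>) * (S + S' * \<rho>) - (S + S' * \<rho>)^2 * (zeta3^2 + zeta3)"
    by (simp add: power2_eq_square algebra_simps)
  also have "zeta3^2 + zeta3 = - 1" using zeta3_square by simp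
  also have "(R + R' * \<rho>)^2 - (R + R' * \<rho>) * (S + S' * \<rho>) - (S + S' * \<rho>)^2 * (- 1) =
      (R^2 - R * S + S^2) + (R'^2 - R' * S' + S'^2) * \<rho>^2 + (2 * R * R' - R * S' - R' * S + 2 * S * S') * \<rho>"
    by (simp add: power2_eq_square algebra_simps)
  also have "\<dots> = of_rat (r^2 - r * s + s^2 + 6 * (r'^2 - r' * s' + s'^2)) +
      of_rat (2 * r * r' - r * s' - r' * s + 2 * s * s') * \<rho>"
    unfolding rho2 R_def S_def R'_def S'_def
    by (simp add: of_rat_add of_rat_mult of_rat_diff of_rat_power algebra_simps)
  finally show ?thesis by blast
qed

lemma common_denominator:
  "\<exists>D a b :: int. D > 0 \<and> of_int D * (of_rat A + of_rat B * \<rho>) = of_int a + of_int b * \<rho>"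
proof -
  obtain a D b D' where "A = Rat.Fract a D" "D > 0" "B = Rat.Fract b D'" "D' > 0" by (metis Rat_cases)
  then show ?thesis
    by (intro exI[of _ "D * D'"] exI[of _ "a * D'"] exI[of _ "b * D"]) (simp add: of_rat_rat field_simps)
qed

lemma unit_u_square: "unit_u e = (1 + \<rho> ^ e)^2 / of_int (1 - 6 ^ e)" if "e > 0"
proof -
  have n: "(1 - \<rho> ^ e) * (1 + \<rho> ^ e) = of_int (1 - 6 ^ e)"
    using rho_square_power[of e] by (simp add: power2_eq_square algebra_simps)
  have "(1 - 6 ^ e :: int) \<noteq> 0" using power_inject_exp[of "6::int" e 0] that by simp
  then have "(1 - \<rho> ^ e) * (1 + \<rho> ^ e) \<noteq> 0" unfolding n by (simp only: of_int_eq_0_iff not_False_eq_True)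
  then show ?thesis unfolding n[symmetric] unit_u_def by (simp add: power2_eq_square)
qed

text \<open>Taking norms to \<open>\<rat>(\<rho>)\<close> doubles the exponents, which does no harm
  modulo 3. By \<open>unit_u_square\<close> the numerators are then powers of
  \<open>1 + \<rho>^e\<close> and the denominators are integers. At the prime above \<open>p\<close>
  where \<open>\<rho>^e0\<close> reduces to 1 all numerators are units, and \<open>p\<close> divides
  only the denominator with index \<open>e0\<close>, where \<open>6 ^ e0 - 1\<close> has a
  multiplicity prime to 3. Congruences modulo a power of \<open>p\<close> take the place of the
  valuation.\<close>

theorem unit_u_independent:
  assumes P: "finite P" "\<And>e. e \<in> P \<Longrightarrow> Factorial_Ring.prime e \<and> e > 5" and xy: "x \<in> K" "y \<in> K"
    and cube: "(\<Prod>e\<in>P. unit_u e ^ m e) = (x + y * \<rho>)^3" and e0: "e0 \<in> P"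
  shows "3 dvd m e0"
proof -
  obtain A' B' where AB': "(x + y * \<rho>) * cnj (x + y * \<rho>) = of_rat A' + of_rat B' * \<rho>" using norm_K[OF xy] by blast
  obtain D A B :: int where D: "D > 0" and AB: "of_int D * (of_rat A' + of_rat B' * \<rho>) = of_int A + of_int B * \<rho>"
    using common_denominator by blast
  define F where "F = (\<Prod>e\<in>P. (1 - 6 ^ e :: int) ^ (2 * m e))"
  define H where "H = (\<Prod>e\<in>P. (1 + \<rho> ^ e) ^ (4 * m e))"
  have nz: "(1 - 6 ^ e :: int) \<noteq> 0" if "e \<in> P" for e
    using power_inject_exp[of "6::int" e 0] P(2)[OF that] by simp
  have F0: "F \<noteq> 0" using nz P(1) by (simp add: F_def)
  have "cnj (unit_u e) = unit_u e" for e by (simp add: unit_u_def \<rho>_def)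
  then have "(\<Prod>e\<in>P. unit_u e ^ m e) * cnj (\<Prod>e\<in>P. unit_u e ^ m e) = (\<Prod>e\<in>P. (unit_u e ^ m e)^2)"
    by (simp add: cnj_prod prod.distrib[symmetric] power2_eq_square)
  also have "\<dots> = (\<Prod>e\<in>P. (1 + \<rho> ^ e) ^ (4 * m e) / of_int ((1 - 6 ^ e) ^ (2 * m e)))"
  proof (rule prod.cong[OF refl])
    fix e assume "e \<in> P"
    then have u: "unit_u e = (1 + \<rho> ^ e)^2 / of_int (1 - 6 ^ e)" using unit_u_square[of e] P(2)[of e] by auto
    show "(unit_u e ^ m e)^2 = (1 + \<rho> ^ e) ^ (4 * m e) / of_int ((1 - 6 ^ e) ^ (2 * m e))"
      unfolding u of_int_power power_divide power_mult[symmetric] by (simp add: mult.commute mult.left_commute)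
  qed
  also have "\<dots> = (\<Prod>e\<in>P. (1 + \<rho> ^ e) ^ (4 * m e)) / of_int F" by (simp only: prod_dividef F_def of_int_prod)
  finally have "(\<Prod>e\<in>P. unit_u e ^ m e) * cnj (\<Prod>e\<in>P. unit_u e ^ m e) = H / of_int F"
    by (simp add: H_def)
  moreover have "(\<Prod>e\<in>P. unit_u e ^ m e) * cnj (\<Prod>e\<in>P. unit_u e ^ m e) =
      ((x + y * \<rho>) * cnj (x + y * \<rho>))^3"
    unfolding cube by (simp only: complex_cnj_power power_mult_distrib)
  ultimately have "(of_rat A' + of_rat B' * \<rho>)^3 = H / of_int F" unfolding AB' by (simp only:)
  then have HF: "H = (of_rat A' + of_rat B' * \<rho>)^3 * of_int F" using F0 by simp
  have rel: "of_int (D^3) * H = (of_int A + of_int B * \<rho>)^3 * of_int F"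
    unfolding HF AB[symmetric] by (simp add: power_mult_distrib)
  have pe: "Factorial_Ring.prime e0" "e0 > 5" using P(2)[OF e0] by auto
  have odd_e: "odd e0" using pe prime_odd_nat by auto
  obtain p where p: "Factorial_Ring.prime p" "int p dvd 6 ^ e0 - 1" "\<not> int p dvd 5"
    and p3: "\<not> 3 dvd multiplicity (int p) (6 ^ e0 - 1)" using repunit_prime[OF pe] .
  have pi: "Factorial_Ring.prime (int p)" using p(1) by simp
  have "e0 > 0" using pe by simp
  then have "\<not> 2 dvd (6::int) ^ e0 - 1" by simp
  then have p2: "\<not> int p dvd 2"
    using p(2) primes_dvd_imp_eq[OF pi two_is_prime] by fastforce
  have odd_p: "odd p"
  proof
    assume "even p"
    then have "p = 2" using p(1) primes_dvd_imp_eq[of 2 p] two_is_prime_nat by auto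
    then show False using p2 by simp
  qed
  define wD where "wD = 3 * multiplicity (int p) D"
  \<comment> \<open>By \<open>prime_power_dvd_power_sub_one\<close> the power \<open>6 ^ E\<close>
    is 1 modulo \<open>M\<close>. As \<open>E\<close> is odd, \<open>6 ^ ((E + 1) div 2)\<close> is
    then a square root of 6 modulo \<open>M\<close>.\<close>
  define E where "E = e0 * p ^ wD"
  have oE: "odd E" using odd_e odd_p by (simp add: E_def)
  define h where "h = (E + 1) div 2"
  have h2: "2 * h = E + 1" using oE by (simp add: h_def)
  define r where "r = (6::int) ^ h"
  define M where "M = int p ^ Suc wD"
  have E1: "M dvd 6 ^ E - 1"
    using prime_power_dvd_power_sub_one[OF p(2), of wD] by (simp add: M_def E_def power_mult)
  have pM: "int p dvd M" by (simp add: M_def)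
  have "r^2 = 6 ^ (2 * h)" by (simp add: r_def power_mult[symmetric] mult.commute)
  then have "r^2 - 6 = 6 * (6 ^ E - 1)" by (simp add: h2)
  then have r2: "M dvd r^2 - 6" using dvd_mult[OF E1, of 6] by (simp only:)
  have r2p: "int p dvd r^2 - 6" using r2 pM dvd_trans by blast
  have re: "int p dvd (r ^ e)^2 - 6 ^ e" for e
  proof -
    have "(r ^ e)^2 - 6 ^ e = (r^2) ^ e - 6 ^ e" by (simp add: power_mult[symmetric] mult.commute)
    moreover have "[(r^2) ^ e = 6 ^ e] (mod int p)" using r2p by (intro cong_pow) (simp add: cong_iff_dvd_diff)
    ultimately show ?thesis by (simp add: cong_iff_dvd_diff)
  qed
  \<comment> \<open>A priori \<open>r ^ e0\<close> is only a sign modulo \<open>p\<close>. It is 1,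
    because its power with the odd exponent \<open>p ^ wD\<close> is \<open>r ^ E\<close>, which is
    a power of \<open>6 ^ E\<close>.\<close>
  have r1: "int p dvd r ^ e0 - 1"
  proof -
    define s where "s = r ^ e0"
    have "odd (p ^ wD)" using odd_p by simp
    then obtain t where "p ^ wD = 2 * t + 1" by (rule oddE)
    then have t: "p ^ wD = Suc (2 * t)" by simp
    have "[s^2 = 6 ^ e0] (mod int p)" using re[of e0] by (simp add: s_def cong_iff_dvd_diff)
    moreover have "[6 ^ e0 = 1] (mod int p)" using p(2) by (simp add: cong_iff_dvd_diff)
    ultimately have "[s^2 = 1] (mod int p)" by (rule cong_trans)
    then have "[s * (s^2) ^ t = s * 1 ^ t] (mod int p)" by (intro cong_mult cong_refl cong_pow)
    moreover have "s * (s^2) ^ t = r ^ E" by (simp add: s_def E_def t power_add power_mult)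
    moreover have "[r ^ E = 1] (mod int p)"
    proof -
      have "r ^ E = (6 ^ E) ^ h" by (simp add: r_def power_mult[symmetric] mult.commute)
      moreover have "int p dvd (6 ^ E) ^ h - 1"
        by (rule dvd_trans[OF dvd_trans[OF pM E1] sub_one_dvd_power])
      ultimately show ?thesis by (simp add: cong_iff_dvd_diff)
    qed
    ultimately have "[1 = s * 1 ^ t] (mod int p)" using cong_trans[OF cong_sym] by metis
    then have "[s = 1] (mod int p)" by (simp add: cong_sym)
    then show ?thesis by (simp add: s_def cong_iff_dvd_diff)
  qed
  have other: "\<not> int p dvd 6 ^ e - 1" if "e \<in> P" "e \<noteq> e0" for e
    using common_repunit_prime[OF _ pe(1) that(2), of "int p"] P(2)[OF that(1)] p(2,3) by auto
  have unit: "\<not> int p dvd 1 + r ^ e" if e: "e \<in> P" for e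
  proof
    assume d: "int p dvd 1 + r ^ e"
    show False
    proof (cases "e = e0")
      case True
      then have "int p dvd (1 + r ^ e) - (r ^ e0 - 1)" using dvd_diff[OF d r1] by blast
      then show False using True p2 by simp
    next
      case False
      have "6 ^ e - 1 = (1 + r ^ e) * (r ^ e - 1) - ((r ^ e)^2 - 6 ^ e)"
        by (simp add: power2_eq_square algebra_simps)
      then have "int p dvd 6 ^ e - 1" using dvd_diff[OF dvd_mult2[OF d] re[of e]] by metis
      then show False using other[OF e False] by simp
    qed
  qed
  define H' where "H' = (\<Prod>e\<in>P. (1 + r ^ e) ^ (4 * m e))"
  have Hr: "\<not> int p dvd H'"
  proof
    assume "int p dvd H'"
    then obtain e where "e \<in> P" "int p dvd (1 + r ^ e) ^ (4 * m e)"
      unfolding H'_def prime_dvd_prod_iff[OF P(1) pi] by blast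
    then show False using unit prime_dvd_power[OF pi] by blast
  qed
  define lhs rhs where "lhs = D^3 * H'" and "rhs = (A + B * r)^3 * F"
  note red = reduces_of_int[OF r2] reduces_rho[OF r2] reduces_add[OF r2] reduces_mult[OF r2] reduces_power[OF r2]
  have one: "reduces M r 1 1" using red(1)[of 1] by simp
  have "reduces M r (of_int (D^3) * H) lhs"
    unfolding lhs_def H_def H'_def
    by (rule red(4)[OF red(1)], rule reduces_prod[OF r2], rule red(5)[OF red(3)[OF one red(5)[OF red(2)]]])
  moreover have "reduces M r ((of_int A + of_int B * \<rho>)^3 * of_int F) rhs"
    unfolding rhs_def by (rule red(4)[OF red(5)[OF red(3)[OF red(1) red(4)[OF red(1) red(2)]]] red(1)])
  ultimately have "M dvd lhs - rhs" using reduces_unique[OF r2] unfolding rel by blast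
  have H0: "H' \<noteq> 0" using Hr by auto
  have pp: "prime_elem (int p)" using pi by simp
  have lhs: "lhs \<noteq> 0" "multiplicity (int p) lhs = wD"
    using D H0 Hr not_dvd_imp_multiplicity_0[OF Hr] pp
    by (simp_all add: lhs_def wD_def prime_elem_multiplicity_mult_distrib prime_elem_multiplicity_power_distrib)
  have Xd: "int p ^ wD dvd lhs" "\<not> int p ^ Suc wD dvd lhs"
  proof -
    have "\<not> is_unit (int p)" using pi by auto
    note iff = power_dvd_iff_le_multiplicity[OF _ this, of lhs]
    show "int p ^ wD dvd lhs" "\<not> int p ^ Suc wD dvd lhs" unfolding iff[OF lhs(1)] lhs(2) by simp_all
  qed
  have "int p ^ wD dvd lhs - rhs" 
    using \<open>M dvd lhs - rhs\<close> unfolding M_def by (rule dvd_trans[OF le_imp_power_dvd, rotated]) simp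
  from dvd_diff[OF Xd(1) this] have "int p ^ wD dvd rhs" by simp
  moreover have "\<not> int p ^ Suc wD dvd rhs"
  proof
    assume "int p ^ Suc wD dvd rhs"
    from dvd_add[OF \<open>M dvd lhs - rhs\<close>[unfolded M_def] this] show False using Xd(2) by (simp only: diff_add_cancel)
  qed
  ultimately have rhs: "multiplicity (int p) rhs = wD" by (rule multiplicity_eqI)
  have rhs0: "rhs \<noteq> 0" using \<open>\<not> int p ^ Suc wD dvd rhs\<close> by auto
  then have Ar: "A + B * r \<noteq> 0" unfolding rhs_def by auto
  have "multiplicity (int p) F = (\<Sum>e\<in>P. multiplicity (int p) ((1 - 6 ^ e) ^ (2 * m e)))"
    unfolding F_def using nz by (intro prime_elem_multiplicity_prod_distrib[OF pp _ P(1)]) auto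
  also have "\<dots> = (\<Sum>e\<in>P. if e = e0 then 2 * m e0 * multiplicity (int p) (6 ^ e0 - 1) else 0)"
  proof (rule sum.cong[OF refl])
    fix e assume e: "e \<in> P"
    have "multiplicity (int p) ((1 - 6 ^ e) ^ (2 * m e)) = 2 * m e * multiplicity (int p) (1 - 6 ^ e)"
      using nz[OF e] by (intro prime_elem_multiplicity_power_distrib[OF pp])
    also have "multiplicity (int p) (1 - 6 ^ e) = multiplicity (int p) (6 ^ e - 1)"
      by (rule multiplicity_cong) (metis dvd_minus_iff minus_diff_eq)
    finally show "multiplicity (int p) ((1 - 6 ^ e) ^ (2 * m e)) =
        (if e = e0 then 2 * m e0 * multiplicity (int p) (6 ^ e0 - 1) else 0)"
      using not_dvd_imp_multiplicity_0[OF other[OF e]] by auto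
  qed
  also have "\<dots> = 2 * m e0 * multiplicity (int p) (6 ^ e0 - 1)" using e0 P(1) by simp
  finally have F: "multiplicity (int p) F = 2 * m e0 * multiplicity (int p) (6 ^ e0 - 1)" .
  have "multiplicity (int p) rhs = 3 * multiplicity (int p) (A + B * r) + multiplicity (int p) F"
    using Ar F0 unfolding rhs_def
    by (simp add: prime_elem_multiplicity_mult_distrib[OF pp] prime_elem_multiplicity_power_distrib[OF pp])
  then have "3 * multiplicity (int p) D = 3 * multiplicity (int p) (A + B * r) + 2 * m e0 * multiplicity (int p) (6 ^ e0 - 1)"
    by (simp add: rhs F wD_def)
  then have "3 dvd 2 * m e0 * multiplicity (int p) (6 ^ e0 - 1)"
    by (metis dvd_add_right_iff dvd_triv_left)
  moreover have "Factorial_Ring.prime (3::nat)" by simp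
  ultimately have "3 dvd 2 * m e0 \<or> 3 dvd multiplicity (int p) (6 ^ e0 - 1)" using prime_dvd_mult_iff by blast
  then have "3 dvd 2 * m e0" using p3 by simp
  then show ?thesis by presburger
qed

subsection \<open>The theorem\<close>

lemma rational_isogeny_psi:
  assumes ab: "a * b * (4 * a + 27 * b) \<noteq> 0"
  shows "rational_isogeny (E a b) (Ehat a b) (psi a b) 3"
proof -
  have F: "complex_subfield \<rat>" by (auto simp: complex_subfield_def)
  define t where "t = csqrt (of_int (a * b^2))"
  have t2: "t^2 = of_int (a * b^2)" by (simp add: t_def)
  have t0: "t \<noteq> 0" using ab by (simp add: t_def)
  have "t^2 \<in> alg_cl \<rat>" unfolding t2 using alg_cl_superset[OF F] subfield_of_int[OF F] by blast
  then have t: "t \<in> alg_cl \<rat>" by (rule alg_cl_root[OF F]) simp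
  then have mt: "- t \<in> alg_cl \<rat>" by (rule alg_cl_intros(5)[OF F])
  have "ker_pts (E a b) (psi a b) (alg_cl \<rat>) = {None, Some (0, t), Some (0, - t)}"
  proof -
    have "Some (0, y) \<in> points (E a b) (alg_cl \<rat>) \<longleftrightarrow> y = t \<or> y = - t" for y
    proof -
      have "y^2 = 0^3 + of_int a * (0 - of_int b)^2 \<longleftrightarrow> y^2 = t^2" by (simp add: t2)
      then show ?thesis using t mt alg_cl_intros(1)[OF F] unfolding points_E power2_eq_iff by blast
    qed
    moreover have "None \<in> points (E a b) (alg_cl \<rat>)" by (simp add: points_def)
    ultimately show ?thesis unfolding ker_pts_def psi_eq_None by blast
  qed
  moreover have "card {None, Some (0, t), Some (0, - t)} = 3" using t0 by simp
  moreover have "psi a b ` points (E a b) (alg_cl \<rat>) = points (Ehat a b) (alg_cl \<rat>)"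
  proof
    show "psi a b ` points (E a b) (alg_cl \<rat>) \<subseteq> points (Ehat a b) (alg_cl \<rat>)"
      using psi_points_over[OF complex_subfield_alg_cl[OF F]] by blast
    show "points (Ehat a b) (alg_cl \<rat>) \<subseteq> psi a b ` points (E a b) (alg_cl \<rat>)"
      using psi_surj[OF ab _ F, of "csqrt (- 3 * of_int a)"] by auto
  qed
  moreover have "\<forall>P\<in>points (E a b) (alg_cl \<rat>). \<forall>Q\<in>points (E a b) (alg_cl \<rat>).
      psi a b (ec_add (E a b) P Q) = ec_add (Ehat a b) (psi a b P) (psi a b Q)"
    using psi_add[OF ab] points_UNIV by blast
  moreover have "\<exists>p q r s :: complex poly.
      (\<forall>i. Polynomial.coeff p i \<in> \<rat> \<and> Polynomial.coeff q i \<in> \<rat> \<and> Polynomial.coeff r i \<in> \<rat> \<and> Polynomial.coeff s i \<in> \<rat>) \<and>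
      (\<forall>x y. Some (x, y) \<in> points (E a b) (alg_cl \<rat>) \<longrightarrow> psi a b (Some (x, y)) \<noteq> None \<longrightarrow>
         poly q x \<noteq> 0 \<and> poly s x \<noteq> 0 \<and>
         psi a b (Some (x, y)) = Some (poly p x / poly q x, y * (poly r x / poly s x)))"
  proof -
    define A B where "A = complex_of_int a" and "B = complex_of_int b"
    have AB: "A \<in> \<rat>" "B \<in> \<rat>" by (simp_all add: A_def B_def)
    define p q r s where "p = [:36 * A * B^2, - 36 * A * B, 12 * A, 9:]" and "q = [:0, 0, 1 :: complex:]"
      and "r = [:- 216 * A * B^2, 108 * A * B, 0, 27:]" and "s = [:0, 0, 0, 1 :: complex:]"
    have "Polynomial.coeff p i \<in> \<rat> \<and> Polynomial.coeff q i \<in> \<rat> \<and> Polynomial.coeff r i \<in> \<rat> \<and> Polynomial.coeff s i \<in> \<rat>" for i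
      using AB by (auto simp: p_def q_def r_def s_def coeff_pCons split: nat.splits)
    moreover have "poly q x \<noteq> 0 \<and> poly s x \<noteq> 0 \<and>
        psi a b (Some (x, y)) = Some (poly p x / poly q x, y * (poly r x / poly s x))"
      if "psi a b (Some (x, y)) \<noteq> None" for x y
    proof -
      have x: "x \<noteq> 0" using that by auto
      have "poly p x = 9 * (x^3 + 4/3 * A * x^2 - 4 * A * B * x + 4 * A * B^2)"
        "poly r x = 27 * (x^3 + 4 * A * B * x - 8 * A * B^2)" "poly q x = x^2" "poly s x = x^3"
        by (simp_all add: p_def q_def r_def s_def power2_eq_square power3_eq_cube algebra_simps)
      then show ?thesis using x by (simp add: psi.simps(2) Let_def A_def B_def)
    qed
    ultimately show ?thesis by blast
  qed
  ultimately show ?thesis unfolding rational_isogeny_def by (simp only: finite.intros simp_thms ball_simps)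
qed

section \<open>The Selmer classes of the elements \<open>unit_u e\<close>\<close>

lemma unit_u_components:
  assumes e: "odd e"
  obtains c1 c2 where "c1 \<in> K" "c2 \<in> K" "unit_u e = c1 + c2 * \<rho>" "inverse (unit_u e) = c1 - c2 * \<rho>"
    "unit_u e \<noteq> 0"
proof -
  have e0: "e > 0" using e by (cases e) auto
  define D where "D = complex_of_int (1 - 6 ^ e)"
  define c1 c2 where "c1 = (1 + 6 ^ e) / D" and "c2 = 2 * 6 ^ ((e - 1) div 2) / D"
  have n: "(1 - \<rho> ^ e) * (1 + \<rho> ^ e) = D"
    using rho_square_power[of e] by (simp add: D_def power2_eq_square algebra_simps)
  have "(1 - 6 ^ e :: int) \<noteq> 0" using power_inject_exp[of "6::int" e 0] e0 by simp
  then have D0: "D \<noteq> 0" unfolding D_def by (simp only: of_int_eq_0_iff not_False_eq_True)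
  have sq: "(1 + \<rho> ^ e)^2 / D = c1 + c2 * \<rho>" "(1 - \<rho> ^ e)^2 / D = c1 - c2 * \<rho>"
    using rho_square_power[of e] D0 unfolding c1_def c2_def
    by (simp_all add: rho_odd_power[OF e] power2_eq_square field_simps)
  have u: "unit_u e = (1 + \<rho> ^ e)^2 / D" using unit_u_square[OF e0] by (simp add: D_def)
  have nz: "1 - \<rho> ^ e \<noteq> 0" "1 + \<rho> ^ e \<noteq> 0" using n D0 by auto
  have "inverse (unit_u e) = (1 - \<rho> ^ e)^2 / D"
    unfolding unit_u_def n[symmetric] using nz by (simp add: power2_eq_square)
  moreover have "unit_u e \<noteq> 0" using nz by (simp add: unit_u_def)
  moreover have "c1 \<in> K" "c2 \<in> K" unfolding c1_def c2_def D_def by (intro K_intros)+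
  ultimately show thesis using that[of c1 c2] u sq by simp
qed

lemma unit_u_nonzero: "odd e \<Longrightarrow> unit_u e \<noteq> 0"
  by (rule unit_u_components)

lemma K_alg_cl: "x \<in> K \<Longrightarrow> x \<in> alg_cl K"
  using alg_cl_superset[OF complex_subfield_K] by blast

lemma unit_u_alg_cl:
  assumes "odd e"
  shows "unit_u e \<in> alg_cl K"
proof -
  obtain c1 c2 where c: "c1 \<in> K" "c2 \<in> K" "unit_u e = c1 + c2 * \<rho>" by (rule unit_u_components[OF assms])
  note i = alg_cl_intros[OF complex_subfield_K]
  show ?thesis unfolding c(3) by (intro i(3) i(4) K_alg_cl c(1,2) rho_alg_cl)
qed

lemma sigma_unit_u:
  assumes \<sigma>: "\<sigma> \<in> gal K" and e: "odd e"
  shows "\<sigma> \<rho> = \<rho> \<Longrightarrow> \<sigma> (unit_u e) = unit_u e"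
    and "\<sigma> \<rho> = - \<rho> \<Longrightarrow> \<sigma> (unit_u e) = inverse (unit_u e)"
proof -
  obtain c1 c2 where c: "c1 \<in> K" "c2 \<in> K" "unit_u e = c1 + c2 * \<rho>" "inverse (unit_u e) = c1 - c2 * \<rho>"
    by (rule unit_u_components[OF e])
  note i = alg_cl_intros[OF complex_subfield_K] and h = galD[OF \<sigma>]
  have "\<sigma> (unit_u e) = c1 + c2 * \<sigma> \<rho>"
    unfolding c(3) h(3)[OF K_alg_cl[OF c(1)] i(4)[OF K_alg_cl[OF c(2)] rho_alg_cl]]
      h(4)[OF K_alg_cl[OF c(2)] rho_alg_cl] h(5)[OF c(1)] h(5)[OF c(2)] ..
  then show "\<sigma> \<rho> = \<rho> \<Longrightarrow> \<sigma> (unit_u e) = unit_u e" "\<sigma> \<rho> = - \<rho> \<Longrightarrow> \<sigma> (unit_u e) = inverse (unit_u e)"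
    unfolding c(4) unfolding c(3) by simp_all
qed

definition K_rho :: "complex set" where
  "K_rho = {x + y * \<rho> | x y. x \<in> K \<and> y \<in> K}"

lemma K_rho: "complex_subfield K_rho" "K \<subseteq> K_rho" "K_rho \<subseteq> alg_cl K"
proof -
  have I: "x + y * \<rho> \<in> K_rho" if "x \<in> K" "y \<in> K" for x y using that by (auto simp: K_rho_def)
  show sub: "K \<subseteq> K_rho" using I[OF _ K_intros(1)] by auto
  note i = alg_cl_intros[OF complex_subfield_K]
  show "K_rho \<subseteq> alg_cl K" using K_alg_cl rho_alg_cl by (auto simp: K_rho_def intro!: i(3) i(4))
  show "complex_subfield K_rho" unfolding complex_subfield_def
  proof (intro conjI ballI)
    show "0 \<in> K_rho" "1 \<in> K_rho" using sub K_intros(1,2) by blast+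
  next
    fix a b assume "a \<in> K_rho" "b \<in> K_rho"
    then obtain x y x' y' where ab: "a = x + y * \<rho>" "b = x' + y' * \<rho>"
      and k: "x \<in> K" "y \<in> K" "x' \<in> K" "y' \<in> K" by (auto simp: K_rho_def)
    have "a + b = (x + x') + (y + y') * \<rho>" unfolding ab by (simp add: algebra_simps)
    then show "a + b \<in> K_rho" using I k K_intros(3) by metis
    have "a * b = (x * x' + y * y' * \<rho>^2) + (x * y' + y * x') * \<rho>"
      unfolding ab by (simp add: algebra_simps power2_eq_square)
    then have "a * b = (x * x' + y * y' * 6) + (x * y' + y * x') * \<rho>" unfolding rho2 .
    moreover have "x * x' + y * y' * 6 \<in> K" "x * y' + y * x' \<in> K" using k by (auto intro!: K_intros)
    ultimately show "a * b \<in> K_rho" using I by metis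
  next
    fix a assume "a \<in> K_rho"
    then obtain x y where a: "a = x + y * \<rho>" and k: "x \<in> K" "y \<in> K" by (auto simp: K_rho_def)
    have "- a = (- x) + (- y) * \<rho>" unfolding a by simp
    then show "- a \<in> K_rho" using I k K_intros(5) by metis
    show "inverse a \<in> K_rho"
    proof (cases "a = 0")
      case True
      then show ?thesis using sub K_intros(1) by auto
    next
      case False
      have c: "x - y * \<rho> \<noteq> 0"
      proof
        assume e: "x - y * \<rho> = 0"
        have "y = 0"
        proof (rule ccontr)
          assume "y \<noteq> 0"
          then have "\<rho> = x / y" using e by (simp add: field_simps)
          then show False using rho_not_K K_intros(8)[OF k] by simp
        qed
        then show False using e False a by simp
      qed
      define D where "D = x^2 - 6 * y^2"
      have "a * (x - y * \<rho>) = x^2 - \<rho>^2 * y^2" unfolding a by (simp add: algebra_simps power2_eq_square)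
      then have D: "a * (x - y * \<rho>) = D" unfolding rho2 D_def .
      then have "D \<noteq> 0" using c False by auto
      then have "a * (x / D + (- y / D) * \<rho>) = 1" using D by (simp add: field_simps)
      then have "inverse a = x / D + (- y / D) * \<rho>" by (rule inverse_unique)
      moreover have "D \<in> K" unfolding D_def using k by (auto intro!: K_intros)
      then have "x / D \<in> K" "- y / D \<in> K" using k by (auto intro!: K_intros(5,8))
      ultimately show ?thesis using I by metis
    qed
  qed
qed

context
  fixes N :: nat
  assumes N: "N \<ge> 2" "odd N"
begin

abbreviation (input) "WN \<equiv> E (curve_a N) 1"
abbreviation (input) "psiN \<equiv> psi (curve_a N) 1"

interpretation iso: isogeny WN psiN
  by (rule isogeny_psi[OF curve_a_nonzero[OF N(1)]])

lemma kcocycle_carrier: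
  assumes "odd e" "z^3 = unit_u e"
  shows "kcocycle N z \<in> carrier (Z1 WN psiN K)"
proof -
  show ?thesis
    using kcocycle_Z1[OF N assms(2) unit_u_nonzero[OF assms(1)] unit_u_alg_cl[OF assms(1)]] sigma_unit_u[OF _ assms(1)] by blast
qed

lemma kcocycle_selmer:
  assumes e: "odd e" "e \<ge> 5" "e dvd N" and z: "z^3 = unit_u e"
  shows "H1_class WN psiN K (kcocycle N z) \<in> selmer WN (Ehat (curve_a N) 1) psiN K"
proof (rule iso.selmerI[OF complex_subfield_K kcocycle_carrier[OF e(1) z]])
  fix v L w assume prime: "finite_prime K v" and compl: "completion_of K v L w"
  have L: "complex_subfield L" "K \<subseteq> L" using compl by (auto simp: completion_of_def)
  interpret KC: K_completion L w v
    using prime compl by unfold_locales (auto simp: completion_of_def)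
  obtain \<alpha> \<beta> where ab: "\<alpha> \<in> L" "\<beta> \<in> L"
    and eq: "unit_u e * (\<alpha> + \<beta> * \<rho>)^3 - inverse (unit_u e) * (\<alpha> - \<beta> * \<rho>)^3 =
      6 * \<kappa> N * ((\<alpha> + \<beta> * \<rho>) * (\<alpha> - \<beta> * \<rho>) - of_int (4 * curve_a N + 27))"
    using KC.locally_soluble[OF N e] unfolding KC.soluble_def[OF N e] by blast
  obtain c1 c2 where c: "c1 \<in> K" "c2 \<in> K" "unit_u e = c1 + c2 * \<rho>" "inverse (unit_u e) = c1 - c2 * \<rho>"
    "unit_u e \<noteq> 0" by (rule unit_u_components[OF e(1)])
  have cL: "c1 \<in> L" "c2 \<in> L" using c(1,2) L(2) by auto
  show "\<exists>Q\<in>points WN (alg_cl L). psiN Q \<in> points (Ehat (curve_a N) 1) L \<and>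
      res_cocycle K L (kcocycle N z) = coboundary WN L Q"
    by (rule kcocycle_local[OF N z c(5) unit_u_alg_cl[OF e(1)] _ _ L ab cL c(3,4) refl[of "\<alpha> + \<beta> * \<rho>"] refl[of "\<alpha> - \<beta> * \<rho>"] eq])
      (simp_all add: sigma_unit_u[OF _ e(1)])
qed

text \<open>The exponents are reduced modulo 3, which is harmless because the cocycles are killed by
  3; \<open>unit_u_independent\<close> expects natural exponents.\<close>

lemma finprod_kcocycle:
  fixes m :: "nat \<Rightarrow> int"
  assumes P: "finite P" "\<And>e. e \<in> P \<Longrightarrow> odd e" and z: "\<And>e. z e ^ 3 = unit_u e"
  shows "finprod (Z1 WN psiN K) (\<lambda>e. kcocycle N (z e) [^]\<^bsub>Z1 WN psiN K\<^esub> m e) P =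
    (\<lambda>\<sigma>\<in>gal K. tors N (\<Prod>e\<in>P. twist (z e) \<sigma> ^ nat (m e mod 3)))"
proof -
  interpret Z: comm_group "Z1 WN psiN K" by (rule iso.comm_group_Z1[OF complex_subfield_K])
  have car: "kcocycle N (z e) \<in> carrier (Z1 WN psiN K)" if "e \<in> P" for e
    using kcocycle_carrier[OF P(2)[OF that] z] .
  have cube: "twist (z e) \<sigma> ^ 3 = 1" if "e \<in> P" "\<sigma> \<in> gal K" for e \<sigma>
  proof -
    show ?thesis
      using twist_cube[OF N z unit_u_nonzero[OF P(2)[OF that(1)]] unit_u_alg_cl[OF P(2)[OF that(1)]] _ _ that(2)] sigma_unit_u[OF _ P(2)[OF that(1)]] by blast
  qed
  have pow: "kcocycle N (z e) [^]\<^bsub>Z1 WN psiN K\<^esub> (n::nat) = (\<lambda>\<sigma>\<in>gal K. tors N (twist (z e) \<sigma> ^ n))"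
    if e: "e \<in> P" for e n
  proof (induction n)
    case 0
    then show ?case by (simp add: tors_def Z1_def)
  next
    case (Suc n)
    have "(twist (z e) \<sigma> ^ n) ^ 3 = 1" if "\<sigma> \<in> gal K" for \<sigma>
      using cube[OF e that] by (metis power_commutes power_mult mult.commute power_one)
    then show ?case using Suc cube[OF e]
      by (auto simp: iso.Z1_simps[OF complex_subfield_K] kcocycle_def tors_mult[OF N, symmetric] mult.commute)
  qed
  have pow3: "kcocycle N (z e) [^]\<^bsub>Z1 WN psiN K\<^esub> m e =
      (\<lambda>\<sigma>\<in>gal K. tors N (twist (z e) \<sigma> ^ nat (m e mod 3)))" if e: "e \<in> P" for e
  proof -
    define f where "f = kcocycle N (z e)"
    have f: "f \<in> carrier (Z1 WN psiN K)" using car[OF e] by (simp add: f_def)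
    have "f [^]\<^bsub>Z1 WN psiN K\<^esub> (3::nat) = \<one>\<^bsub>Z1 WN psiN K\<^esub>"
      unfolding f_def pow[OF e] using cube[OF e] by (auto simp: tors_def Z1_def)
    then have f3: "f [^]\<^bsub>Z1 WN psiN K\<^esub> (3::int) = \<one>\<^bsub>Z1 WN psiN K\<^esub>"
      using int_pow_int[of "Z1 WN psiN K" f 3] by simp
    have "f [^]\<^bsub>Z1 WN psiN K\<^esub> m e = f [^]\<^bsub>Z1 WN psiN K\<^esub> (3 * (m e div 3) + int (nat (m e mod 3)))" by simp
    also have "\<dots> = f [^]\<^bsub>Z1 WN psiN K\<^esub> (3 * (m e div 3)) \<otimes>\<^bsub>Z1 WN psiN K\<^esub> f [^]\<^bsub>Z1 WN psiN K\<^esub> int (nat (m e mod 3))"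
      by (rule Z.int_pow_mult[OF f])
    also have "f [^]\<^bsub>Z1 WN psiN K\<^esub> (3 * (m e div 3)) = \<one>\<^bsub>Z1 WN psiN K\<^esub>"
      unfolding Z.int_pow_pow[OF f, symmetric] f3 by (rule Z.int_pow_one)
    also have "\<one>\<^bsub>Z1 WN psiN K\<^esub> \<otimes>\<^bsub>Z1 WN psiN K\<^esub> f [^]\<^bsub>Z1 WN psiN K\<^esub> int (nat (m e mod 3)) =
        f [^]\<^bsub>Z1 WN psiN K\<^esub> nat (m e mod 3)"
      unfolding int_pow_int by (rule Z.l_one[OF Z.nat_pow_closed[OF f]])
    finally show ?thesis using pow[OF e] by (simp add: f_def)
  qed
  show ?thesis using P(1) car pow3 cube
  proof (induction P rule: finite_induct)
    case empty
    show ?case unfolding Z.finprod_empty by (simp add: tors_def Z1_def)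
  next
    case (insert x P)
    have y: "(twist (z e) \<sigma> ^ k) ^ 3 = 1" if "e \<in> insert x P" "\<sigma> \<in> gal K" for e \<sigma> k
      using insert.prems(3)[OF that] by (metis power_commutes power_mult mult.commute power_one)
    have yP: "(\<Prod>e\<in>P. twist (z e) \<sigma> ^ nat (m e mod 3)) ^ 3 = 1" if "\<sigma> \<in> gal K" for \<sigma>
      using y[OF _ that] by (simp add: prod_power_distrib)
    have "finprod (Z1 WN psiN K) (\<lambda>e. kcocycle N (z e) [^]\<^bsub>Z1 WN psiN K\<^esub> m e) (insert x P) =
        kcocycle N (z x) [^]\<^bsub>Z1 WN psiN K\<^esub> m x \<otimes>\<^bsub>Z1 WN psiN K\<^esub>
        finprod (Z1 WN psiN K) (\<lambda>e. kcocycle N (z e) [^]\<^bsub>Z1 WN psiN K\<^esub> m e) P"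
      using insert.prems(1) by (intro Z.finprod_insert[OF insert.hyps]) (auto intro: Z.int_pow_closed)
    also have "finprod (Z1 WN psiN K) (\<lambda>e. kcocycle N (z e) [^]\<^bsub>Z1 WN psiN K\<^esub> m e) P =
        (\<lambda>\<sigma>\<in>gal K. tors N (\<Prod>e\<in>P. twist (z e) \<sigma> ^ nat (m e mod 3)))"
      using insert.prems by (intro insert.IH) auto
    also have "kcocycle N (z x) [^]\<^bsub>Z1 WN psiN K\<^esub> m x =
        (\<lambda>\<sigma>\<in>gal K. tors N (twist (z x) \<sigma> ^ nat (m x mod 3)))"
      by (rule insert.prems(2)) simp
    finally show ?case using y[of x] yP insert.hyps
      by (auto simp: iso.Z1_simps[OF complex_subfield_K] tors_mult[OF N])
  qed
qed

text \<open>A combination with trivial class is the coboundary of a kernel point \<open>T\<close>.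
  An automorphism that fixes \<open>K(\<rho>)\<close> fixes \<open>T\<close>, and therefore also the
  product \<open>\<gamma>\<close> of the cube roots. Hence \<open>\<gamma>\<close> lies in
  \<open>K(\<rho>)\<close>, and \<open>unit_u_independent\<close> applies to its cube.\<close>

lemma kcocycle_independent:
  fixes m :: "nat \<Rightarrow> int"
  assumes P: "finite P" "\<And>e. e \<in> P \<Longrightarrow> Factorial_Ring.prime e \<and> e > 5" and z: "\<And>e. z e ^ 3 = unit_u e"
    and one: "finprod (H1 WN psiN K) (\<lambda>e. H1_class WN psiN K (kcocycle N (z e)) [^]\<^bsub>H1 WN psiN K\<^esub> m e) P =
      \<one>\<^bsub>H1 WN psiN K\<^esub>"
    and e0: "e0 \<in> P"
  shows "3 dvd m e0"
proof -
  let ?Z = "Z1 WN psiN K" and ?H = "H1 WN psiN K"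
  interpret Z: comm_group ?Z by (rule iso.comm_group_Z1[OF complex_subfield_K])
  interpret H: comm_group ?H by (rule iso.comm_group_H1[OF complex_subfield_K])
  have odd: "odd e" if "e \<in> P" for e using P(2)[OF that] prime_odd_nat by auto
  have car: "kcocycle N (z e) \<in> carrier ?Z" if "e \<in> P" for e by (rule kcocycle_carrier[OF odd[OF that] z])
  have hom: "H1_class WN psiN K \<in> hom ?Z ?H"
    using iso.H1_class_mult[OF complex_subfield_K] iso.carrier_H1[OF complex_subfield_K] by (auto intro!: homI)
  define F where "F = finprod ?Z (\<lambda>e. kcocycle N (z e) [^]\<^bsub>?Z\<^esub> m e) P"
  have FE: "F = (\<lambda>\<sigma>\<in>gal K. tors N (\<Prod>e\<in>P. twist (z e) \<sigma> ^ nat (m e mod 3)))"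
    unfolding F_def by (rule finprod_kcocycle[OF P(1) odd z])
  have F: "F \<in> carrier ?Z" unfolding F_def using car by (intro Z.finprod_closed) auto
  have "H1_class WN psiN K F = finprod ?H (\<lambda>e. H1_class WN psiN K (kcocycle N (z e) [^]\<^bsub>?Z\<^esub> m e)) P"
    unfolding F_def using car by (intro hom_finprod_comm_group[OF Z.comm_group_axioms H.comm_group_axioms hom]) auto
  also have "\<dots> = finprod ?H (\<lambda>e. H1_class WN psiN K (kcocycle N (z e)) [^]\<^bsub>?H\<^esub> m e) P"
    using car hom_in_carrier[OF hom] hom_int_pow[OF hom _ Z.is_group H.is_group]
    by (intro H.finprod_cong') auto
  also have "\<dots> = H1_class WN psiN K \<one>\<^bsub>?Z\<^esub>" unfolding one using hom_one[OF hom Z.is_group H.is_group] by simp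
  finally obtain T where T: "T \<in> ker_pts WN psiN (alg_cl K)" "F = coboundary WN K T \<otimes>\<^bsub>?Z\<^esub> \<one>\<^bsub>?Z\<^esub>"
    using iso.H1_class_eq_iff[OF complex_subfield_K F Z.one_closed] by blast
  have "coboundary WN K T \<in> B1 WN psiN K" using T(1) by (auto simp: B1_def)
  then have "coboundary WN K T \<in> carrier ?Z" using iso.B1_Z1[OF complex_subfield_K] by blast
  then have FT: "F = coboundary WN K T" using T(2) by simp
  define r where "r = (\<lambda>e. nat (m e mod 3))"
  define \<gamma> where "\<gamma> = (\<Prod>e\<in>P. z e ^ r e)"
  have z_nz: "z e \<noteq> 0" "z e \<in> alg_cl K" if "e \<in> P" for e
  proof -
    show "z e \<noteq> 0" using z[of e] unit_u_nonzero[OF odd[OF that]] by auto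
    have "z e ^ 3 \<in> alg_cl K" using unit_u_alg_cl[OF odd[OF that]] z by simp
    then show "z e \<in> alg_cl K" by (rule alg_cl_root[OF complex_subfield_K]) simp
  qed
  note i = alg_cl_intros[OF complex_subfield_K]
  have g_alg: "\<gamma> \<in> alg_cl K" unfolding \<gamma>_def
    using z_nz i(9) by (intro subfield_prod[OF complex_subfield_alg_cl[OF complex_subfield_K]]) auto
  have "\<gamma> \<in> K_rho"
  proof (rule ccontr)
    assume "\<gamma> \<notin> K_rho"
    then obtain \<sigma> where \<sigma>: "\<sigma> \<in> gal K" "\<forall>y\<in>K_rho. \<sigma> y = y" "\<sigma> \<gamma> \<noteq> \<gamma>"
      using gal_moves[OF complex_subfield_K K_rho g_alg] by blast
    have "0 + 1 * \<rho> \<in> K_rho" unfolding K_rho_def using K_intros(1,2) by blast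
    then have sr: "\<sigma> \<rho> = \<rho>" using \<sigma>(2) by simp
    have "act \<sigma> T = T"
    proof -
      have "T = None \<or> (\<exists>y. T = Some (0, y) \<and> y^2 = \<tau> N ^ 2)"
        using T(1) tau_square[OF N(1)] by (auto simp: ker_pts_def psi_eq_None points_E)
      then have "T = None \<or> T = Some (0, \<tau> N) \<or> T = Some (0, - \<tau> N)" unfolding power2_eq_iff by blast
      moreover have "tors N 1 = None" "tors N zeta3 = Some (0, \<tau> N)" "tors N (zeta3^2) = Some (0, - \<tau> N)"
        using zeta3_neq by (simp_all add: tors_def)
      moreover have "(1::complex)^3 = 1" "zeta3^3 = 1" "(zeta3^2)^3 = 1"
        using zeta3_cube by (simp_all add: power2_eq_square power_mult_distrib)
      ultimately show ?thesis
        using act_tors(1)[OF N complex_subfield_K order_refl \<sigma>(1) _ sr] by metis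
    qed
    then have "F \<sigma> = None" unfolding FT coboundary_def using \<sigma>(1) ec_add_neg by simp
    then have "tors N (\<Prod>e\<in>P. twist (z e) \<sigma> ^ r e) = None"
      using \<sigma>(1) unfolding FE by (simp add: r_def)
    then have tw: "(\<Prod>e\<in>P. twist (z e) \<sigma> ^ r e) = 1" by (simp add: tors_def split: if_splits)
    have sp: "\<sigma> (prod f P') = (\<Prod>e\<in>P'. \<sigma> (f e))" if "finite P'" "\<And>e. e \<in> P' \<Longrightarrow> f e \<in> alg_cl K" for f P'
      using that
    proof (induction P' rule: finite_induct)
      case empty
      then show ?case using gal_consts[OF complex_subfield_K \<sigma>(1)] by simp
    next
      case (insert x P')
      have "prod f P' \<in> alg_cl K"
        using insert.prems by (intro subfield_prod[OF complex_subfield_alg_cl[OF complex_subfield_K]]) auto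
      then show ?case using insert galD(4)[OF \<sigma>(1)] by simp
    qed
    have "\<sigma> \<gamma> = (\<Prod>e\<in>P. \<sigma> (z e ^ r e))" unfolding \<gamma>_def
      by (rule sp[OF P(1)], rule i(9), rule z_nz(2))
    also have "\<dots> = (\<Prod>e\<in>P. twist (z e) \<sigma> ^ r e * z e ^ r e)"
    proof (rule prod.cong[OF refl])
      fix e assume e: "e \<in> P"
      have "\<sigma> (z e) = twist (z e) \<sigma> * z e" using z_nz(1)[OF e] sr by (simp add: twist_def)
      then show "\<sigma> (z e ^ r e) = twist (z e) \<sigma> ^ r e * z e ^ r e"
        using gal_power[OF complex_subfield_K \<sigma>(1) z_nz(2)[OF e]] by (simp add: power_mult_distrib)
    qed
    also have "\<dots> = \<gamma>" by (simp add: prod.distrib tw \<gamma>_def)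
    finally show False using \<sigma>(3) by simp
  qed
  then obtain x y where xy: "x \<in> K" "y \<in> K" "\<gamma> = x + y * \<rho>" by (auto simp: K_rho_def)
  have "(\<Prod>e\<in>P. unit_u e ^ r e) = \<gamma> ^ 3"
    unfolding \<gamma>_def prod_power_distrib z[symmetric] by (simp add: power_mult[symmetric] mult.commute)
  then have "3 dvd r e0" using unit_u_independent[OF P xy(1,2) _ e0, of r] unfolding xy(3) by blast
  moreover have "r e0 < 3" by (simp add: r_def nat_less_iff)
  ultimately have "r e0 = 0" by (auto dest: dvd_imp_le)
  then have "m e0 mod 3 \<le> 0" by (simp add: r_def)
  then show ?thesis using pos_mod_sign[of 3 "m e0"] by (simp add: dvd_eq_mod_eq_0)
qed

theorem F3_dim_selmer_ge:
  assumes P: "finite P" "\<And>e. e \<in> P \<Longrightarrow> Factorial_Ring.prime e \<and> e > 5 \<and> e dvd N"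
  shows "F3_dim (H1 WN psiN K) (selmer WN (Ehat (curve_a N) 1) psiN K) \<ge> enat (card P)"
proof -
  have "\<forall>e. \<exists>z. z ^ 3 = unit_u e"
    using nth_root_exists[of 3] by auto
  then obtain z where z: "\<And>e. z e ^ 3 = unit_u e" by metis
  have odd: "odd e" "e \<ge> 5" if "e \<in> P" for e using P(2)[OF that] prime_odd_nat by auto
  show ?thesis
  proof (rule F3_dim_ge_card[OF iso.comm_group_H1[OF complex_subfield_K] P(1),
        where c = "\<lambda>e. H1_class WN psiN K (kcocycle N (z e))"])
    show "(\<lambda>e. H1_class WN psiN K (kcocycle N (z e))) ` P \<subseteq> selmer WN (Ehat (curve_a N) 1) psiN K"
      using kcocycle_selmer odd P(2) z by blast
    show "selmer WN (Ehat (curve_a N) 1) psiN K \<subseteq> carrier (H1 WN psiN K)" by (auto simp: selmer_def)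
  next
    fix m :: "nat \<Rightarrow> int"
    assume "finprod (H1 WN psiN K) (\<lambda>e. H1_class WN psiN K (kcocycle N (z e)) [^]\<^bsub>H1 WN psiN K\<^esub> m e) P =
      \<one>\<^bsub>H1 WN psiN K\<^esub>"
    then show "\<forall>e\<in>P. 3 dvd m e" using kcocycle_independent[OF P(1) _ z] P(2) by blast
  qed
qed

end

theorem theorem4p1:
  fixes n :: nat
  shows "infinite {a :: int. a * (4 * a + 27) \<noteq> 0 \<and>
     F3_dim (H1 (E a 1) (ec_triple (E a 1)) K) (selmer (E a 1) (E a 1) (ec_triple (E a 1)) K)
       \<ge> F3_dim (H1 (E a 1) (psi a 1) K) (selmer (E a 1) (Ehat a 1) (psi a 1) K) \<and>
     F3_dim (H1 (E a 1) (psi a 1) K) (selmer (E a 1) (Ehat a 1) (psi a 1) K) \<ge> enat (2 * n) \<and>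
     rational_isogeny (E a 1) (Ehat a 1) (psi a 1) 3 \<and>
     {P \<in> points (E a 1) K. ec_triple (E a 1) P = None} = {None}}" (is "infinite ?S")
proof -
  have "infinite {p :: nat. Factorial_Ring.prime p \<and> p > 5}"
  proof
    assume "finite {p :: nat. Factorial_Ring.prime p \<and> p > 5}"
    then have "finite ({p :: nat. Factorial_Ring.prime p \<and> p > 5} \<union> {..5})" by simp
    then have "finite {p :: nat. Factorial_Ring.prime p}" by (rule rev_finite_subset) auto
    then show False using primes_infinite by simp
  qed
  then obtain P :: "nat set" where P: "finite P" "card P = 2 * n" "P \<subseteq> {p. Factorial_Ring.prime p \<and> p > 5}"
    using infinite_arbitrarily_large[of _ "2 * n"] by blast
  define Q where "Q = \<Prod>P"
  have "odd Q" unfolding Q_def using P(1,3) prime_odd_nat by (auto simp: even_prod_iff)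
  then have Q0: "Q > 0" by (cases Q) auto
  \<comment> \<open>Odd cofactors keep \<open>N j\<close> odd, and starting with 3 keeps it at least
    2 even for \<open>n = 0\<close>, where \<open>Q = 1\<close>.\<close>
  define N where "N = (\<lambda>j. Q * (2 * j + 3))"
  have N: "N j \<ge> 2" "odd (N j)" for j
    using Q0 \<open>odd Q\<close> by (auto simp: N_def intro: order_trans[OF _ mult_le_mono1[of 1 Q "2 * j + 3"]])
  have "curve_a (N j) \<in> ?S" for j
  proof -
    define a where "a = curve_a (N j)"
    have ab: "a * 1 * (4 * a + 27 * 1) \<noteq> 0" unfolding a_def by (rule curve_a_nonzero[OF N(1)])
    \<comment> \<open>The target curve is again of the form \<open>E\<close>, with the parameters
      \<open>- 27 * a\<close> and \<open>4 * a + 27\<close>, so \<open>no_3_torsion\<close> applies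
      to it; the last factor here is 729.\<close>
    have ab': "(- 27 * a) * (4 * a + 27 * 1) * (4 * (- 27 * a) + 27 * (4 * a + 27 * 1)) \<noteq> 0"
      using ab by simp
    have dvd: "e dvd N j" if "e \<in> P" for e using dvd_prodI[OF P(1) that, of "\<lambda>x. x"] by (simp add: N_def Q_def)
    have ge: "F3_dim (H1 (E a 1) (psi a 1) K) (selmer (E a 1) (Ehat a 1) (psi a 1) K) \<ge> enat (2 * n)"
      using F3_dim_selmer_ge[OF N[of j] P(1)] P(3) dvd unfolding a_def P(2) by blast
    have "Q' = None" if "Q' \<in> points (Ehat a 1) K" "ec_triple (Ehat a 1) Q' = None" for Q'
      by (rule no_3_torsion[OF ab' complex_subfield_K theta_K theta2 not_square_K[OF N[of j], folded a_def]])
        (use that in \<open>simp_all only: Ehat_def\<close>)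
    then have le: "F3_dim (H1 (E a 1) (psi a 1) K) (selmer (E a 1) (Ehat a 1) (psi a 1) K) \<le>
        F3_dim (H1 (E a 1) (ec_triple (E a 1)) K) (selmer (E a 1) (E a 1) (ec_triple (E a 1)) K)"
      by (rule F3_dim_selmer_le[OF ab complex_subfield_K])
    have "Q' = None" if "Q' \<in> points (E a 1) K" "ec_triple (E a 1) Q' = None" for Q'
      by (rule no_3_torsion[OF ab complex_subfield_K theta_K theta2 not_square_K'[OF N[of j], folded a_def] that])
    moreover have "None \<in> points (E a 1) K" "ec_triple (E a 1) None = None" by (simp_all add: points_def ec_triple_def)
    ultimately have tors: "{Q' \<in> points (E a 1) K. ec_triple (E a 1) Q' = None} = {None}" by blast
    have "a * (4 * a + 27) \<noteq> 0" using ab by simp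
    then show ?thesis
      unfolding a_def[symmetric] using ge le rational_isogeny_psi[OF ab] tors
      by (intro CollectI conjI)
  qed
  then have "range (\<lambda>j. curve_a (N j)) \<subseteq> ?S" by (rule image_subsetI)
  moreover have "inj (\<lambda>j. curve_a (N j))"
  proof (rule injI)
    fix i j assume "curve_a (N i) = curve_a (N j)"
    then have "(6::int) ^ (N i - 2) = 6 ^ (N j - 2)" by (simp add: curve_a_def)
    then have "N i - 2 = N j - 2" by (simp add: power_inject_exp)
    then have "N i = N j" using N(1)[of i] N(1)[of j] by simp
    then show "i = j" using Q0 by (simp add: N_def)
  qed
  then have "infinite (range (\<lambda>j. curve_a (N j)))" by (rule range_inj_infinite)
  ultimately show ?thesis by (rule infinite_super)
qed

end
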